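(* Let $\mathcal{C}$ be the monoidal category of finite dimensional complex $\mathfrak{sl}_2$-modules and let $\mathfrak{b}\subset\mathfrak{sl}_2$ be the Borel subalgebra spanned by $h$ and $e$. Fix $\lambda\in\mathbb{C}$ and, for $i\in\mathbb{Z}_{\geq 0}$, let $Q(\lambda,i):=N(\lambda-i)/N(\lambda+2+i)$. Let $\mathcal{N}_6$ be the additive closure of all $Q(\lambda,i)$, $i\in\mathbb{Z}_{\geq 0}$, in the category of $\mathfrak{b}$-modules, with the $\mathcal{C}$-action $V\cdot Q=\mathrm{Res}^{\mathfrak{sl}_2}_{\mathfrak{b}}(V)\otimes_{\mathbb{C}}Q$. Then the $\mathcal{C}$-module category $\mathcal{N}_6$ is simple transitive of type $A_\infty$.
   Context: Everything is over $\mathbb{C}$; $\mathfrak{sl}_2$ has standard basis $e,f,h$. $\mathcal{C}$ is the monoidal category (under $\otimes_{\mathbb{C}}$) of finite dimensional $\mathfrak{sl}_2$-modules; $L(1)$ is the simple module of dimension $2$. For $\mu\in\mathbb{C}$, $N(\mu)$ is the $\mathfrak{b}$-module with basis $\{v_\nu:\nu\in\mu+2\mathbb{Z}_{\geq 0}\}$ and action $hv_\nu=\nu v_\nu$, $ev_\nu=v_{\nu+2}$; for $k\in\mathbb{Z}_{\ge 0}$, $N(\mu+2k)$ is identified with the submodule of $N(\mu)$ spanned by the $v_\nu$ with $\nu\in\mu+2k+2\mathbb{Z}_{\geq 0}$. The additive closure of a set of modules is the full subcategory of modules isomorphic to direct summands of finite direct sums of them. A $\mathcal{C}$-module category $\mathcal{M}$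 is locally finitary if it is $\mathbb{C}$-linear, additive, idempotent split, Krull-Schmidt, has at most countably many indecomposable objects up to isomorphism, and has finite dimensional hom-spaces. It is simple transitive if it has no non-trivial $\mathcal{C}$-invariant ideals (ideals other than $0$ and $\mathcal{M}$). A locally finitary $\mathcal{C}$-module category is of type $A_\infty$ if its indecomposables, up to isomorphism, can be listed without repetition as $X_0,X_1,X_2,\dots$ so that $L(1)\cdot X_0\cong X_1$ and $L(1)\cdot X_i\cong X_{i-1}\oplus X_{i+1}$ for $i\geq 1$. *)

theory Defs
  imports "Jordan_Normal_Form.VS_Connect" "HOL-Algebra.AbelCoset" "HOL-Library.Countable_Set"
begin

section \<open>Linear categories\<close>

text \<open>
  Hom-sets are vector spaces over the complex numbers (\<^const>\<open>vectorspace\<close> over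
  \<^term>\<open>class_ring :: complex ring\<close>); of a \<open>module\<close> record only the fields
  \<open>carrier\<close>, \<open>zero\<close>, \<open>add\<close> and \<open>smult\<close> matter.  \<open>Cmp C g f\<close> is \<open>g\<close> after \<open>f\<close>.
\<close>

record ('o, 'm) lincat =
  Ob :: "'o set"
  Hom :: "'o \<Rightarrow> 'o \<Rightarrow> (complex, 'm) module"
  Id :: "'o \<Rightarrow> 'm"
  Cmp :: "'m \<Rightarrow> 'm \<Rightarrow> 'm"

abbreviation Arr :: "('o, 'm, 'x) lincat_scheme \<Rightarrow> 'o \<Rightarrow> 'o \<Rightarrow> 'm set"
  where "Arr C X Y \<equiv> carrier (Hom C X Y)"

locale linear_category =
  fixes C :: "('o, 'm, 'x) lincat_scheme"
  assumes Hom_vectorspace: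
      "\<lbrakk>X \<in> Ob C; Y \<in> Ob C\<rbrakk> \<Longrightarrow> vectorspace class_ring (Hom C X Y)"
    and Id_arr: "X \<in> Ob C \<Longrightarrow> Id C X \<in> Arr C X X"
    and Cmp_arr:
      "\<lbrakk>X \<in> Ob C; Y \<in> Ob C; Z \<in> Ob C; f \<in> Arr C X Y; g \<in> Arr C Y Z\<rbrakk>
        \<Longrightarrow> Cmp C g f \<in> Arr C X Z"
    and Cmp_Id_left:
      "\<lbrakk>X \<in> Ob C; Y \<in> Ob C; f \<in> Arr C X Y\<rbrakk> \<Longrightarrow> Cmp C (Id C Y) f = f"
    and Cmp_Id_right:
      "\<lbrakk>X \<in> Ob C; Y \<in> Ob C; f \<in> Arr C X Y\<rbrakk> \<Longrightarrow> Cmp C f (Id C X) = f"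
    and Cmp_assoc:
      "\<lbrakk>X \<in> Ob C; Y \<in> Ob C; Z \<in> Ob C; W \<in> Ob C;
        f \<in> Arr C X Y; g \<in> Arr C Y Z; h \<in> Arr C Z W\<rbrakk>
        \<Longrightarrow> Cmp C h (Cmp C g f) = Cmp C (Cmp C h g) f"
    and Cmp_add_left:
      "\<lbrakk>X \<in> Ob C; Y \<in> Ob C; Z \<in> Ob C; f \<in> Arr C X Y; g \<in> Arr C Y Z; g' \<in> Arr C Y Z\<rbrakk>
        \<Longrightarrow> Cmp C (g \<oplus>\<^bsub>Hom C Y Z\<^esub> g') f = Cmp C g f \<oplus>\<^bsub>Hom C X Z\<^esub> Cmp C g' f"
    and Cmp_add_right:
      "\<lbrakk>X \<in> Ob C; Y \<in> Ob C; Z \<in> Ob C; f \<in> Arr C X Y; f' \<in> Arr C X Y; g \<in> Arr C Y Z\<rbrakk>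
        \<Longrightarrow> Cmp C g (f \<oplus>\<^bsub>Hom C X Y\<^esub> f') = Cmp C g f \<oplus>\<^bsub>Hom C X Z\<^esub> Cmp C g f'"
    and Cmp_smult_left:
      "\<lbrakk>X \<in> Ob C; Y \<in> Ob C; Z \<in> Ob C; f \<in> Arr C X Y; g \<in> Arr C Y Z\<rbrakk>
        \<Longrightarrow> Cmp C (a \<odot>\<^bsub>Hom C Y Z\<^esub> g) f = a \<odot>\<^bsub>Hom C X Z\<^esub> Cmp C g f"
    and Cmp_smult_right:
      "\<lbrakk>X \<in> Ob C; Y \<in> Ob C; Z \<in> Ob C; f \<in> Arr C X Y; g \<in> Arr C Y Z\<rbrakk>
        \<Longrightarrow> Cmp C g (a \<odot>\<^bsub>Hom C X Y\<^esub> f) = a \<odot>\<^bsub>Hom C X Z\<^esub> Cmp C g f"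

definition is_iso :: "('o, 'm, 'x) lincat_scheme \<Rightarrow> 'o \<Rightarrow> 'o \<Rightarrow> 'm \<Rightarrow> bool"
  where "is_iso C X Y f \<longleftrightarrow>
    f \<in> Arr C X Y \<and> (\<exists>g\<in>Arr C Y X. Cmp C g f = Id C X \<and> Cmp C f g = Id C Y)"

definition iso_ob :: "('o, 'm, 'x) lincat_scheme \<Rightarrow> 'o \<Rightarrow> 'o \<Rightarrow> bool"
  where "iso_ob C X Y \<longleftrightarrow> X \<in> Ob C \<and> Y \<in> Ob C \<and> (\<exists>f. is_iso C X Y f)"

definition zero_ob :: "('o, 'm, 'x) lincat_scheme \<Rightarrow> 'o \<Rightarrow> bool"
  where "zero_ob C X \<longleftrightarrow> X \<in> Ob C \<and>
    (\<forall>Y\<in>Ob C. Arr C X Y = {\<zero>\<^bsub>Hom C X Y\<^esub>} \<and> Arr C Y X = {\<zero>\<^bsub>Hom C Y X\<^esub>})"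

text \<open>\<open>direct_sum C Xs P\<close>: the object \<open>P\<close> is a biproduct of the objects in the list \<open>Xs\<close>.\<close>

definition direct_sum :: "('o, 'm, 'x) lincat_scheme \<Rightarrow> 'o list \<Rightarrow> 'o \<Rightarrow> bool"
  where "direct_sum C Xs P \<longleftrightarrow> set Xs \<subseteq> Ob C \<and> P \<in> Ob C \<and>
    (\<exists>inj prj.
      (\<forall>i<length Xs. inj i \<in> Arr C (Xs ! i) P \<and> prj i \<in> Arr C P (Xs ! i)) \<and>
      (\<forall>i<length Xs. \<forall>j<length Xs. Cmp C (prj i) (inj j) =
        (if i = j then Id C (Xs ! i) else \<zero>\<^bsub>Hom C (Xs ! j) (Xs ! i)\<^esub>)) \<and>
      finsum (Hom C P P) (\<lambda>i. Cmp C (inj i) (prj i)) {..<length Xs} = Id C P)"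

definition additive_category :: "('o, 'm, 'x) lincat_scheme \<Rightarrow> bool"
  where "additive_category C \<longleftrightarrow> linear_category C \<and>
    (\<exists>Z. zero_ob C Z) \<and> (\<forall>X\<in>Ob C. \<forall>Y\<in>Ob C. \<exists>P. direct_sum C [X, Y] P)"

definition idempotent_split :: "('o, 'm, 'x) lincat_scheme \<Rightarrow> bool"
  where "idempotent_split C \<longleftrightarrow>
    (\<forall>X\<in>Ob C. \<forall>e\<in>Arr C X X. Cmp C e e = e \<longrightarrow>
      (\<exists>Y\<in>Ob C. \<exists>r\<in>Arr C X Y. \<exists>s\<in>Arr C Y X. Cmp C s r = e \<and> Cmp C r s = Id C Y))"

definition indecomposable :: "('o, 'm, 'x) lincat_scheme \<Rightarrow> 'o \<Rightarrow> bool"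
  where "indecomposable C X \<longleftrightarrow> X \<in> Ob C \<and> \<not> zero_ob C X \<and>
    (\<forall>A\<in>Ob C. \<forall>B\<in>Ob C. direct_sum C [A, B] X \<longrightarrow> zero_ob C A \<or> zero_ob C B)"

definition local_End :: "('o, 'm, 'x) lincat_scheme \<Rightarrow> 'o \<Rightarrow> bool"
  where "local_End C X \<longleftrightarrow> Id C X \<noteq> \<zero>\<^bsub>Hom C X X\<^esub> \<and>
    (\<forall>f\<in>Arr C X X. \<forall>g\<in>Arr C X X.
      \<not> is_iso C X X f \<and> \<not> is_iso C X X g \<longrightarrow> \<not> is_iso C X X (f \<oplus>\<^bsub>Hom C X X\<^esub> g))"

definition krull_schmidt :: "('o, 'm, 'x) lincat_scheme \<Rightarrow> bool"
  where "krull_schmidt C \<longleftrightarrow>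
    (\<forall>X\<in>Ob C. \<exists>Xs. (\<forall>Y\<in>set Xs. local_End C Y) \<and> direct_sum C Xs X)"

definition countably_many_indecomposables :: "('o, 'm, 'x) lincat_scheme \<Rightarrow> bool"
  where "countably_many_indecomposables C \<longleftrightarrow>
    (\<exists>S. countable S \<and> S \<subseteq> Ob C \<and> (\<forall>X. indecomposable C X \<longrightarrow> (\<exists>Y\<in>S. iso_ob C X Y)))"

definition finite_dimensional_Homs :: "('o, 'm, 'x) lincat_scheme \<Rightarrow> bool"
  where "finite_dimensional_Homs C \<longleftrightarrow>
    (\<forall>X\<in>Ob C. \<forall>Y\<in>Ob C. vectorspace.fin_dim class_ring (Hom C X Y))"


section \<open>Monoidal categories and module categories\<close>

text \<open>
  \<open>AssocT C U V W\<close> is the associator from \<open>(U \<otimes> V) \<otimes> W\<close> to \<open>U \<otimes> (V \<otimes> W)\<close>; \<open>LUnit C V\<close> and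
  \<open>RUnit C V\<close> go from \<open>1 \<otimes> V\<close> and \<open>V \<otimes> 1\<close> to \<open>V\<close>.  Tensor products and actions of linear
  categories are required to be bilinear on arrows.
\<close>

record ('o, 'm) moncat = "('o, 'm) lincat" +
  TensO :: "'o \<Rightarrow> 'o \<Rightarrow> 'o"
  TensA :: "'m \<Rightarrow> 'm \<Rightarrow> 'm"
  UnitO :: 'o
  AssocT :: "'o \<Rightarrow> 'o \<Rightarrow> 'o \<Rightarrow> 'm"
  LUnit :: "'o \<Rightarrow> 'm"
  RUnit :: "'o \<Rightarrow> 'm"

text \<open>A bilinear bifunctor from \<open>A\<close> and \<open>B\<close> to \<open>D\<close>, given on objects by \<open>FO\<close> and on arrows by \<open>FA\<close>.\<close>

locale bilinear_bifunctor =
  A: linear_category A + B: linear_category B + D: linear_category D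
  for A :: "('a, 'k, 'x) lincat_scheme"
    and B :: "('b, 'l, 'y) lincat_scheme"
    and D :: "('d, 'm, 'z) lincat_scheme" +
  fixes FO :: "'a \<Rightarrow> 'b \<Rightarrow> 'd" and FA :: "'k \<Rightarrow> 'l \<Rightarrow> 'm"
  assumes FO_ob: "\<lbrakk>V \<in> Ob A; X \<in> Ob B\<rbrakk> \<Longrightarrow> FO V X \<in> Ob D"
    and FA_arr:
      "\<lbrakk>V \<in> Ob A; V' \<in> Ob A; X \<in> Ob B; X' \<in> Ob B; f \<in> Arr A V V'; g \<in> Arr B X X'\<rbrakk>
        \<Longrightarrow> FA f g \<in> Arr D (FO V X) (FO V' X')"
    and FA_Id: "\<lbrakk>V \<in> Ob A; X \<in> Ob B\<rbrakk> \<Longrightarrow> FA (Id A V) (Id B X) = Id D (FO V X)"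
    and FA_Cmp:
      "\<lbrakk>V \<in> Ob A; V' \<in> Ob A; V'' \<in> Ob A; X \<in> Ob B; X' \<in> Ob B; X'' \<in> Ob B;
        f \<in> Arr A V V'; f' \<in> Arr A V' V''; g \<in> Arr B X X'; g' \<in> Arr B X' X''\<rbrakk>
        \<Longrightarrow> FA (Cmp A f' f) (Cmp B g' g) = Cmp D (FA f' g') (FA f g)"
    and FA_add_left:
      "\<lbrakk>V \<in> Ob A; V' \<in> Ob A; X \<in> Ob B; X' \<in> Ob B;
        f \<in> Arr A V V'; f' \<in> Arr A V V'; g \<in> Arr B X X'\<rbrakk>
        \<Longrightarrow> FA (f \<oplus>\<^bsub>Hom A V V'\<^esub> f') g = FA f g \<oplus>\<^bsub>Hom D (FO V X) (FO V' X')\<^esub> FA f' g"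
    and FA_add_right:
      "\<lbrakk>V \<in> Ob A; V' \<in> Ob A; X \<in> Ob B; X' \<in> Ob B;
        f \<in> Arr A V V'; g \<in> Arr B X X'; g' \<in> Arr B X X'\<rbrakk>
        \<Longrightarrow> FA f (g \<oplus>\<^bsub>Hom B X X'\<^esub> g') = FA f g \<oplus>\<^bsub>Hom D (FO V X) (FO V' X')\<^esub> FA f g'"
    and FA_smult_left:
      "\<lbrakk>V \<in> Ob A; V' \<in> Ob A; X \<in> Ob B; X' \<in> Ob B; f \<in> Arr A V V'; g \<in> Arr B X X'\<rbrakk>
        \<Longrightarrow> FA (a \<odot>\<^bsub>Hom A V V'\<^esub> f) g = a \<odot>\<^bsub>Hom D (FO V X) (FO V' X')\<^esub> FA f g"
    and FA_smult_right:
      "\<lbrakk>V \<in> Ob A; V' \<in> Ob A; X \<in> Ob B; X' \<in> Ob B; f \<in> Arr A V V'; g \<in> Arr B X X'\<rbrakk>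
        \<Longrightarrow> FA f (a \<odot>\<^bsub>Hom B X X'\<^esub> g) = a \<odot>\<^bsub>Hom D (FO V X) (FO V' X')\<^esub> FA f g"

locale monoidal_category =
  bilinear_bifunctor C C C "TensO C" "TensA C" for C :: "('c, 'k, 'x) moncat_scheme" +
  assumes UnitO_ob: "UnitO C \<in> Ob C"
    and AssocT_iso:
      "\<lbrakk>U \<in> Ob C; V \<in> Ob C; W \<in> Ob C\<rbrakk> \<Longrightarrow>
        is_iso C (TensO C (TensO C U V) W) (TensO C U (TensO C V W)) (AssocT C U V W)"
    and LUnit_iso: "V \<in> Ob C \<Longrightarrow> is_iso C (TensO C (UnitO C) V) V (LUnit C V)"
    and RUnit_iso: "V \<in> Ob C \<Longrightarrow> is_iso C (TensO C V (UnitO C)) V (RUnit C V)"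
    and AssocT_natural:
      "\<lbrakk>U \<in> Ob C; U' \<in> Ob C; V \<in> Ob C; V' \<in> Ob C; W \<in> Ob C; W' \<in> Ob C;
        f \<in> Arr C U U'; g \<in> Arr C V V'; h \<in> Arr C W W'\<rbrakk> \<Longrightarrow>
        Cmp C (TensA C f (TensA C g h)) (AssocT C U V W)
          = Cmp C (AssocT C U' V' W') (TensA C (TensA C f g) h)"
    and LUnit_natural:
      "\<lbrakk>V \<in> Ob C; V' \<in> Ob C; f \<in> Arr C V V'\<rbrakk> \<Longrightarrow>
        Cmp C f (LUnit C V) = Cmp C (LUnit C V') (TensA C (Id C (UnitO C)) f)"
    and RUnit_natural:
      "\<lbrakk>V \<in> Ob C; V' \<in> Ob C; f \<in> Arr C V V'\<rbrakk> \<Longrightarrow>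
        Cmp C f (RUnit C V) = Cmp C (RUnit C V') (TensA C f (Id C (UnitO C)))"
    and pentagon:
      "\<lbrakk>U \<in> Ob C; V \<in> Ob C; W \<in> Ob C; X \<in> Ob C\<rbrakk> \<Longrightarrow>
        Cmp C (TensA C (Id C U) (AssocT C V W X))
          (Cmp C (AssocT C U (TensO C V W) X) (TensA C (AssocT C U V W) (Id C X)))
        = Cmp C (AssocT C U V (TensO C W X)) (AssocT C (TensO C U V) W X)"
    and triangle:
      "\<lbrakk>V \<in> Ob C; W \<in> Ob C\<rbrakk> \<Longrightarrow>
        Cmp C (TensA C (Id C V) (LUnit C W)) (AssocT C V (UnitO C) W)
          = TensA C (RUnit C V) (Id C W)"

text \<open>
  \<open>ActAssoc M U V X\<close> goes from \<open>(U \<otimes> V) \<cdot> X\<close> to \<open>U \<cdot> (V \<cdot> X)\<close> and \<open>ActUnit M X\<close> from \<open>1 \<cdot> X\<close> to \<open>X\<close>.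
\<close>

record ('o, 'm, 'c, 'k) modcat = "('o, 'm) lincat" +
  ActO :: "'c \<Rightarrow> 'o \<Rightarrow> 'o"
  ActA :: "'k \<Rightarrow> 'm \<Rightarrow> 'm"
  ActAssoc :: "'c \<Rightarrow> 'c \<Rightarrow> 'o \<Rightarrow> 'm"
  ActUnit :: "'o \<Rightarrow> 'm"

locale module_category =
  C: monoidal_category C + bilinear_bifunctor C M M "ActO M" "ActA M"
  for C :: "('c, 'k, 'x) moncat_scheme" and M :: "('o, 'm, 'c, 'k, 'y) modcat_scheme" +
  assumes ActAssoc_iso:
      "\<lbrakk>U \<in> Ob C; V \<in> Ob C; X \<in> Ob M\<rbrakk> \<Longrightarrow>
        is_iso M (ActO M (TensO C U V) X) (ActO M U (ActO M V X)) (ActAssoc M U V X)"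
    and ActUnit_iso: "X \<in> Ob M \<Longrightarrow> is_iso M (ActO M (UnitO C) X) X (ActUnit M X)"
    and ActAssoc_natural:
      "\<lbrakk>U \<in> Ob C; U' \<in> Ob C; V \<in> Ob C; V' \<in> Ob C; X \<in> Ob M; X' \<in> Ob M;
        f \<in> Arr C U U'; g \<in> Arr C V V'; h \<in> Arr M X X'\<rbrakk> \<Longrightarrow>
        Cmp M (ActA M f (ActA M g h)) (ActAssoc M U V X)
          = Cmp M (ActAssoc M U' V' X') (ActA M (TensA C f g) h)"
    and ActUnit_natural:
      "\<lbrakk>X \<in> Ob M; X' \<in> Ob M; h \<in> Arr M X X'\<rbrakk> \<Longrightarrow>
        Cmp M h (ActUnit M X) = Cmp M (ActUnit M X') (ActA M (Id C (UnitO C)) h)"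
    and act_pentagon:
      "\<lbrakk>U \<in> Ob C; V \<in> Ob C; W \<in> Ob C; X \<in> Ob M\<rbrakk> \<Longrightarrow>
        Cmp M (ActA M (Id C U) (ActAssoc M V W X))
          (Cmp M (ActAssoc M U (TensO C V W) X) (ActA M (AssocT C U V W) (Id M X)))
        = Cmp M (ActAssoc M U V (ActO M W X)) (ActAssoc M (TensO C U V) W X)"
    and act_triangle:
      "\<lbrakk>V \<in> Ob C; X \<in> Ob M\<rbrakk> \<Longrightarrow>
        Cmp M (ActA M (Id C V) (ActUnit M X)) (ActAssoc M V (UnitO C) X)
          = ActA M (RUnit C V) (Id M X)"

definition locally_finitary ::
    "('c, 'k, 'x) moncat_scheme \<Rightarrow> ('o, 'm, 'c, 'k, 'y) modcat_scheme \<Rightarrow> bool"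
  where "locally_finitary C M \<longleftrightarrow> module_category C M \<and>
    additive_category M \<and> idempotent_split M \<and> krull_schmidt M \<and>
    countably_many_indecomposables M \<and> finite_dimensional_Homs M"

definition category_ideal ::
    "('o, 'm, 'x) lincat_scheme \<Rightarrow> ('o \<Rightarrow> 'o \<Rightarrow> 'm set) \<Rightarrow> bool"
  where "category_ideal C I \<longleftrightarrow>
    (\<forall>X\<in>Ob C. \<forall>Y\<in>Ob C. subspace class_ring (I X Y) (Hom C X Y)) \<and>
    (\<forall>X\<in>Ob C. \<forall>Y\<in>Ob C. \<forall>Z\<in>Ob C. \<forall>f\<in>I X Y. \<forall>g\<in>Arr C Y Z. Cmp C g f \<in> I X Z) \<and>
    (\<forall>X\<in>Ob C. \<forall>Y\<in>Ob C. \<forall>Z\<in>Ob C. \<forall>f\<in>Arr C X Y. \<forall>g\<in>I Y Z. Cmp C g f \<in> I X Z)"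

definition invariant_ideal ::
    "('c, 'k, 'x) moncat_scheme \<Rightarrow> ('o, 'm, 'c, 'k, 'y) modcat_scheme \<Rightarrow>
      ('o \<Rightarrow> 'o \<Rightarrow> 'm set) \<Rightarrow> bool"
  where "invariant_ideal C M I \<longleftrightarrow> category_ideal M I \<and>
    (\<forall>V\<in>Ob C. \<forall>X\<in>Ob M. \<forall>Y\<in>Ob M. \<forall>f\<in>I X Y.
      ActA M (Id C V) f \<in> I (ActO M V X) (ActO M V Y))"

definition simple_transitive ::
    "('c, 'k, 'x) moncat_scheme \<Rightarrow> ('o, 'm, 'c, 'k, 'y) modcat_scheme \<Rightarrow> bool"
  where "simple_transitive C M \<longleftrightarrow> module_category C M \<and>
    (\<forall>I. invariant_ideal C M I \<longrightarrow>
      (\<forall>X\<in>Ob M. \<forall>Y\<in>Ob M. I X Y = {\<zero>\<^bsub>Hom M X Y\<^esub>}) \<or>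
      (\<forall>X\<in>Ob M. \<forall>Y\<in>Ob M. I X Y = Arr M X Y))"

text \<open>The parameter \<open>L\<close> is the object of \<open>C\<close> that plays the role of \<open>L(1)\<close>.\<close>

definition type_A_infinity ::
    "('c, 'k, 'x) moncat_scheme \<Rightarrow> 'c \<Rightarrow> ('o, 'm, 'c, 'k, 'y) modcat_scheme \<Rightarrow> bool"
  where "type_A_infinity C L M \<longleftrightarrow> locally_finitary C M \<and>
    (\<exists>X :: nat \<Rightarrow> 'o.
      (\<forall>i. indecomposable M (X i)) \<and>
      (\<forall>i j. iso_ob M (X i) (X j) \<longrightarrow> i = j) \<and>
      (\<forall>Y. indecomposable M Y \<longrightarrow> (\<exists>i. iso_ob M Y (X i))) \<and>
      iso_ob M (ActO M L (X 0)) (X 1) \<and>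
      (\<forall>i\<ge>1. direct_sum M [X (i - 1), X (i + 1)] (ActO M L (X i))))"


section \<open>Lie algebras and their modules\<close>

definition mat_e :: "complex mat"
  where "mat_e = mat_of_rows_list 2 [[0, 1], [0, 0]]"

definition mat_h :: "complex mat"
  where "mat_h = mat_of_rows_list 2 [[1, 0], [0, -1]]"

definition sl2 :: "complex mat set"
  where "sl2 = {x \<in> carrier_mat 2 2. x $$ (0, 0) + x $$ (1, 1) = 0}"

definition borel :: "complex mat set"
  where "borel = {a \<cdot>\<^sub>m mat_h + c \<cdot>\<^sub>m mat_e | a c. True}"

record 'v lmod = "(complex, 'v) module" +
  act :: "complex mat \<Rightarrow> 'v \<Rightarrow> 'v"

text \<open>
  Modules over a Lie algebra \<open>g\<close> of 2 by 2 matrices.  Only the values of \<open>act M\<close> on \<open>g\<close> are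
  constrained, so restricting an \<open>sl2\<close>-module to \<open>borel\<close> does not change the record.
\<close>

definition lie_module :: "complex mat set \<Rightarrow> 'v lmod \<Rightarrow> bool"
  where "lie_module g M \<longleftrightarrow> vectorspace class_ring M \<and>
    (\<forall>x\<in>g. act M x \<in> LinearCombinations.module_hom class_ring M M) \<and>
    (\<forall>x\<in>g. \<forall>y\<in>g. \<forall>v\<in>carrier M. act M (x + y) v = act M x v \<oplus>\<^bsub>M\<^esub> act M y v) \<and>
    (\<forall>x\<in>g. \<forall>c. \<forall>v\<in>carrier M. act M (c \<cdot>\<^sub>m x) v = c \<odot>\<^bsub>M\<^esub> act M x v) \<and>
    (\<forall>x\<in>g. \<forall>y\<in>g. \<forall>v\<in>carrier M.
      act M (x * y - y * x) v = act M x (act M y v) \<ominus>\<^bsub>M\<^esub> act M y (act M x v))"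

definition lie_hom :: "complex mat set \<Rightarrow> 'v lmod \<Rightarrow> 'w lmod \<Rightarrow> ('v \<Rightarrow> 'w) set"
  where "lie_hom g M N = {f \<in> LinearCombinations.module_hom class_ring M N \<inter> extensional (carrier M).
    \<forall>x\<in>g. \<forall>v\<in>carrier M. f (act M x v) = act N x (f v)}"

definition lie_isomorphic :: "complex mat set \<Rightarrow> 'v lmod \<Rightarrow> 'w lmod \<Rightarrow> bool"
  where "lie_isomorphic g M N \<longleftrightarrow> (\<exists>f\<in>lie_hom g M N. bij_betw f (carrier M) (carrier N))"

definition lie_submodule :: "complex mat set \<Rightarrow> 'v set \<Rightarrow> 'v lmod \<Rightarrow> bool"
  where "lie_submodule g A M \<longleftrightarrow>
    subspace class_ring A M \<and> (\<forall>x\<in>g. \<forall>v\<in>A. act M x v \<in> A)"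

definition lie_simple :: "complex mat set \<Rightarrow> 'v lmod \<Rightarrow> bool"
  where "lie_simple g M \<longleftrightarrow> lie_module g M \<and> carrier M \<noteq> {\<zero>\<^bsub>M\<^esub>} \<and>
    (\<forall>A. lie_submodule g A M \<longrightarrow> A = {\<zero>\<^bsub>M\<^esub>} \<or> A = carrier M)"

text \<open>The elements of the quotient are cosets, as in \<^const>\<open>A_FactGroup\<close>.\<close>

definition lie_quotient :: "'v lmod \<Rightarrow> 'v set \<Rightarrow> 'v set lmod"
  where "lie_quotient M A =
    \<lparr>carrier = a_rcosets\<^bsub>M\<^esub> A, mult = undefined, one = undefined,
     zero = A, add = (<+>\<^bsub>M\<^esub>),
     smult = (\<lambda>c Y. \<Union>v\<in>Y. A +>\<^bsub>M\<^esub> (c \<odot>\<^bsub>M\<^esub> v)),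
     act = (\<lambda>x Y. \<Union>v\<in>Y. A +>\<^bsub>M\<^esub> (act M x v))\<rparr>"

definition lie_direct_sum :: "'v lmod list \<Rightarrow> 'v list lmod"
  where "lie_direct_sum Ms =
    \<lparr>carrier = {vs. length vs = length Ms \<and> (\<forall>i<length Ms. vs ! i \<in> carrier (Ms ! i))},
     mult = undefined, one = undefined,
     zero = map zero Ms,
     add = (\<lambda>vs ws. map (\<lambda>i. vs ! i \<oplus>\<^bsub>Ms ! i\<^esub> ws ! i) [0..<length Ms]),
     smult = (\<lambda>c vs. map (\<lambda>i. c \<odot>\<^bsub>Ms ! i\<^esub> (vs ! i)) [0..<length Ms]),
     act = (\<lambda>x vs. map (\<lambda>i. act (Ms ! i) x (vs ! i)) [0..<length Ms])\<rparr>"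

text \<open>
  The additive closure, inside the \<open>g\<close>-modules with carrier in the type \<open>'u\<close>, of a set of
  \<open>g\<close>-modules which may live on a different type \<open>'v\<close>.
\<close>

definition additive_closure :: "complex mat set \<Rightarrow> 'v lmod set \<Rightarrow> 'u lmod set"
  where "additive_closure g S = {M. lie_module g M \<and>
    (\<exists>Ms A B. set Ms \<subseteq> S \<and>
      lie_submodule g A (lie_direct_sum Ms) \<and> lie_submodule g B (lie_direct_sum Ms) \<and>
      A \<inter> B = {\<zero>\<^bsub>lie_direct_sum Ms\<^esub>} \<and>
      A <+>\<^bsub>lie_direct_sum Ms\<^esub> B = carrier (lie_direct_sum Ms) \<and>
      lie_isomorphic g M ((lie_direct_sum Ms)\<lparr>carrier := A\<rparr>))}"


section \<open>Tensor products\<close>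

definition bilinear_map ::
    "'u lmod \<Rightarrow> 'u lmod \<Rightarrow> (complex, 'u, 'x) module_scheme \<Rightarrow> ('u \<Rightarrow> 'u \<Rightarrow> 'u) \<Rightarrow> bool"
  where "bilinear_map V W Z b \<longleftrightarrow>
    (\<forall>v\<in>carrier V. b v \<in> LinearCombinations.module_hom class_ring W Z) \<and>
    (\<forall>w\<in>carrier W. (\<lambda>v. b v w) \<in> LinearCombinations.module_hom class_ring V Z)"

definition lifts_bilinear ::
    "'u lmod \<Rightarrow> 'u lmod \<Rightarrow> (complex, 'u) module \<Rightarrow> ('u \<Rightarrow> 'u \<Rightarrow> 'u) \<Rightarrow>
      (complex, 'u, 'x) module_scheme \<Rightarrow> ('u \<Rightarrow> 'u \<Rightarrow> 'u) \<Rightarrow> ('u \<Rightarrow> 'u) \<Rightarrow> bool"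
  where "lifts_bilinear V W T t Z b f \<longleftrightarrow>
    f \<in> LinearCombinations.module_hom class_ring T Z \<inter> extensional (carrier T) \<and>
    (\<forall>v\<in>carrier V. \<forall>w\<in>carrier W. f (t v w) = b v w)"

definition is_tensor ::
    "'u lmod \<Rightarrow> 'u lmod \<Rightarrow> (complex, 'u) module \<Rightarrow> ('u \<Rightarrow> 'u \<Rightarrow> 'u) \<Rightarrow> bool"
  where "is_tensor V W T t \<longleftrightarrow> vectorspace class_ring T \<and> bilinear_map V W T t \<and>
    (\<forall>(Z :: (complex, 'u) module) b. vectorspace class_ring Z \<and> bilinear_map V W Z b \<longrightarrow>
      (\<exists>!f. lifts_bilinear V W T t Z b f))"

text \<open>
  Carriers live in a fixed type \<open>'u\<close>, so the tensor product is a chosen solution of the universal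
  problem; for finite dimensional \<open>V\<close> and \<open>W\<close> one exists as soon as the complex numbers embed
  into \<open>'u\<close>.
\<close>

definition tensor_pair :: "'u lmod \<Rightarrow> 'u lmod \<Rightarrow> (complex, 'u) module \<times> ('u \<Rightarrow> 'u \<Rightarrow> 'u)"
  where "tensor_pair V W = (SOME p. is_tensor V W (fst p) (snd p))"

abbreviation tensor_space :: "'u lmod \<Rightarrow> 'u lmod \<Rightarrow> (complex, 'u) module"
  where "tensor_space V W \<equiv> fst (tensor_pair V W)"

abbreviation pure_tensor :: "'u lmod \<Rightarrow> 'u lmod \<Rightarrow> 'u \<Rightarrow> 'u \<Rightarrow> 'u"
  where "pure_tensor V W \<equiv> snd (tensor_pair V W)"

definition tensor_lift ::
    "'u lmod \<Rightarrow> 'u lmod \<Rightarrow> (complex, 'u, 'x) module_scheme \<Rightarrow> ('u \<Rightarrow> 'u \<Rightarrow> 'u) \<Rightarrow> 'u \<Rightarrow> 'u"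
  where "tensor_lift V W Z b =
    (THE f. lifts_bilinear V W (tensor_space V W) (pure_tensor V W) Z b f)"

definition tensor :: "'u lmod \<Rightarrow> 'u lmod \<Rightarrow> 'u lmod"
  where "tensor V W =
    (let T = tensor_space V W; t = pure_tensor V W in
    \<lparr>carrier = carrier T, mult = undefined, one = undefined,
     zero = zero T, add = add T, smult = smult T,
     act = (\<lambda>x. tensor_lift V W T (\<lambda>v w. t (act V x v) w \<oplus>\<^bsub>T\<^esub> t v (act W x w)))\<rparr>)"

text \<open>An arrow is a triple of domain, underlying map (undefined outside the carrier), codomain.\<close>

type_synonym 'u arrow = "'u lmod \<times> ('u \<Rightarrow> 'u) \<times> 'u lmod"

fun tensor_arrow :: "'u arrow \<Rightarrow> 'u arrow \<Rightarrow> 'u arrow"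
  where "tensor_arrow (V, f, V') (W, g, W') =
    (tensor V W,
     tensor_lift V W (tensor V' W') (\<lambda>v w. pure_tensor V' W' (f v) (g w)),
     tensor V' W')"

text \<open>The linear map sending \<open>(u \<otimes> v) \<otimes> w\<close> to \<open>u \<otimes> (v \<otimes> w)\<close>.\<close>

definition tensor_assoc :: "'u lmod \<Rightarrow> 'u lmod \<Rightarrow> 'u lmod \<Rightarrow> 'u arrow"
  where "tensor_assoc U V W =
    (tensor (tensor U V) W,
     tensor_lift (tensor U V) W (tensor U (tensor V W))
       (\<lambda>y w. tensor_lift U V (tensor U (tensor V W))
         (\<lambda>u v. pure_tensor U (tensor V W) u (pure_tensor V W v w)) y),
     tensor U (tensor V W))"

text \<open>The trivial one dimensional module, with a chosen basis vector.\<close>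

definition is_trivial_module :: "'u lmod \<Rightarrow> 'u \<Rightarrow> bool"
  where "is_trivial_module U u \<longleftrightarrow> lie_module sl2 U \<and>
    u \<in> carrier U \<and> u \<noteq> \<zero>\<^bsub>U\<^esub> \<and> carrier U = {c \<odot>\<^bsub>U\<^esub> u | c. True} \<and>
    (\<forall>x\<in>sl2. \<forall>v\<in>carrier U. act U x v = \<zero>\<^bsub>U\<^esub>)"

definition trivial_pair :: "'u lmod \<times> 'u"
  where "trivial_pair = (SOME p. is_trivial_module (fst p) (snd p))"

definition trivial_module :: "'u lmod"
  where "trivial_module = fst trivial_pair"

definition trivial_coeff :: "'u \<Rightarrow> complex"
  where "trivial_coeff v = (THE c. v = c \<odot>\<^bsub>trivial_module\<^esub> snd trivial_pair)"

definition tensor_lunit :: "'u lmod \<Rightarrow> 'u arrow"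
  where "tensor_lunit V =
    (tensor trivial_module V,
     tensor_lift trivial_module V V (\<lambda>a v. trivial_coeff a \<odot>\<^bsub>V\<^esub> v), V)"

definition tensor_runit :: "'u lmod \<Rightarrow> 'u arrow"
  where "tensor_runit V =
    (tensor V trivial_module,
     tensor_lift V trivial_module V (\<lambda>v a. trivial_coeff a \<odot>\<^bsub>V\<^esub> v), V)"


section \<open>The categories\<close>

fun arrow_compose :: "'u arrow \<Rightarrow> 'u arrow \<Rightarrow> 'u arrow"
  where "arrow_compose (N', g, P) (M, f, N) = (M, compose (carrier M) g f, P)"

definition lie_Id :: "'u lmod \<Rightarrow> 'u arrow"
  where "lie_Id M = (M, restrict (\<lambda>v. v) (carrier M), M)"

definition lie_Hom :: "complex mat set \<Rightarrow> 'u lmod \<Rightarrow> 'u lmod \<Rightarrow> (complex, 'u arrow) module"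
  where "lie_Hom g M N =
    \<lparr>carrier = {(M, f, N) | f. f \<in> lie_hom g M N},
     mult = undefined, one = undefined,
     zero = (M, restrict (\<lambda>v. \<zero>\<^bsub>N\<^esub>) (carrier M), N),
     add = (\<lambda>p q. (M, restrict (\<lambda>v. fst (snd p) v \<oplus>\<^bsub>N\<^esub> fst (snd q) v) (carrier M), N)),
     smult = (\<lambda>c p. (M, restrict (\<lambda>v. c \<odot>\<^bsub>N\<^esub> fst (snd p) v) (carrier M), N))\<rparr>"

definition sl2_mod :: "('u lmod, 'u arrow) moncat"
  where "sl2_mod =
    \<lparr>Ob = {V. lie_module sl2 V \<and> vectorspace.fin_dim class_ring V},
     Hom = lie_Hom sl2, Id = lie_Id, Cmp = arrow_compose,
     TensO = tensor, TensA = tensor_arrow, UnitO = trivial_module,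
     AssocT = tensor_assoc, LUnit = tensor_lunit, RUnit = tensor_runit\<rparr>"

definition L1 :: "'u lmod"
  where "L1 = (SOME L. L \<in> Ob sl2_mod \<and> lie_simple sl2 L \<and> vectorspace.dim class_ring L = 2)"

text \<open>
  The vector with coordinate function \<open>c\<close> is the finite sum of the \<open>c \<nu> v\<^sub>\<nu>\<close>.  On \<open>borel\<close>, the
  matrix \<open>x\<close> equals \<open>x $$ (0, 0)\<close> times \<open>h\<close> plus \<open>x $$ (0, 1)\<close> times \<open>e\<close>.
\<close>

definition Nmod :: "complex \<Rightarrow> (complex \<Rightarrow> complex) lmod"
  where "Nmod \<mu> =
    \<lparr>carrier = {c. finite {\<nu>. c \<nu> \<noteq> 0} \<and> {\<nu>. c \<nu> \<noteq> 0} \<subseteq> {\<mu> + 2 * of_nat k | k. True}},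
     mult = undefined, one = undefined,
     zero = (\<lambda>\<nu>. 0), add = (\<lambda>c d \<nu>. c \<nu> + d \<nu>), smult = (\<lambda>a c \<nu>. a * c \<nu>),
     act = (\<lambda>x c \<nu>. x $$ (0, 0) * (\<nu> * c \<nu>) + x $$ (0, 1) * c (\<nu> - 2))\<rparr>"

definition Qmod :: "complex \<Rightarrow> nat \<Rightarrow> (complex \<Rightarrow> complex) set lmod"
  where "Qmod l i = lie_quotient (Nmod (l - of_nat i)) (carrier (Nmod (l + 2 + of_nat i)))"

definition N6 :: "complex \<Rightarrow> ('u lmod, 'u arrow, 'u lmod, 'u arrow) modcat"
  where "N6 l =
    \<lparr>Ob = additive_closure borel (range (Qmod l)),
     Hom = lie_Hom borel, Id = lie_Id, Cmp = arrow_compose,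
     ActO = tensor, ActA = tensor_arrow,
     ActAssoc = tensor_assoc, ActUnit = tensor_lunit\<rparr>"

end

theory Submission
  imports Defs "HOL-Library.Function_Algebras" "HOL-Computational_Algebra.Fundamental_Theorem_Algebra"
begin

text \<open>
  The sum of the \<open>Q(\<lambda>, n)\<close> with multiplicities carries a lowering operator \<open>F\<close> with
  \<open>[h, F] = - 2 F\<close> and \<open>[e, F] = h - \<lambda>\<close>, and every \<open>borel\<close>-homomorphism commutes with it, because a
  map lowering weights by 2 and commuting with \<open>e\<close> vanishes.  Hence direct summands inherit \<open>F\<close>,
  and conversely a finite dimensional \<open>borel\<close>-module with such an \<open>F\<close> is, after a shift of the weights by
  \<open>\<lambda>\<close>, an \<open>sl2\<close>-module and so a sum of strings \<open>Q(\<lambda>, n)\<close>.  The category is therefore that of the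
  finite dimensional \<open>borel\<close>-modules admitting \<open>F\<close>, which is closed under tensor products with
  \<open>sl2\<close>-modules.  There are no nonzero maps between different \<open>Q(\<lambda>, n)\<close> and only scalars on each of
  them, so an ideal is determined by the set of \<open>n\<close> whose identity it contains, and by
  \<open>L(1) \<cdot> Q(\<lambda>, n) = Q(\<lambda>, n - 1) \<oplus> Q(\<lambda>, n + 1)\<close> an invariant one contains none or all.
\<close>

section \<open>Complex vector spaces as records: linear maps, coordinates and finite bases\<close>

section \<open>Linear algebra on records\<close>

text \<open>The module Q(\<lambda>, n) is the restriction of the simple sl2-module of dimension n +
  1, tensored with the line on which h acts by \<lambda> and e by 0; this is the origin of F and of
  the shift in [e, F] = h - \<lambda>. The obstacle is that objects are arbitrary direct summands,
  while modules over the Borel subalgebra are not completely reducible, so the definition does not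
  show what a summand looks like. An operator that the module itself determines is what survives the
  passage to a summand. The vanishing of lowering maps is a count of heights: a lowest vector of
  weight \<lambda> - n dies under e^(n+1), while a vector of weight \<lambda> - n - 2 in a sum of
  strings only meets strings with more than n + 1 steps left above it. A second constraint is
  set-theoretic. All carriers lie in one type, and the tensor product, the unit object and L(1) are
  chosen objects. Each is handled through a universal property, or through what all possible choices
  share, and a copy of the complex numbers in the carrier type guarantees that there is something to
  choose.\<close>

abbreviation cvs :: "(complex, 'v, 'x) module_scheme \<Rightarrow> bool"
  where "cvs M \<equiv> vectorspace class_ring M"

abbreviation lin :: "(complex, 'v, 'x) module_scheme \<Rightarrow> (complex, 'w, 'y) module_scheme \<Rightarrow> ('v \<Rightarrow> 'w) \<Rightarrow> bool"
  where "lin M N f \<equiv> f \<in> LinearCombinations.module_hom class_ring M N"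

text \<open>Additive inverses enter as \<open>(-1)\<close>-multiples: the records built below have
  no negation field, so inverses for \<open>add\<close> have to come from
  \<open>smult\<close>.\<close>

lemma cvsI:
  fixes M :: "(complex, 'v, 'x) module_scheme"
  assumes "\<zero>\<^bsub>M\<^esub> \<in> carrier M"
    and "\<And>v w. \<lbrakk>v \<in> carrier M; w \<in> carrier M\<rbrakk> \<Longrightarrow> v \<oplus>\<^bsub>M\<^esub> w \<in> carrier M"
    and "\<And>c v. v \<in> carrier M \<Longrightarrow> c \<odot>\<^bsub>M\<^esub> v \<in> carrier M"
    and "\<And>v w. \<lbrakk>v \<in> carrier M; w \<in> carrier M\<rbrakk> \<Longrightarrow> v \<oplus>\<^bsub>M\<^esub> w = w \<oplus>\<^bsub>M\<^esub> v"
    and "\<And>v w x. \<lbrakk>v \<in> carrier M; w \<in> carrier M; x \<in> carrier M\<rbrakk>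
      \<Longrightarrow> (v \<oplus>\<^bsub>M\<^esub> w) \<oplus>\<^bsub>M\<^esub> x = v \<oplus>\<^bsub>M\<^esub> (w \<oplus>\<^bsub>M\<^esub> x)"
    and "\<And>v. v \<in> carrier M \<Longrightarrow> v \<oplus>\<^bsub>M\<^esub> \<zero>\<^bsub>M\<^esub> = v"
    and "\<And>v. v \<in> carrier M \<Longrightarrow> v \<oplus>\<^bsub>M\<^esub> ((-1) \<odot>\<^bsub>M\<^esub> v) = \<zero>\<^bsub>M\<^esub>"
    and "\<And>a b v. v \<in> carrier M \<Longrightarrow> (a * b) \<odot>\<^bsub>M\<^esub> v = a \<odot>\<^bsub>M\<^esub> (b \<odot>\<^bsub>M\<^esub> v)"
    and "\<And>v. v \<in> carrier M \<Longrightarrow> 1 \<odot>\<^bsub>M\<^esub> v = v"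
    and "\<And>a b v. v \<in> carrier M \<Longrightarrow> (a + b) \<odot>\<^bsub>M\<^esub> v = a \<odot>\<^bsub>M\<^esub> v \<oplus>\<^bsub>M\<^esub> b \<odot>\<^bsub>M\<^esub> v"
    and "\<And>a v w. \<lbrakk>v \<in> carrier M; w \<in> carrier M\<rbrakk>
      \<Longrightarrow> a \<odot>\<^bsub>M\<^esub> (v \<oplus>\<^bsub>M\<^esub> w) = a \<odot>\<^bsub>M\<^esub> v \<oplus>\<^bsub>M\<^esub> a \<odot>\<^bsub>M\<^esub> w"
  shows "cvs M"
proof -
  have "Module.module (class_ring :: complex ring) M"
    by (rule module_criteria, use assms in \<open>auto intro: class_cring.cring_axioms\<close>)
      (use assms in blast)?
  thus ?thesis
    by (simp add: vectorspace_def class_field)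
qed

lemma cvs_simps:
  fixes M :: "(complex, 'v, 'x) module_scheme"
  assumes "cvs M"
  shows "\<zero>\<^bsub>M\<^esub> \<in> carrier M"
    and "\<lbrakk>v \<in> carrier M; w \<in> carrier M\<rbrakk> \<Longrightarrow> v \<oplus>\<^bsub>M\<^esub> w \<in> carrier M"
    and "v \<in> carrier M \<Longrightarrow> c \<odot>\<^bsub>M\<^esub> v \<in> carrier M"
    and "\<lbrakk>v \<in> carrier M; w \<in> carrier M\<rbrakk> \<Longrightarrow> v \<ominus>\<^bsub>M\<^esub> w \<in> carrier M"
    and "v \<in> carrier M \<Longrightarrow> v \<oplus>\<^bsub>M\<^esub> \<zero>\<^bsub>M\<^esub> = v"
    and "v \<in> carrier M \<Longrightarrow> \<zero>\<^bsub>M\<^esub> \<oplus>\<^bsub>M\<^esub> v = v"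
    and "v \<in> carrier M \<Longrightarrow> 1 \<odot>\<^bsub>M\<^esub> v = v"
    and "v \<in> carrier M \<Longrightarrow> 0 \<odot>\<^bsub>M\<^esub> v = \<zero>\<^bsub>M\<^esub>"
    and "c \<odot>\<^bsub>M\<^esub> \<zero>\<^bsub>M\<^esub> = \<zero>\<^bsub>M\<^esub>"
    and "v \<in> carrier M \<Longrightarrow> a \<odot>\<^bsub>M\<^esub> (b \<odot>\<^bsub>M\<^esub> v) = (a * b) \<odot>\<^bsub>M\<^esub> v"
proof -
  interpret vectorspace "class_ring :: complex ring" M by fact
  show "\<zero>\<^bsub>M\<^esub> \<in> carrier M"
    and "\<lbrakk>v \<in> carrier M; w \<in> carrier M\<rbrakk> \<Longrightarrow> v \<oplus>\<^bsub>M\<^esub> w \<in> carrier M"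
    and "v \<in> carrier M \<Longrightarrow> c \<odot>\<^bsub>M\<^esub> v \<in> carrier M"
    and "\<lbrakk>v \<in> carrier M; w \<in> carrier M\<rbrakk> \<Longrightarrow> v \<ominus>\<^bsub>M\<^esub> w \<in> carrier M"
    and "v \<in> carrier M \<Longrightarrow> v \<oplus>\<^bsub>M\<^esub> \<zero>\<^bsub>M\<^esub> = v"
    and "v \<in> carrier M \<Longrightarrow> \<zero>\<^bsub>M\<^esub> \<oplus>\<^bsub>M\<^esub> v = v"
    and "v \<in> carrier M \<Longrightarrow> 1 \<odot>\<^bsub>M\<^esub> v = v"
    and "v \<in> carrier M \<Longrightarrow> 0 \<odot>\<^bsub>M\<^esub> v = \<zero>\<^bsub>M\<^esub>"
    and "c \<odot>\<^bsub>M\<^esub> \<zero>\<^bsub>M\<^esub> = \<zero>\<^bsub>M\<^esub>"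
    and "v \<in> carrier M \<Longrightarrow> a \<odot>\<^bsub>M\<^esub> (b \<odot>\<^bsub>M\<^esub> v) = (a * b) \<odot>\<^bsub>M\<^esub> v"
    using smult_one smult_l_null smult_r_null smult_closed smult_assoc1 by auto
qed

lemma cvs_distribs:
  fixes M :: "(complex, 'v, 'x) module_scheme"
  assumes "cvs M"
  shows "v \<in> carrier M \<Longrightarrow> (a + b) \<odot>\<^bsub>M\<^esub> v = a \<odot>\<^bsub>M\<^esub> v \<oplus>\<^bsub>M\<^esub> b \<odot>\<^bsub>M\<^esub> v"
    and "\<lbrakk>v \<in> carrier M; w \<in> carrier M\<rbrakk>
      \<Longrightarrow> a \<odot>\<^bsub>M\<^esub> (v \<oplus>\<^bsub>M\<^esub> w) = a \<odot>\<^bsub>M\<^esub> v \<oplus>\<^bsub>M\<^esub> a \<odot>\<^bsub>M\<^esub> w"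
    and "\<lbrakk>v \<in> carrier M; w \<in> carrier M\<rbrakk> \<Longrightarrow> v \<ominus>\<^bsub>M\<^esub> w = v \<oplus>\<^bsub>M\<^esub> (-1) \<odot>\<^bsub>M\<^esub> w"
    and "\<lbrakk>v \<in> carrier M; w \<in> carrier M\<rbrakk> \<Longrightarrow> v \<oplus>\<^bsub>M\<^esub> w = w \<oplus>\<^bsub>M\<^esub> v"
    and "\<lbrakk>v \<in> carrier M; w \<in> carrier M; x \<in> carrier M\<rbrakk>
      \<Longrightarrow> (v \<oplus>\<^bsub>M\<^esub> w) \<oplus>\<^bsub>M\<^esub> x = v \<oplus>\<^bsub>M\<^esub> (w \<oplus>\<^bsub>M\<^esub> x)"
    and "\<lbrakk>v \<in> carrier M; w \<in> carrier M; x \<in> carrier M\<rbrakk>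
      \<Longrightarrow> v \<oplus>\<^bsub>M\<^esub> (w \<oplus>\<^bsub>M\<^esub> x) = w \<oplus>\<^bsub>M\<^esub> (v \<oplus>\<^bsub>M\<^esub> x)"
    and "v \<in> carrier M \<Longrightarrow> v \<ominus>\<^bsub>M\<^esub> v = \<zero>\<^bsub>M\<^esub>"
    and "\<lbrakk>v \<in> carrier M; w \<in> carrier M\<rbrakk> \<Longrightarrow> v \<ominus>\<^bsub>M\<^esub> w = \<zero>\<^bsub>M\<^esub> \<longleftrightarrow> v = w"
proof -
  interpret vectorspace "class_ring :: complex ring" M by fact
  have neg: "(-1) \<odot>\<^bsub>M\<^esub> w = \<ominus>\<^bsub>M\<^esub> w" if "w \<in> carrier M" for w
    using smult_minus_1[OF that] by (simp add: class_ring_simps)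
  show "v \<in> carrier M \<Longrightarrow> (a + b) \<odot>\<^bsub>M\<^esub> v = a \<odot>\<^bsub>M\<^esub> v \<oplus>\<^bsub>M\<^esub> b \<odot>\<^bsub>M\<^esub> v"
    and "\<lbrakk>v \<in> carrier M; w \<in> carrier M\<rbrakk>
      \<Longrightarrow> a \<odot>\<^bsub>M\<^esub> (v \<oplus>\<^bsub>M\<^esub> w) = a \<odot>\<^bsub>M\<^esub> v \<oplus>\<^bsub>M\<^esub> a \<odot>\<^bsub>M\<^esub> w"
    using smult_l_distr smult_r_distr by auto
  show "\<lbrakk>v \<in> carrier M; w \<in> carrier M\<rbrakk> \<Longrightarrow> v \<ominus>\<^bsub>M\<^esub> w = v \<oplus>\<^bsub>M\<^esub> (-1) \<odot>\<^bsub>M\<^esub> w"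
    by (simp add: neg a_minus_def)
  show "\<lbrakk>v \<in> carrier M; w \<in> carrier M\<rbrakk> \<Longrightarrow> v \<oplus>\<^bsub>M\<^esub> w = w \<oplus>\<^bsub>M\<^esub> v"
    and "\<lbrakk>v \<in> carrier M; w \<in> carrier M; x \<in> carrier M\<rbrakk>
      \<Longrightarrow> (v \<oplus>\<^bsub>M\<^esub> w) \<oplus>\<^bsub>M\<^esub> x = v \<oplus>\<^bsub>M\<^esub> (w \<oplus>\<^bsub>M\<^esub> x)"
    and "\<lbrakk>v \<in> carrier M; w \<in> carrier M; x \<in> carrier M\<rbrakk>
      \<Longrightarrow> v \<oplus>\<^bsub>M\<^esub> (w \<oplus>\<^bsub>M\<^esub> x) = w \<oplus>\<^bsub>M\<^esub> (v \<oplus>\<^bsub>M\<^esub> x)"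
    by (simp_all add: M.a_ac)
  show "v \<in> carrier M \<Longrightarrow> v \<ominus>\<^bsub>M\<^esub> v = \<zero>\<^bsub>M\<^esub>"
    by (simp add: a_minus_def M.r_neg)
  show "\<lbrakk>v \<in> carrier M; w \<in> carrier M\<rbrakk> \<Longrightarrow> v \<ominus>\<^bsub>M\<^esub> w = \<zero>\<^bsub>M\<^esub> \<longleftrightarrow> v = w"
    by auto
qed

lemma lin_iff:
  "lin M N f \<longleftrightarrow> (\<forall>v\<in>carrier M. f v \<in> carrier N) \<and>
    (\<forall>v\<in>carrier M. \<forall>w\<in>carrier M. f (v \<oplus>\<^bsub>M\<^esub> w) = f v \<oplus>\<^bsub>N\<^esub> f w) \<and>
    (\<forall>c. \<forall>v\<in>carrier M. f (c \<odot>\<^bsub>M\<^esub> v) = c \<odot>\<^bsub>N\<^esub> f v)"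
  by (auto simp: LinearCombinations.module_hom_def)

lemma linI:
  assumes "\<And>v. v \<in> carrier M \<Longrightarrow> f v \<in> carrier N"
    and "\<And>v w. \<lbrakk>v \<in> carrier M; w \<in> carrier M\<rbrakk> \<Longrightarrow> f (v \<oplus>\<^bsub>M\<^esub> w) = f v \<oplus>\<^bsub>N\<^esub> f w"
    and "\<And>c v. v \<in> carrier M \<Longrightarrow> f (c \<odot>\<^bsub>M\<^esub> v) = c \<odot>\<^bsub>N\<^esub> f v"
  shows "lin M N f"
  using assms by (simp add: lin_iff)

lemma linD:
  assumes "lin M N f"
  shows "v \<in> carrier M \<Longrightarrow> f v \<in> carrier N"
    and "\<lbrakk>v \<in> carrier M; w \<in> carrier M\<rbrakk> \<Longrightarrow> f (v \<oplus>\<^bsub>M\<^esub> w) = f v \<oplus>\<^bsub>N\<^esub> f w"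
    and "v \<in> carrier M \<Longrightarrow> f (c \<odot>\<^bsub>M\<^esub> v) = c \<odot>\<^bsub>N\<^esub> f v"
  using assms by (auto simp: lin_iff)

lemma lin_cong:
  assumes "cvs M" "lin M N f" "\<And>v. v \<in> carrier M \<Longrightarrow> g v = f v"
  shows "lin M N g"
  using assms(2,3) by (simp add: lin_iff cvs_simps[OF assms(1)])

lemma lin_restrict_iff [simp]:
  "cvs M \<Longrightarrow> lin M N (restrict f (carrier M)) \<longleftrightarrow> lin M N f"
  by (auto intro: lin_cong)

lemma lin_zero:
  assumes "cvs M" "cvs N" "lin M N f"
  shows "f \<zero>\<^bsub>M\<^esub> = \<zero>\<^bsub>N\<^esub>"
proof -
  note M = cvs_simps[OF assms(1)] and N = cvs_simps[OF assms(2)] and f = linD[OF assms(3)]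
  have "f (0 \<odot>\<^bsub>M\<^esub> \<zero>\<^bsub>M\<^esub>) = 0 \<odot>\<^bsub>N\<^esub> f \<zero>\<^bsub>M\<^esub>" by (rule f(3)) (rule M)
  thus ?thesis using M N f(1) by simp
qed

lemma lin_minus:
  assumes "cvs M" "cvs N" "lin M N f" "v \<in> carrier M" "w \<in> carrier M"
  shows "f (v \<ominus>\<^bsub>M\<^esub> w) = f v \<ominus>\<^bsub>N\<^esub> f w"
  by (simp add: assms cvs_distribs(3) cvs_simps linD[OF assms(3)])

lemma lin_id: "lin M M (\<lambda>v. v)" by (simp add: lin_iff)

lemma lin_const_zero: "cvs N \<Longrightarrow> lin M N (\<lambda>v. \<zero>\<^bsub>N\<^esub>)"
  by (simp add: lin_iff cvs_simps)

lemma lin_compose: "\<lbrakk>lin M N f; lin N P g\<rbrakk> \<Longrightarrow> lin M P (\<lambda>v. g (f v))"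
  by (simp add: lin_iff)

lemma lin_add:
  assumes "cvs N" "lin M N f" "lin M N g"
  shows "lin M N (\<lambda>v. f v \<oplus>\<^bsub>N\<^esub> g v)"
  by (rule linI) (use assms(2,3) in \<open>simp_all add: lin_iff cvs_simps[OF assms(1)] cvs_distribs[OF assms(1)]\<close>)

lemma lin_smult:
  assumes "cvs N" "lin M N f"
  shows "lin M N (\<lambda>v. c \<odot>\<^bsub>N\<^esub> f v)"
  by (rule linI) (use assms(2) in \<open>simp_all add: lin_iff cvs_simps[OF assms(1)] cvs_distribs(2)[OF assms(1)] mult.commute\<close>)

lemma lin_diff:
  assumes "cvs N" "lin M N f" "lin M N g"
  shows "lin M N (\<lambda>v. f v \<ominus>\<^bsub>N\<^esub> g v)"
proof -
  have "lin M N (\<lambda>v. f v \<oplus>\<^bsub>N\<^esub> (-1) \<odot>\<^bsub>N\<^esub> g v)"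
    using assms by (intro lin_add lin_smult)
  thus ?thesis
    using assms(2,3) by (simp add: lin_iff cvs_distribs(3)[OF assms(1)] cvs_simps[OF assms(1)])
      (simp add: lin_iff cvs_distribs(3)[OF assms(1)] cvs_simps[OF assms(1)])?
qed

text \<open>Transport of structure along a bijection onto a record of which only the operations are
  known. The zero has its own hypothesis: preserving \<open>add\<close> and \<open>smult\<close>
  says nothing about the field \<open>zero\<close> of \<open>N\<close> before \<open>N\<close> is
  known to be a vector space.\<close>

lemma cvs_iso:
  assumes M: "cvs M" and bij: "bij_betw \<phi> (carrier M) (carrier N)" and lin: "lin M N \<phi>"
    and zero: "\<zero>\<^bsub>N\<^esub> = \<phi> \<zero>\<^bsub>M\<^esub>"
  shows "cvs N"
proof -
  note S = cvs_simps[OF M]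
  have surj: "\<exists>x\<in>carrier M. v = \<phi> x" if "v \<in> carrier N" for v
    using bij that by (auto simp: bij_betw_def)
  have eqs: "\<phi> x \<oplus>\<^bsub>N\<^esub> \<phi> y = \<phi> (x \<oplus>\<^bsub>M\<^esub> y)" "c \<odot>\<^bsub>N\<^esub> \<phi> x = \<phi> (c \<odot>\<^bsub>M\<^esub> x)"
    if "x \<in> carrier M" "y \<in> carrier M" for x y c
    using lin that by (simp_all add: lin_iff)
  show ?thesis
  proof (rule cvsI)
    show "\<zero>\<^bsub>N\<^esub> \<in> carrier N" using S(1) lin zero by (simp add: lin_iff)
  qed (use lin in \<open>auto dest!: surj simp: eqs zero S cvs_distribs(1,2)[OF M] simp: lin_iff
      simp del: minus_one_mult_self\<close>,
    (use cvs_distribs(3,4,5,7)[OF M] S in \<open>auto simp: eqs\<close>)+)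
qed

lemma cvs_carrier_update:
  assumes "VectorSpace.subspace class_ring A M"
  shows "cvs (M\<lparr>carrier := A\<rparr>)"
  using vectorspace.subspace_is_vs[OF _ assms] assms by (simp add: VectorSpace.subspace_def)

lemma subspace_iff:
  fixes M :: "(complex, 'v, 'x) module_scheme"
  shows "VectorSpace.subspace class_ring A M \<longleftrightarrow> cvs M \<and> A \<subseteq> carrier M \<and> \<zero>\<^bsub>M\<^esub> \<in> A \<and>
    (\<forall>v\<in>A. \<forall>w\<in>A. v \<oplus>\<^bsub>M\<^esub> w \<in> A) \<and> (\<forall>c. \<forall>v\<in>A. c \<odot>\<^bsub>M\<^esub> v \<in> A)"
  by (auto simp: VectorSpace.subspace_def submodule_def vectorspace_def)

subsection \<open>Coordinate spaces and finite bases\<close>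

text \<open>Coordinate vectors are total functions that vanish off \<open>I\<close>, not extensional
  ones. The space is thus at once a record and a subspace of a function type with pointwise
  operations, to which span and dependence theory applies.\<close>

definition fs :: "'i set \<Rightarrow> (complex, 'i \<Rightarrow> complex) module"
  where "fs I = \<lparr>carrier = {c. \<forall>i. i \<notin> I \<longrightarrow> c i = 0}, monoid.mult = undefined, one = undefined,
    zero = (\<lambda>i. 0), add = (\<lambda>c d i. c i + d i), module.smult = (\<lambda>a c i. a * c i)\<rparr>"

lemma fs_sel [simp]:
  "c \<in> carrier (fs I) \<longleftrightarrow> (\<forall>i. i \<notin> I \<longrightarrow> c i = 0)"
  "\<zero>\<^bsub>fs I\<^esub> = (\<lambda>i. 0)" "c \<oplus>\<^bsub>fs I\<^esub> d = (\<lambda>i. c i + d i)" "a \<odot>\<^bsub>fs I\<^esub> c = (\<lambda>i. a * c i)"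
  by (simp_all add: fs_def)

lemma fs_cvs: "cvs (fs I)"
  by (rule cvsI) (simp_all add: fun_eq_iff algebra_simps)

text \<open>Combinations of a family rather than of a set: a basis can then be mapped or reindexed
  by acting on the family, and repetitions do no harm before independence is known.\<close>

definition comb :: "(complex, 'v, 'x) module_scheme \<Rightarrow> ('i \<Rightarrow> 'v) \<Rightarrow> 'i set \<Rightarrow> ('i \<Rightarrow> complex) \<Rightarrow> 'v"
  where "comb M b I c = finsum M (\<lambda>i. c i \<odot>\<^bsub>M\<^esub> b i) I"

lemma lin_finsum:
  assumes "cvs M" "cvs N" "lin M N f" "g \<in> A \<rightarrow> carrier M"
  shows "f (finsum M g A) = finsum N (\<lambda>i. f (g i)) A"
proof -
  interpret M: vectorspace "class_ring :: complex ring" M by fact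
  interpret N: vectorspace "class_ring :: complex ring" N by fact
  show ?thesis using assms(4)
  proof (induction A rule: infinite_finite_induct)
    case (insert a A)
    have "f (finsum M g (insert a A)) = f (g a \<oplus>\<^bsub>M\<^esub> finsum M g A)"
      using insert by (subst M.finsum_insert) auto
    also have "\<dots> = f (g a) \<oplus>\<^bsub>N\<^esub> f (finsum M g A)"
      using insert.prems by (intro linD[OF assms(3)] M.finsum_closed) auto
    also have "\<dots> = finsum N (\<lambda>i. f (g i)) (insert a A)"
      using insert linD(1)[OF assms(3)] by (subst N.finsum_insert) auto
    finally show ?case .
  qed (simp_all add: lin_zero[OF assms(1-3)])
qed

lemma comb_lin:
  assumes "cvs M" "finite I" "b \<in> I \<rightarrow> carrier M"
  shows "lin (fs I) M (comb M b I)"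
proof -
  interpret M: vectorspace "class_ring :: complex ring" M by fact
  have in_M: "c i \<odot>\<^bsub>M\<^esub> b i \<in> carrier M" if "i \<in> I" for c i
    using that assms by (auto intro: cvs_simps)
  show ?thesis
  proof (rule linI)
    fix v w assume "v \<in> carrier (fs I)" "w \<in> carrier (fs I)"
    have "comb M b I (v \<oplus>\<^bsub>fs I\<^esub> w) = finsum M (\<lambda>i. v i \<odot>\<^bsub>M\<^esub> b i \<oplus>\<^bsub>M\<^esub> w i \<odot>\<^bsub>M\<^esub> b i) I"
      unfolding comb_def
      using assms(3) by (intro M.finsum_cong') (auto simp: cvs_distribs(1)[OF assms(1)] Pi_iff intro: in_M)
    also have "\<dots> = comb M b I v \<oplus>\<^bsub>M\<^esub> comb M b I w"
      unfolding comb_def using in_M by (intro M.finsum_addf) auto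
    finally show "comb M b I (v \<oplus>\<^bsub>fs I\<^esub> w) = comb M b I v \<oplus>\<^bsub>M\<^esub> comb M b I w" .
  next
    fix a v assume "v \<in> carrier (fs I)"
    have "a \<odot>\<^bsub>M\<^esub> comb M b I v = finsum M (\<lambda>i. a \<odot>\<^bsub>M\<^esub> (v i \<odot>\<^bsub>M\<^esub> b i)) I"
      unfolding comb_def using in_M assms(2) by (intro M.finsum_smult_ldistr) auto
    also have "\<dots> = comb M b I (a \<odot>\<^bsub>fs I\<^esub> v)"
      unfolding comb_def using in_M assms(3)
      by (intro M.finsum_cong') (auto simp: cvs_simps[OF assms(1)] Pi_iff)
    finally show "comb M b I (a \<odot>\<^bsub>fs I\<^esub> v) = a \<odot>\<^bsub>M\<^esub> comb M b I v" by simp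
  qed (use in_M in \<open>auto simp: comb_def\<close>)
qed

definition unit :: "'i \<Rightarrow> 'i \<Rightarrow> complex"
  where "unit i = (\<lambda>j. if j = i then 1 else 0)"

lemma comb_unit:
  assumes "cvs M" "finite I" "b \<in> I \<rightarrow> carrier M" "i \<in> I"
  shows "comb M b I (unit i) = b i"
proof -
  interpret M: vectorspace "class_ring :: complex ring" M by fact
  have "comb M b I (unit i) = finsum M (\<lambda>j. if i = j then b j else \<zero>\<^bsub>M\<^esub>) I"
    unfolding comb_def unit_def
    using assms(3) by (intro M.finsum_cong') (auto simp: cvs_simps[OF assms(1)] Pi_iff)
  also have "\<dots> = b i" using assms by (intro M.finsum_singleton) auto
  finally show ?thesis .
qed

lemma lin_comb:
  assumes "cvs M" "cvs N" "lin M N f" "b \<in> I \<rightarrow> carrier M"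
  shows "f (comb M b I c) = comb N (\<lambda>i. f (b i)) I c"
proof -
  interpret N: vectorspace "class_ring :: complex ring" N by fact
  have in_M: "c i \<odot>\<^bsub>M\<^esub> b i \<in> carrier M" if "i \<in> I" for c i
    using that assms by (auto intro: cvs_simps)
  show ?thesis unfolding comb_def
    using assms in_M linD[OF assms(3)]
    by (subst lin_finsum[OF assms(1-3)]) (auto simp: Pi_iff intro!: N.finsum_cong' cvs_simps(3)[OF assms(2)])
qed

lemma comb_cong:
  assumes "cvs M" "b' \<in> I \<rightarrow> carrier M" "\<And>i. i \<in> I \<Longrightarrow> b i = b' i" "\<And>i. i \<in> I \<Longrightarrow> c i = c' i"
  shows "comb M b I c = comb M b' I c'"
proof -
  interpret M: vectorspace "class_ring :: complex ring" M by fact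
  show ?thesis unfolding comb_def
    using assms by (intro M.finsum_cong') (auto intro: cvs_simps)
qed

lemma comb_fs_unit:
  assumes "finite I" "c \<in> carrier (fs I)"
  shows "comb (fs I) unit I c = c"
proof -
  have fi: "finsum (fs I) f A = (\<lambda>j. \<Sum>i\<in>A. f i j)" if "finite A" "f \<in> A \<rightarrow> carrier (fs I)" for f A
  proof -
    interpret M: vectorspace "class_ring :: complex ring" "fs I" by (rule fs_cvs)
    show ?thesis using that
      by (induction A rule: finite_induct) (simp_all add: fun_eq_iff)
  qed
  have "comb (fs I) unit I c = (\<lambda>j. \<Sum>i\<in>I. (c i \<odot>\<^bsub>fs I\<^esub> unit i) j)"
    unfolding comb_def by (rule fi[OF assms(1)]) (auto simp: unit_def)
  also have "\<dots> = c"
  proof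
    fix j
    have "(\<Sum>i\<in>I. (c i \<odot>\<^bsub>fs I\<^esub> unit i) j) = (\<Sum>i\<in>I. if i = j then c j else 0)"
      by (rule sum.cong) (auto simp: unit_def)
    also have "\<dots> = c j" using assms by (simp add: sum.delta)
    finally show "(\<Sum>i\<in>I. (c i \<odot>\<^bsub>fs I\<^esub> unit i) j) = c j" .
  qed
  finally show ?thesis .
qed

text \<open>A basis is recorded as an isomorphism from the coordinate space, which gives coordinates
  and the extension of linear maps without a detour through span and independence.\<close>

definition fbasis :: "(complex, 'v, 'x) module_scheme \<Rightarrow> ('i \<Rightarrow> 'v) \<Rightarrow> 'i set \<Rightarrow> bool"
  where "fbasis M b I \<longleftrightarrow> cvs M \<and> finite I \<and> b \<in> I \<rightarrow> carrier M \<and>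
    bij_betw (comb M b I) (carrier (fs I)) (carrier M)"

lemma fbasisD:
  assumes "fbasis M b I"
  shows "cvs M" "finite I" "b \<in> I \<rightarrow> carrier M" "i \<in> I \<Longrightarrow> b i \<in> carrier M"
    "bij_betw (comb M b I) (carrier (fs I)) (carrier M)" "lin (fs I) M (comb M b I)"
  using assms comb_lin by (auto simp: fbasis_def)

lemma lin_from_fs:
  assumes "cvs M" "finite I" "lin (fs I) M \<phi>" "c \<in> carrier (fs I)"
  shows "\<phi> c = comb M (\<lambda>i. \<phi> (unit i)) I c"
  using lin_comb[OF fs_cvs assms(1,3), of unit I c] assms comb_fs_unit[OF assms(2,4)]
  by (auto simp: unit_def)

lemma fbasis_of_iso:
  assumes "finite I" "cvs M" "lin (fs I) M \<phi>" "bij_betw \<phi> (carrier (fs I)) (carrier M)"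
  shows "fbasis M (\<lambda>i. \<phi> (unit i)) I"
  unfolding fbasis_def
proof (intro conjI assms Pi_I)
  show "\<phi> (unit i) \<in> carrier M" if "i \<in> I" for i
    by (rule linD(1)[OF assms(3)]) (use that in \<open>simp add: unit_def\<close>)
  show "bij_betw (comb M (\<lambda>i. \<phi> (unit i)) I) (carrier (fs I)) (carrier M)"
    using assms(4) by (rule bij_betw_cong[THEN iffD1, rotated]) (rule lin_from_fs[OF assms(2,1,3)])
qed

lemma fbasis_cong:
  assumes "fbasis M b I" "\<And>i. i \<in> I \<Longrightarrow> b' i = b i"
  shows "fbasis M b' I"
  using assms fbasisD[OF assms(1)] unfolding fbasis_def
  by (auto simp: Pi_iff intro!: bij_betw_cong[THEN iffD1, OF _ fbasisD(5)[OF assms(1)]] comb_cong)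

lemma fbasis_image:
  assumes "fbasis M b I" "cvs N" "lin M N f" "bij_betw f (carrier M) (carrier N)"
  shows "fbasis N (\<lambda>i. f (b i)) I"
proof -
  note B = fbasisD[OF assms(1)]
  have "fbasis N (\<lambda>i. f (comb M b I (unit i))) I"
    by (rule fbasis_of_iso) (use B assms in \<open>auto intro: lin_compose bij_betw_trans[unfolded comp_def]\<close>)
  thus ?thesis by (rule fbasis_cong) (use B in \<open>simp add: comb_unit\<close>)
qed

definition crd :: "(complex, 'v, 'x) module_scheme \<Rightarrow> ('i \<Rightarrow> 'v) \<Rightarrow> 'i set \<Rightarrow> 'v \<Rightarrow> 'i \<Rightarrow> complex"
  where "crd M b I = inv_into (carrier (fs I)) (comb M b I)"

lemma lin_inv_into:
  assumes "cvs M" "lin M N f" "bij_betw f (carrier M) (carrier N)"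
  shows "lin N M (inv_into (carrier M) f)"
proof -
  let ?g = "inv_into (carrier M) f"
  have g: "?g v \<in> carrier M" "f (?g v) = v" if "v \<in> carrier N" for v
    using assms(3) that by (auto simp: bij_betw_def inv_into_into f_inv_into_f)
  have gf: "?g (f v) = v" if "v \<in> carrier M" for v
    using assms(3) that by (simp add: bij_betw_def)
  note f = linD[OF assms(2)]
  show ?thesis
  proof (rule linI)
    fix v w assume "v \<in> carrier N" "w \<in> carrier N"
    thus "?g (v \<oplus>\<^bsub>N\<^esub> w) = ?g v \<oplus>\<^bsub>M\<^esub> ?g w"
      using gf[of "?g v \<oplus>\<^bsub>M\<^esub> ?g w"] g cvs_simps[OF assms(1)] by (simp add: f)
  next
    fix c v assume "v \<in> carrier N"
    thus "?g (c \<odot>\<^bsub>N\<^esub> v) = c \<odot>\<^bsub>M\<^esub> ?g v"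
      using gf[of "c \<odot>\<^bsub>M\<^esub> ?g v"] g cvs_simps[OF assms(1)] by (simp add: f)
  qed (rule g)
qed

lemma crd:
  assumes "fbasis M b I"
  shows "lin M (fs I) (crd M b I)" "bij_betw (crd M b I) (carrier M) (carrier (fs I))"
    "v \<in> carrier M \<Longrightarrow> comb M b I (crd M b I v) = v"
    "c \<in> carrier (fs I) \<Longrightarrow> crd M b I (comb M b I c) = c"
    "i \<in> I \<Longrightarrow> crd M b I (b i) = unit i"
proof -
  note B = fbasisD[OF assms]
  show "lin M (fs I) (crd M b I)" "bij_betw (crd M b I) (carrier M) (carrier (fs I))"
    unfolding crd_def using B by (auto intro: lin_inv_into bij_betw_inv_into fs_cvs)
  show *: "v \<in> carrier M \<Longrightarrow> comb M b I (crd M b I v) = v"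
    "c \<in> carrier (fs I) \<Longrightarrow> crd M b I (comb M b I c) = c" for v c
    unfolding crd_def using B(5) by (auto simp: bij_betw_def f_inv_into_f simp del: fs_sel)
  show "i \<in> I \<Longrightarrow> crd M b I (b i) = unit i"
    using *(2)[of "unit i"] comb_unit[OF B(1-3)] by (auto simp: unit_def)
qed

lemma lin_ext:
  assumes "fbasis M b I" "cvs N" "lin M N f" "lin M N g" "\<And>i. i \<in> I \<Longrightarrow> f (b i) = g (b i)" "v \<in> carrier M"
  shows "f v = g v"
proof -
  note B = fbasisD[OF assms(1)] and C = crd[OF assms(1)]
  have "f (comb M b I (crd M b I v)) = g (comb M b I (crd M b I v))"
    using lin_comb[OF B(1) assms(2,3) B(3)] lin_comb[OF B(1) assms(2,4) B(3)] assms(5) B(4) linD(1)[OF assms(4)]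
    by (auto intro!: comb_cong[OF assms(2)])
  thus ?thesis using C(3)[OF assms(6)] by simp
qed

lemma lin_extend:
  assumes "fbasis M b I" "cvs N" "g \<in> I \<rightarrow> carrier N"
  obtains f where "lin M N f" "f \<in> extensional (carrier M)" "\<And>i. i \<in> I \<Longrightarrow> f (b i) = g i"
proof
  note B = fbasisD[OF assms(1)] and C = crd[OF assms(1)]
  let ?f = "restrict (\<lambda>v. comb N g I (crd M b I v)) (carrier M)"
  show "lin M N ?f"
    using B C comb_lin[OF assms(2) B(2) assms(3)] by (simp add: lin_compose[where M = M and N = "fs I"])
  show "?f (b i) = g i" if "i \<in> I" for i
    using B(2,4) C(5) that comb_unit[OF assms(2) B(2) assms(3)] by simp
qed simp

text \<open>In a carrier-based space there is no ring normalisation. Testing against an arbitrary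
  functional turns an identity of vectors into one of complex numbers, where there is; the
  coordinate functions provide enough functionals. Most bracket computations below are closed in
  this way.\<close>

lemma sep:
  fixes M :: "(complex, 'v, 'x) module_scheme"
  assumes "fbasis M b I" "v \<in> carrier M" "w \<in> carrier M"
    and "\<And>\<chi> :: 'v \<Rightarrow> complex. \<lbrakk>\<And>x y. \<lbrakk>x \<in> carrier M; y \<in> carrier M\<rbrakk> \<Longrightarrow> \<chi> (x \<oplus>\<^bsub>M\<^esub> y) = \<chi> x + \<chi> y;
      \<And>c x. x \<in> carrier M \<Longrightarrow> \<chi> (c \<odot>\<^bsub>M\<^esub> x) = c * \<chi> x;
      \<And>x y. \<lbrakk>x \<in> carrier M; y \<in> carrier M\<rbrakk> \<Longrightarrow> \<chi> (x \<ominus>\<^bsub>M\<^esub> y) = \<chi> x - \<chi> y;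
      \<chi> \<zero>\<^bsub>M\<^esub> = 0\<rbrakk> \<Longrightarrow> \<chi> v = \<chi> w"
  shows "v = w"
proof -
  note B = fbasisD[OF assms(1)] and C = crd[OF assms(1)]
  have "crd M b I v i = crd M b I w i" for i
  proof (rule assms(4)[of "\<lambda>v. crd M b I v i"])
    fix x y assume "x \<in> carrier M" "y \<in> carrier M"
    thus "crd M b I (x \<oplus>\<^bsub>M\<^esub> y) i = crd M b I x i + crd M b I y i"
      "crd M b I (x \<ominus>\<^bsub>M\<^esub> y) i = crd M b I x i - crd M b I y i"
      using linD(2,3)[OF C(1)] cvs_simps(3)[OF B(1)] by (simp_all add: cvs_distribs(3)[OF B(1)])
  qed (use linD(3)[OF C(1)] lin_zero[OF B(1) fs_cvs C(1)] in auto)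
  hence "crd M b I v = crd M b I w" by blast
  thus ?thesis using C(3) assms(2,3) by metis
qed

section \<open>Weight theory of sl2 and complete reducibility in finite dimension\<close>

section \<open>Finite dimensional representations of the three operators\<close>

text \<open>Operators are analysed on a whole additive group type, where span and independence are
  available for subsets; modules given by records are brought here by coordinates.\<close>

locale cspace = vector_space scale
  for scale :: "complex \<Rightarrow> 'b::ab_group_add \<Rightarrow> 'b" (infixr \<open>*s\<close> 75)
begin

definition lop :: "('b \<Rightarrow> 'b) \<Rightarrow> bool"
  where "lop f \<longleftrightarrow> (\<forall>x y. f (x + y) = f x + f y) \<and> (\<forall>c x. f (c *s x) = c *s f x)"

lemma lopD:
  assumes "lop f"
  shows "f (x + y) = f x + f y" "f (c *s x) = c *s f x" "f 0 = 0" "f (x - y) = f x - f y"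
    "f (- x) = - f x" "f (sum g A) = (\<Sum>i\<in>A. f (g i))"
proof -
  show a: "f (x + y) = f x + f y" and s: "f (c *s x) = c *s f x" for x y c
    using assms by (auto simp: lop_def)
  show z: "f 0 = 0" using s[of 0 0] by simp
  show n: "f (- x) = - f x" for x using s[of "-1" x] by simp
  show "f (x - y) = f x - f y" using a[of x "- y"] n by simp
  show "f (sum g A) = (\<Sum>i\<in>A. f (g i))"
    by (induction A rule: infinite_finite_induct) (simp_all add: a z)
qed

lemma scale_two: "2 *s x = x + x" "(2 * a) *s x = a *s x + a *s x" "(a * 2) *s x = a *s x + a *s x"
  using scale_left_distrib[of 1 1 x]
  by (simp_all only: mult_2 mult_2_right scale_left_distrib one_add_one scale_one)

lemma lop_pow: "lop f \<Longrightarrow> lop (f ^^ n)"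
  by (induction n) (auto simp: lop_def)

text \<open>Finite dimension of a subspace is expressed throughout by a finite set whose span
  contains it. Such a set may lie outside \<open>W\<close>; it is exchanged here for a basis
  inside.\<close>

lemma finite_basis:
  assumes "subspace W" "finite B" "W \<subseteq> span B"
  obtains A where "finite A" "A \<subseteq> W" "independent A" "span A = W" "card A \<le> card B"
proof -
  obtain A where A: "A \<subseteq> W" "independent A" "W \<subseteq> span A"
    using maximal_independent_subset by blast
  hence "finite A \<and> card A \<le> card B"
    using independent_span_bound[OF assms(2) A(2)] assms(3) by blast
  with A assms(1) show thesis
    using span_minimal[of A W] by (intro that) auto
qed

text \<open>Among the first \<open>card B + 1\<close> vectors either two coincide, and their
  difference is a relation, or all are distinct and too many to be independent. Coefficients are
  attached to positions, so that the relation can later be read as a polynomial.\<close>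

lemma nontrivial_relation:
  fixes x :: "nat \<Rightarrow> 'b"
  assumes "finite B" "\<And>i. x i \<in> span B"
  obtains n c where "\<exists>i\<le>n. c i \<noteq> 0" "(\<Sum>i\<le>n. c i *s x i) = 0"
proof (cases "inj_on x {..card B}")
  case True
  have "dependent (x ` {..card B})"
  proof (rule ccontr)
    assume "\<not> ?thesis"
    hence "card (x ` {..card B}) \<le> card B"
      using independent_span_bound[OF assms(1)] assms(2) by blast
    thus False using True by (simp add: card_image)
  qed
  then obtain u where u: "\<exists>v\<in>x ` {..card B}. u v \<noteq> 0" "(\<Sum>v\<in>x ` {..card B}. u v *s v) = 0"
    using dependent_finite[of "x ` {..card B}"] by auto
  hence "(\<Sum>i\<le>card B. u (x i) *s x i) = 0"
    by (simp add: sum.reindex[OF True])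
  with u(1) show thesis by (intro that[of "card B" "\<lambda>i. u (x i)"]) auto
next
  case False
  then obtain i j where ij: "i \<le> card B" "j \<le> card B" "i \<noteq> j" "x i = x j"
    by (auto simp: inj_on_def)
  let ?c = "\<lambda>k. (if k = i then 1 else 0) + (if k = j then -1 else 0) :: complex"
  have "(\<Sum>k\<le>card B. ?c k *s x k)
      = (\<Sum>k\<le>card B. if k = i then x k else 0) + (\<Sum>k\<le>card B. if k = j then - x k else 0)"
    by (simp only: sum.distrib[symmetric]) (rule sum.cong, auto simp: scale_left_distrib)
  also have "\<dots> = 0" using ij by (simp add: sum.delta)
  finally show thesis using ij by (intro that[of "card B" ?c]) auto
qed

definition polyop :: "('b \<Rightarrow> 'b) \<Rightarrow> complex poly \<Rightarrow> 'b \<Rightarrow> 'b"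
  where "polyop f p x = (\<Sum>i\<le>degree p. coeff p i *s (f ^^ i) x)"

lemma polyop_altdef:
  assumes "degree p \<le> n"
  shows "polyop f p x = (\<Sum>i\<le>n. coeff p i *s (f ^^ i) x)"
  unfolding polyop_def using assms
  by (intro sum.mono_neutral_left) (auto simp: coeff_eq_0)

text \<open>The case of multiplicativity that peels a single root off a polynomial.\<close>

lemma polyop_linear_factor:
  assumes "lop f"
  shows "polyop f ([:- c, 1:] * q) x = f (polyop f q x) - c *s polyop f q x"
proof -
  let ?n = "Suc (degree q)"
  have "coeff ([:- c, 1:] * q) i = (case i of 0 \<Rightarrow> 0 | Suc j \<Rightarrow> coeff q j) - c * coeff q i" for i
    by (cases i) auto
  hence "polyop f ([:- c, 1:] * q) x
      = (\<Sum>i\<le>?n. (case i of 0 \<Rightarrow> 0 | Suc j \<Rightarrow> coeff q j) *s (f ^^ i) x) - (\<Sum>i\<le>?n. (c * coeff q i) *s (f ^^ i) x)"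
    using degree_mult_le[of "[:- c, 1:]" q]
    by (subst polyop_altdef[of _ ?n]) (simp_all add: scale_left_diff_distrib sum_subtractf del: sum.atMost_Suc mult_pCons_left)
  also have "(\<Sum>i\<le>?n. (case i of 0 \<Rightarrow> 0 | Suc j \<Rightarrow> coeff q j) *s (f ^^ i) x) = f (polyop f q x)"
    by (subst sum.atMost_Suc_shift) (simp add: polyop_def lopD[OF assms])
  also have "(\<Sum>i\<le>?n. (c * coeff q i) *s (f ^^ i) x) = c *s polyop f q x"
    by (subst polyop_altdef[of q ?n]) (simp_all add: scale_sum_right scale_right_distrib del: scale_scale add: scale_scale[symmetric])
  finally show ?thesis .
qed

definition eigenval :: "('b \<Rightarrow> 'b) \<Rightarrow> 'b set \<Rightarrow> complex \<Rightarrow> bool"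
  where "eigenval f W c \<longleftrightarrow> (\<exists>v\<in>W. v \<noteq> 0 \<and> f v = c *s v)"

lemma polyop_in:
  assumes "subspace W" "\<And>w. w \<in> W \<Longrightarrow> f w \<in> W" "w \<in> W"
  shows "polyop f p w \<in> W"
proof -
  have "(f ^^ i) w \<in> W" for i by (induction i) (use assms in auto)
  thus ?thesis unfolding polyop_def using assms(1) by (intro subspace_sum subspace_scale)
qed

text \<open>The roots of \<open>p\<close> are removed one at a time. At the first removal that
  leaves a quotient \<open>q\<close> with q(f) w nonzero, this vector is killed by f - c and is an
  eigenvector.\<close>

lemma eigenval_of_annihilator:
  assumes "lop f" "subspace W" "\<And>w. w \<in> W \<Longrightarrow> f w \<in> W"
    and "w \<in> W" "w \<noteq> 0" "p \<noteq> 0" "polyop f p w = 0"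
  shows "\<exists>c. eigenval f W c"
  using assms(6,7)
proof (induction "degree p" arbitrary: p rule: less_induct)
  case less
  show ?case
  proof (cases "degree p = 0")
    case True
    hence "coeff p 0 *s w = 0" using less.prems by (simp add: polyop_def)
    moreover have "coeff p 0 \<noteq> 0" using True less.prems(1) by (metis leading_coeff_0_iff)
    ultimately show ?thesis using assms(5) by simp
  next
    case False
    then obtain c where "poly p c = 0"
      using fundamental_theorem_of_algebra[of p] by (auto simp: constant_degree)
    then obtain q where q: "p = [:- c, 1:] * q" by (auto simp: poly_eq_0_iff_dvd dvd_def)
    with less.prems have "q \<noteq> 0" by auto
    hence deg: "degree q < degree p" by (simp add: q degree_mult_eq del: mult_pCons_left)
    show ?thesis
    proof (cases "polyop f q w = 0")
      case True thus ?thesis using less.hyps[OF deg \<open>q \<noteq> 0\<close>] by blast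
    next
      case False
      moreover have "f (polyop f q w) = c *s polyop f q w"
        using less.prems(2) by (simp add: q polyop_linear_factor[OF assms(1)] del: mult_pCons_left)
      ultimately show ?thesis
        using polyop_in[OF assms(2) _ assms(4), of f q] assms(3) unfolding eigenval_def by blast
    qed
  qed
qed

text \<open>The iterates of \<open>f\<close> on a nonzero vector satisfy a linear relation, whose
  coefficients are those of an annihilating polynomial.\<close>

lemma eigenval_exists:
  assumes "lop f" "subspace W" "\<And>w. w \<in> W \<Longrightarrow> f w \<in> W" "finite B" "W \<subseteq> span B" "w \<in> W" "w \<noteq> 0"
  shows "\<exists>c. eigenval f W c"
proof -
  have "(f ^^ i) w \<in> W" for i by (induction i) (use assms in auto)
  hence "(f ^^ i) w \<in> span B" for i using assms(5) by blast
  then obtain n c where c: "\<exists>i\<le>n. c i \<noteq> 0" "(\<Sum>i\<le>n. c i *s (f ^^ i) w) = 0"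
    using nontrivial_relation[OF assms(4), of "\<lambda>i. (f ^^ i) w"] by metis
  let ?p = "\<Sum>i\<le>n. monom (c i) i"
  have coeff: "coeff ?p i = (if i \<le> n then c i else 0)" for i
    by (simp add: coeff_sum)
  have "degree ?p \<le> n" by (rule degree_le) (simp add: coeff)
  hence "polyop f ?p w = 0"
    using c(2) by (simp add: polyop_altdef[of _ n] coeff)
  moreover have "?p \<noteq> 0" using c(1) coeff by (metis coeff_0)
  ultimately show ?thesis using eigenval_of_annihilator[OF assms(1-3,6,7)] by blast
qed

text \<open>Eigenvectors to distinct eigenvalues are independent, so infinitely many eigenvalues
  would give an infinite sequence without relations inside a finite span.\<close>

lemma finite_spectrum:
  assumes "lop f" "finite B" "W \<subseteq> span B"
  shows "finite {c. eigenval f W c}"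
proof (rule ccontr)
  assume "infinite {c. eigenval f W c}"
  then obtain \<mu> :: "nat \<Rightarrow> complex" where \<mu>: "inj \<mu>" "range \<mu> \<subseteq> {c. eigenval f W c}"
    using infinite_countable_subset by blast
  hence "\<forall>i. \<exists>v. v \<in> W \<and> v \<noteq> 0 \<and> f v = \<mu> i *s v" by (auto simp: eigenval_def)
  then obtain v where v: "\<And>i. v i \<in> W" "\<And>i. v i \<noteq> 0" "\<And>i. f (v i) = \<mu> i *s v i" by metis
  have indep: "\<forall>i<n. c i = 0" if "(\<Sum>i<n. c i *s v i) = 0" for n c
    using that
  proof (induction n arbitrary: c)
    case (Suc n)
    have "f (\<Sum>i<Suc n. c i *s v i) = (\<Sum>i<Suc n. (c i * \<mu> i) *s v i)"
      by (simp add: lopD[OF assms(1)] v(3))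
    \<comment> \<open>Subtracting \<mu> n times the relation from its image under \<open>f\<close>
      removes the last term.\<close>
    hence "(\<Sum>i<Suc n. (c i * \<mu> i) *s v i) - \<mu> n *s (\<Sum>i<Suc n. c i *s v i) = 0"
      using Suc.prems by (simp add: lopD[OF assms(1)] del: sum.lessThan_Suc)
    hence "(\<Sum>i<Suc n. (c i * (\<mu> i - \<mu> n)) *s v i) = 0"
      by (simp add: scale_sum_right sum_subtractf[symmetric] scale_left_diff_distrib[symmetric]
        right_diff_distrib mult.commute del: sum.lessThan_Suc)
    hence "(\<Sum>i<n. (c i * (\<mu> i - \<mu> n)) *s v i) = 0" by simp
    hence "\<forall>i<n. c i * (\<mu> i - \<mu> n) = 0" by (rule Suc.IH)
    hence c0: "\<forall>i<n. c i = 0" using \<mu>(1) by (auto dest: injD)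
    hence "c n *s v n = 0" using Suc.prems by simp
    thus ?case using c0 v(2) by (auto simp: less_Suc_eq)
  qed simp
  obtain n c where c: "\<exists>i\<le>n. c i \<noteq> 0" "(\<Sum>i\<le>n. c i *s v i) = 0"
    by (rule nontrivial_relation[OF assms(2), of v]) (use v(1) assms(3) in auto)
  thus False using indep[of c "Suc n"] by (auto simp: lessThan_Suc_atMost)
qed

text \<open>The image of a basis of \<open>W\<close> is an independent set of the same size inside
  \<open>W\<close>, which leaves no room for a further independent vector.\<close>

lemma inj_imp_surj:
  assumes "lop f" "subspace W" "\<And>w. w \<in> W \<Longrightarrow> f w \<in> W" "finite B" "W \<subseteq> span B"
    and inj: "\<And>w. \<lbrakk>w \<in> W; f w = 0\<rbrakk> \<Longrightarrow> w = 0" and w: "w \<in> W"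
  shows "\<exists>u\<in>W. f u = w"
proof -
  obtain A where A: "finite A" "A \<subseteq> W" "independent A" "span A = W"
    using assms(2,4,5) by (rule finite_basis)
  have inj': "x = y" if "x \<in> W" "y \<in> W" "f x = f y" for x y
    using inj[of "x - y"] that subspace_diff[OF assms(2)] by (simp add: lopD[OF assms(1)])
  hence injA: "inj_on f A" using A(2) by (auto simp: inj_on_def)
  have indep: "independent (f ` A)"
  proof (rule independent_if_scalars_zero)
    show "finite (f ` A)" using A by simp
    fix g x assume g: "(\<Sum>x\<in>f ` A. g x *s x) = 0" "x \<in> f ` A"
    have "(\<Sum>a\<in>A. g (f a) *s a) \<in> W"
      using A(2) assms(2) by (intro subspace_sum subspace_scale) auto
    moreover have "f (\<Sum>a\<in>A. g (f a) *s a) = 0"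
      using g(1) by (simp add: lopD[OF assms(1)] sum.reindex[OF injA])
    ultimately have "(\<Sum>a\<in>A. g (f a) *s a) = 0" by (rule inj)
    hence "\<forall>a\<in>A. g (f a) = 0"
      using A(1,3) dependent_finite[of A] by metis
    thus "g x = 0" using g(2) by auto
  qed
  have "w \<in> span (f ` A)"
  proof (rule ccontr)
    assume nin: "w \<notin> span (f ` A)"
    hence "independent (insert w (f ` A))" using indep by (simp add: independent_insertI)
    moreover have "insert w (f ` A) \<subseteq> span A" using A assms(3) w by auto
    ultimately have "card (insert w (f ` A)) \<le> card A"
      using independent_span_bound[OF A(1)] by blast
    moreover have "w \<notin> f ` A" using nin span_superset by blast
    ultimately show False using A(1) by (simp add: card_image[OF injA])
  qed
  then obtain u where u: "w = (\<Sum>v\<in>f ` A. u v *s v)"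
    using span_finite[of "f ` A"] A(1) by auto
  have "f (\<Sum>a\<in>A. u (f a) *s a) = w"
    by (simp add: lopD[OF assms(1)] u sum.reindex[OF injA])
  moreover have "(\<Sum>a\<in>A. u (f a) *s a) \<in> W"
    using A(2) assms(2) by (intro subspace_sum subspace_scale) auto
  ultimately show ?thesis by blast
qed

text \<open>The functional is prescribed on a basis of \<open>S\<close> together with
  \<open>y\<close>, a set that is independent because \<open>y\<close> lies outside
  \<open>S\<close>.\<close>

lemma functional_exists:
  assumes "subspace S" "y \<notin> S"
  obtains \<phi> :: "'b \<Rightarrow> complex"
    where "\<And>x y. \<phi> (x + y) = \<phi> x + \<phi> y" "\<And>c x. \<phi> (c *s x) = c * \<phi> x"
      "\<And>x. x \<in> S \<Longrightarrow> \<phi> x = 0" "\<phi> y = 1"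
proof -
  interpret C: vector_space "(*) :: complex \<Rightarrow> complex \<Rightarrow> complex"
    by unfold_locales (simp_all add: algebra_simps)
  interpret P: vector_space_pair scale "(*) :: complex \<Rightarrow> complex \<Rightarrow> complex" ..
  obtain A where A: "A \<subseteq> S" "independent A" "S \<subseteq> span A"
    using maximal_independent_subset by blast
  have "span A = S" using A assms(1) span_minimal[of A S] by blast
  hence ind: "independent (insert y A)" using A assms(2) by (intro independent_insertI) auto
  obtain g where g: "Vector_Spaces.linear scale (*) g"
      "\<forall>x\<in>insert y A. g x = (if x = y then 1 else 0)"
    using P.linear_independent_extend[OF ind, of "\<lambda>x. if x = y then 1 else 0"] by blast
  interpret g: Vector_Spaces.linear scale "(*) :: complex \<Rightarrow> complex \<Rightarrow> complex" g by (rule g)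
  have "g x = 0" if "x \<in> S" for x
  proof -
    have "x \<in> span A" using that A by blast
    thus ?thesis
    proof (induction rule: span_induct_alt)
      case (step c x z)
      hence "x \<noteq> y" using A assms(2) by blast
      with step show ?case using g(2) by (simp add: g.add g.scale)
    qed (simp add: g.zero)
  qed
  with g(2) show thesis by (intro that[of g]) (auto simp: g.add g.scale)
qed

end

text \<open>The operators are linear on the whole type but obey the relations only on
  \<open>W\<close>: an induction over invariant subspaces can then shrink \<open>W\<close> while
  keeping \<open>H\<close>, \<open>E\<close> and \<open>F\<close>.\<close>

locale sl2_ops = cspace scale
  for scale :: "complex \<Rightarrow> 'b::ab_group_add \<Rightarrow> 'b" (infixr \<open>*s\<close> 75) +
  fixes H E F :: "'b \<Rightarrow> 'b" and W :: "'b set"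
  assumes H: "lop H" and E: "lop E" and F: "lop F" and W: "subspace W"
    and H_in: "w \<in> W \<Longrightarrow> H w \<in> W" and E_in: "w \<in> W \<Longrightarrow> E w \<in> W" and F_in: "w \<in> W \<Longrightarrow> F w \<in> W"
    and HE: "w \<in> W \<Longrightarrow> H (E w) = E (H w) + 2 *s E w"
    and HF: "w \<in> W \<Longrightarrow> H (F w) = F (H w) - 2 *s F w"
    and EF: "w \<in> W \<Longrightarrow> E (F w) = F (E w) + H w"
begin

lemma pow_in: "w \<in> W \<Longrightarrow> (E ^^ k) w \<in> W" "w \<in> W \<Longrightarrow> (F ^^ k) w \<in> W"
  by (induction k) (auto intro: E_in F_in)

lemma W_ops: "\<lbrakk>v \<in> W; w \<in> W\<rbrakk> \<Longrightarrow> v + w \<in> W" "\<lbrakk>v \<in> W; w \<in> W\<rbrakk> \<Longrightarrow> v - w \<in> W"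
   "w \<in> W \<Longrightarrow> c *s w \<in> W" "0 \<in> W"
  using W by (auto intro: subspace_add subspace_diff subspace_scale subspace_0)

lemma H_pow_E: "w \<in> W \<Longrightarrow> H ((E ^^ k) w) = (E ^^ k) (H w) + (2 * of_nat k) *s (E ^^ k) w"
proof (induction k)
  case (Suc k)
  hence "H ((E ^^ Suc k) w) = E (H ((E ^^ k) w)) + 2 *s E ((E ^^ k) w)"
    by (simp add: HE pow_in)
  thus ?case using Suc by (simp add: lopD[OF E] scale_two algebra_simps)
qed simp

lemma H_pow_F: "w \<in> W \<Longrightarrow> H ((F ^^ k) w) = (F ^^ k) (H w) - (2 * of_nat k) *s (F ^^ k) w"
proof (induction k)
  case (Suc k)
  hence "H ((F ^^ Suc k) w) = F (H ((F ^^ k) w)) - 2 *s F ((F ^^ k) w)"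
    by (simp add: HF pow_in)
  thus ?case using Suc by (simp add: lopD[OF F] scale_two algebra_simps)
qed simp

text \<open>On a vector of weight \<mu> killed by \<open>E\<close>, the right side becomes
  (k+1)(\<mu>-k) times the vector F^k w; the zero of this coefficient is what makes highest weights
  natural numbers.\<close>

lemma E_pow_F:
  "w \<in> W \<Longrightarrow> E ((F ^^ Suc k) w)
    = (F ^^ Suc k) (E w) + of_nat (Suc k) *s (F ^^ k) (H w - of_nat k *s w)"
proof (induction k)
  case (Suc k)
  have "E ((F ^^ Suc (Suc k)) w) = F (E ((F ^^ Suc k) w)) + H ((F ^^ Suc k) w)"
    using EF[OF pow_in(2)[OF Suc.prems, of "Suc k"]] by simp
  also have "\<dots> = (F ^^ Suc (Suc k)) (E w) + of_nat (Suc k) *s (F ^^ Suc k) (H w - of_nat k *s w)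
      + ((F ^^ Suc k) (H w) - (2 * of_nat (Suc k)) *s (F ^^ Suc k) w)"
    by (simp only: Suc.IH[OF Suc.prems] H_pow_F[OF Suc.prems]) (simp add: lopD[OF F])
  also have "\<dots> = (F ^^ Suc (Suc k)) (E w) + of_nat (Suc (Suc k)) *s (F ^^ Suc k) (H w - of_nat (Suc k) *s w)"
    by (simp add: lopD[OF lop_pow[OF F]] lopD[OF F] scale_two algebra_simps)
  finally show ?case .
qed (simp add: EF lopD[OF F])

text \<open>The form adapted to functionals: under a functional that vanishes on the image of
  \<open>F\<close>, it links the values on consecutive powers of \<open>E\<close>.\<close>

lemma pow_E_F:
  "w \<in> W \<Longrightarrow> (E ^^ Suc k) (F w)
    = F ((E ^^ Suc k) w) + of_nat (Suc k) *s (E ^^ k) (H w + of_nat k *s w)"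
proof (induction k arbitrary: w)
  case (Suc k)
  have "(E ^^ Suc (Suc k)) (F w) = (E ^^ Suc k) (F (E w)) + (E ^^ Suc k) (H w)"
    using EF[OF Suc.prems] by (simp add: funpow_Suc_right lopD[OF lop_pow[OF E]] lopD[OF E] del: funpow.simps)
  also have "\<dots> = F ((E ^^ Suc (Suc k)) w) + of_nat (Suc k) *s (E ^^ k) (E (H w) + 2 *s E w + of_nat k *s E w)
      + (E ^^ Suc k) (H w)"
    using Suc.IH[OF E_in[OF Suc.prems]] HE[OF Suc.prems] by (simp add: funpow_Suc_right del: funpow.simps)
  also have "\<dots> = F ((E ^^ Suc (Suc k)) w) + of_nat (Suc (Suc k)) *s (E ^^ Suc k) (H w + of_nat (Suc k) *s w)"
    by (simp add: lopD[OF lop_pow[OF E]] lopD[OF E] funpow_Suc_right scale_two algebra_simps del: funpow.simps)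
  finally show ?case .
qed (simp add: EF lopD[OF E])

text \<open>The vector \<open>y\<close> is a highest weight vector whose weight is maximal among all weights, and the
  functional \<open>\<phi>\<close> plays the same role in the dual.\<close>

lemma extremal_pair:
  assumes B: "finite B" "W \<subseteq> span B" and "w \<in> W" "w \<noteq> 0"
  obtains n x and \<phi> :: "'b \<Rightarrow> complex" where "x \<in> W" "H x = - of_nat n *s x" "(E ^^ Suc n) x = 0"
    "\<And>x y. \<phi> (x + y) = \<phi> x + \<phi> y" "\<And>c x. \<phi> (c *s x) = c * \<phi> x"
    "\<And>w. w \<in> W \<Longrightarrow> \<phi> (H w) = of_nat n * \<phi> w" "\<And>w. w \<in> W \<Longrightarrow> \<phi> (F w) = 0"
    "\<And>w k. \<lbrakk>w \<in> W; n < k\<rbrakk> \<Longrightarrow> \<phi> ((E ^^ k) w) = 0" "\<phi> ((E ^^ n) x) = 1"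
proof -
  define S where "S = {c. eigenval H W c}"
  have finS: "finite S" unfolding S_def by (rule finite_spectrum[OF H B])
  have "S \<noteq> {}" unfolding S_def using eigenval_exists[OF H W H_in B assms(3,4)] by auto
  \<comment> \<open>Complex weights are not ordered. An eigenvalue with maximal real part serves as
    highest weight, because \<mu> + 2 has larger real part and hence is no eigenvalue.\<close>
  hence "Max (Re ` S) \<in> Re ` S" using finS by (intro Max_in) auto
  then obtain \<mu> where \<mu>: "\<mu> \<in> S" "Re \<mu> = Max (Re ` S)" by auto
  have \<mu>: "\<mu> \<in> S" "\<And>c. c \<in> S \<Longrightarrow> Re c \<le> Re \<mu>"
    using \<mu> finS by auto
  have top: "v = 0" if "v \<in> W" "H v = (\<mu> + 2) *s v" for v
  proof (rule ccontr)
    assume "v \<noteq> 0"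
    hence "\<mu> + 2 \<in> S" using that by (auto simp: S_def eigenval_def)
    from \<mu>(2)[OF this] show False by simp
  qed
  obtain y where y: "y \<in> W" "y \<noteq> 0" "H y = \<mu> *s y"
    using \<mu>(1) by (auto simp: S_def eigenval_def)
  have Ey: "E y = 0"
    by (rule top) (use y in \<open>simp_all add: E_in HE lopD[OF E] scale_left_distrib\<close>)
  \<comment> \<open>Vectors of weight \<mu> - 2 k vanish for large \<open>k\<close>, as the spectrum
    is finite. The offset \<open>k0\<close> is for the second use below, where the eigenvector
    equation holds only from \<open>Suc n\<close> on.\<close>
  have eventually_zero: "\<exists>K. \<forall>k\<ge>K. u k = 0"
    if "\<And>k. u k \<in> W" "\<And>k. k \<ge> k0 \<Longrightarrow> H (u k) = (\<mu> - 2 * of_nat k) *s u k" for u k0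
  proof -
    have "inj (\<lambda>k. \<mu> - 2 * of_nat k)" by (auto simp: inj_def)
    hence "finite {k. \<mu> - 2 * of_nat k \<in> S}"
      using finite_vimageI[OF finS] by (simp add: vimage_def)
    then obtain K where K: "\<And>k. \<mu> - 2 * of_nat k \<in> S \<Longrightarrow> k < K"
      using finite_nat_set_iff_bounded by auto
    have "u k = 0" if "k \<ge> max K k0" for k
    proof (rule ccontr)
      assume "u k \<noteq> 0"
      moreover have "H (u k) = (\<mu> - 2 * of_nat k) *s u k" using \<open>k \<ge> max K k0\<close> that by (simp add: \<open>\<And>k. k \<ge> k0 \<Longrightarrow> H (u k) = (\<mu> - 2 * of_nat k) *s u k\<close>)
      ultimately have "\<mu> - 2 * of_nat k \<in> S" using \<open>\<And>k. u k \<in> W\<close> by (auto simp: S_def eigenval_def)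
      from K[OF this] show False using that by simp
    qed
    thus ?thesis by blast
  qed
  have HFy: "H ((F ^^ k) y) = (\<mu> - 2 * of_nat k) *s (F ^^ k) y" for k
    using y by (simp add: H_pow_F lopD[OF lop_pow[OF F]] scale_left_diff_distrib)
  have EFy: "E ((F ^^ Suc k) y) = (of_nat (Suc k) * (\<mu> - of_nat k)) *s (F ^^ k) y" for k
    using y by (simp add: E_pow_F Ey lopD[OF lop_pow[OF F]] lopD[OF F] scale_left_diff_distrib[symmetric] del: funpow.simps)
  obtain K where "(F ^^ K) y = 0"
    using eventually_zero[of "\<lambda>k. (F ^^ k) y" 0] pow_in(2)[OF y(1)] HFy by blast
  define n' where "n' = (LEAST k. (F ^^ k) y = 0)"
  have n': "(F ^^ n') y = 0" "\<And>k. k < n' \<Longrightarrow> (F ^^ k) y \<noteq> 0"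
    unfolding n'_def using LeastI[of "\<lambda>k. (F ^^ k) y = 0", OF \<open>(F ^^ K) y = 0\<close>] not_less_Least by auto
  with y(2) obtain n where n: "n' = Suc n" by (cases n') auto
  \<comment> \<open>The end of the chain fixes the weight: applying \<open>E\<close> to the first
    vanishing vector gives (n+1)(\<mu>-n) = 0.\<close>
  have "(of_nat (Suc n) * (\<mu> - of_nat n)) *s (F ^^ n) y = 0"
    using n'(1) EFy[of n] by (simp add: n lopD[OF E] del: funpow.simps)
  hence \<mu>n: "\<mu> = of_nat n" using n'(2)[of n] by (simp add: n del: of_nat_Suc)
  have Fn: "(F ^^ n) y \<noteq> 0" "(F ^^ Suc n) y = 0" using n' n by auto
  \<comment> \<open>A functional that vanishes on the range of H - n but not at \<open>y\<close> has
    weight n and detects \<open>y\<close>. It exists as soon as \<open>y\<close> is outside that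
    range, that is, when no Jordan block of \<open>H\<close> ends in \<open>y\<close>.\<close>
  define S1 where "S1 = (\<lambda>w. H w - of_nat n *s w) ` W"
  have S1: "subspace S1"
  proof (rule subspaceI)
    show "0 \<in> S1" unfolding S1_def by (rule image_eqI[of _ _ 0]) (simp_all add: lopD[OF H] W_ops)
    show "a + b \<in> S1" if "a \<in> S1" "b \<in> S1" for a b
    proof -
      from that obtain u v where "u \<in> W" "a = H u - of_nat n *s u" "v \<in> W" "b = H v - of_nat n *s v"
        by (auto simp: S1_def)
      thus ?thesis unfolding S1_def
        by (intro image_eqI[of _ _ "u + v"]) (simp_all add: lopD[OF H] W_ops scale_right_distrib)
    qed
    show "c *s a \<in> S1" if "a \<in> S1" for c a
    proof -
      from that obtain u where "u \<in> W" "a = H u - of_nat n *s u" by (auto simp: S1_def)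
      thus ?thesis unfolding S1_def
        by (intro image_eqI[of _ _ "c *s u"])
          (simp_all add: lopD[OF H] W_ops scale_right_diff_distrib mult.commute)
    qed
  qed
  \<comment> \<open>If (H - n) z = y, then E z = 0 by maximality of the weight, and E F^(k+1) z has
    an additional term (k+1) F^k y. Above height n this term is zero, so the vanishing of F^k z for
    large k descends, the factor n - k being nonzero, to k = n + 1. At k = n that factor is zero,
    and only (n+1) F^n y is left, which would have to vanish.\<close>
  have y_notin: "y \<notin> S1"
  proof
    assume "y \<in> S1"
    then obtain z where z: "z \<in> W" "H z = of_nat n *s z + y" by (auto simp: S1_def)
    have Ez: "E z = 0"
      by (rule top) (use z in \<open>simp_all add: E_in HE lopD[OF E] Ey \<mu>n scale_left_distrib\<close>)
    have EFz: "E ((F ^^ Suc k) z) = (of_nat (Suc k) * (of_nat n - of_nat k)) *s (F ^^ k) z + of_nat (Suc k) *s (F ^^ k) y" for k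
    proof -
      have "E ((F ^^ Suc k) z) = of_nat (Suc k) *s (F ^^ k) ((of_nat n - of_nat k) *s z + y)"
        using z by (simp add: E_pow_F Ez lopD[OF lop_pow[OF F]] lopD[OF F] scale_left_diff_distrib algebra_simps del: funpow.simps of_nat_Suc)
      thus ?thesis by (simp add: lopD[OF lop_pow[OF F]] scale_right_distrib del: funpow.simps of_nat_Suc)
    qed
    have Fy0: "(F ^^ k) y = 0" if "k \<ge> Suc n" for k
      using that by (induction rule: dec_induct) (use Fn(2) in \<open>simp_all add: lopD[OF F]\<close>)
    have HFz: "H ((F ^^ k) z) = (\<mu> - 2 * of_nat k) *s (F ^^ k) z" if "k \<ge> Suc n" for k
      using z Fy0[OF that] by (simp add: H_pow_F lopD[OF lop_pow[OF F]] \<mu>n scale_left_diff_distrib)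
    obtain K where K: "\<And>k. k \<ge> K \<Longrightarrow> (F ^^ k) z = 0"
      using eventually_zero[of "\<lambda>k. (F ^^ k) z" "Suc n"] pow_in(2)[OF z(1)] HFz by blast
    have "(F ^^ k) z = 0" if "Suc n \<le> k" "k \<le> max K (Suc n)" for k
      using that(2,1)
    proof (induction rule: inc_induct)
      case base
      show ?case by (rule K) simp
    next
      case (step k)
      have "(of_nat (Suc k) * (of_nat n - of_nat k)) *s (F ^^ k) z = 0"
        using EFz[of k] step Fy0[of k] by (simp add: lopD[OF E] del: funpow.simps of_nat_Suc)
      moreover have "(of_nat n - of_nat k :: complex) \<noteq> 0" using step by (simp del: of_nat_Suc)
      ultimately show ?case by (simp del: of_nat_Suc)
    qed
    from this[of "Suc n"] have "(F ^^ Suc n) z = 0" by (simp del: funpow.simps)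
    hence "of_nat (Suc n) *s (F ^^ n) y = 0" using EFz[of n] by (simp add: lopD[OF E] del: funpow.simps of_nat_Suc)
    thus False using Fn(1) by (simp del: of_nat_Suc)
  qed
  obtain \<phi> :: "'b \<Rightarrow> complex"
    where \<phi>: "\<And>x y. \<phi> (x + y) = \<phi> x + \<phi> y" "\<And>c x. \<phi> (c *s x) = c * \<phi> x"
      "\<And>x. x \<in> S1 \<Longrightarrow> \<phi> x = 0" "\<phi> y = 1"
    using functional_exists[OF S1 y_notin] by blast
  have \<phi>_diff: "\<phi> (a - b) = \<phi> a - \<phi> b" for a b
    using \<phi>(1)[of a "(-1) *s b"] \<phi>(2)[of "-1" b] by simp
  have \<phi>_0: "\<phi> 0 = 0" using \<phi>_diff[of 0 0] by simp
  have \<phi>H: "\<phi> (H w) = of_nat n * \<phi> w" if "w \<in> W" for w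
    using \<phi>(3)[of "H w - of_nat n *s w"] that by (simp add: S1_def \<phi>_diff \<phi>(2))
  \<comment> \<open>Off the spectrum H - c is injective, hence onto; every vector is then of the
    form (H - c) u for a convenient c.\<close>
  have surj: "\<exists>u\<in>W. w = H u - c *s u" if "w \<in> W" "c \<notin> S" for w c
  proof -
    have "\<exists>u\<in>W. (\<lambda>u. H u - c *s u) u = w"
    proof (rule inj_imp_surj[OF _ W _ B _ that(1)])
      show "lop (\<lambda>u. H u - c *s u)"
        using H by (auto simp: lop_def algebra_simps)
      show "v = 0" if "v \<in> W" "H v - c *s v = 0" for v
        using that \<open>c \<notin> S\<close> by (auto simp: S_def eigenval_def)
    qed (simp add: H_in W_ops)
    thus ?thesis by auto
  qed
  \<comment> \<open>With w = (H - (n+2)) u the relation between \<open>H\<close> and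
    \<open>F\<close> gives F w = (H - n) F u, and \<phi> vanishes on the range of H - n.\<close>
  have \<phi>F: "\<phi> (F w) = 0" if "w \<in> W" for w
  proof -
    have "of_nat n + 2 \<notin> S" using \<mu>(2)[of "\<mu> + 2"] by (auto simp: \<mu>n)
    from surj[OF that this] obtain u where u: "u \<in> W" "w = H u - (of_nat n + 2) *s u" by blast
    have "F w = F (H u) - (of_nat n + 2) *s F u" by (simp add: u(2) lopD[OF F])
    hence "F w = H (F u) - of_nat n *s F u"
      using u(1) by (simp add: HF scale_left_distrib)
    thus ?thesis using \<phi>H[OF F_in[OF u(1)]] by (simp add: \<phi>_diff \<phi>(2))
  qed
  have \<phi>E_H: "\<phi> ((E ^^ k) (H w)) = (of_nat n - 2 * of_nat k) * \<phi> ((E ^^ k) w)" if "w \<in> W" for w k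
    using \<phi>H[OF pow_in(1)[OF that, of k]] H_pow_E[OF that, of k]
    by (simp add: \<phi>(1,2) algebra_simps)
  \<comment> \<open>For large \<open>k\<close> the number n - 2 k is no eigenvalue, so w = (H - (n -
    2 k)) u for some u; since \<phi> o E^k has weight n - 2 k, its value on w is zero.\<close>
  obtain K where K: "\<And>w k. \<lbrakk>w \<in> W; k \<ge> K\<rbrakk> \<Longrightarrow> \<phi> ((E ^^ k) w) = 0"
  proof -
    have "inj (\<lambda>k. of_nat n - 2 * of_nat k :: complex)" by (auto simp: inj_def)
    hence "finite {k. of_nat n - 2 * of_nat k \<in> S}"
      using finite_vimageI[OF finS] by (simp add: vimage_def)
    then obtain K where K: "\<And>k. of_nat n - 2 * of_nat k \<in> S \<Longrightarrow> k < K"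
      using finite_nat_set_iff_bounded by auto
    show thesis
    proof (rule that)
      fix w k assume w: "w \<in> W" and "k \<ge> K"
      hence "of_nat n - 2 * of_nat k \<notin> S" using K by (meson not_less)
      from surj[OF w this] obtain u where u: "u \<in> W" "w = H u - (of_nat n - 2 * of_nat k) *s u" by blast
      thus "\<phi> ((E ^^ k) w) = 0"
        by (simp add: lopD[OF lop_pow[OF E]] \<phi>_diff \<phi>(2) \<phi>E_H del: funpow.simps)
    qed
  qed
  \<comment> \<open>From the bound \<open>K\<close> the vanishing descends to every k > n: the value
    of \<phi> on E^(k+1) F w is (k+1)(n-k) times its value on E^k w, and the factor is nonzero in
    this range.\<close>
  have \<phi>E: "\<phi> ((E ^^ k) w) = 0" if "w \<in> W" "n < k" for w k
  proof (cases "k \<le> K")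
    case True
    from this that(2) have "\<forall>w\<in>W. \<phi> ((E ^^ k) w) = 0"
    proof (induction rule: inc_induct)
      case base thus ?case using K by blast
    next
      case (step k)
      show ?case
      proof
        fix w assume w: "w \<in> W"
        have "0 = \<phi> ((E ^^ Suc k) (F w))" using step.IH step.prems F_in[OF w] by simp
        also have "\<dots> = of_nat (Suc k) * ((of_nat n - of_nat k) * \<phi> ((E ^^ k) w))"
          using w by (simp add: pow_E_F \<phi>(1,2) \<phi>F pow_in lopD[OF lop_pow[OF E]] \<phi>E_H algebra_simps del: funpow.simps of_nat_Suc)
        finally show "\<phi> ((E ^^ k) w) = 0" using step.prems by (simp del: of_nat_Suc)
      qed
    qed
    thus ?thesis using that by blast
  qed (use K that in auto)
  \<comment> \<open>Climbing back from the bottom of the chain multiplies by factors (m+1)(\<mu>-m)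
    with m < n, none of which is zero.\<close>
  have EkFn: "\<exists>c. c \<noteq> 0 \<and> (E ^^ k) ((F ^^ n) y) = c *s (F ^^ (n - k)) y" if "k \<le> n" for k
    using that
  proof (induction k)
    case 0 show ?case by (intro exI[of _ 1]) simp
  next
    case (Suc k)
    then obtain c where c: "c \<noteq> 0" "(E ^^ k) ((F ^^ n) y) = c *s (F ^^ (n - k)) y" by auto
    have nk: "n - k = Suc (n - Suc k)" using Suc.prems by simp
    have "(E ^^ Suc k) ((F ^^ n) y) = (c * (of_nat (Suc (n - Suc k)) * (\<mu> - of_nat (n - Suc k)))) *s (F ^^ (n - Suc k)) y"
      using c(2) EFy[of "n - Suc k"] by (simp add: nk lopD[OF E] del: of_nat_Suc funpow.simps(2)) (simp add: c nk lopD[OF E])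
    moreover have "\<mu> - of_nat (n - Suc k) \<noteq> 0" 
      using Suc.prems of_nat_eq_iff[of n "n - Suc k", where 'a = complex]
      by (auto simp del: of_nat_diff simp: \<mu>n)
    moreover have "of_nat (Suc (n - Suc k)) \<noteq> (0 :: complex)" by (rule of_nat_neq_0)
    ultimately show ?case using c(1)
      by (intro exI[of _ "c * (of_nat (Suc (n - Suc k)) * (\<mu> - of_nat (n - Suc k)))"] conjI)
        (simp_all del: of_nat_Suc funpow.simps)
  qed
  from EkFn[of n] obtain c where c: "c \<noteq> 0" "(E ^^ n) ((F ^^ n) y) = c *s y" by auto
  \<comment> \<open>The bottom vector of the chain, scaled so that E^n maps it exactly to
    \<open>y\<close>, where \<phi> is 1.\<close>
  define x where "x = inverse c *s (F ^^ n) y"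
  have x: "x \<in> W" unfolding x_def using y by (intro W_ops pow_in)
  have En: "(E ^^ n) x = y" using c by (simp add: x_def lopD[OF lop_pow[OF E]])
  show thesis
  proof (rule that[OF x _ _ \<phi>(1,2) \<phi>H \<phi>F \<phi>E])
    show "H x = - of_nat n *s x"
      using HFy[of n] by (simp add: x_def lopD[OF H] \<mu>n mult.commute)
    show "(E ^^ Suc n) x = 0" using En Ey by simp
    show "\<phi> ((E ^^ n) x) = 1" using En \<phi>(4) by simp
  qed
qed

end

text \<open>Complete reducibility by splitting off one string at a time. The functionals \<phi> o
  E^k of an extremal pair, for k up to n0, restrict to a dual basis on the string of
  \<open>x0\<close>; the common kernel of all \<phi> o E^k is a complement of this string, stable
  under the three operators, and the induction runs on it.\<close>

theorem (in cspace) string_basis: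
  assumes "sl2_ops scale H E F W" "finite B" "W \<subseteq> span B"
  shows "\<exists>(N :: nat) n x.
    (\<forall>j<N. x j \<in> W \<and> H (x j) = - of_nat (n j) *s x j \<and> (E ^^ Suc (n j)) (x j) = 0) \<and>
    (\<forall>w\<in>W. \<exists>c. w = (\<Sum>j<N. \<Sum>k\<le>n j. c (j, k) *s (E ^^ k) (x j))) \<and>
    (\<forall>c. (\<Sum>j<N. \<Sum>k\<le>n j. c (j, k) *s (E ^^ k) (x j)) = 0 \<longrightarrow> (\<forall>j<N. \<forall>k\<le>n j. c (j, k) = 0))"
  using assms
proof (induction "card B" arbitrary: B W rule: less_induct)
  case less
  interpret sl2_ops scale H E F W by (rule less.prems)
  show ?case
  proof (cases "\<exists>w\<in>W. w \<noteq> 0")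
    case False
    thus ?thesis by (intro exI[of _ 0]) auto
  next
    case True
    then obtain w where w: "w \<in> W" "w \<noteq> 0" by blast
    obtain n0 x0 \<phi> where x0: "x0 \<in> W" "H x0 = - of_nat n0 *s x0" "(E ^^ Suc n0) x0 = 0"
      and \<phi>: "\<And>x y. \<phi> (x + y) = \<phi> x + \<phi> y" "\<And>c x. \<phi> (c *s x) = c * \<phi> x"
      "\<And>w. w \<in> W \<Longrightarrow> \<phi> (H w) = of_nat n0 * \<phi> w" "\<And>w. w \<in> W \<Longrightarrow> \<phi> (F w) = 0"
      "\<And>w k. \<lbrakk>w \<in> W; n0 < k\<rbrakk> \<Longrightarrow> \<phi> ((E ^^ k) w) = 0" "\<phi> ((E ^^ n0) x0) = 1"
      by (rule extremal_pair[OF less.prems(2,3) w]) (rule that)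
    have \<phi>_0: "\<phi> 0 = 0" using \<phi>(2)[of 0 0] by simp
    have \<phi>_diff: "\<phi> (a - b) = \<phi> a - \<phi> b" for a b
      using \<phi>(1)[of a "(-1) *s b"] \<phi>(2)[of "-1" b] by simp
    have \<phi>_sum: "\<phi> (sum g A) = (\<Sum>i\<in>A. \<phi> (g i))" for g :: "nat \<Rightarrow> 'b" and A
      by (induction A rule: infinite_finite_induct) (simp_all add: \<phi>(1) \<phi>_0)
    have \<phi>E_H: "\<phi> ((E ^^ k) (H w)) = (of_nat n0 - 2 * of_nat k) * \<phi> ((E ^^ k) w)" if "w \<in> W" for w k
      using \<phi>(3)[OF pow_in(1)[OF that, of k]] H_pow_E[OF that, of k]
      by (simp add: \<phi>(1,2) algebra_simps)
    \<comment> \<open>Weights separate the heights: \<phi> o E^m has weight n0 - 2 m and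
      \<open>x0\<close> has weight - n0, so only m = n0 can give a nonzero value.\<close>
    have \<phi>x0: "\<phi> ((E ^^ m) x0) = (if m = n0 then 1 else 0)" for m
    proof -
      have "H x0 = (- of_nat n0) *s x0" using x0(2) by simp
      hence "- of_nat n0 * \<phi> ((E ^^ m) x0) = (of_nat n0 - 2 * of_nat m) * \<phi> ((E ^^ m) x0)"
        using \<phi>E_H[OF x0(1), of m] by (simp only: lopD[OF lop_pow[OF E]] \<phi>(2))
      hence "(of_nat m - of_nat n0) * \<phi> ((E ^^ m) x0) = 0" by (simp add: algebra_simps)
      thus ?thesis using \<phi>(6) by auto
    qed
    define W' where "W' = {w \<in> W. \<forall>k. \<phi> ((E ^^ k) w) = 0}"
    have subW': "subspace W'"
      unfolding W'_def
      by (rule subspaceI) (auto simp: W_ops lopD[OF lop_pow[OF E]] \<phi>(1,2) \<phi>_0)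
    \<comment> \<open>The kernel is stable under \<open>H\<close> since \<phi> o E^k is a weight
      functional, and under \<open>E\<close> by a shift of \<open>k\<close>. For \<open>F\<close>,
      moving E^k past it leaves a value of \<phi> on the image of \<open>F\<close>, which is zero,
      and a multiple of \<phi> o E^(k-1).\<close>
    have ops': "sl2_ops scale H E F W'"
    proof unfold_locales
      fix w assume "w \<in> W'"
      hence w: "w \<in> W" "\<And>k. \<phi> ((E ^^ k) w) = 0" by (auto simp: W'_def)
      show "H w \<in> W'" using w by (simp add: W'_def H_in \<phi>E_H)
      show "E w \<in> W'" using w(1) w(2)[of "Suc _"] by (simp add: W'_def E_in funpow_Suc_right del: funpow.simps)
      have "\<phi> ((E ^^ k) (F w)) = 0" for k
      proof (cases k)
        case (Suc m)
        thus ?thesis using w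
          by (simp add: pow_E_F \<phi>(1,2,4) pow_in lopD[OF lop_pow[OF E]] \<phi>E_H del: funpow.simps)
      qed (use w in \<open>simp add: \<phi>(4)\<close>)
      thus "F w \<in> W'" using w by (simp add: W'_def F_in)
    qed (use H E F subW' HE HF EF in \<open>auto simp: W'_def\<close>)
    have "W' \<subseteq> span B" using less.prems(3) by (auto simp: W'_def)
    then obtain A where A: "finite A" "A \<subseteq> W'" "independent A" "span A = W'"
      using finite_basis[OF subW' less.prems(2)] by metis
    \<comment> \<open>The vector E^n0 x0 lies in the span of \<open>B\<close> but outside W', so a
      basis of W' together with it still has at most \<open>card B\<close> elements.\<close>
    have card: "card A < card B"
    proof -
      let ?y = "(E ^^ n0) x0"
      have "\<phi> ((E ^^ 0) ?y) \<noteq> 0" using \<phi>x0 by simp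
      hence y: "?y \<notin> span A" unfolding A(4) W'_def by blast
      hence "independent (insert ?y A)" using A(3) by (rule independent_insertI)
      moreover have "insert ?y A \<subseteq> span B"
        using less.prems(3) pow_in(1)[OF x0(1), of n0] A(2) by (auto simp: W'_def)
      ultimately have "card (insert ?y A) \<le> card B"
        using independent_span_bound[OF less.prems(2)] by blast
      moreover have "?y \<notin> A" using y span_superset by blast
      ultimately show ?thesis using A(1) by simp
    qed
    have "W' \<subseteq> span A" using A(4) by simp
    from less.hyps[OF card ops' A(1) this] obtain N :: nat and n x where
      IH: "\<forall>j<N. x j \<in> W' \<and> H (x j) = - of_nat (n j) *s x j \<and> (E ^^ Suc (n j)) (x j) = 0"
        "\<forall>w\<in>W'. \<exists>c. w = (\<Sum>j<N. \<Sum>k\<le>n j. c (j, k) *s (E ^^ k) (x j))"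
        "\<forall>c. (\<Sum>j<N. \<Sum>k\<le>n j. c (j, k) *s (E ^^ k) (x j)) = 0 \<longrightarrow> (\<forall>j<N. \<forall>k\<le>n j. c (j, k) = 0)"
      by (elim exE conjE) (rule that, assumption+)
    define n' where "n' = n(N := n0)"
    define x' where "x' = x(N := x0)"
    have sum_split: "(\<Sum>j<Suc N. \<Sum>k\<le>n' j. c (j, k) *s (E ^^ k) (x' j))
      = (\<Sum>j<N. \<Sum>k\<le>n j. c (j, k) *s (E ^^ k) (x j)) + (\<Sum>k\<le>n0. c (N, k) *s (E ^^ k) x0)" for c
      by (simp add: n'_def x'_def)
    have \<phi>_string: "\<phi> ((E ^^ m) (\<Sum>k\<le>n0. c k *s (E ^^ k) x0)) = (if m \<le> n0 then c (n0 - m) else 0)" for m c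
    proof -
      have "\<phi> ((E ^^ m) (\<Sum>k\<le>n0. c k *s (E ^^ k) x0)) = (\<Sum>k\<le>n0. c k * \<phi> ((E ^^ (m + k)) x0))"
        by (simp add: lopD[OF lop_pow[OF E]] \<phi>_sum \<phi>(2) funpow_add)
      also have "\<dots> = (\<Sum>k\<le>n0. if k = n0 - m then (if m \<le> n0 then c k else 0) else 0)"
        by (rule sum.cong) (auto simp: \<phi>x0)
      also have "\<dots> = (if m \<le> n0 then c (n0 - m) else 0)" by (subst sum.delta) auto
      finally show ?thesis .
    qed
    have "\<exists>c. w = (\<Sum>j<Suc N. \<Sum>k\<le>n' j. c (j, k) *s (E ^^ k) (x' j))" if w: "w \<in> W" for w
    proof -
      \<comment> \<open>The projection to the string: by duality the coefficient of E^k x0 is read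
        off by \<phi> o E^(n0-k).\<close>
      define s where "s = (\<Sum>k\<le>n0. \<phi> ((E ^^ (n0 - k)) w) *s (E ^^ k) x0)"
      have "s \<in> W" unfolding s_def using x0(1) W by (intro subspace_sum W_ops pow_in)
      have "\<phi> ((E ^^ m) (w - s)) = 0" for m
        using \<phi>_string[of m "\<lambda>k. \<phi> ((E ^^ (n0 - k)) w)"] \<phi>(5)[OF w, of m]
        by (simp add: lopD(4)[OF lop_pow[OF E]] \<phi>_diff s_def[symmetric] split: if_splits)
      hence "w - s \<in> W'" using w \<open>s \<in> W\<close> by (simp add: W'_def W_ops)
      from bspec[OF IH(2) this] obtain c where c: "w - s = (\<Sum>j<N. \<Sum>k\<le>n j. c (j, k) *s (E ^^ k) (x j))" by blast
      let ?c = "\<lambda>(j, k). if j = N then \<phi> ((E ^^ (n0 - k)) w) else c (j, k)"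
      have "(\<Sum>j<N. \<Sum>k\<le>n j. ?c (j, k) *s (E ^^ k) (x j)) = w - s"
        unfolding c by (intro sum.cong refl) auto
      hence "w = (\<Sum>j<Suc N. \<Sum>k\<le>n' j. ?c (j, k) *s (E ^^ k) (x' j))"
        unfolding sum_split by (simp add: s_def)
      thus ?thesis by blast
    qed
    moreover have "c (j, k) = 0"
      if c: "(\<Sum>j<Suc N. \<Sum>k\<le>n' j. c (j, k) *s (E ^^ k) (x' j)) = 0" and jk: "j < Suc N" "k \<le> n' j" for c j k
    proof -
      let ?s = "\<Sum>j<N. \<Sum>k\<le>n j. c (j, k) *s (E ^^ k) (x j)"
      have "?s \<in> W'"
        using subW' IH(1) sl2_ops.pow_in(1)[OF ops'] by (intro subspace_sum subspace_scale) auto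
      hence "\<phi> ((E ^^ m) (\<Sum>k\<le>n0. c (N, k) *s (E ^^ k) x0)) = \<phi> ((E ^^ m) (?s + (\<Sum>k\<le>n0. c (N, k) *s (E ^^ k) x0)))" for m
        by (simp add: W'_def lopD(1)[OF lop_pow[OF E]] \<phi>(1))
      hence "(if m \<le> n0 then c (N, n0 - m) else 0) = 0" for m
        using c unfolding sum_split \<phi>_string by (simp add: lopD[OF lop_pow[OF E]] \<phi>_0)
      hence cN: "c (N, k) = 0" if "k \<le> n0" for k
        using that by (metis diff_diff_cancel diff_le_self)
      hence "?s = 0" using c unfolding sum_split by simp
      from IH(3)[rule_format, OF this] cN jk show ?thesis
        by (cases "j = N") (auto simp: n'_def)
    qed
    moreover have "x' j \<in> W \<and> H (x' j) = - of_nat (n' j) *s x' j \<and> (E ^^ Suc (n' j)) (x' j) = 0" if "j < Suc N" for j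
      using that IH(1)[rule_format, of j] x0 by (cases "j = N") (auto simp: n'_def x'_def W'_def)
    ultimately show ?thesis by blast
  qed
qed

section \<open>Finite dimensionality for spaces given by records\<close>

section \<open>Finite dimensional spaces\<close>

lemma fbasisI:
  assumes "cvs M" "finite I" "b \<in> I \<rightarrow> carrier M"
    and inj: "\<And>c i. \<lbrakk>c \<in> carrier (fs I); comb M b I c = \<zero>\<^bsub>M\<^esub>; i \<in> I\<rbrakk> \<Longrightarrow> c i = 0"
    and surj: "\<And>v. v \<in> carrier M \<Longrightarrow> \<exists>c. v = comb M b I c"
  shows "fbasis M b I"
  unfolding fbasis_def
proof (intro conjI assms(1-3))
  note L = comb_lin[OF assms(1-3)]
  show "bij_betw (comb M b I) (carrier (fs I)) (carrier M)"
  proof (rule bij_betw_imageI)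
    show "inj_on (comb M b I) (carrier (fs I))"
    proof (rule inj_onI)
      fix c d assume cd: "c \<in> carrier (fs I)" "d \<in> carrier (fs I)" "comb M b I c = comb M b I d"
      have "c \<ominus>\<^bsub>fs I\<^esub> d \<in> carrier (fs I)" by (rule cvs_simps(4)[OF fs_cvs cd(1,2)])
      moreover have "comb M b I (c \<ominus>\<^bsub>fs I\<^esub> d) = \<zero>\<^bsub>M\<^esub>"
        using cd linD(1)[OF L cd(2)]
        by (subst lin_minus[OF fs_cvs assms(1) L cd(1,2)]) (simp add: cvs_distribs(7)[OF assms(1)])
      ultimately have "(c \<ominus>\<^bsub>fs I\<^esub> d) i = 0" if "i \<in> I" for i using inj that by blast
      moreover have "(c \<ominus>\<^bsub>fs I\<^esub> d) = (\<lambda>i. c i - d i)"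
        using cvs_distribs(3)[OF fs_cvs cd(1,2)] by simp
      ultimately have "c i = d i" if "i \<in> I" for i using that by simp
      moreover have "c i = d i" if "i \<notin> I" for i using that cd by simp
      ultimately show "c = d" by blast
    qed
    show "comb M b I ` carrier (fs I) = carrier M"
    proof (intro equalityI subsetI)
      fix v assume "v \<in> carrier M"
      then obtain c where c: "v = comb M b I c" using surj by blast
      have "comb M b I c = comb M b I (\<lambda>i. if i \<in> I then c i else 0)"
        by (rule comb_cong[OF assms(1,3)]) simp_all
      thus "v \<in> comb M b I ` carrier (fs I)"
        unfolding c by (intro image_eqI) auto
    qed (use linD(1)[OF L] in auto)
  qed
qed

lemma fbasis_zero:
  assumes "fbasis M b I" "comb M b I c = \<zero>\<^bsub>M\<^esub>" "i \<in> I"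
  shows "c i = 0"
proof -
  note B = fbasisD[OF assms(1)]
  let ?c = "\<lambda>i. if i \<in> I then c i else 0"
  have "comb M b I ?c = comb M b I c" by (rule comb_cong[OF B(1,3)]) simp_all
  hence "comb M b I ?c = comb M b I \<zero>\<^bsub>fs I\<^esub>"
    using assms(2) lin_zero[OF fs_cvs B(1,6)] by simp
  hence "?c = \<zero>\<^bsub>fs I\<^esub>"
    using crd(4)[OF assms(1), of ?c] crd(4)[OF assms(1), of "\<zero>\<^bsub>fs I\<^esub>"] by simp
  thus ?thesis using assms(3) by (simp add: fun_eq_iff) metis
qed

lemma comb_reindex:
  assumes "cvs M" "bij_betw h J I" "b \<in> I \<rightarrow> carrier M"
  shows "comb M (\<lambda>j. b (h j)) J (\<lambda>j. c (h j)) = comb M b I c"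
proof -
  interpret M: vectorspace "class_ring :: complex ring" M by fact
  have I: "I = h ` J" using assms(2) by (simp add: bij_betw_def)
  show ?thesis unfolding comb_def I
    using assms by (subst M.finsum_reindex) (auto simp: bij_betw_def intro!: cvs_simps(3)[OF assms(1)])
qed

lemma fbasis_reindex:
  assumes "fbasis M b I" "bij_betw h J I"
  shows "fbasis M (\<lambda>j. b (h j)) J"
proof (rule fbasisI)
  note B = fbasisD[OF assms(1)]
  have h: "h j \<in> I" if "j \<in> J" for j using assms(2) that by (auto simp: bij_betw_def)
  define g where "g = the_inv_into J h"
  have g: "g (h j) = j" if "j \<in> J" for j
    using assms(2) that by (auto simp: g_def bij_betw_def the_inv_into_f_f)
  show "cvs M" by (rule B)
  show "finite J" using assms(2) B(2) by (simp add: bij_betw_finite)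
  show J: "(\<lambda>j. b (h j)) \<in> J \<rightarrow> carrier M" using B(4) h by blast
  fix c j assume c: "comb M (\<lambda>j. b (h j)) J c = \<zero>\<^bsub>M\<^esub>" "j \<in> J"
  have "comb M b I (\<lambda>i. c (g i)) = comb M (\<lambda>j. b (h j)) J c"
    by (subst comb_reindex[OF B(1) assms(2) B(3), symmetric]) (rule comb_cong[OF B(1) J], simp_all add: g)
  from fbasis_zero[OF assms(1), of "\<lambda>i. c (g i)" "h j"] this c h g show "c j = 0" by simp
next
  note B = fbasisD[OF assms(1)]
  fix v assume "v \<in> carrier M"
  hence "v = comb M b I (crd M b I v)" using crd(3)[OF assms(1)] by simp
  thus "\<exists>c. v = comb M (\<lambda>j. b (h j)) J c"
    using comb_reindex[OF B(1) assms(2) B(3)] by metis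
qed

text \<open>The index set is an initial segment of the naturals because an existential quantifier
  cannot range over index types; any finite index set can be renamed into this form.\<close>

definition fd :: "(complex, 'v, 'x) module_scheme \<Rightarrow> bool"
  where "fd M \<longleftrightarrow> (\<exists>b. \<exists>N :: nat. fbasis M b {..<N})"

lemma fbasis_imp_fd:
  assumes "fbasis M b I"
  shows "fd M"
proof -
  obtain h where "bij_betw h {0..<card I} I"
    using ex_bij_betw_nat_finite fbasisD(2)[OF assms] by blast
  from fbasis_reindex[OF assms this] show ?thesis by (auto simp: fd_def lessThan_atLeast0)
qed

lemma fdE:
  assumes "fd M"
  obtains b and N :: nat where "fbasis M b {..<N}"
  using assms by (auto simp: fd_def)

lemma fd_cvs: "fd M \<Longrightarrow> cvs M"
  by (auto simp: fd_def dest: fbasisD)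

interpretation fv: cspace "\<lambda>(a :: complex) (c :: 'i \<Rightarrow> complex) i. a * c i"
  by unfold_locales (simp_all add: fun_eq_iff algebra_simps)

lemma finsum_fs:
  assumes "finite A" "f \<in> A \<rightarrow> carrier (fs I)"
  shows "finsum (fs I) f A = sum f A"
proof -
  interpret M: vectorspace "class_ring :: complex ring" "fs I" by (rule fs_cvs)
  show ?thesis using assms
    by (induction A rule: finite_induct) (simp_all add: fun_eq_iff zero_fun_def plus_fun_def)
qed

lemma comb_fs:
  assumes "finite J" "b \<in> J \<rightarrow> carrier (fs I)"
  shows "comb (fs I) b J c = (\<Sum>j\<in>J. (\<lambda>i. c j * b j i))"
  unfolding comb_def using assms by (subst finsum_fs) (auto simp: Pi_iff)

lemma fs_subset_span: "finite I \<Longrightarrow> carrier (fs I) \<subseteq> fv.span (unit ` I)"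
proof
  fix c assume "finite I" and c: "c \<in> carrier (fs I)"
  hence "c = (\<Sum>i\<in>I. (\<lambda>j. c i * unit i j))"
    using comb_fs_unit[of I c] by (subst (asm) comb_fs) (auto simp: unit_def)
  also have "\<dots> \<in> fv.span (unit ` I)"
    by (intro fv.span_sum fv.span_scale fv.span_base) auto
  finally show "c \<in> fv.span (unit ` I)" .
qed

text \<open>A basis of the image inside the coordinate space is pulled back along \<theta>. This
  serves for subspaces and for spaces of homomorphisms, which come without a basis of their
  own.\<close>

lemma fd_of_inj:
  assumes "cvs M" "finite I" "lin M (fs I) \<theta>" "inj_on \<theta> (carrier M)"
  shows "fd M"
proof -
  note M = cvs_simps[OF assms(1)] and \<theta> = linD[OF assms(3)]
  let ?S = "\<theta> ` carrier M"
  have S: "fv.subspace ?S"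
  proof (rule fv.subspaceI)
    show "0 \<in> ?S" using M(1) lin_zero[OF assms(1) fs_cvs assms(3)] by (force simp: zero_fun_def)
    show "x + y \<in> ?S" if "x \<in> ?S" "y \<in> ?S" for x y
    proof -
      from that obtain u v where uv: "u \<in> carrier M" "v \<in> carrier M" "x = \<theta> u" "y = \<theta> v" by auto
      thus ?thesis using \<theta>(2)[OF uv(1,2)] M(2)[OF uv(1,2)]
        by (intro image_eqI[of _ _ "u \<oplus>\<^bsub>M\<^esub> v"]) (simp_all add: plus_fun_def)
    qed
    show "(\<lambda>i. c * x i) \<in> ?S" if "x \<in> ?S" for c x
    proof -
      from that obtain u where u: "u \<in> carrier M" "x = \<theta> u" by auto
      thus ?thesis using \<theta>(3)[OF u(1), of c] M(3)[OF u(1)]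
        by (intro image_eqI[of _ _ "c \<odot>\<^bsub>M\<^esub> u"]) simp_all
    qed
  qed
  have "?S \<subseteq> fv.span (unit ` I)" using fs_subset_span[OF assms(2)] \<theta>(1) by blast
  then obtain A where A: "finite A" "A \<subseteq> ?S" "fv.independent A" "fv.span A = ?S"
    using S assms(2) fv.finite_basis[of ?S "unit ` I"] by (metis finite_imageI)
  define b where "b = inv_into (carrier M) \<theta>"
  have b: "b a \<in> carrier M" "\<theta> (b a) = a" if "a \<in> A" for a
    using that A(2) by (auto simp: b_def inv_into_into f_inv_into_f)
  have b_in: "b \<in> A \<rightarrow> carrier M" using b by blast
  have comb: "\<theta> (comb M b A c) = (\<Sum>a\<in>A. (\<lambda>i. c a * a i))" for c
  proof -
    have "\<theta> (comb M b A c) = comb (fs I) (\<lambda>a. \<theta> (b a)) A c"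
      by (rule lin_comb[OF assms(1) fs_cvs assms(3) b_in])
    also have "\<dots> = (\<Sum>a\<in>A. (\<lambda>i. c a * \<theta> (b a) i))"
      using A(1) b(1) \<theta>(1) by (intro comb_fs) auto
    also have "\<dots> = (\<Sum>a\<in>A. (\<lambda>i. c a * a i))" by (rule sum.cong) (simp_all add: b)
    finally show ?thesis .
  qed
  have "fbasis M b A"
  proof (rule fbasisI[OF assms(1) A(1) b_in])
    fix c a assume c: "comb M b A c = \<zero>\<^bsub>M\<^esub>" "a \<in> A"
    have "(\<Sum>a\<in>A. (\<lambda>i. c a * a i)) = 0"
      using comb[of c] lin_zero[OF assms(1) fs_cvs assms(3)] c(1) by (simp add: zero_fun_def)
    moreover have "\<not> (\<exists>u. (\<exists>v\<in>A. u v \<noteq> 0) \<and> (\<Sum>v\<in>A. (\<lambda>i. u v * v i)) = 0)"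
      using fv.dependent_finite[OF A(1)] A(3) by simp
    ultimately show "c a = 0" using c(2) by blast
  next
    fix v assume v: "v \<in> carrier M"
    hence "\<theta> v \<in> fv.span A" using A(4) by blast
    then obtain c where "\<theta> v = (\<Sum>a\<in>A. (\<lambda>i. c a * a i))"
      using fv.span_finite[OF A(1)] by auto
    hence "\<theta> v = \<theta> (comb M b A c)" using comb by simp
    moreover have "comb M b A c \<in> carrier M"
      unfolding comb_def using b_in
      by (intro abelian_monoid.finsum_closed) (use assms(1) M(3) in \<open>auto simp: vectorspace_def Module.module_def abelian_group_def\<close>)
    ultimately show "\<exists>c. v = comb M b A c" using assms(4) v by (auto dest: inj_onD)
  qed
  thus ?thesis by (rule fbasis_imp_fd)
qed

lemma fd_of_inj_fd:
  assumes "cvs M" "fd N" "lin M N \<theta>" "inj_on \<theta> (carrier M)"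
  shows "fd M"
proof -
  from assms(2) obtain b and n :: nat where b: "fbasis N b {..<n}" by (rule fdE)
  note C = crd[OF b]
  show ?thesis
  proof (rule fd_of_inj[OF assms(1)])
    show "lin M (fs {..<n}) (\<lambda>v. crd N b {..<n} (\<theta> v))" by (rule lin_compose[OF assms(3) C(1)])
    show "inj_on (\<lambda>v. crd N b {..<n} (\<theta> v)) (carrier M)"
    proof (rule inj_onI)
      fix x y assume xy: "x \<in> carrier M" "y \<in> carrier M" "crd N b {..<n} (\<theta> x) = crd N b {..<n} (\<theta> y)"
      have "\<theta> x = comb N b {..<n} (crd N b {..<n} (\<theta> x))"
        by (rule C(3)[OF linD(1)[OF assms(3) xy(1)], symmetric])
      also have "\<dots> = \<theta> y"
        unfolding xy(3) by (rule C(3)[OF linD(1)[OF assms(3) xy(2)]])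
      finally have "\<theta> x = \<theta> y" .
      thus "x = y" using assms(4) xy by (auto dest: inj_onD)
    qed
  qed simp
qed

lemma fd_subspace:
  assumes "fd M" "VectorSpace.subspace class_ring A M"
  shows "fd (M\<lparr>carrier := A\<rparr>)"
  by (rule fd_of_inj_fd[OF cvs_carrier_update[OF assms(2)] assms(1), of "\<lambda>v. v"])
    (use assms(2) in \<open>auto simp: lin_iff subspace_iff\<close>)

lemma comb_id_lincomb:
  assumes "cvs M"
  shows "comb M (\<lambda>v. v) A c = LinearCombinations.module.lincomb M c A"
proof -
  interpret M: vectorspace "class_ring :: complex ring" M by fact
  show ?thesis by (simp add: comb_def M.lincomb_def)
qed

lemma fin_dim_basis:
  fixes M :: "(complex, 'v, 'x) module_scheme"
  assumes "cvs M" "vectorspace.fin_dim class_ring M"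
  obtains A where "fbasis M (\<lambda>v. v) A" "card A = vectorspace.dim class_ring M"
proof -
  interpret M: vectorspace "class_ring :: complex ring" M by fact
  obtain A where A: "finite A" "M.basis A" using M.finite_basis_exists assms(2) by auto
  hence A': "M.lin_indpt A" "M.span A = carrier M" "A \<subseteq> carrier M" by (auto simp: M.basis_def)
  have "fbasis M (\<lambda>v. v) A"
  proof (rule fbasisI[OF assms(1) A(1)])
    show "(\<lambda>v. v) \<in> A \<rightarrow> carrier M" using A'(3) by auto
    show "c i = 0" if "comb M (\<lambda>v. v) A c = \<zero>\<^bsub>M\<^esub>" "i \<in> A" for c i
      using A'(1) M.lin_dep_crit[OF A(1) subset_refl, of c i] that
      by (auto simp: comb_id_lincomb[OF assms(1)])
    show "\<exists>c. v = comb M (\<lambda>v. v) A c" if "v \<in> carrier M" for v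
      using M.finite_span[OF A(1) A'(3)] A'(2) that by (auto simp: comb_id_lincomb[OF assms(1)])
  qed
  thus thesis using M.dim_basis[OF A] by (intro that) auto
qed

text \<open>Connects family bases with the set-based dimension of the definitions. The family is
  injective, as equal vectors would have equal unit vectors as coordinates, so its range is a basis
  with \<open>card I\<close> elements.\<close>

lemma fbasis_fin_dim:
  fixes M :: "(complex, 'v, 'x) module_scheme"
  assumes "fbasis M b I"
  shows "vectorspace.fin_dim class_ring M" "vectorspace.dim class_ring M = card I"
proof -
  note B = fbasisD[OF assms]
  interpret M: vectorspace "class_ring :: complex ring" M by (rule B)
  have inj: "inj_on b I"
  proof (rule inj_onI)
    fix i j assume ij: "i \<in> I" "j \<in> I" "b i = b j"
    have "unit i = (unit j :: _ \<Rightarrow> complex)" using crd(5)[OF assms] ij by metis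
    from fun_cong[OF this, of i] show "i = j" by (auto simp: unit_def split: if_splits)
  qed
  hence bij: "bij_betw b I (b ` I)" by (simp add: bij_betw_def)
  have comb: "M.lincomb a (b ` I) = comb M b I (\<lambda>i. a (b i))" for a
  proof -
    have "(\<lambda>v. v) \<in> b ` I \<rightarrow> carrier M" using B(4) by auto
    from comb_reindex[OF B(1) bij this, of a] show ?thesis by (simp add: comb_id_lincomb[OF B(1)])
  qed
  have sub: "b ` I \<subseteq> carrier M" and fin: "finite (b ` I)" using B(2,4) by auto
  have gen: "M.gen_set (b ` I)"
  proof (intro equalityI subsetI)
    fix v assume "v \<in> carrier M"
    hence v: "v = comb M b I (crd M b I v)" using crd(3)[OF assms] by simp
    have "v = M.lincomb (\<lambda>w. crd M b I v (inv_into I b w)) (b ` I)"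
      unfolding comb by (subst v, rule comb_cong[OF B(1,3)]) (simp_all add: inv_into_f_f[OF inj])
    thus "v \<in> M.span (b ` I)" unfolding M.finite_span[OF fin sub] by auto
  qed (use M.span_is_subset2[OF sub] in auto)
  have indep: "M.lin_indpt (b ` I)"
    by (rule M.finite_lin_indpt2[OF fin sub]) (use fbasis_zero[OF assms] in \<open>auto simp: comb\<close>)
  show "M.fin_dim" unfolding M.fin_dim_def using fin sub gen by blast
  show "M.dim = card I"
    using M.dim_basis[OF fin] indep gen sub card_image[OF inj] by (simp add: M.basis_def)
qed

lemma fd_iff: "cvs M \<Longrightarrow> fd M \<longleftrightarrow> vectorspace.fin_dim class_ring M"
  by (meson fin_dim_basis fbasis_imp_fd fbasis_fin_dim(1) fdE)

section \<open>Modules over matrix Lie algebras and their tensor products\<close>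

section \<open>Lie modules\<close>

text \<open>A Lie algebra is given as a mere set of matrices. Transporting the module axioms along a
  map that intertwines the action of \<open>g\<close> uses that sums, multiples and brackets stay in
  \<open>g\<close>.\<close>

definition lie_closed :: "complex mat set \<Rightarrow> bool"
  where "lie_closed g \<longleftrightarrow> (\<forall>x\<in>g. \<forall>y\<in>g. x + y \<in> g \<and> x * y - y * x \<in> g) \<and> (\<forall>x\<in>g. \<forall>c. c \<cdot>\<^sub>m x \<in> g)"

lemma lie_moduleD:
  assumes "lie_module g M"
  shows "cvs M" "x \<in> g \<Longrightarrow> lin M M (act M x)"
    "\<lbrakk>x \<in> g; y \<in> g; v \<in> carrier M\<rbrakk> \<Longrightarrow> act M (x + y) v = act M x v \<oplus>\<^bsub>M\<^esub> act M y v"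
    "\<lbrakk>x \<in> g; v \<in> carrier M\<rbrakk> \<Longrightarrow> act M (c \<cdot>\<^sub>m x) v = c \<odot>\<^bsub>M\<^esub> act M x v"
    "\<lbrakk>x \<in> g; y \<in> g; v \<in> carrier M\<rbrakk>
      \<Longrightarrow> act M (x * y - y * x) v = act M x (act M y v) \<ominus>\<^bsub>M\<^esub> act M y (act M x v)"
    "\<lbrakk>x \<in> g; v \<in> carrier M\<rbrakk> \<Longrightarrow> act M x v \<in> carrier M"
  using assms by (auto simp: lie_module_def lin_iff)

lemma lie_moduleI:
  assumes "cvs M" "\<And>x. x \<in> g \<Longrightarrow> lin M M (act M x)"
    "\<And>x y v. \<lbrakk>x \<in> g; y \<in> g; v \<in> carrier M\<rbrakk> \<Longrightarrow> act M (x + y) v = act M x v \<oplus>\<^bsub>M\<^esub> act M y v"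
    "\<And>x c v. \<lbrakk>x \<in> g; v \<in> carrier M\<rbrakk> \<Longrightarrow> act M (c \<cdot>\<^sub>m x) v = c \<odot>\<^bsub>M\<^esub> act M x v"
    "\<And>x y v. \<lbrakk>x \<in> g; y \<in> g; v \<in> carrier M\<rbrakk>
      \<Longrightarrow> act M (x * y - y * x) v = act M x (act M y v) \<ominus>\<^bsub>M\<^esub> act M y (act M x v)"
  shows "lie_module g M"
  using assms by (simp add: lie_module_def)

lemma lie_module_iso:
  assumes g: "lie_closed g" and M: "lie_module g M"
    and bij: "bij_betw \<phi> (carrier M) (carrier N)" and lin: "lin M N \<phi>"
    and zero: "\<zero>\<^bsub>N\<^esub> = \<phi> \<zero>\<^bsub>M\<^esub>"
    and eq: "\<And>x v. \<lbrakk>x \<in> g; v \<in> carrier M\<rbrakk> \<Longrightarrow> act N x (\<phi> v) = \<phi> (act M x v)"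
  shows "lie_module g N"
proof -
  note D = lie_moduleD[OF M]
  have N: "cvs N" by (rule cvs_iso[OF D(1) bij lin zero])
  have surj: "\<exists>v\<in>carrier M. w = \<phi> v" if "w \<in> carrier N" for w
    using bij that by (auto simp: bij_betw_def)
  note L = linD[OF lin] and S = cvs_simps[OF D(1)]
  note cl = g[unfolded lie_closed_def]
  have L': "\<phi> v \<oplus>\<^bsub>N\<^esub> \<phi> w = \<phi> (v \<oplus>\<^bsub>M\<^esub> w)" "c \<odot>\<^bsub>N\<^esub> \<phi> v = \<phi> (c \<odot>\<^bsub>M\<^esub> v)" "\<phi> v \<ominus>\<^bsub>N\<^esub> \<phi> w = \<phi> (v \<ominus>\<^bsub>M\<^esub> w)"
    if "v \<in> carrier M" "w \<in> carrier M" for v w c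
    using that L lin_minus[OF D(1) N lin] by simp_all
  show ?thesis
  proof (rule lie_moduleI[OF N])
    show "lin N N (act N x)" if "x \<in> g" for x
      by (rule linI) (use that in \<open>auto dest!: surj simp: L' eq D(6) L(1) S linD[OF D(2)]\<close>)
  qed (use cl in \<open>auto dest!: surj simp: L' eq D(6) L(1) S D(3-5)\<close>)
qed

lemma lie_hom_iff: "f \<in> lie_hom g M N \<longleftrightarrow> lin M N f \<and> f \<in> extensional (carrier M) \<and>
    (\<forall>x\<in>g. \<forall>v\<in>carrier M. f (act M x v) = act N x (f v))"
  by (auto simp: lie_hom_def)

section \<open>Existence of tensor products\<close>

lemma bilinear_mapI:
  assumes "\<And>v w. \<lbrakk>v \<in> carrier V; w \<in> carrier W\<rbrakk> \<Longrightarrow> b v w \<in> carrier Z"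
    "\<And>v v' w. \<lbrakk>v \<in> carrier V; v' \<in> carrier V; w \<in> carrier W\<rbrakk> \<Longrightarrow> b (v \<oplus>\<^bsub>V\<^esub> v') w = b v w \<oplus>\<^bsub>Z\<^esub> b v' w"
    "\<And>v w w'. \<lbrakk>v \<in> carrier V; w \<in> carrier W; w' \<in> carrier W\<rbrakk> \<Longrightarrow> b v (w \<oplus>\<^bsub>W\<^esub> w') = b v w \<oplus>\<^bsub>Z\<^esub> b v w'"
    "\<And>c v w. \<lbrakk>v \<in> carrier V; w \<in> carrier W\<rbrakk> \<Longrightarrow> b (c \<odot>\<^bsub>V\<^esub> v) w = c \<odot>\<^bsub>Z\<^esub> b v w"
    "\<And>c v w. \<lbrakk>v \<in> carrier V; w \<in> carrier W\<rbrakk> \<Longrightarrow> b v (c \<odot>\<^bsub>W\<^esub> w) = c \<odot>\<^bsub>Z\<^esub> b v w"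
  shows "bilinear_map V W Z b"
  using assms by (auto simp: bilinear_map_def lin_iff)

lemma bilinear_mapD:
  assumes "bilinear_map V W Z b"
  shows "v \<in> carrier V \<Longrightarrow> lin W Z (b v)" "w \<in> carrier W \<Longrightarrow> lin V Z (\<lambda>v. b v w)"
    "\<lbrakk>v \<in> carrier V; w \<in> carrier W\<rbrakk> \<Longrightarrow> b v w \<in> carrier Z"
    "\<lbrakk>v \<in> carrier V; v' \<in> carrier V; w \<in> carrier W\<rbrakk> \<Longrightarrow> b (v \<oplus>\<^bsub>V\<^esub> v') w = b v w \<oplus>\<^bsub>Z\<^esub> b v' w"
    "\<lbrakk>v \<in> carrier V; w \<in> carrier W; w' \<in> carrier W\<rbrakk> \<Longrightarrow> b v (w \<oplus>\<^bsub>W\<^esub> w') = b v w \<oplus>\<^bsub>Z\<^esub> b v w'"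
    "\<lbrakk>v \<in> carrier V; w \<in> carrier W\<rbrakk> \<Longrightarrow> b (c \<odot>\<^bsub>V\<^esub> v) w = c \<odot>\<^bsub>Z\<^esub> b v w"
    "\<lbrakk>v \<in> carrier V; w \<in> carrier W\<rbrakk> \<Longrightarrow> b v (c \<odot>\<^bsub>W\<^esub> w) = c \<odot>\<^bsub>Z\<^esub> b v w"
  using assms by (auto simp: bilinear_map_def lin_iff)

lemma bilinear_compose:
  "\<lbrakk>bilinear_map V' W' Z b; lin V V' f; lin W W' g\<rbrakk> \<Longrightarrow> bilinear_map V W Z (\<lambda>v w. b (f v) (g w))"
  by (rule bilinear_mapI) (simp_all add: linD bilinear_mapD)

lemma bilinear_add:
  "\<lbrakk>cvs Z; bilinear_map V W Z b; bilinear_map V W Z b'\<rbrakk> \<Longrightarrow> bilinear_map V W Z (\<lambda>v w. b v w \<oplus>\<^bsub>Z\<^esub> b' v w)"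
  unfolding bilinear_map_def by (intro conjI ballI lin_add) simp_all

text \<open>The defining property of a tensor product quantifies over plain vector space records.
  With a basis of pure tensors the lift exists and is unique for every record \<open>Z\<close>, in
  particular for modules that also carry an action. Agreement on basis vectors is extended in one
  argument at a time.\<close>

lemma lift_ex1:
  fixes V W :: "'u lmod" and Z :: "(complex, 'u, 'x) module_scheme"
  assumes V: "fbasis V p I" and W: "fbasis W q J" and bil: "bilinear_map V W T t"
    and T: "fbasis T (\<lambda>(i, j). t (p i) (q j)) (I \<times> J)"
    and Z: "cvs Z" and b: "bilinear_map V W Z b"
  shows "\<exists>!f. lifts_bilinear V W T t Z b f"
proof -
  note V' = fbasisD[OF V] and W' = fbasisD[OF W]
  have "(\<lambda>(i, j). b (p i) (q j)) \<in> I \<times> J \<rightarrow> carrier Z"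
    using V'(4) W'(4) bilinear_mapD(3)[OF b] by auto
  then obtain f where f: "lin T Z f" "f \<in> extensional (carrier T)"
      "\<And>ij. ij \<in> I \<times> J \<Longrightarrow> f ((\<lambda>(i, j). t (p i) (q j)) ij) = (\<lambda>(i, j). b (p i) (q j)) ij"
    using lin_extend[OF T Z] by metis
  have 1: "f (t v (q j)) = b v (q j)" if "j \<in> J" "v \<in> carrier V" for v j
  proof (rule lin_ext[OF V Z _ _ _ that(2)])
    show "lin V Z (\<lambda>v. f (t v (q j)))" "lin V Z (\<lambda>v. b v (q j))"
      using that W'(4) by (auto intro: lin_compose[OF bilinear_mapD(2)[OF bil] f(1)] bilinear_mapD(2)[OF b])
    show "f (t (p i) (q j)) = b (p i) (q j)" if "i \<in> I" for i
      using f(3)[of "(i, j)"] that \<open>j \<in> J\<close> by simp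
  qed
  have 2: "f (t v w) = b v w" if "v \<in> carrier V" "w \<in> carrier W" for v w
  proof (rule lin_ext[OF W Z _ _ _ that(2)])
    show "lin W Z (\<lambda>w. f (t v w))" "lin W Z (\<lambda>w. b v w)"
      using that by (auto intro: lin_compose[OF bilinear_mapD(1)[OF bil] f(1)] bilinear_mapD(1)[OF b])
    show "f (t v (q j)) = b v (q j)" if "j \<in> J" for j
      using 1 that \<open>v \<in> carrier V\<close> by simp
  qed
  show ?thesis
  proof (rule ex1I[of _ f])
    show "lifts_bilinear V W T t Z b f" using f 2 by (auto simp: lifts_bilinear_def)
    fix h assume "lifts_bilinear V W T t Z b h"
    hence h: "lin T Z h" "h \<in> extensional (carrier T)"
      "\<And>v w. \<lbrakk>v \<in> carrier V; w \<in> carrier W\<rbrakk> \<Longrightarrow> h (t v w) = b v w"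
      by (auto simp: lifts_bilinear_def)
    show "h = f"
    proof (rule extensionalityI[OF h(2) f(2)])
      fix x assume x: "x \<in> carrier T"
      show "h x = f x"
        by (rule lin_ext[OF T Z h(1) f(1) _ x]) (use h(3) 2 V'(4) W'(4) in auto)
    qed
  qed
qed

lemma inj_complex_pair: "\<exists>f :: complex \<times> complex \<Rightarrow> complex. inj f"
proof -
  have "\<exists>f. bij_betw f (UNIV \<times> UNIV :: (complex \<times> complex) set) (UNIV :: complex set)"
    unfolding card_of_ordIso by (rule card_of_Times_same_infinite) (rule infinite_UNIV_char_0)
  thus ?thesis by (auto simp: bij_betw_def)
qed

text \<open>A matter of cardinality alone: a finite power of the complex numbers injects into the
  complex numbers as a set, so one copy of them in the carrier type has room for every finite
  dimensional space.\<close>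

lemma inj_fs_complex:
  assumes "finite I"
  shows "\<exists>f :: ('i \<Rightarrow> complex) \<Rightarrow> complex. inj_on f (carrier (fs I))"
  using assms
proof (induction I rule: finite_induct)
  case empty
  show ?case by (rule exI[of _ "\<lambda>_. 0"]) (auto simp: inj_on_def)
next
  case (insert a I)
  then obtain f :: "('i \<Rightarrow> complex) \<Rightarrow> complex" where f: "inj_on f (carrier (fs I))" by blast
  obtain p :: "complex \<times> complex \<Rightarrow> complex" where p: "inj p" using inj_complex_pair by blast
  have "inj_on (\<lambda>c. p (c a, f (c(a := 0)))) (carrier (fs (insert a I)))"
  proof (rule inj_onI)
    fix c d assume cd: "c \<in> carrier (fs (insert a I))" "d \<in> carrier (fs (insert a I))"
      "p (c a, f (c(a := 0))) = p (d a, f (d(a := 0)))"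
    hence "c a = d a" "f (c(a := 0)) = f (d(a := 0))" using p by (auto dest: injD)
    moreover from this(2) have "c(a := 0) = d(a := 0)"
      using cd(1,2) by (intro inj_onD[OF f]) auto
    ultimately show "c = d" by (metis fun_upd_triv fun_upd_upd)
  qed
  thus ?case by blast
qed

locale embedded_complex =
  fixes embed :: "complex \<Rightarrow> 'u"
  assumes inj_embed: "inj embed"
begin

lemma model_exists:
  assumes "finite I"
  shows "\<exists>(T :: (complex, 'u) module) \<phi>. cvs T \<and> lin (fs I) T \<phi> \<and> bij_betw \<phi> (carrier (fs I)) (carrier T)"
proof -
  obtain f :: "('a \<Rightarrow> complex) \<Rightarrow> complex" where f: "inj_on f (carrier (fs I))"
    using inj_fs_complex[OF assms] by blast
  define j where "j = (\<lambda>c. embed (f c))"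
  define h where "h = inv_into (carrier (fs I)) j"
  have j: "inj_on j (carrier (fs I))"
    using f inj_embed by (auto simp: j_def inj_on_def simp del: fs_sel)
  have h: "h (j c) = c" if "c \<in> carrier (fs I)" for c
    unfolding h_def by (rule inv_into_f_f[OF j that])
  define T :: "(complex, 'u) module" where "T = \<lparr>carrier = j ` carrier (fs I), monoid.mult = undefined, one = undefined,
     zero = j (\<lambda>i. 0), add = (\<lambda>x y. j (\<lambda>i. h x i + h y i)), module.smult = (\<lambda>a x. j (\<lambda>i. a * h x i))\<rparr>"
  have bij: "bij_betw j (carrier (fs I)) (carrier T)"
    using j by (simp add: bij_betw_def T_def)
  have lin: "lin (fs I) T j"
    by (rule linI) (use h in \<open>auto simp: T_def\<close>)
  have "cvs T" by (rule cvs_iso[OF fs_cvs bij lin]) (simp add: T_def)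
  with bij lin show ?thesis by blast
qed

text \<open>The source of modules in the carrier type: an explicit module on some other type is
  moved across. The action is intertwined for every matrix, inside \<open>g\<close> or not, since
  the action of \<open>N\<close> is defined by pulling vectors back to \<open>M\<close>.\<close>

lemma lie_model_exists:
  fixes M :: "'v lmod"
  assumes "lie_closed g" "lie_module g M" "fd M"
  shows "\<exists>(N :: 'u lmod) \<phi>. lie_module g N \<and> lin M N \<phi> \<and> bij_betw \<phi> (carrier M) (carrier N) \<and>
    (\<forall>x. \<forall>v\<in>carrier M. act N x (\<phi> v) = \<phi> (act M x v))"
proof -
  from assms(3) obtain b and n :: nat where b: "fbasis M b {..<n}" by (rule fdE)
  obtain T :: "(complex, 'u) module" and \<phi> where T: "cvs T" "lin (fs {..<n}) T \<phi>"
    "bij_betw \<phi> (carrier (fs {..<n})) (carrier T)" using model_exists[of "{..<n}"] by auto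
  define \<psi> where "\<psi> = (\<lambda>v. \<phi> (crd M b {..<n} v))"
  have \<psi>: "lin M T \<psi>" "bij_betw \<psi> (carrier M) (carrier T)"
    unfolding \<psi>_def
    using lin_compose[OF crd(1)[OF b] T(2)] bij_betw_trans[OF crd(2)[OF b] T(3)] by (simp_all add: comp_def)
  define h where "h = inv_into (carrier M) \<psi>"
  have h: "h (\<psi> v) = v" if "v \<in> carrier M" for v
    unfolding h_def using \<psi>(2) that by (simp add: bij_betw_def)
  define N :: "'u lmod" where "N = \<lparr>carrier = carrier T, monoid.mult = undefined, one = undefined,
     zero = zero T, add = add T, module.smult = module.smult T, act = (\<lambda>x w. \<psi> (act M x (h w)))\<rparr>"
  have \<psi>': "lin M N \<psi>" "bij_betw \<psi> (carrier M) (carrier N)" "\<zero>\<^bsub>N\<^esub> = \<psi> \<zero>\<^bsub>M\<^esub>"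
    using \<psi> lin_zero[OF lie_moduleD(1)[OF assms(2)] T(1) \<psi>(1)] by (auto simp: N_def lin_iff)
  have eq: "act N x (\<psi> v) = \<psi> (act M x v)" if "v \<in> carrier M" for x v
    using h[OF that] by (simp add: N_def)
  have "lie_module g N"
    by (rule lie_module_iso[OF assms(1,2) \<psi>'(2,1,3)]) (rule eq)
  with \<psi>' eq show ?thesis by blast
qed

text \<open>The model consists of matrices of coordinates, with the outer product of two coordinate
  vectors as pure tensor.\<close>

lemma tensor_data_exists:
  fixes V W :: "'u lmod"
  assumes V: "fbasis V p I" and W: "fbasis W q J"
  shows "\<exists>(T :: (complex, 'u) module) t. bilinear_map V W T t \<and> fbasis T (\<lambda>(i, j). t (p i) (q j)) (I \<times> J)"
proof -
  note V' = fbasisD[OF V] and W' = fbasisD[OF W] and cV = crd[OF V] and cW = crd[OF W]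
  have fin: "finite (I \<times> J)" using V'(2) W'(2) by simp
  obtain T :: "(complex, 'u) module" and \<phi> where T: "cvs T" "lin (fs (I \<times> J)) T \<phi>"
    "bij_betw \<phi> (carrier (fs (I \<times> J))) (carrier T)" using model_exists[OF fin] by auto
  define s where "s = (\<lambda>v w. \<lambda>(i, j). crd V p I v i * crd W q J w j)"
  have s_in: "s v w \<in> carrier (fs (I \<times> J))" if "v \<in> carrier V" "w \<in> carrier W" for v w
    using linD(1)[OF cV(1) that(1)] linD(1)[OF cW(1) that(2)] by (auto simp: s_def)
  have "bilinear_map V W T (\<lambda>v w. \<phi> (s v w))"
  proof (rule bilinear_mapI)
    fix v v' w assume "v \<in> carrier V" "v' \<in> carrier V" "w \<in> carrier W"
    moreover from this have "s (v \<oplus>\<^bsub>V\<^esub> v') w = s v w \<oplus>\<^bsub>fs (I \<times> J)\<^esub> s v' w"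
      by (auto simp: s_def linD[OF cV(1)] fun_eq_iff algebra_simps)
    ultimately show "\<phi> (s (v \<oplus>\<^bsub>V\<^esub> v') w) = \<phi> (s v w) \<oplus>\<^bsub>T\<^esub> \<phi> (s v' w)"
      by (simp only: linD(2)[OF T(2)] s_in)
  next
    fix v w w' assume "v \<in> carrier V" "w \<in> carrier W" "w' \<in> carrier W"
    moreover from this have "s v (w \<oplus>\<^bsub>W\<^esub> w') = s v w \<oplus>\<^bsub>fs (I \<times> J)\<^esub> s v w'"
      by (auto simp: s_def linD[OF cW(1)] fun_eq_iff algebra_simps)
    ultimately show "\<phi> (s v (w \<oplus>\<^bsub>W\<^esub> w')) = \<phi> (s v w) \<oplus>\<^bsub>T\<^esub> \<phi> (s v w')"
      by (simp only: linD(2)[OF T(2)] s_in)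
  next
    fix c v w assume vw: "v \<in> carrier V" "w \<in> carrier W"
    hence "s (c \<odot>\<^bsub>V\<^esub> v) w = c \<odot>\<^bsub>fs (I \<times> J)\<^esub> s v w" "s v (c \<odot>\<^bsub>W\<^esub> w) = c \<odot>\<^bsub>fs (I \<times> J)\<^esub> s v w"
      by (auto simp: s_def linD[OF cV(1)] linD[OF cW(1)] fun_eq_iff)
    thus "\<phi> (s (c \<odot>\<^bsub>V\<^esub> v) w) = c \<odot>\<^bsub>T\<^esub> \<phi> (s v w)" "\<phi> (s v (c \<odot>\<^bsub>W\<^esub> w)) = c \<odot>\<^bsub>T\<^esub> \<phi> (s v w)"
      using vw by (simp_all only: linD(3)[OF T(2)] s_in)
  qed (rule linD(1)[OF T(2) s_in])
  moreover have "fbasis T (\<lambda>(i, j). \<phi> (s (p i) (q j))) (I \<times> J)"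
  proof (rule fbasis_cong[OF fbasis_of_iso[OF fin T]])
    fix ij assume "ij \<in> I \<times> J"
    then obtain i j where ij: "ij = (i, j)" "i \<in> I" "j \<in> J" by auto
    hence "s (p i) (q j) = unit ij" by (auto simp: s_def cV(5) cW(5) unit_def)
    thus "(case ij of (i, j) \<Rightarrow> \<phi> (s (p i) (q j))) = \<phi> (unit ij)" by (simp add: ij)
  qed
  ultimately show ?thesis by (intro exI conjI)
qed

text \<open>The chosen tensor product may be any solution of the universal problem on this type.
  Comparing it with the coordinate model in both directions gives an isomorphism, so it inherits a
  basis of pure tensors, on which the later constructions rest.\<close>

lemma tensor_space_basis:
  fixes V W :: "'u lmod"
  assumes V: "fbasis V p I" and W: "fbasis W q J"
  shows "bilinear_map V W (tensor_space V W) (pure_tensor V W)"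
    "fbasis (tensor_space V W) (\<lambda>(i, j). pure_tensor V W (p i) (q j)) (I \<times> J)"
proof -
  note V' = fbasisD[OF V] and W' = fbasisD[OF W]
  obtain T :: "(complex, 'u) module" and t where T: "bilinear_map V W T t"
      "fbasis T (\<lambda>(i, j). t (p i) (q j)) (I \<times> J)"
    using tensor_data_exists[OF V W] by blast
  have "is_tensor V W T t"
    unfolding is_tensor_def using lift_ex1[OF V W T] fbasisD(1)[OF T(2)] T(1) by blast
  hence "\<exists>p. is_tensor V W (fst p) (snd p)" by (intro exI[of _ "(T, t)"]) simp
  hence ten: "is_tensor V W (tensor_space V W) (pure_tensor V W)"
    unfolding tensor_pair_def by (rule someI_ex)
  let ?S = "tensor_space V W" and ?s = "pure_tensor V W"
  have S: "cvs ?S" and s: "bilinear_map V W ?S ?s" using ten by (auto simp: is_tensor_def)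
  show "bilinear_map V W ?S ?s" by (rule s)
  have T': "cvs T" by (rule fbasisD(1)[OF T(2)])
  obtain f where f: "lin T ?S f" "\<And>v w. \<lbrakk>v \<in> carrier V; w \<in> carrier W\<rbrakk> \<Longrightarrow> f (t v w) = ?s v w"
    using lift_ex1[OF V W T S s] by (auto simp: lifts_bilinear_def)
  have "\<exists>!f. lifts_bilinear V W ?S ?s T t f"
    using ten T' T(1) unfolding is_tensor_def by blast
  then obtain g where g: "lin ?S T g" "\<And>v w. \<lbrakk>v \<in> carrier V; w \<in> carrier W\<rbrakk> \<Longrightarrow> g (?s v w) = t v w"
    by (auto simp: lifts_bilinear_def)
  have gf: "g (f x) = x" if "x \<in> carrier T" for x
    by (rule lin_ext[OF T(2) T' lin_compose[OF f(1) g(1)] lin_id _ that])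
      (use V'(4) W'(4) f(2) g(2) in auto)
  \<comment> \<open>Uniqueness of lifts: the composite and the identity both lift the chosen pure
    tensor map. They are restricted to the carrier because lifts are extensional.\<close>
  have fg: "f (g x) = x" if "x \<in> carrier ?S" for x
  proof -
    have "\<exists>!f. lifts_bilinear V W ?S ?s ?S ?s f"
      using ten S s unfolding is_tensor_def by blast
    moreover have "lifts_bilinear V W ?S ?s ?S ?s (restrict (\<lambda>x. f (g x)) (carrier ?S))"
      "lifts_bilinear V W ?S ?s ?S ?s (restrict (\<lambda>x. x) (carrier ?S))"
      unfolding lifts_bilinear_def
      using f g S bilinear_mapD(3)[OF s] by (auto simp: lin_id intro: lin_compose)
    ultimately have "restrict (\<lambda>x. f (g x)) (carrier ?S) = restrict (\<lambda>x. x) (carrier ?S)" by blast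
    from fun_cong[OF this, of x] that show ?thesis by simp
  qed
  have bij: "bij_betw f (carrier T) (carrier ?S)"
    by (rule bij_betw_byWitness[of _ g]) (use gf fg linD(1)[OF f(1)] linD(1)[OF g(1)] in auto)
  show "fbasis ?S (\<lambda>(i, j). ?s (p i) (q j)) (I \<times> J)"
    by (rule fbasis_cong[OF fbasis_image[OF T(2) S f(1) bij]]) (use V'(4) W'(4) f(2) in auto)
qed

end

section \<open>Tensor products of Lie modules\<close>

lemma sep_fd:
  fixes M :: "(complex, 'v, 'x) module_scheme"
  assumes "fd M" "v \<in> carrier M" "w \<in> carrier M"
    and "\<And>\<chi> :: 'v \<Rightarrow> complex. \<lbrakk>\<And>x y. \<lbrakk>x \<in> carrier M; y \<in> carrier M\<rbrakk> \<Longrightarrow> \<chi> (x \<oplus>\<^bsub>M\<^esub> y) = \<chi> x + \<chi> y;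
      \<And>c x. x \<in> carrier M \<Longrightarrow> \<chi> (c \<odot>\<^bsub>M\<^esub> x) = c * \<chi> x;
      \<And>x y. \<lbrakk>x \<in> carrier M; y \<in> carrier M\<rbrakk> \<Longrightarrow> \<chi> (x \<ominus>\<^bsub>M\<^esub> y) = \<chi> x - \<chi> y;
      \<chi> \<zero>\<^bsub>M\<^esub> = 0\<rbrakk> \<Longrightarrow> \<chi> v = \<chi> w"
  shows "v = w"
proof -
  from assms(1) obtain b and n :: nat where "fbasis M b {..<n}" by (rule fdE)
  from sep[OF this assms(2,3)] assms(4) show ?thesis by blast
qed

lemma bij_of_bases:
  assumes "fbasis M b I" "lin M N f" "fbasis N (\<lambda>i. f (b i)) I"
  shows "bij_betw f (carrier M) (carrier N)"
proof -
  note B = fbasisD[OF assms(1)] and B' = fbasisD[OF assms(3)]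
  have "bij_betw (comb N (\<lambda>i. f (b i)) I \<circ> crd M b I) (carrier M) (carrier N)"
    using crd(2)[OF assms(1)] B'(5) by (rule bij_betw_trans)
  thus ?thesis
  proof (rule bij_betw_cong[THEN iffD1, rotated])
    fix v assume v: "v \<in> carrier M"
    show "(comb N (\<lambda>i. f (b i)) I \<circ> crd M b I) v = f v"
      using lin_comb[OF B(1) B'(1) assms(2) B(3), of "crd M b I v"] crd(3)[OF assms(1) v] by simp
  qed
qed

lemma tensor_sel [simp]:
  "carrier (tensor V W) = carrier (tensor_space V W)" "\<zero>\<^bsub>tensor V W\<^esub> = \<zero>\<^bsub>tensor_space V W\<^esub>"
  "add (tensor V W) = add (tensor_space V W)" "module.smult (tensor V W) = module.smult (tensor_space V W)"
  by (simp_all add: tensor_def Let_def)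

text \<open>The map component of \<open>tensor_arrow\<close>, as \<open>tass\<close> is that of
  \<open>tensor_assoc\<close>, separated from domain and codomain so that linear algebra can be
  stated for it.\<close>

definition tmap :: "'u lmod \<Rightarrow> 'u lmod \<Rightarrow> 'u lmod \<Rightarrow> 'u lmod \<Rightarrow> ('u \<Rightarrow> 'u) \<Rightarrow> ('u \<Rightarrow> 'u) \<Rightarrow> 'u \<Rightarrow> 'u"
  where "tmap V W V' W' f g = tensor_lift V W (tensor V' W') (\<lambda>v w. pure_tensor V' W' (f v) (g w))"

definition tass :: "'u lmod \<Rightarrow> 'u lmod \<Rightarrow> 'u lmod \<Rightarrow> 'u \<Rightarrow> 'u"
  where "tass U V W = tensor_lift (tensor U V) W (tensor U (tensor V W))
       (\<lambda>y w. tensor_lift U V (tensor U (tensor V W))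
         (\<lambda>u v. pure_tensor U (tensor V W) u (pure_tensor V W v w)) y)"

context embedded_complex
begin

lemma tensor_basis:
  fixes V W :: "'u lmod"
  assumes "fbasis V p I" "fbasis W q J"
  shows "fbasis (tensor V W) (\<lambda>(i, j). pure_tensor V W (p i) (q j)) (I \<times> J)"
proof -
  note S = tensor_space_basis(2)[OF assms]
  have l: "lin (tensor_space V W) (tensor V W) (\<lambda>x. x)" by (simp add: lin_iff fbasisD(1)[OF S] cvs_simps)
  have b: "bij_betw (\<lambda>x. x) (carrier (tensor_space V W)) (carrier (tensor V W))"
    by (simp add: bij_betw_def)
  have "cvs (tensor V W)" by (rule cvs_iso[OF fbasisD(1)[OF S] b l]) simp
  from fbasis_image[OF S this l b] show ?thesis by simp
qed

lemma fd_tensor [simp]: "\<lbrakk>fd (V :: 'u lmod); fd W\<rbrakk> \<Longrightarrow> fd (tensor V W)"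
  using tensor_basis fbasis_imp_fd by (metis fd_def)

lemma pt_bilinear: "\<lbrakk>fd (V :: 'u lmod); fd W\<rbrakk> \<Longrightarrow> bilinear_map V W (tensor V W) (pure_tensor V W)"
proof -
  assume "fd V" "fd W"
  then obtain p q and n m :: nat where "fbasis V p {..<n}" "fbasis W q {..<m}" by (auto simp: fd_def)
  thus ?thesis using tensor_space_basis(1) by (simp add: bilinear_map_def lin_iff)
qed

lemma lift_props:
  fixes V W :: "'u lmod" and Z :: "(complex, 'u, 'x) module_scheme"
  assumes "fd V" "fd W" "cvs Z" "bilinear_map V W Z b"
  shows "lin (tensor V W) Z (tensor_lift V W Z b)"
    "tensor_lift V W Z b \<in> extensional (carrier (tensor V W))"
    "\<lbrakk>v \<in> carrier V; w \<in> carrier W\<rbrakk> \<Longrightarrow> tensor_lift V W Z b (pure_tensor V W v w) = b v w"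
proof -
  from assms obtain p q and n m :: nat where pq: "fbasis V p {..<n}" "fbasis W q {..<m}"
    by (auto simp: fd_def)
  have "\<exists>!f. lifts_bilinear V W (tensor_space V W) (pure_tensor V W) Z b f"
    by (rule lift_ex1[OF pq tensor_space_basis[OF pq] assms(3,4)])
  hence "lifts_bilinear V W (tensor_space V W) (pure_tensor V W) Z b (tensor_lift V W Z b)"
    unfolding tensor_lift_def by (rule theI')
  thus "lin (tensor V W) Z (tensor_lift V W Z b)"
    "tensor_lift V W Z b \<in> extensional (carrier (tensor V W))"
    "\<lbrakk>v \<in> carrier V; w \<in> carrier W\<rbrakk> \<Longrightarrow> tensor_lift V W Z b (pure_tensor V W v w) = b v w"
    by (auto simp: lifts_bilinear_def lin_iff)
qed

lemma pt_simps:
  fixes V W :: "'u lmod"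
  assumes "fd V" "fd W"
  shows "\<lbrakk>v \<in> carrier V; w \<in> carrier W\<rbrakk> \<Longrightarrow> pure_tensor V W v w \<in> carrier (tensor_space V W)"
    "v \<in> carrier V \<Longrightarrow> lin W (tensor V W) (pure_tensor V W v)"
    "w \<in> carrier W \<Longrightarrow> lin V (tensor V W) (\<lambda>v. pure_tensor V W v w)"
  using bilinear_mapD[OF pt_bilinear[OF assms]] by auto

text \<open>Identities between maps out of tensor products are checked on pure tensors. The versions
  for three and four factors, to which naturality of the associator and the pentagon reduce, follow
  by fixing the last factor.\<close>

lemma tensor_ext:
  fixes V W :: "'u lmod"
  assumes "fd V" "fd W" "cvs Z" "lin (tensor V W) Z f" "lin (tensor V W) Z h"
    and "\<And>v w. \<lbrakk>v \<in> carrier V; w \<in> carrier W\<rbrakk> \<Longrightarrow> f (pure_tensor V W v w) = h (pure_tensor V W v w)"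
    and "x \<in> carrier (tensor_space V W)"
  shows "f x = h x"
proof -
  from assms obtain p q and n m :: nat where pq: "fbasis V p {..<n}" "fbasis W q {..<m}"
    by (auto simp: fd_def)
  show ?thesis
    by (rule lin_ext[OF tensor_basis[OF pq] assms(3,4,5)])
      (use fbasisD(4)[OF pq(1)] fbasisD(4)[OF pq(2)] assms(6,7) in auto)
qed

lemma tensor_ext3:
  fixes U V W :: "'u lmod"
  assumes fin: "fd U" "fd V" "fd W" and "cvs Z"
    and l: "lin (tensor (tensor U V) W) Z f" "lin (tensor (tensor U V) W) Z h"
    and "\<And>u v w. \<lbrakk>u \<in> carrier U; v \<in> carrier V; w \<in> carrier W\<rbrakk> \<Longrightarrow>
      f (pure_tensor (tensor U V) W (pure_tensor U V u v) w) = h (pure_tensor (tensor U V) W (pure_tensor U V u v) w)"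
    and "x \<in> carrier (tensor_space (tensor U V) W)"
  shows "f x = h x"
proof (rule tensor_ext[OF _ _ assms(4) l _ assms(8)])
  show fUV: "fd (tensor U V)" "fd W" using fin by simp_all
  fix y w assume yw: "y \<in> carrier (tensor U V)" "w \<in> carrier W"
  note pl = pt_simps(3)[OF fUV yw(2)]
  show "f (pure_tensor (tensor U V) W y w) = h (pure_tensor (tensor U V) W y w)"
    by (rule tensor_ext[OF fin(1,2) assms(4) lin_compose[OF pl l(1)] lin_compose[OF pl l(2)]])
      (use assms(7) yw in auto)
qed

lemma tensor_ext4:
  fixes U V W X :: "'u lmod"
  assumes fin: "fd U" "fd V" "fd W" "fd X" and "cvs Z"
    and l: "lin (tensor (tensor (tensor U V) W) X) Z f" "lin (tensor (tensor (tensor U V) W) X) Z h"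
    and "\<And>u v w x. \<lbrakk>u \<in> carrier U; v \<in> carrier V; w \<in> carrier W; x \<in> carrier X\<rbrakk> \<Longrightarrow>
      f (pure_tensor (tensor (tensor U V) W) X (pure_tensor (tensor U V) W (pure_tensor U V u v) w) x) =
      h (pure_tensor (tensor (tensor U V) W) X (pure_tensor (tensor U V) W (pure_tensor U V u v) w) x)"
    and "t \<in> carrier (tensor_space (tensor (tensor U V) W) X)"
  shows "f t = h t"
proof (rule tensor_ext[OF _ _ assms(5) l _ assms(9)])
  show fUVW: "fd (tensor (tensor U V) W)" "fd X" using fin by simp_all
  fix y x assume yx: "y \<in> carrier (tensor (tensor U V) W)" "x \<in> carrier X"
  note pl = pt_simps(3)[OF fUVW yx(2)]
  show "f (pure_tensor (tensor (tensor U V) W) X y x) = h (pure_tensor (tensor (tensor U V) W) X y x)"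
    by (rule tensor_ext3[OF fin(1-3) assms(5) lin_compose[OF pl l(1)] lin_compose[OF pl l(2)]])
      (use assms(8) yx in auto)
qed

text \<open>The action was defined as a lift into the plain space record; the Leibniz rule is the
  value of this lift on pure tensors.\<close>

lemma tensor_act:
  fixes V W :: "'u lmod"
  assumes V: "lie_module g V" "fd V" and W: "lie_module g W" "fd W" and x: "x \<in> g"
  shows "lin (tensor V W) (tensor V W) (act (tensor V W) x)"
    "\<lbrakk>v \<in> carrier V; w \<in> carrier W\<rbrakk> \<Longrightarrow> act (tensor V W) x (pure_tensor V W v w) =
      pure_tensor V W (act V x v) w \<oplus>\<^bsub>tensor V W\<^esub> pure_tensor V W v (act W x w)"
proof -
  have Z: "cvs (tensor V W)" using V W by (simp add: fd_cvs)
  have act: "act (tensor V W) x = tensor_lift V W (tensor_space V W)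
      (\<lambda>v w. pure_tensor V W (act V x v) w \<oplus>\<^bsub>tensor V W\<^esub> pure_tensor V W v (act W x w))"
    by (simp add: tensor_def Let_def)
  have "bilinear_map V W (tensor V W)
      (\<lambda>v w. pure_tensor V W (act V x v) w \<oplus>\<^bsub>tensor V W\<^esub> pure_tensor V W v (act W x w))"
    using V W x
    by (intro bilinear_add[OF Z] bilinear_compose[OF pt_bilinear] lie_moduleD(2) lin_id) auto
  hence b: "bilinear_map V W (tensor_space V W)
      (\<lambda>v w. pure_tensor V W (act V x v) w \<oplus>\<^bsub>tensor V W\<^esub> pure_tensor V W v (act W x w))"
    by (simp add: bilinear_map_def lin_iff)
  have T: "cvs (tensor_space V W)"
    using V(2) W(2) tensor_space_basis(2) fbasisD(1) by (metis fd_def)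
  show "lin (tensor V W) (tensor V W) (act (tensor V W) x)"
    using lift_props(1)[OF V(2) W(2) T b] unfolding act by (simp add: lin_iff)
  show "\<lbrakk>v \<in> carrier V; w \<in> carrier W\<rbrakk> \<Longrightarrow> act (tensor V W) x (pure_tensor V W v w) =
      pure_tensor V W (act V x v) w \<oplus>\<^bsub>tensor V W\<^esub> pure_tensor V W v (act W x w)"
    using lift_props(3)[OF V(2) W(2) T b] unfolding act by simp
qed

lemma lie_module_tensor:
  fixes V W :: "'u lmod"
  assumes g: "lie_closed g" and V: "lie_module g V" "fd V" and W: "lie_module g W" "fd W"
  shows "lie_module g (tensor V W)"
proof (rule lie_moduleI)
  let ?T = "tensor V W"
  let ?p = "pure_tensor V W"
  have fT: "fd ?T" using V W by simp
  show T: "cvs ?T" using fT by (rule fd_cvs)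
  note act = tensor_act[OF V W] and VD = lie_moduleD[OF V(1)] and WD = lie_moduleD[OF W(1)]
  note pt = bilinear_mapD[OF pt_bilinear[OF V(2) W(2)]]
  note S = cvs_simps[OF T]
  note cl = g[unfolded lie_closed_def]
  show "lin ?T ?T (act ?T x)" if "x \<in> g" for x by (rule act(1)[OF that])
  fix x v assume x: "x \<in> g" and v: "v \<in> carrier ?T"
  show "act ?T (x + y) v = act ?T x v \<oplus>\<^bsub>?T\<^esub> act ?T y v" if y: "y \<in> g" for y
  proof (rule tensor_ext[OF V(2) W(2) T _ lin_add[OF T act(1)[OF x] act(1)[OF y]]])
    have xy: "x + y \<in> g" using cl x y by blast
    show "lin ?T ?T (act ?T (x + y))" by (rule act(1)[OF xy])
    fix v w assume vw: "v \<in> carrier V" "w \<in> carrier W"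
    show "act ?T (x + y) (?p v w) = act ?T x (?p v w) \<oplus>\<^bsub>?T\<^esub> act ?T y (?p v w)"
      unfolding act(2)[OF x vw] act(2)[OF y vw] act(2)[OF xy vw] VD(3)[OF x y vw(1)] WD(3)[OF x y vw(2)]
      using x y vw by (simp only: pt(4,5) VD(6) WD(6) pt(3) S(2) cvs_distribs(4-6)[OF T])
  qed (use v in simp)
  show "act ?T (c \<cdot>\<^sub>m x) v = c \<odot>\<^bsub>?T\<^esub> act ?T x v" for c
  proof (rule tensor_ext[OF V(2) W(2) T _ lin_smult[OF T act(1)[OF x]]])
    have cx: "c \<cdot>\<^sub>m x \<in> g" using cl x by blast
    show "lin ?T ?T (act ?T (c \<cdot>\<^sub>m x))" by (rule act(1)[OF cx])
    fix v w assume vw: "v \<in> carrier V" "w \<in> carrier W"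
    show "act ?T (c \<cdot>\<^sub>m x) (?p v w) = c \<odot>\<^bsub>?T\<^esub> act ?T x (?p v w)"
      unfolding act(2)[OF x vw] act(2)[OF cx vw] VD(4)[OF x vw(1)] WD(4)[OF x vw(2)]
      using x vw by (simp only: pt(6,7) VD(6) WD(6) pt(3) cvs_distribs(2)[OF T])
  qed (use v in simp)
  show "act ?T (x * y - y * x) v = act ?T x (act ?T y v) \<ominus>\<^bsub>?T\<^esub> act ?T y (act ?T x v)" if y: "y \<in> g" for y
  proof (rule tensor_ext[OF V(2) W(2) T _ lin_diff[OF T lin_compose[OF act(1)[OF y] act(1)[OF x]]
          lin_compose[OF act(1)[OF x] act(1)[OF y]]]])
    have xy: "x * y - y * x \<in> g" using cl x y by blast
    show "lin ?T ?T (act ?T (x * y - y * x))" by (rule act(1)[OF xy])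
    fix v w assume vw: "v \<in> carrier V" "w \<in> carrier W"
    have mem': "act V x v \<in> carrier V" "act V y v \<in> carrier V" "act W x w \<in> carrier W" "act W y w \<in> carrier W"
      "act V x (act V y v) \<in> carrier V" "act V y (act V x v) \<in> carrier V"
      "act W x (act W y w) \<in> carrier W" "act W y (act W x w) \<in> carrier W"
      using vw x y VD(6) WD(6) by auto
    have ptm: "v1 \<in> carrier V \<Longrightarrow> v2 \<in> carrier V \<Longrightarrow> ?p (v1 \<ominus>\<^bsub>V\<^esub> v2) w = ?p v1 w \<ominus>\<^bsub>?T\<^esub> ?p v2 w"
      "w1 \<in> carrier W \<Longrightarrow> w2 \<in> carrier W \<Longrightarrow> ?p v (w1 \<ominus>\<^bsub>W\<^esub> w2) = ?p v w1 \<ominus>\<^bsub>?T\<^esub> ?p v w2" for v1 v2 w1 w2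
      using lin_minus[OF VD(1) T pt(2)[OF vw(2)]] lin_minus[OF WD(1) T pt(1)[OF vw(1)]] by auto
    have L: "act ?T (x * y - y * x) (?p v w) =
      (?p (act V x (act V y v)) w \<ominus>\<^bsub>?T\<^esub> ?p (act V y (act V x v)) w) \<oplus>\<^bsub>?T\<^esub>
      (?p v (act W x (act W y w)) \<ominus>\<^bsub>?T\<^esub> ?p v (act W y (act W x w)))"
      unfolding act(2)[OF xy vw] VD(5)[OF x y vw(1)] WD(5)[OF x y vw(2)]
      by (simp only: ptm mem')
    \<comment> \<open>The two middle terms, where \<open>a\<close> and \<open>b\<close> act on
      different factors, are symmetric in \<open>a\<close> and \<open>b\<close> and therefore cancel
      in the commutator.\<close>
    have R: "act ?T a (act ?T b (?p v w)) = (?p (act V a (act V b v)) w \<oplus>\<^bsub>?T\<^esub> ?p (act V b v) (act W a w)) \<oplus>\<^bsub>?T\<^esub>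
      (?p (act V a v) (act W b w) \<oplus>\<^bsub>?T\<^esub> ?p v (act W a (act W b w)))" if "a \<in> {x, y}" "b \<in> {x, y}" for a b
    proof -
      have ab: "a \<in> g" "b \<in> g" using that x y by auto
      show ?thesis
        unfolding act(2)[OF ab(2) vw]
        by (simp only: linD(2)[OF act(1)[OF ab(1)]] pt(3) act(2)[OF ab(1)] VD(6)[OF ab(1)] VD(6)[OF ab(2)]
          WD(6)[OF ab(1)] WD(6)[OF ab(2)] vw)
    qed
    have xy_mem: "x \<in> {x, y}" "y \<in> {x, y}" by auto
    show "act ?T (x * y - y * x) (?p v w) = act ?T x (act ?T y (?p v w)) \<ominus>\<^bsub>?T\<^esub> act ?T y (act ?T x (?p v w))"
      unfolding L R[OF xy_mem] R[OF xy_mem(2,1)]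
    proof (rule sep_fd[OF fT], goal_cases)
      case (3 \<chi>)
      show ?case using 3(1-3) pt(3) mem' vw S(2,4) by (simp del: tensor_sel)
    qed (use pt(3) mem' vw S(2,4) in \<open>simp_all del: tensor_sel\<close>)
  qed (use v in simp)
qed

subsection \<open>Tensor products of linear maps, associativity\<close>

lemma tmap_props:
  fixes V W V' W' :: "'u lmod"
  assumes "fd V" "fd W" "fd V'" "fd W'" "lin V V' f" "lin W W' h"
  shows "lin (tensor V W) (tensor V' W') (tmap V W V' W' f h)"
    "tmap V W V' W' f h \<in> extensional (carrier (tensor V W))"
    "\<lbrakk>v \<in> carrier V; w \<in> carrier W\<rbrakk> \<Longrightarrow> tmap V W V' W' f h (pure_tensor V W v w) = pure_tensor V' W' (f v) (h w)"
proof -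
  have "cvs (tensor V' W')" using assms by (simp add: fd_cvs)
  note L = lift_props[OF assms(1,2) this bilinear_compose[OF pt_bilinear[OF assms(3,4)] assms(5,6)]]
  show "lin (tensor V W) (tensor V' W') (tmap V W V' W' f h)"
    "tmap V W V' W' f h \<in> extensional (carrier (tensor V W))"
    "\<lbrakk>v \<in> carrier V; w \<in> carrier W\<rbrakk> \<Longrightarrow> tmap V W V' W' f h (pure_tensor V W v w) = pure_tensor V' W' (f v) (h w)"
    unfolding tmap_def by (fact L(1), fact L(2), rule L(3))
qed

lemma tmap_hom:
  fixes V W V' W' :: "'u lmod"
  assumes M: "lie_module g V" "fd V" "lie_module g W" "fd W" "lie_module g V'" "fd V'" "lie_module g W'" "fd W'"
    and f: "f \<in> lie_hom g V V'" and h: "h \<in> lie_hom g W W'" and g: "lie_closed g"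
  shows "tmap V W V' W' f h \<in> lie_hom g (tensor V W) (tensor V' W')"
proof -
  have l: "lin V V' f" "lin W W' h" using f h by (auto simp: lie_hom_iff)
  note P = tmap_props[OF M(2,4,6,8) l]
  have T': "cvs (tensor V' W')" using M by (simp add: fd_cvs)
  have "tmap V W V' W' f h (act (tensor V W) x t) = act (tensor V' W') x (tmap V W V' W' f h t)"
    if x: "x \<in> g" and t: "t \<in> carrier (tensor V W)" for x t
  proof (rule tensor_ext[OF M(2,4) T' lin_compose[OF tensor_act(1)[OF M(1-4) x] P(1)]
        lin_compose[OF P(1) tensor_act(1)[OF M(5-8) x]]])
    fix v w assume vw: "v \<in> carrier V" "w \<in> carrier W"
    have xvw: "act V x v \<in> carrier V" "act W x w \<in> carrier W" "f v \<in> carrier V'" "h w \<in> carrier W'"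
      using vw lie_moduleD(6)[OF M(1) x] lie_moduleD(6)[OF M(3) x] linD(1)[OF l(1)] linD(1)[OF l(2)] by auto
    have eq: "f (act V x v) = act V' x (f v)" "h (act W x w) = act W' x (h w)"
      using f h x vw by (auto simp: lie_hom_iff)
    show "tmap V W V' W' f h (act (tensor V W) x (pure_tensor V W v w))
      = act (tensor V' W') x (tmap V W V' W' f h (pure_tensor V W v w))"
      unfolding P(3)[OF vw] tensor_act(2)[OF M(1-4) x vw] tensor_act(2)[OF M(5-8) x xvw(3,4)]
      using xvw vw bilinear_mapD(3)[OF pt_bilinear[OF M(2,4)]]
      by (simp only: linD(2)[OF P(1)] P(3) eq)
  qed (use t in simp)
  with P show ?thesis by (simp add: lie_hom_iff)
qed

lemma tass_props:
  fixes U V W :: "'u lmod"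
  assumes fin: "fd U" "fd V" "fd W"
  shows "lin (tensor (tensor U V) W) (tensor U (tensor V W)) (tass U V W)"
    "tass U V W \<in> extensional (carrier (tensor (tensor U V) W))"
    "\<lbrakk>u \<in> carrier U; v \<in> carrier V; w \<in> carrier W\<rbrakk> \<Longrightarrow>
      tass U V W (pure_tensor (tensor U V) W (pure_tensor U V u v) w) = pure_tensor U (tensor V W) u (pure_tensor V W v w)"
    "bij_betw (tass U V W) (carrier (tensor (tensor U V) W)) (carrier (tensor U (tensor V W)))"
proof -
  let ?Z = "tensor U (tensor V W)"
  have fVW: "fd (tensor V W)" and fUV: "fd (tensor U V)" and fZ: "fd ?Z" using fin by auto
  note Z = fd_cvs[OF fZ]
  note b1 = bilinear_mapD[OF pt_bilinear[OF fin(2,3)]] and b2 = bilinear_mapD[OF pt_bilinear[OF fin(1) fVW]]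
  \<comment> \<open>For fixed \<open>w\<close> the regrouping is a linear map on the first tensor
    product; what remains is that it depends linearly on \<open>w\<close>, again tested on pure
    tensors.\<close>
  define r where "r w = tensor_lift U V ?Z (\<lambda>u v. pure_tensor U (tensor V W) u (pure_tensor V W v w))" for w
  have bil: "bilinear_map U V ?Z (\<lambda>u v. pure_tensor U (tensor V W) u (pure_tensor V W v w))" if "w \<in> carrier W" for w
    by (rule bilinear_compose[OF pt_bilinear[OF fin(1) fVW] lin_id pt_simps(3)[OF fin(2,3) that]])
  have r: "lin (tensor U V) ?Z (r w)"
    "\<lbrakk>u \<in> carrier U; v \<in> carrier V\<rbrakk> \<Longrightarrow> r w (pure_tensor U V u v) = pure_tensor U (tensor V W) u (pure_tensor V W v w)"
    if "w \<in> carrier W" for w u v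
    unfolding r_def using lift_props(1,3)[OF fin(1,2) Z bil[OF that]] by auto
  have "bilinear_map (tensor U V) W ?Z (\<lambda>y w. r w y)"
    unfolding bilinear_map_def
  proof (intro conjI ballI)
    show "lin (tensor U V) ?Z (\<lambda>y. r w y)" if "w \<in> carrier W" for w by (rule r(1)[OF that])
    fix y assume y: "y \<in> carrier (tensor U V)"
    show "lin W ?Z (\<lambda>w. r w y)"
    proof (rule linI)
      fix w w' assume w: "w \<in> carrier W" "w' \<in> carrier W"
      hence ww: "w \<oplus>\<^bsub>W\<^esub> w' \<in> carrier W" using cvs_simps(2)[OF fd_cvs[OF fin(3)]] by blast
      show "r (w \<oplus>\<^bsub>W\<^esub> w') y = r w y \<oplus>\<^bsub>?Z\<^esub> r w' y"
        by (rule tensor_ext[OF fin(1,2) Z r(1)[OF ww] lin_add[OF Z r(1)[OF w(1)] r(1)[OF w(2)]]])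
          (use w ww in \<open>simp only: r(2) b1(3,5) b2(3,5)\<close>, use y in simp)
    next
      fix c w assume w: "w \<in> carrier W"
      hence cw: "c \<odot>\<^bsub>W\<^esub> w \<in> carrier W" using cvs_simps(3)[OF fd_cvs[OF fin(3)]] by blast
      show "r (c \<odot>\<^bsub>W\<^esub> w) y = c \<odot>\<^bsub>?Z\<^esub> r w y"
        by (rule tensor_ext[OF fin(1,2) Z r(1)[OF cw] lin_smult[OF Z r(1)[OF w]]])
          (use w cw in \<open>simp only: r(2) b1(3,7) b2(3,7)\<close>, use y in simp)
    qed (rule linD(1)[OF r(1) y])
  qed
  note L = lift_props[OF fUV fin(3) Z this]
  have tass: "tass U V W = tensor_lift (tensor U V) W ?Z (\<lambda>y w. r w y)"
    by (simp add: tass_def r_def)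
  show l: "lin (tensor (tensor U V) W) ?Z (tass U V W)"
    and "tass U V W \<in> extensional (carrier (tensor (tensor U V) W))"
    unfolding tass by (fact L(1), fact L(2))
  show ev: "tass U V W (pure_tensor (tensor U V) W (pure_tensor U V u v) w) = pure_tensor U (tensor V W) u (pure_tensor V W v w)"
    if "u \<in> carrier U" "v \<in> carrier V" "w \<in> carrier W" for u v w
    unfolding tass using L(3)[OF _ that(3), of "pure_tensor U V u v"] r(2)[OF that(3,1,2)] that pt_simps(1)[OF fin(1,2)] by simp
  from fin obtain p q s and n m k :: nat where
    B: "fbasis U p {..<n}" "fbasis V q {..<m}" "fbasis W s {..<k}" by (auto simp: fd_def)
  show "bij_betw (tass U V W) (carrier (tensor (tensor U V) W)) (carrier ?Z)"
  proof (rule bij_of_bases[OF tensor_basis[OF tensor_basis[OF B(1,2)] B(3)] l])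
    \<comment> \<open>Regrouping the index triples matches the two bases of iterated pure
      tensors.\<close>
    have "bij_betw (\<lambda>((i, j), l). (i, (j, l))) (({..<n} \<times> {..<m}) \<times> {..<k}) ({..<n} \<times> {..<m} \<times> {..<k})"
      by (rule bij_betw_byWitness[of _ "\<lambda>(i, (j, l)). ((i, j), l)"]) auto
    from fbasis_reindex[OF tensor_basis[OF B(1) tensor_basis[OF B(2,3)]] this]
    show "fbasis ?Z (\<lambda>i. tass U V W (case i of (i, j) \<Rightarrow> pure_tensor (tensor U V) W (case i of (i, j) \<Rightarrow> pure_tensor U V (p i) (q j)) (s j)))
       (({..<n} \<times> {..<m}) \<times> {..<k})"
      by (rule fbasis_cong) (use ev fbasisD(4)[OF B(1)] fbasisD(4)[OF B(2)] fbasisD(4)[OF B(3)] in auto)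
  qed
qed

lemma tass_hom:
  fixes U V W :: "'u lmod"
  assumes M: "lie_module g U" "fd U" "lie_module g V" "fd V" "lie_module g W" "fd W" and g: "lie_closed g"
  shows "tass U V W \<in> lie_hom g (tensor (tensor U V) W) (tensor U (tensor V W))"
proof -
  note P = tass_props[OF M(2,4,6)]
  have UV: "lie_module g (tensor U V)" "fd (tensor U V)" and VW: "lie_module g (tensor V W)" "fd (tensor V W)"
    using lie_module_tensor[OF g] M by auto
  have Z: "cvs (tensor U (tensor V W))" using M by (simp add: fd_cvs)
  have "tass U V W (act (tensor (tensor U V) W) x t) = act (tensor U (tensor V W)) x (tass U V W t)"
    if x: "x \<in> g" and t: "t \<in> carrier (tensor (tensor U V) W)" for x t
  proof (rule tensor_ext3[OF M(2,4,6) Z lin_compose[OF tensor_act(1)[OF UV M(5,6) x] P(1)]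
        lin_compose[OF P(1) tensor_act(1)[OF M(1,2) VW x]]])
    fix u v w assume uvw: "u \<in> carrier U" "v \<in> carrier V" "w \<in> carrier W"
    have xuvw: "act U x u \<in> carrier U" "act V x v \<in> carrier V" "act W x w \<in> carrier W"
      using uvw lie_moduleD(6)[OF M(1) x] lie_moduleD(6)[OF M(3) x] lie_moduleD(6)[OF M(5) x] by auto
    note pUV = bilinear_mapD[OF pt_bilinear[OF M(2,4)]] and pVW = bilinear_mapD[OF pt_bilinear[OF M(4,6)]]
      and pUV_W = bilinear_mapD[OF pt_bilinear[OF UV(2) M(6)]] and pU_VW = bilinear_mapD[OF pt_bilinear[OF M(2) VW(2)]]
    show "tass U V W (act (tensor (tensor U V) W) x (pure_tensor (tensor U V) W (pure_tensor U V u v) w)) =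
      act (tensor U (tensor V W)) x (tass U V W (pure_tensor (tensor U V) W (pure_tensor U V u v) w))"
      unfolding P(3)[OF uvw] tensor_act(2)[OF UV M(5,6) x pUV(3)[OF uvw(1,2)] uvw(3)]
        tensor_act(2)[OF M(1,2) VW x uvw(1) pVW(3)[OF uvw(2,3)]] tensor_act(2)[OF M(1-4) x uvw(1,2)]
        tensor_act(2)[OF M(3-6) x uvw(2,3)]
      using xuvw uvw cvs_simps(2)[OF Z]
      by (simp only: pUV(3) pVW(3) pUV_W(3,4) pU_VW(3,5) linD(2)[OF P(1)] cvs_simps(2)[OF lie_moduleD(1)[OF UV(1)]] cvs_simps(2)[OF lie_moduleD(1)[OF VW(1)]]
        cvs_simps(2)[OF lie_moduleD(1)[OF lie_module_tensor[OF g UV M(5,6)]]] P(3) cvs_distribs(5)[OF Z])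
  qed (use t in simp)
  with P show ?thesis by (simp add: lie_hom_iff)
qed

end

section \<open>Linear, monoidal and module category structures\<close>

section \<open>Categories of Lie modules\<close>

lemma lie_Hom_sel [simp]:
  "p \<in> carrier (lie_Hom g M N) \<longleftrightarrow> (\<exists>f\<in>lie_hom g M N. p = (M, f, N))"
  "\<zero>\<^bsub>lie_Hom g M N\<^esub> = (M, restrict (\<lambda>v. \<zero>\<^bsub>N\<^esub>) (carrier M), N)"
  "p \<oplus>\<^bsub>lie_Hom g M N\<^esub> q = (M, restrict (\<lambda>v. fst (snd p) v \<oplus>\<^bsub>N\<^esub> fst (snd q) v) (carrier M), N)"
  "c \<odot>\<^bsub>lie_Hom g M N\<^esub> p = (M, restrict (\<lambda>v. c \<odot>\<^bsub>N\<^esub> fst (snd p) v) (carrier M), N)"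
  by (auto simp: lie_Hom_def)

lemma lie_homD:
  assumes "f \<in> lie_hom g M N"
  shows "lin M N f" "f \<in> extensional (carrier M)" "v \<in> carrier M \<Longrightarrow> f v \<in> carrier N"
    "\<lbrakk>x \<in> g; v \<in> carrier M\<rbrakk> \<Longrightarrow> f (act M x v) = act N x (f v)"
  using assms linD(1)[of f M N] by (auto simp: lie_hom_iff)

lemma lie_hom_restrictI:
  assumes M: "lie_module g M" and f: "lin M N f"
    and eq: "\<And>x v. \<lbrakk>x \<in> g; v \<in> carrier M\<rbrakk> \<Longrightarrow> f (act M x v) = act N x (f v)"
  shows "restrict f (carrier M) \<in> lie_hom g M N"
  using assms lie_moduleD(1,6)[OF M] by (auto simp: lie_hom_iff)

lemma lie_hom_zero:
  assumes M: "lie_module g M" and N: "lie_module g N"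
  shows "restrict (\<lambda>v. \<zero>\<^bsub>N\<^esub>) (carrier M) \<in> lie_hom g M N"
  by (rule lie_hom_restrictI[OF M lin_const_zero[OF lie_moduleD(1)[OF N]]])
    (simp add: lin_zero[OF lie_moduleD(1)[OF N] lie_moduleD(1)[OF N] lie_moduleD(2)[OF N]])

lemma lie_hom_ops:
  assumes M: "lie_module g M" and N: "lie_module g N" and f: "f \<in> lie_hom g M N" and h: "h \<in> lie_hom g M N"
  shows "restrict (\<lambda>v. f v \<oplus>\<^bsub>N\<^esub> h v) (carrier M) \<in> lie_hom g M N"
    "restrict (\<lambda>v. c \<odot>\<^bsub>N\<^esub> f v) (carrier M) \<in> lie_hom g M N"
proof -
  note D = lie_moduleD[OF M] and D' = lie_moduleD[OF N] and F = lie_homD[OF f] and H = lie_homD[OF h]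
  show "restrict (\<lambda>v. f v \<oplus>\<^bsub>N\<^esub> h v) (carrier M) \<in> lie_hom g M N"
    by (rule lie_hom_restrictI[OF M lin_add[OF D'(1) F(1) H(1)]]) (simp add: F(3,4) H(3,4) linD(2)[OF D'(2)])
  show "restrict (\<lambda>v. c \<odot>\<^bsub>N\<^esub> f v) (carrier M) \<in> lie_hom g M N"
    by (rule lie_hom_restrictI[OF M lin_smult[OF D'(1) F(1)]]) (simp add: F(3,4) linD(3)[OF D'(2)])
qed

lemma lie_hom_compose:
  assumes M: "lie_module g M" and f: "f \<in> lie_hom g M N" and h: "h \<in> lie_hom g N P"
  shows "compose (carrier M) h f \<in> lie_hom g M P"
  unfolding compose_def
  by (rule lie_hom_restrictI[OF M lin_compose[OF lie_homD(1)[OF f] lie_homD(1)[OF h]]])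
    (simp add: lie_homD(3,4)[OF f] lie_homD(4)[OF h])

lemma lie_hom_id: "lie_module g M \<Longrightarrow> restrict (\<lambda>v. v) (carrier M) \<in> lie_hom g M M"
  by (rule lie_hom_restrictI) (simp_all add: lin_id)

lemma lie_hom_inverse:
  assumes M: "lie_module g M" and N: "lie_module g N" and f: "f \<in> lie_hom g M N"
    and bij: "bij_betw f (carrier M) (carrier N)"
  shows "restrict (inv_into (carrier M) f) (carrier N) \<in> lie_hom g N M"
proof (rule lie_hom_restrictI[OF N lin_inv_into[OF lie_moduleD(1)[OF M] lie_homD(1)[OF f] bij]])
  let ?h = "inv_into (carrier M) f"
  fix x w assume x: "x \<in> g" and w: "w \<in> carrier N"
  have h: "?h w \<in> carrier M" "f (?h w) = w" using bij w by (auto simp: bij_betw_def inv_into_into f_inv_into_f)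
  have "act N x w = f (act M x (?h w))" using lie_homD(4)[OF f x h(1)] h(2) by simp
  thus "?h (act N x w) = act M x (?h w)"
    using bij lie_moduleD(6)[OF M x h(1)] by (simp add: bij_betw_def)
qed

lemma lie_Hom_cvs:
  assumes M: "lie_module g M" and N: "lie_module g N"
  shows "cvs (lie_Hom g M N)"
proof -
  note D' = lie_moduleD(1)[OF N]
  note S = cvs_simps[OF D'] and T = cvs_distribs[OF D']
  have r: "restrict a A = restrict b A \<longleftrightarrow> (\<forall>v\<in>A. a v = b v)" for a b :: "'a \<Rightarrow> 'a" and A
    by (auto simp: restrict_def fun_eq_iff)
  have e: "restrict a (carrier M) = f \<longleftrightarrow> (\<forall>v\<in>carrier M. a v = f v)" if "f \<in> lie_hom g M N" for a f
    using lie_homD(2)[OF that] by (auto simp: restrict_def fun_eq_iff extensional_def)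
  note z = lie_hom_zero[OF M N]
  have n: "v \<oplus>\<^bsub>N\<^esub> (-1) \<odot>\<^bsub>N\<^esub> v = \<zero>\<^bsub>N\<^esub>" if "v \<in> carrier N" for v
    using T(3,7)[of v] that by simp
  show ?thesis
  proof (rule cvsI)
    show "\<zero>\<^bsub>lie_Hom g M N\<^esub> \<in> carrier (lie_Hom g M N)" using z by auto
    show "p \<oplus>\<^bsub>lie_Hom g M N\<^esub> q \<in> carrier (lie_Hom g M N)"
      if "p \<in> carrier (lie_Hom g M N)" "q \<in> carrier (lie_Hom g M N)" for p q
      using that by (auto simp: lie_hom_ops[OF M N])
    show "c \<odot>\<^bsub>lie_Hom g M N\<^esub> p \<in> carrier (lie_Hom g M N)" if "p \<in> carrier (lie_Hom g M N)" for c p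
      using that by (auto simp: lie_hom_ops[OF M N])
  qed (auto simp: r e lie_homD(3) S n T(1,2,5), (auto simp: lie_homD(3) intro: T(4))?)
qed

lemma fst_snd_lie_Hom: "p \<in> carrier (lie_Hom g M N) \<Longrightarrow> fst (snd p) \<in> lie_hom g M N"
  by auto

text \<open>Shared by the acting category and \<open>N6\<close>: both are full subcategories of
  \<open>g\<close>-modules, with \<open>g\<close> equal to \<open>sl2\<close> or
  \<open>borel\<close>, so the linear structure is verified once.\<close>

locale lie_cat =
  fixes g and C :: "('u lmod, 'u arrow, 'x) lincat_scheme"
  assumes Ob_lie: "M \<in> Ob C \<Longrightarrow> lie_module g M"
    and Hom_C [simp]: "Hom C = lie_Hom g" and Id_C [simp]: "Id C = lie_Id" and Cmp_C [simp]: "Cmp C = arrow_compose"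
begin

lemma ext_compose_eq:
  assumes "f \<in> extensional A" "f' \<in> extensional A" "\<And>x. x \<in> A \<Longrightarrow> f x = f' x"
  shows "(M, f, N) = (M, f', N)"
  using assms by (auto intro: extensionalityI)

sublocale linear_category C
proof (rule linear_category.intro)
  show "Id C X \<in> Arr C X X" if "X \<in> Ob C" for X
    by (simp add: lie_Id_def lie_hom_id[OF Ob_lie[OF that]])
next
  fix X Y assume X: "X \<in> Ob C" and Y: "Y \<in> Ob C"
  note X' = Ob_lie[OF X] and Y' = Ob_lie[OF Y]
  show "vectorspace class_ring (Hom C X Y)" by (simp add: lie_Hom_cvs X' Y')
  fix f assume f: "f \<in> Arr C X Y"
  then obtain f0 where f0: "f = (X, f0, Y)" "f0 \<in> lie_hom g X Y" by auto
  show "Cmp C (Id C Y) f = f"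
    unfolding f0 Cmp_C Id_C lie_Id_def arrow_compose.simps
    by (rule ext_compose_eq[of _ "carrier X"]) (simp_all add: lie_homD(2,3)[OF f0(2)] compose_eq)
  show "Cmp C f (Id C X) = f"
    unfolding f0 Cmp_C Id_C lie_Id_def arrow_compose.simps
    by (rule ext_compose_eq[of _ "carrier X"]) (simp_all add: lie_homD(2,3)[OF f0(2)] compose_eq)
  fix Z assume Z: "Z \<in> Ob C"
  note Z' = Ob_lie[OF Z]
  fix h assume h: "h \<in> Arr C Y Z"
  then obtain h0 where h0: "h = (Y, h0, Z)" "h0 \<in> lie_hom g Y Z" by auto
  show "Cmp C h f \<in> Arr C X Z"
    using lie_hom_compose[OF X' f0(2) h0(2)] by (simp add: f0 h0)
  note S = cvs_simps[OF lie_moduleD(1)[OF Z']] and S' = cvs_simps[OF lie_moduleD(1)[OF Y']]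
  show "Cmp C (a \<odot>\<^bsub>Hom C Y Z\<^esub> h) f = a \<odot>\<^bsub>Hom C X Z\<^esub> Cmp C h f" for a
    unfolding f0 h0 by (simp, rule extensionalityI[of _ "carrier X"]) (simp_all add: compose_eq lie_homD(3)[OF f0(2)])
  show "Cmp C h (a \<odot>\<^bsub>Hom C X Y\<^esub> f) = a \<odot>\<^bsub>Hom C X Z\<^esub> Cmp C h f" for a
    unfolding f0 h0 by (simp, rule extensionalityI[of _ "carrier X"])
      (simp_all add: compose_eq lie_homD(3)[OF f0(2)] linD[OF lie_homD(1)[OF h0(2)]])
  show "Cmp C (h \<oplus>\<^bsub>Hom C Y Z\<^esub> h') f = Cmp C h f \<oplus>\<^bsub>Hom C X Z\<^esub> Cmp C h' f" if h': "h' \<in> Arr C Y Z" for h'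
  proof -
    from h' obtain h1 where h1: "h' = (Y, h1, Z)" "h1 \<in> lie_hom g Y Z" by auto
    show ?thesis unfolding f0 h0 h1
      by (simp, rule extensionalityI[of _ "carrier X"]) (simp_all add: compose_eq lie_homD(3)[OF f0(2)])
  qed
  show "Cmp C h (f \<oplus>\<^bsub>Hom C X Y\<^esub> f') = Cmp C h f \<oplus>\<^bsub>Hom C X Z\<^esub> Cmp C h f'" if f': "f' \<in> Arr C X Y" for f'
  proof -
    from f' obtain f1 where f1: "f' = (X, f1, Y)" "f1 \<in> lie_hom g X Y" by auto
    show ?thesis unfolding f0 h0 f1
      by (simp, rule extensionalityI[of _ "carrier X"])
        (simp_all add: compose_eq lie_homD(3)[OF f0(2)] lie_homD(3)[OF f1(2)] linD[OF lie_homD(1)[OF h0(2)]])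
  qed
  show "Cmp C k (Cmp C h f) = Cmp C (Cmp C k h) f" if W: "W \<in> Ob C" and k: "k \<in> Arr C Z W" for W k
  proof -
    from k obtain k0 where k0: "k = (Z, k0, W)" by auto
    show ?thesis unfolding f0 h0 k0
      by (simp, rule extensionalityI[of _ "carrier X"]) (simp_all add: compose_eq lie_homD(3)[OF f0(2)])
  qed
qed

lemma is_iso_bij:
  assumes "M \<in> Ob C" "N \<in> Ob C" "f \<in> lie_hom g M N" "bij_betw f (carrier M) (carrier N)"
  shows "is_iso C M N (M, f, N)"
proof -
  let ?h = "restrict (inv_into (carrier M) f) (carrier N)"
  have h: "?h \<in> lie_hom g N M" using assms Ob_lie by (intro lie_hom_inverse) auto
  have "compose (carrier M) ?h f = restrict (\<lambda>v. v) (carrier M)"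
    by (rule extensionalityI[of _ "carrier M"])
      (use assms(4) in \<open>auto simp: compose_eq bij_betw_def\<close>)
  moreover have "compose (carrier N) f ?h = restrict (\<lambda>v. v) (carrier N)"
    by (rule extensionalityI[of _ "carrier N"])
      (use assms(4) in \<open>auto simp: compose_eq bij_betw_def f_inv_into_f\<close>)
  ultimately show ?thesis
    unfolding is_iso_def using assms(3) h
    by (intro conjI bexI[of _ "(N, ?h, M)"]) (simp_all add: lie_Id_def)
qed

end

section \<open>The module category axioms\<close>

lemma sl2_iff: "x \<in> sl2 \<longleftrightarrow> x \<in> carrier_mat 2 2 \<and> x $$ (1, 1) = - x $$ (0, 0)"
  by (auto simp: sl2_def add_eq_0_iff2) (simp add: eq_neg_iff_add_eq_0 add.commute)?

lemma mat_entries [simp]: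
  "mat_e \<in> carrier_mat 2 2" "mat_h \<in> carrier_mat 2 2"
  "mat_e $$ (0, 0) = 0" "mat_e $$ (0, Suc 0) = 1" "mat_e $$ (Suc 0, 0) = 0" "mat_e $$ (Suc 0, Suc 0) = 0"
  "mat_h $$ (0, 0) = 1" "mat_h $$ (0, Suc 0) = 0" "mat_h $$ (Suc 0, 0) = 0" "mat_h $$ (Suc 0, Suc 0) = -1"
  by (rule carrier_matI | simp_all add: mat_e_def mat_h_def mat_of_rows_list_def)+

lemma mat_dims [simp]: "dim_row mat_e = 2" "dim_col mat_e = 2" "dim_row mat_h = 2" "dim_col mat_h = 2"
  using carrier_matD[OF mat_entries(1)] carrier_matD[OF mat_entries(2)] by simp_all

lemma mat2_eqI:
  assumes "x \<in> carrier_mat 2 2" "y \<in> carrier_mat 2 2" "x $$ (0, 0) = y $$ (0, 0)" "x $$ (0, 1) = y $$ (0, 1)"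
    "x $$ (1, 0) = y $$ (1, 0)" "x $$ (1, 1) = y $$ (1, 1)"
  shows "x = y"
proof (rule eq_matI)
  fix i j assume "i < dim_row y" "j < dim_col y"
  hence "i = 0 \<or> i = 1" "j = 0 \<or> j = 1" using assms(2) by auto
  thus "x $$ (i, j) = y $$ (i, j)" using assms(3-6) by auto
qed (use assms in auto)

lemma mat2_mult:
  fixes x y :: "complex mat"
  assumes "x \<in> carrier_mat 2 2" "y \<in> carrier_mat 2 2" "i < 2" "j < 2"
  shows "(x * y) $$ (i, j) = x $$ (i, 0) * y $$ (0, j) + x $$ (i, 1) * y $$ (1, j)"
  using assms by (simp add: scalar_prod_def numeral_2_eq_2)

lemma borel_iff: "x \<in> borel \<longleftrightarrow> x \<in> carrier_mat 2 2 \<and> x $$ (1, 1) = - x $$ (0, 0) \<and> x $$ (1, 0) = 0"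
proof
  assume "x \<in> borel"
  then obtain a c where "x = a \<cdot>\<^sub>m mat_h + c \<cdot>\<^sub>m mat_e" by (auto simp: borel_def)
  thus "x \<in> carrier_mat 2 2 \<and> x $$ (1, 1) = - x $$ (0, 0) \<and> x $$ (1, 0) = 0"
    using mat_entries(1,2) by simp
next
  assume x: "x \<in> carrier_mat 2 2 \<and> x $$ (1, 1) = - x $$ (0, 0) \<and> x $$ (1, 0) = 0"
  have "x = x $$ (0, 0) \<cdot>\<^sub>m mat_h + x $$ (0, 1) \<cdot>\<^sub>m mat_e"
    by (rule mat2_eqI) (use x mat_entries(1,2) in simp_all)
  thus "x \<in> borel" unfolding borel_def by blast
qed

lemma borel_subset_sl2: "borel \<subseteq> sl2"
  by (auto simp: borel_iff sl2_iff)

lemma lie_closed_sl2: "lie_closed sl2"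
  unfolding lie_closed_def
proof (intro conjI ballI allI)
  fix x y assume "x \<in> sl2" "y \<in> sl2"
  hence x: "x \<in> carrier_mat 2 2" "x $$ (1, 1) = - x $$ (0, 0)" and y: "y \<in> carrier_mat 2 2" "y $$ (1, 1) = - y $$ (0, 0)"
    by (auto simp: sl2_iff)
  show "x + y \<in> sl2" using x y by (simp add: sl2_iff)
  have "x * y - y * x \<in> carrier_mat 2 2"
    using x(1) y(1) by (intro minus_carrier_mat mult_carrier_mat)
  thus "x * y - y * x \<in> sl2" using x y by (simp add: sl2_iff mat2_mult del: index_mult_mat(1))
next
  fix x c assume "x \<in> sl2" thus "c \<cdot>\<^sub>m x \<in> sl2" by (auto simp: sl2_iff)
qed

lemma lie_closed_borel: "lie_closed borel"
  unfolding lie_closed_def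
proof (intro conjI ballI allI)
  fix x y assume "x \<in> borel" "y \<in> borel"
  hence x: "x \<in> carrier_mat 2 2" "x $$ (1, 1) = - x $$ (0, 0)" "x $$ (1, 0) = 0"
    and y: "y \<in> carrier_mat 2 2" "y $$ (1, 1) = - y $$ (0, 0)" "y $$ (1, 0) = 0"
    by (auto simp: borel_iff)
  show "x + y \<in> borel" using x y by (simp add: borel_iff)
  have "x * y - y * x \<in> carrier_mat 2 2"
    using x(1) y(1) by (intro minus_carrier_mat mult_carrier_mat)
  thus "x * y - y * x \<in> borel" using x y by (simp add: borel_iff mat2_mult del: index_mult_mat(1))
next
  fix x c assume "x \<in> borel" thus "c \<cdot>\<^sub>m x \<in> borel" by (auto simp: borel_iff)
qed

lemma lie_module_subset: "\<lbrakk>lie_module g' M; g \<subseteq> g'\<rbrakk> \<Longrightarrow> lie_module g M"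
  unfolding lie_module_def by blast

lemma lie_hom_subset: "\<lbrakk>f \<in> lie_hom g' M N; g \<subseteq> g'\<rbrakk> \<Longrightarrow> f \<in> lie_hom g M N"
  by (auto simp: lie_hom_iff)

lemma sl2_mod_sel [simp]:
  "Hom sl2_mod = lie_Hom sl2" "Id sl2_mod = lie_Id" "Cmp sl2_mod = arrow_compose"
  "TensO sl2_mod = tensor" "TensA sl2_mod = tensor_arrow" "UnitO sl2_mod = trivial_module"
  "AssocT sl2_mod = tensor_assoc" "LUnit sl2_mod = tensor_lunit" "RUnit sl2_mod = tensor_runit"
  by (simp_all add: sl2_mod_def)

lemma Ob_sl2_mod: "V \<in> Ob sl2_mod \<longleftrightarrow> lie_module sl2 V \<and> fd V"
  using fd_iff[of V] by (auto simp: sl2_mod_def dest: lie_moduleD(1))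

interpretation sl2_cat: lie_cat sl2 sl2_mod
  by unfold_locales (simp_all add: Ob_sl2_mod)

abbreviation triv_vec :: "'u" where "triv_vec \<equiv> snd trivial_pair"

definition lun :: "'u lmod \<Rightarrow> 'u \<Rightarrow> 'u"
  where "lun V = tensor_lift trivial_module V V (\<lambda>a v. trivial_coeff a \<odot>\<^bsub>V\<^esub> v)"

definition run :: "'u lmod \<Rightarrow> 'u \<Rightarrow> 'u"
  where "run V = tensor_lift V trivial_module V (\<lambda>v a. trivial_coeff a \<odot>\<^bsub>V\<^esub> v)"

lemma arrow_simps:
  "tensor_arrow (V, f, V') (W, h, W') = (tensor V W, tmap V W V' W' f h, tensor V' W')"
  "tensor_assoc U V W = (tensor (tensor U V) W, tass U V W, tensor U (tensor V W))"
  "tensor_lunit V = (tensor trivial_module V, lun V, V)"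
  "tensor_runit V = (tensor V trivial_module, run V, V)"
  by (simp_all add: tmap_def tensor_assoc_def tass_def tensor_lunit_def lun_def tensor_runit_def run_def)

context embedded_complex
begin

text \<open>The choice in \<open>trivial_pair\<close> becomes meaningful through a witness: the
  complex line with zero action, moved into the carrier type.\<close>

lemma trivial: "is_trivial_module (trivial_module :: 'u lmod) triv_vec"
proof -
  define M :: "(unit \<Rightarrow> complex) lmod" where "M = \<lparr>carrier = UNIV, monoid.mult = undefined, one = undefined,
     zero = (\<lambda>i. 0), add = (\<lambda>c d i. c i + d i), module.smult = (\<lambda>a c i. a * c i), act = (\<lambda>x c i. 0)\<rparr>"
  have l: "lin (fs UNIV) M (\<lambda>c. c)" and b: "bij_betw (\<lambda>c. c) (carrier (fs UNIV)) (carrier M)"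
    by (auto simp: M_def lin_iff bij_betw_def)
  have M: "cvs M" by (rule cvs_iso[OF fs_cvs b l]) (simp add: M_def)
  have fM: "fd M" by (rule fbasis_imp_fd[OF fbasis_of_iso[OF _ M l b]]) simp
  have "lie_module sl2 M"
    by (rule lie_moduleI[OF M]) (simp_all add: M_def lin_iff fun_eq_iff cvs_distribs(3)[OF M, unfolded M_def, simplified])
  from lie_model_exists[OF lie_closed_sl2 this fM] obtain N :: "'u lmod" and \<phi> where
    N: "lie_module sl2 N" "lin M N \<phi>" "bij_betw \<phi> (carrier M) (carrier N)"
      "\<And>x v. v \<in> carrier M \<Longrightarrow> act N x (\<phi> v) = \<phi> (act M x v)" by blast
  have z: "\<phi> (\<lambda>_. 0) = \<zero>\<^bsub>N\<^esub>" using lin_zero[OF M lie_moduleD(1)[OF N(1)] N(2)] by (simp add: M_def)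
  have im: "carrier N = \<phi> ` UNIV" using N(3) by (simp add: bij_betw_def M_def)
  have "is_trivial_module N (\<phi> (\<lambda>_. 1))"
    unfolding is_trivial_module_def
  proof (intro conjI ballI N(1))
    show "\<phi> (\<lambda>_. 1) \<in> carrier N" by (simp add: im)
    show "\<phi> (\<lambda>_. 1) \<noteq> \<zero>\<^bsub>N\<^esub>"
    proof
      assume "\<phi> (\<lambda>_. 1) = \<zero>\<^bsub>N\<^esub>"
      moreover have "inj_on \<phi> (carrier M)" using N(3) by (simp add: bij_betw_def)
      moreover have "carrier M = UNIV" by (simp add: M_def)
      ultimately have "(\<lambda>_. 1) = (\<lambda>_. 0 :: complex)"
        unfolding z[symmetric] by (metis inj_onD UNIV_I)
      from fun_cong[OF this] show False by simp
    qed
    have "\<phi> c = c () \<odot>\<^bsub>N\<^esub> \<phi> (\<lambda>_. 1)" for c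
      using linD(3)[OF N(2), of "\<lambda>_. 1" "c ()"] by (simp add: M_def)
    moreover have "a \<odot>\<^bsub>N\<^esub> \<phi> (\<lambda>_. 1) \<in> carrier N" for a
      by (rule cvs_simps(3)[OF lie_moduleD(1)[OF N(1)]]) (simp add: im)
    ultimately show "carrier N = {c \<odot>\<^bsub>N\<^esub> \<phi> (\<lambda>_. 1) |c. True}" unfolding im by blast
    show "act N x v = \<zero>\<^bsub>N\<^esub>" if "v \<in> carrier N" for x v
      using that N(4) z by (auto simp: im M_def)
  qed
  hence "\<exists>p. is_trivial_module (fst p) (snd p :: 'u)" by (intro exI[of _ "(N, _)"]) simp
  thus ?thesis unfolding trivial_module_def trivial_pair_def by (rule someI_ex)
qed

lemma trivial_props:
  shows "lie_module sl2 (trivial_module :: 'u lmod)" "(triv_vec :: 'u) \<in> carrier trivial_module"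
    "\<lbrakk>x \<in> sl2; v \<in> carrier (trivial_module :: 'u lmod)\<rbrakk> \<Longrightarrow> act trivial_module x v = \<zero>\<^bsub>trivial_module\<^esub>"
    "trivial_coeff (c \<odot>\<^bsub>trivial_module\<^esub> (triv_vec :: 'u)) = c"
    "v \<in> carrier (trivial_module :: 'u lmod) \<Longrightarrow> v = trivial_coeff v \<odot>\<^bsub>trivial_module\<^esub> triv_vec"
proof -
  note T = trivial[unfolded is_trivial_module_def]
  show T1: "lie_module sl2 (trivial_module :: 'u lmod)" and tv: "(triv_vec :: 'u) \<in> carrier trivial_module"
    and "\<lbrakk>x \<in> sl2; v \<in> carrier (trivial_module :: 'u lmod)\<rbrakk> \<Longrightarrow> act trivial_module x v = \<zero>\<^bsub>trivial_module\<^esub>"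
    using T by auto
  note S = cvs_simps[OF lie_moduleD(1)[OF T1]] and D = cvs_distribs[OF lie_moduleD(1)[OF T1]]
  have inj: "c = d" if "c \<odot>\<^bsub>trivial_module\<^esub> (triv_vec :: 'u) = d \<odot>\<^bsub>trivial_module\<^esub> triv_vec" for c d
  proof (rule ccontr)
    assume "c \<noteq> d"
    have "(c - d) \<odot>\<^bsub>trivial_module\<^esub> (triv_vec :: 'u) = c \<odot>\<^bsub>trivial_module\<^esub> triv_vec \<oplus>\<^bsub>trivial_module\<^esub> (- d) \<odot>\<^bsub>trivial_module\<^esub> triv_vec"
      using D(1)[OF tv, of c "- d"] by simp
    also have "\<dots> = (d + - d) \<odot>\<^bsub>trivial_module\<^esub> triv_vec" unfolding that D(1)[OF tv] ..
    finally have "(c - d) \<odot>\<^bsub>trivial_module\<^esub> (triv_vec :: 'u) = \<zero>\<^bsub>trivial_module\<^esub>" using S(8)[OF tv] by simp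
    hence "inverse (c - d) \<odot>\<^bsub>trivial_module\<^esub> ((c - d) \<odot>\<^bsub>trivial_module\<^esub> (triv_vec :: 'u)) = \<zero>\<^bsub>trivial_module\<^esub>"
      using S(9) by simp
    hence "(triv_vec :: 'u) = \<zero>\<^bsub>trivial_module\<^esub>" using \<open>c \<noteq> d\<close> S(7)[OF tv] by (simp add: S(10)[OF tv])
    thus False using T by simp
  qed
  show coeff: "trivial_coeff (c \<odot>\<^bsub>trivial_module\<^esub> (triv_vec :: 'u)) = c" for c
    unfolding trivial_coeff_def by (rule the_equality) (auto dest: inj)
  show "v = trivial_coeff v \<odot>\<^bsub>trivial_module\<^esub> triv_vec" if "v \<in> carrier (trivial_module :: 'u lmod)" for v
    using T that coeff by auto
qed

lemma trivial_coeff_lin: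
  fixes v w :: 'u
  assumes v: "v \<in> carrier trivial_module"
  shows "w \<in> carrier trivial_module \<Longrightarrow> trivial_coeff (v \<oplus>\<^bsub>trivial_module\<^esub> w) = trivial_coeff v + trivial_coeff w"
    "trivial_coeff (c \<odot>\<^bsub>trivial_module\<^esub> v) = c * trivial_coeff v"
    "trivial_coeff (\<zero>\<^bsub>trivial_module\<^esub> :: 'u) = 0"
proof -
  note C = lie_moduleD(1)[OF trivial_props(1)]
  note tv = trivial_props(2)
  note S = cvs_simps[OF C] and D = cvs_distribs[OF C]
  show "trivial_coeff (v \<oplus>\<^bsub>trivial_module\<^esub> w) = trivial_coeff v + trivial_coeff w" if w: "w \<in> carrier trivial_module"
  proof -
    have "v \<oplus>\<^bsub>trivial_module\<^esub> w = (trivial_coeff v + trivial_coeff w) \<odot>\<^bsub>trivial_module\<^esub> triv_vec"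
      unfolding D(1)[OF tv] using trivial_props(5)[OF v] trivial_props(5)[OF w] by simp
    thus ?thesis using trivial_props(4) by metis
  qed
  have "c \<odot>\<^bsub>trivial_module\<^esub> v = (c * trivial_coeff v) \<odot>\<^bsub>trivial_module\<^esub> triv_vec"
    unfolding S(10)[OF tv, symmetric] using trivial_props(5)[OF v] by simp
  thus "trivial_coeff (c \<odot>\<^bsub>trivial_module\<^esub> v) = c * trivial_coeff v" using trivial_props(4) by metis
  show "trivial_coeff (\<zero>\<^bsub>trivial_module\<^esub> :: 'u) = 0" using trivial_props(4)[of 0] S(8)[OF tv] by simp
qed

lemma trivial_basis: "fbasis (trivial_module :: 'u lmod) (\<lambda>_. triv_vec) {()}"
proof -
  note C = lie_moduleD(1)[OF trivial_props(1)]
  interpret M: vectorspace "class_ring :: complex ring" "trivial_module :: 'u lmod" by (rule C)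
  have comb: "comb (trivial_module :: 'u lmod) (\<lambda>_. triv_vec) {()} c = c () \<odot>\<^bsub>trivial_module\<^esub> triv_vec" for c
    unfolding comb_def using trivial_props(2) cvs_simps(3)[OF C trivial_props(2)] by (simp add: cvs_simps(5)[OF C])
  show ?thesis
  proof (rule fbasisI[OF C])
    fix c i assume "comb (trivial_module :: 'u lmod) (\<lambda>_. triv_vec) {()} c = \<zero>\<^bsub>trivial_module\<^esub>"
    thus "c i = 0" using trivial_props(4)[of "c ()"] trivial_coeff_lin(3)[OF trivial_props(2)] by (simp add: comb)
  next
    fix v :: 'u assume "v \<in> carrier trivial_module"
    from trivial_props(5)[OF this] show "\<exists>c. v = comb trivial_module (\<lambda>_. triv_vec) {()} c"
      by (intro exI[of _ "\<lambda>_. trivial_coeff v"]) (simp add: comb)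
  qed (use trivial_props(2) in auto)
qed

lemma fd_trivial [simp]: "fd (trivial_module :: 'u lmod)"
  by (rule fbasis_imp_fd[OF trivial_basis])

lemma trivial_coeff_vec [simp]: "trivial_coeff (triv_vec :: 'u) = 1"
  using trivial_props(4)[of 1] cvs_simps(7)[OF lie_moduleD(1)[OF trivial_props(1)] trivial_props(2)] by simp

lemma unit_props:
  fixes V :: "'u lmod"
  assumes V: "fd V"
  shows "lin (tensor trivial_module V) V (lun V)" "lun V \<in> extensional (carrier (tensor trivial_module V))"
    "\<lbrakk>a \<in> carrier trivial_module; v \<in> carrier V\<rbrakk> \<Longrightarrow> lun V (pure_tensor trivial_module V a v) = trivial_coeff a \<odot>\<^bsub>V\<^esub> v"
    "bij_betw (lun V) (carrier (tensor trivial_module V)) (carrier V)"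
    "lin (tensor V trivial_module) V (run V)" "run V \<in> extensional (carrier (tensor V trivial_module))"
    "\<lbrakk>a \<in> carrier trivial_module; v \<in> carrier V\<rbrakk> \<Longrightarrow> run V (pure_tensor V trivial_module v a) = trivial_coeff a \<odot>\<^bsub>V\<^esub> v"
    "bij_betw (run V) (carrier (tensor V trivial_module)) (carrier V)"
proof -
  note C = fd_cvs[OF V]
  note S = cvs_simps[OF C] and D = cvs_distribs[OF C]
  have b1: "bilinear_map trivial_module V V (\<lambda>a v. trivial_coeff a \<odot>\<^bsub>V\<^esub> v)"
    by (rule bilinear_mapI) (simp_all add: S D(1,2) trivial_coeff_lin mult.commute)
  have b2: "bilinear_map V trivial_module V (\<lambda>v a. trivial_coeff a \<odot>\<^bsub>V\<^esub> v)"
    by (rule bilinear_mapI) (simp_all add: S D(1,2) trivial_coeff_lin mult.commute)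
  note L1 = lift_props[OF fd_trivial V C b1] and L2 = lift_props[OF V fd_trivial C b2]
  show l1: "lin (tensor trivial_module V) V (lun V)" and "lun V \<in> extensional (carrier (tensor trivial_module V))"
    and l2: "lin (tensor V trivial_module) V (run V)" and "run V \<in> extensional (carrier (tensor V trivial_module))"
    unfolding lun_def run_def by (fact L1(1), fact L1(2), fact L2(1), fact L2(2))
  show ev: "lun V (pure_tensor trivial_module V a v) = trivial_coeff a \<odot>\<^bsub>V\<^esub> v"
    "run V (pure_tensor V trivial_module v a) = trivial_coeff a \<odot>\<^bsub>V\<^esub> v"
    if "a \<in> carrier trivial_module" "v \<in> carrier V" for a v
    unfolding lun_def run_def using L1(3) L2(3) that by auto
  obtain p and n :: nat where p: "fbasis V p {..<n}" using V by (rule fdE)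
  show "bij_betw (lun V) (carrier (tensor trivial_module V)) (carrier V)"
  proof (rule bij_of_bases[OF tensor_basis[OF trivial_basis p] l1])
    have "bij_betw snd ({()} \<times> {..<n}) {..<n}" by (rule bij_betw_byWitness[of _ "\<lambda>i. ((), i)"]) auto
    from fbasis_reindex[OF p this]
    show "fbasis V (\<lambda>i. lun V (case i of (i, j) \<Rightarrow> pure_tensor trivial_module V triv_vec (p j))) ({()} \<times> {..<n})"
      by (rule fbasis_cong) (use fbasisD(4)[OF p] in \<open>auto simp: ev trivial_props(2) S\<close>)
  qed
  show "bij_betw (run V) (carrier (tensor V trivial_module)) (carrier V)"
  proof (rule bij_of_bases[OF tensor_basis[OF p trivial_basis] l2])
    have "bij_betw fst ({..<n} \<times> {()}) {..<n}" by (rule bij_betw_byWitness[of _ "\<lambda>i. (i, ())"]) auto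
    from fbasis_reindex[OF p this]
    show "fbasis V (\<lambda>i. run V (case i of (i, j) \<Rightarrow> pure_tensor V trivial_module (p i) triv_vec)) ({..<n} \<times> {()})"
      by (rule fbasis_cong) (use fbasisD(4)[OF p] in \<open>auto simp: ev trivial_props(2) S\<close>)
  qed
qed

text \<open>The action on the trivial factor is zero, so the Leibniz rule keeps only the term that
  acts on \<open>V\<close>.\<close>

lemma unit_hom:
  fixes V :: "'u lmod"
  assumes V: "lie_module g V" "fd V" and g: "g \<subseteq> sl2"
  shows "lun V \<in> lie_hom g (tensor trivial_module V) V" "run V \<in> lie_hom g (tensor V trivial_module) V"
proof -
  note T = lie_module_subset[OF trivial_props(1) g]
  note C = lie_moduleD(1)[OF V(1)] and U = unit_props[OF V(2)]
  note S = cvs_simps[OF C]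
  have "lun V (act (tensor trivial_module V) x t) = act V x (lun V t)"
    if x: "x \<in> g" and t: "t \<in> carrier (tensor trivial_module V)" for x t
  proof (rule tensor_ext[OF fd_trivial V(2) C lin_compose[OF tensor_act(1)[OF T fd_trivial V x] U(1)]
        lin_compose[OF U(1) lie_moduleD(2)[OF V(1) x]]])
    fix a v assume av: "a \<in> carrier (trivial_module :: 'u lmod)" "v \<in> carrier V"
    have x2: "x \<in> sl2" using x g by blast
    note z = cvs_simps(1)[OF lie_moduleD(1)[OF T]]
    show "lun V (act (tensor trivial_module V) x (pure_tensor trivial_module V a v))
        = act V x (lun V (pure_tensor trivial_module V a v))"
      unfolding tensor_act(2)[OF T fd_trivial V x av] U(3)[OF av] trivial_props(3)[OF x2 av(1)]
      using av lie_moduleD(6)[OF V(1) x av(2)] z bilinear_mapD(3)[OF pt_bilinear[OF fd_trivial V(2)]]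
      by (simp del: tensor_sel add: linD(2)[OF U(1)] U(3) trivial_coeff_lin(3)[OF av(1)] S linD(3)[OF lie_moduleD(2)[OF V(1) x]])
  qed (use t in simp)
  thus "lun V \<in> lie_hom g (tensor trivial_module V) V" using U by (simp add: lie_hom_iff)
  have "run V (act (tensor V trivial_module) x t) = act V x (run V t)"
    if x: "x \<in> g" and t: "t \<in> carrier (tensor V trivial_module)" for x t
  proof (rule tensor_ext[OF V(2) fd_trivial C lin_compose[OF tensor_act(1)[OF V T fd_trivial x] U(5)]
        lin_compose[OF U(5) lie_moduleD(2)[OF V(1) x]]])
    fix v a assume av: "v \<in> carrier V" "a \<in> carrier (trivial_module :: 'u lmod)"
    have x2: "x \<in> sl2" using x g by blast
    note z = cvs_simps(1)[OF lie_moduleD(1)[OF T]]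
    show "run V (act (tensor V trivial_module) x (pure_tensor V trivial_module v a))
        = act V x (run V (pure_tensor V trivial_module v a))"
      unfolding tensor_act(2)[OF V T fd_trivial x av] U(7)[OF av(2,1)] trivial_props(3)[OF x2 av(2)]
      using av lie_moduleD(6)[OF V(1) x av(1)] z bilinear_mapD(3)[OF pt_bilinear[OF V(2) fd_trivial]]
      by (simp del: tensor_sel add: linD(2)[OF U(5)] U(7) trivial_coeff_lin(3)[OF av(2)] S linD(3)[OF lie_moduleD(2)[OF V(1) x]])
  qed (use t in simp)
  thus "run V \<in> lie_hom g (tensor V trivial_module) V" using U by (simp add: lie_hom_iff)
qed

end

lemma lin_compose_fun: "\<lbrakk>cvs M; lin M N f; lin N P h\<rbrakk> \<Longrightarrow> lin M P (compose (carrier M) h f)"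
  by (simp add: compose_def lin_compose)

context embedded_complex
begin

lemma tensor_eqI:
  fixes V W :: "'u lmod"
  assumes "fd V" "fd W" "cvs Z" "lin (tensor V W) Z a" "lin (tensor V W) Z b"
    and "a \<in> extensional (carrier (tensor V W))" "b \<in> extensional (carrier (tensor V W))"
    and "\<And>v w. \<lbrakk>v \<in> carrier V; w \<in> carrier W\<rbrakk> \<Longrightarrow> a (pure_tensor V W v w) = b (pure_tensor V W v w)"
  shows "a = b"
  by (rule extensionalityI[OF assms(6,7)], rule tensor_ext[OF assms(1-5,8)]) simp_all

lemma tensor_eqI3:
  fixes U V W :: "'u lmod"
  assumes "fd U" "fd V" "fd W" "cvs Z" "lin (tensor (tensor U V) W) Z a" "lin (tensor (tensor U V) W) Z b"
    and "a \<in> extensional (carrier (tensor (tensor U V) W))" "b \<in> extensional (carrier (tensor (tensor U V) W))"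
    and "\<And>u v w. \<lbrakk>u \<in> carrier U; v \<in> carrier V; w \<in> carrier W\<rbrakk> \<Longrightarrow>
      a (pure_tensor (tensor U V) W (pure_tensor U V u v) w) = b (pure_tensor (tensor U V) W (pure_tensor U V u v) w)"
  shows "a = b"
  by (rule extensionalityI[OF assms(7,8)], rule tensor_ext3[OF assms(1-6,9)]) simp_all

lemma tensor_eqI4:
  fixes U V W X :: "'u lmod"
  assumes "fd U" "fd V" "fd W" "fd X" "cvs Z"
    and "lin (tensor (tensor (tensor U V) W) X) Z a" "lin (tensor (tensor (tensor U V) W) X) Z b"
    and "a \<in> extensional (carrier (tensor (tensor (tensor U V) W) X))"
    and "b \<in> extensional (carrier (tensor (tensor (tensor U V) W) X))"
    and "\<And>u v w x. \<lbrakk>u \<in> carrier U; v \<in> carrier V; w \<in> carrier W; x \<in> carrier X\<rbrakk> \<Longrightarrow>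
      a (pure_tensor (tensor (tensor U V) W) X (pure_tensor (tensor U V) W (pure_tensor U V u v) w) x) =
      b (pure_tensor (tensor (tensor U V) W) X (pure_tensor (tensor U V) W (pure_tensor U V u v) w) x)"
  shows "a = b"
  by (rule extensionalityI[OF assms(8,9)], rule tensor_ext4[OF assms(1-7,10)]) simp_all

end

text \<open>A class of finite dimensional \<open>g\<close>-modules closed under tensoring with
  \<open>sl2\<close>-modules from the left. Taking \<open>g\<close> to be \<open>sl2\<close> gives
  the acting category on itself and \<open>borel\<close> gives the module category, so the coherence
  conditions are proved once for both.\<close>

locale lie_action = embedded_complex embed + lie_cat g M
  for embed :: "complex \<Rightarrow> 'u" and g and M :: "('u lmod, 'u arrow, 'x) lincat_scheme" +
  assumes g_sl2: "g \<subseteq> sl2" and g_closed: "lie_closed g"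
    and Ob_fd: "X \<in> Ob M \<Longrightarrow> fd X"
    and tensor_Ob: "\<lbrakk>V \<in> Ob sl2_mod; X \<in> Ob M\<rbrakk> \<Longrightarrow> tensor V X \<in> Ob M"
begin

lemma C_Ob: "V \<in> Ob (sl2_mod :: ('u lmod, 'u arrow) moncat) \<Longrightarrow> lie_module g V"
  "V \<in> Ob (sl2_mod :: ('u lmod, 'u arrow) moncat) \<Longrightarrow> fd V"
  by (auto simp: Ob_sl2_mod intro: lie_module_subset[OF _ g_sl2])

lemma C_tensor: "\<lbrakk>U \<in> Ob sl2_mod; V \<in> Ob sl2_mod\<rbrakk> \<Longrightarrow> tensor U (V :: 'u lmod) \<in> Ob sl2_mod"
  by (simp add: Ob_sl2_mod lie_module_tensor[OF lie_closed_sl2])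

lemma C_Arr:
  assumes "f \<in> Arr sl2_mod V V'"
  obtains f0 where "f = (V, f0, V')" "f0 \<in> lie_hom g V V'" "lin V V' f0" "\<And>v. v \<in> carrier V \<Longrightarrow> f0 v \<in> carrier V'"
    "f0 \<in> extensional (carrier V)"
  using assms lie_hom_subset[OF _ g_sl2] lie_homD by fastforce

lemma M_Arr:
  assumes "f \<in> Arr M V V'"
  obtains f0 where "f = (V, f0, V')" "f0 \<in> lie_hom g V V'" "lin V V' f0" "\<And>v. v \<in> carrier V \<Longrightarrow> f0 v \<in> carrier V'"
    "f0 \<in> extensional (carrier V)"
  using assms lie_homD by fastforce

lemma bifunctor: "bilinear_bifunctor (sl2_mod :: ('u lmod, 'u arrow) moncat) M M tensor tensor_arrow"
proof (intro bilinear_bifunctor.intro bilinear_bifunctor_axioms.intro)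
  show "linear_category (sl2_mod :: ('u lmod, 'u arrow) moncat)" by (rule sl2_cat.linear_category_axioms)
  show "linear_category M" "linear_category M" by (rule linear_category_axioms)+
  fix V X assume V: "V \<in> Ob (sl2_mod :: ('u lmod, 'u arrow) moncat)" and X: "X \<in> Ob M"
  show "tensor V X \<in> Ob M" by (rule tensor_Ob[OF V X])
  note fV = C_Ob[OF V] and fX = Ob_lie[OF X] Ob_fd[OF X]
  have c: "cvs V" "cvs X" "fd (tensor V X)" "cvs (tensor V X)" using fV fX by (auto simp: fd_cvs)
  show "tensor_arrow (Id sl2_mod V) (Id M X) = Id M (tensor V X)"
  proof -
    let ?f = "restrict (\<lambda>v. v) (carrier V)" and ?h = "restrict (\<lambda>v. v) (carrier X)"
    have "lin V V ?f" "lin X X ?h" using c by (simp_all add: lin_id)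
    note P = tmap_props[OF fV(2) fX(2) fV(2) fX(2) this]
    have r: "lin (tensor V X) (tensor V X) (restrict (\<lambda>t. t) (carrier (tensor V X)))"
      using c by (simp add: lin_id del: tensor_sel)
    have "tmap V X V X ?f ?h = restrict (\<lambda>t. t) (carrier (tensor V X))"
      by (rule tensor_eqI[OF fV(2) fX(2) c(4) P(1) r P(2)]) (use c pt_simps(1)[OF fV(2) fX(2)] in \<open>simp_all add: lin_id P(3)\<close>)
    thus ?thesis by (simp add: lie_Id_def arrow_simps del: tensor_arrow.simps)
  qed
next
  fix V V' X X' f h
  assume V: "V \<in> Ob (sl2_mod :: ('u lmod, 'u arrow) moncat)" "V' \<in> Ob sl2_mod" and X: "X \<in> Ob M" "X' \<in> Ob M"
    and f: "f \<in> Arr sl2_mod V V'" and h: "h \<in> Arr M X X'"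
  note fin = C_Ob[OF V(1)] Ob_lie[OF X(1)] Ob_fd[OF X(1)] C_Ob[OF V(2)] Ob_lie[OF X(2)] Ob_fd[OF X(2)]
  from f obtain f0 where f0: "f = (V, f0, V')" "f0 \<in> lie_hom g V V'" "lin V V' f0" "\<And>v. v \<in> carrier V \<Longrightarrow> f0 v \<in> carrier V'"
    by (rule C_Arr) blast
  from h obtain h0 where h0: "h = (X, h0, X')" "h0 \<in> lie_hom g X X'" "lin X X' h0" "\<And>v. v \<in> carrier X \<Longrightarrow> h0 v \<in> carrier X'"
    by (rule M_Arr) blast
  show "tensor_arrow f h \<in> Arr M (tensor V X) (tensor V' X')"
    using tmap_hom[OF fin f0(2) h0(2) g_closed] by (simp add: f0(1) h0(1) arrow_simps del: tensor_arrow.simps)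
  have c: "cvs V" "cvs X" "cvs V'" "cvs X'" "cvs (tensor V X)" "cvs (tensor V' X')" using fin by (auto simp: fd_cvs)
  note P = tmap_props[OF fin(2,4,6,8) f0(3) h0(3)] and pt = bilinear_mapD[OF pt_bilinear[OF fin(6,8)]]
    and pt0 = pt_simps(1)[OF fin(2,4)]
  show "tensor_arrow (a \<odot>\<^bsub>Hom sl2_mod V V'\<^esub> f) h = a \<odot>\<^bsub>Hom M (tensor V X) (tensor V' X')\<^esub> tensor_arrow f h"
    and "tensor_arrow f (a \<odot>\<^bsub>Hom M X X'\<^esub> h) = a \<odot>\<^bsub>Hom M (tensor V X) (tensor V' X')\<^esub> tensor_arrow f h" for a
  proof -
    let ?f = "restrict (\<lambda>v. a \<odot>\<^bsub>V'\<^esub> f0 v) (carrier V)" and ?h = "restrict (\<lambda>v. a \<odot>\<^bsub>X'\<^esub> h0 v) (carrier X)"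
    let ?r = "restrict (\<lambda>t. a \<odot>\<^bsub>tensor V' X'\<^esub> tmap V X V' X' f0 h0 t) (carrier (tensor V X))"
    have r: "lin (tensor V X) (tensor V' X') ?r" using c P(1) by (simp add: lin_smult del: tensor_sel)
    have "lin V V' ?f" "lin X X' ?h" using c f0 h0 by (simp_all add: lin_smult)
    note P1 = tmap_props[OF fin(2,4,6,8) this(1) h0(3)] and P2 = tmap_props[OF fin(2,4,6,8) f0(3) this(2)]
    have "tmap V X V' X' ?f h0 = ?r"
      by (rule tensor_eqI[OF fin(2,4) c(6) P1(1) r P1(2)]) (simp_all add: P1(3) P(3) pt0 pt(6,7)[simplified] f0 h0)
    thus "tensor_arrow (a \<odot>\<^bsub>Hom sl2_mod V V'\<^esub> f) h = a \<odot>\<^bsub>Hom M (tensor V X) (tensor V' X')\<^esub> tensor_arrow f h"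
      by (simp add: f0(1) h0(1) arrow_simps del: tensor_arrow.simps)
    have "tmap V X V' X' f0 ?h = ?r"
      by (rule tensor_eqI[OF fin(2,4) c(6) P2(1) r P2(2)]) (simp_all add: P2(3) P(3) pt0 pt(6,7)[simplified] f0 h0)
    thus "tensor_arrow f (a \<odot>\<^bsub>Hom M X X'\<^esub> h) = a \<odot>\<^bsub>Hom M (tensor V X) (tensor V' X')\<^esub> tensor_arrow f h"
      by (simp add: f0(1) h0(1) arrow_simps del: tensor_arrow.simps)
  qed
  show "tensor_arrow (f \<oplus>\<^bsub>Hom sl2_mod V V'\<^esub> f') h
      = tensor_arrow f h \<oplus>\<^bsub>Hom M (tensor V X) (tensor V' X')\<^esub> tensor_arrow f' h" if f': "f' \<in> Arr sl2_mod V V'" for f'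
  proof -
    from f' obtain f1 where f1: "f' = (V, f1, V')" "f1 \<in> lie_hom g V V'" "lin V V' f1" "\<And>v. v \<in> carrier V \<Longrightarrow> f1 v \<in> carrier V'"
      by (rule C_Arr) blast
    note P1 = tmap_props[OF fin(2,4,6,8) f1(3) h0(3)]
    let ?f = "restrict (\<lambda>v. f0 v \<oplus>\<^bsub>V'\<^esub> f1 v) (carrier V)"
    let ?r = "restrict (\<lambda>t. tmap V X V' X' f0 h0 t \<oplus>\<^bsub>tensor V' X'\<^esub> tmap V X V' X' f1 h0 t) (carrier (tensor V X))"
    have r: "lin (tensor V X) (tensor V' X') ?r" using c P(1) P1(1) by (simp add: lin_add del: tensor_sel)
    have "lin V V' ?f" using c f0 f1 by (simp add: lin_add)
    note P2 = tmap_props[OF fin(2,4,6,8) this h0(3)]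
    have "tmap V X V' X' ?f h0 = ?r"
      by (rule tensor_eqI[OF fin(2,4) c(6) P2(1) r P2(2)]) (simp_all add: P2(3) P1(3) P(3) pt0 pt(4)[simplified] f0 f1 h0)
    thus ?thesis by (simp add: f0(1) f1(1) h0(1) arrow_simps del: tensor_arrow.simps)
  qed
  show "tensor_arrow f (h \<oplus>\<^bsub>Hom M X X'\<^esub> h')
      = tensor_arrow f h \<oplus>\<^bsub>Hom M (tensor V X) (tensor V' X')\<^esub> tensor_arrow f h'" if h': "h' \<in> Arr M X X'" for h'
  proof -
    from h' obtain h1 where h1: "h' = (X, h1, X')" "h1 \<in> lie_hom g X X'" "lin X X' h1" "\<And>v. v \<in> carrier X \<Longrightarrow> h1 v \<in> carrier X'"
      by (rule M_Arr) blast
    note P1 = tmap_props[OF fin(2,4,6,8) f0(3) h1(3)]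
    let ?h = "restrict (\<lambda>v. h0 v \<oplus>\<^bsub>X'\<^esub> h1 v) (carrier X)"
    let ?r = "restrict (\<lambda>t. tmap V X V' X' f0 h0 t \<oplus>\<^bsub>tensor V' X'\<^esub> tmap V X V' X' f0 h1 t) (carrier (tensor V X))"
    have r: "lin (tensor V X) (tensor V' X') ?r" using c P(1) P1(1) by (simp add: lin_add del: tensor_sel)
    have "lin X X' ?h" using c h0 h1 by (simp add: lin_add)
    note P2 = tmap_props[OF fin(2,4,6,8) f0(3) this]
    have "tmap V X V' X' f0 ?h = ?r"
      by (rule tensor_eqI[OF fin(2,4) c(6) P2(1) r P2(2)]) (simp_all add: P2(3) P1(3) P(3) pt0 pt(5)[simplified] f0 h1 h0)
    thus ?thesis by (simp add: f0(1) h1(1) h0(1) arrow_simps del: tensor_arrow.simps)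
  qed
  fix V'' X'' f' h'
  assume V'': "V'' \<in> Ob (sl2_mod :: ('u lmod, 'u arrow) moncat)" and X'': "X'' \<in> Ob M"
    and f': "f' \<in> Arr sl2_mod V' V''" and h': "h' \<in> Arr M X' X''"
  note fin' = C_Ob[OF V''] Ob_lie[OF X''] Ob_fd[OF X'']
  show "tensor_arrow (Cmp sl2_mod f' f) (Cmp M h' h) = Cmp M (tensor_arrow f' h') (tensor_arrow f h)"
  proof -
    from f' obtain f1 where f1: "f' = (V', f1, V'')" "f1 \<in> lie_hom g V' V''" "lin V' V'' f1" "\<And>v. v \<in> carrier V' \<Longrightarrow> f1 v \<in> carrier V''"
      by (rule C_Arr) blast
    from h' obtain h1 where h1: "h' = (X', h1, X'')" "h1 \<in> lie_hom g X' X''" "lin X' X'' h1" "\<And>v. v \<in> carrier X' \<Longrightarrow> h1 v \<in> carrier X''"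
      by (rule M_Arr) blast
    have c'': "cvs (tensor V'' X'')" using fin' by (simp add: fd_cvs)
    note P1 = tmap_props[OF fin(6,8) fin'(2,4) f1(3) h1(3)]
      and P2 = tmap_props[OF fin(2,4) fin'(2,4) lin_compose_fun[OF c(1) f0(3) f1(3)] lin_compose_fun[OF c(2) h0(3) h1(3)]]
    have "tmap V X V'' X'' (compose (carrier V) f1 f0) (compose (carrier X) h1 h0)
      = compose (carrier (tensor V X)) (tmap V' X' V'' X'' f1 h1) (tmap V X V' X' f0 h0)"
      by (rule tensor_eqI[OF fin(2,4) c'' P2(1) lin_compose_fun[OF c(5) P(1) P1(1)] P2(2)])
        (simp_all add: P2(3) P1(3) P(3) pt0 compose_eq f0 h0)
    thus ?thesis by (simp add: f0(1) f1(1) h0(1) h1(1) arrow_simps del: tensor_arrow.simps)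
  qed
qed

lemma assoc_iso:
  assumes "U \<in> Ob sl2_mod" "V \<in> Ob sl2_mod" "X \<in> Ob M"
  shows "is_iso M (tensor (tensor U V) X) (tensor U (tensor V X)) (tensor_assoc U V X)"
  unfolding arrow_simps
proof (rule is_iso_bij)
  note fin = C_Ob[OF assms(1)] C_Ob[OF assms(2)] Ob_lie[OF assms(3)] Ob_fd[OF assms(3)]
  show "tass U V X \<in> lie_hom g (tensor (tensor U V) X) (tensor U (tensor V X))"
    by (rule tass_hom[OF fin g_closed])
  show "bij_betw (tass U V X) (carrier (tensor (tensor U V) X)) (carrier (tensor U (tensor V X)))"
    by (rule tass_props(4)[OF fin(2,4,6)])
qed (use assms tensor_Ob C_tensor in auto)

lemma lunit_iso:
  assumes "X \<in> Ob M"
  shows "is_iso M (tensor trivial_module X) X (tensor_lunit X)"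
  unfolding arrow_simps
proof (rule is_iso_bij[OF _ assms])
  have "(trivial_module :: 'u lmod) \<in> Ob sl2_mod" by (simp add: Ob_sl2_mod trivial_props)
  thus "tensor trivial_module X \<in> Ob M" by (rule tensor_Ob[OF _ assms])
  show "lun X \<in> lie_hom g (tensor trivial_module X) X"
    by (rule unit_hom(1)[OF Ob_lie[OF assms] Ob_fd[OF assms] g_sl2])
  show "bij_betw (lun X) (carrier (tensor trivial_module X)) (carrier X)"
    by (rule unit_props(4)[OF Ob_fd[OF assms]])
qed

lemma assoc_natural:
  assumes Ob: "U \<in> Ob sl2_mod" "U' \<in> Ob sl2_mod" "V \<in> Ob sl2_mod" "V' \<in> Ob sl2_mod" "X \<in> Ob M" "X' \<in> Ob M"
    and f: "f \<in> Arr sl2_mod U U'" and h: "h \<in> Arr sl2_mod V V'" and k: "k \<in> Arr M X X'"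
  shows "arrow_compose (tensor_arrow f (tensor_arrow h k)) (tensor_assoc U V X)
    = arrow_compose (tensor_assoc U' V' X') (tensor_arrow (tensor_arrow f h) k)"
proof -
  note fin = C_Ob(2)[OF Ob(1)] C_Ob(2)[OF Ob(3)] Ob_fd[OF Ob(5)] and fin' = C_Ob(2)[OF Ob(2)] C_Ob(2)[OF Ob(4)] Ob_fd[OF Ob(6)]
  from f obtain f0 where f0: "f = (U, f0, U')" "lin U U' f0" "\<And>v. v \<in> carrier U \<Longrightarrow> f0 v \<in> carrier U'" by (rule C_Arr) blast
  from h obtain h0 where h0: "h = (V, h0, V')" "lin V V' h0" "\<And>v. v \<in> carrier V \<Longrightarrow> h0 v \<in> carrier V'" by (rule C_Arr) blast
  from k obtain k0 where k0: "k = (X, k0, X')" "lin X X' k0" "\<And>v. v \<in> carrier X \<Longrightarrow> k0 v \<in> carrier X'" by (rule M_Arr) blast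
  have f2: "fd (tensor U V)" "fd (tensor V X)" "fd (tensor U' V')" "fd (tensor V' X')" using fin fin' by auto
  note P1 = tmap_props[OF fin(2,3) fin'(2,3) h0(2) k0(2)] and P3 = tmap_props[OF fin(1,2) fin'(1,2) f0(2) h0(2)]
  note P2 = tmap_props[OF fin(1) f2(2) fin'(1) f2(4) f0(2) P1(1)] and P4 = tmap_props[OF f2(1) fin(3) f2(3) fin'(3) P3(1) k0(2)]
  note A = tass_props[OF fin] and A' = tass_props[OF fin']
  have c: "cvs (tensor (tensor U V) X)" "cvs (tensor U' (tensor V' X'))" using fin fin' by (auto simp: fd_cvs)
  have "compose (carrier (tensor (tensor U V) X)) (tmap U (tensor V X) U' (tensor V' X') f0 (tmap V X V' X' h0 k0)) (tass U V X)
    = compose (carrier (tensor (tensor U V) X)) (tass U' V' X') (tmap (tensor U V) X (tensor U' V') X' (tmap U V U' V' f0 h0) k0)"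
    by (rule tensor_eqI3[OF fin c(2) lin_compose_fun[OF c(1) A(1) P2(1)] lin_compose_fun[OF c(1) P4(1) A'(1)]])
      (simp_all add: compose_eq pt_simps(1) fin fin' A(3) A'(3) P1(3) P2(3) P3(3) P4(3) f0 h0 k0)
  thus ?thesis by (simp add: f0(1) h0(1) k0(1) arrow_simps del: tensor_arrow.simps)
qed

lemma lunit_natural:
  assumes Ob: "X \<in> Ob M" "X' \<in> Ob M" and h: "h \<in> Arr M X X'"
  shows "arrow_compose h (tensor_lunit X) = arrow_compose (tensor_lunit X') (tensor_arrow (lie_Id trivial_module) h)"
proof -
  note fin = Ob_fd[OF Ob(1)] Ob_fd[OF Ob(2)]
  from h obtain h0 where h0: "h = (X, h0, X')" "lin X X' h0" "\<And>v. v \<in> carrier X \<Longrightarrow> h0 v \<in> carrier X'" by (rule M_Arr) blast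
  have c: "cvs (tensor trivial_module X)" "cvs X'" using fin by (auto simp: fd_cvs)
  let ?i = "restrict (\<lambda>v. v) (carrier (trivial_module :: 'u lmod))"
  have i: "lin trivial_module trivial_module ?i" by (simp add: fd_cvs lin_id)
  note P = tmap_props[OF fd_trivial fin(1) fd_trivial fin(2) i h0(2)]
  note U = unit_props[OF fin(1)] and U' = unit_props[OF fin(2)]
  have "compose (carrier (tensor trivial_module X)) h0 (lun X)
     = compose (carrier (tensor trivial_module X)) (lun X') (tmap trivial_module X trivial_module X' ?i h0)"
    by (rule tensor_eqI[OF fd_trivial fin(1) c(2) lin_compose_fun[OF c(1) U(1) h0(2)] lin_compose_fun[OF c(1) P(1) U'(1)]])
      (simp_all add: compose_eq pt_simps(1) fin U(3) U'(3) P(3) h0 linD(3)[OF h0(2)])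
  thus ?thesis by (simp add: h0(1) arrow_simps lie_Id_def del: tensor_arrow.simps)
qed

lemma pentagon_M:
  assumes Ob: "U \<in> Ob sl2_mod" "V \<in> Ob sl2_mod" "W \<in> Ob sl2_mod" "X \<in> Ob M"
  shows "arrow_compose (tensor_arrow (lie_Id U) (tensor_assoc V W X))
      (arrow_compose (tensor_assoc U (tensor V W) X) (tensor_arrow (tensor_assoc U V W) (lie_Id X)))
    = arrow_compose (tensor_assoc U V (tensor W X)) (tensor_assoc (tensor U V) W X)"
proof -
  note fin = C_Ob(2)[OF Ob(1)] C_Ob(2)[OF Ob(2)] C_Ob(2)[OF Ob(3)] Ob_fd[OF Ob(4)]
  have f2: "fd (tensor U V)" "fd (tensor V W)" "fd (tensor W X)" using fin by auto
  have f3: "fd (tensor (tensor U V) W)" "fd (tensor U (tensor V W))" "fd (tensor (tensor V W) X)" "fd (tensor V (tensor W X))"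
    using fin by auto
  let ?D = "tensor (tensor (tensor U V) W) X" and ?Z = "tensor U (tensor V (tensor W X))"
  have c: "cvs ?D" "cvs ?Z" "cvs U" "cvs X" using fin by (auto simp: fd_cvs)
  let ?i = "restrict (\<lambda>v. v) (carrier U)" and ?j = "restrict (\<lambda>v. v) (carrier X)"
  have i: "lin U U ?i" "lin X X ?j" using c by (simp_all add: lin_id)
  note A1 = tass_props[OF fin(1-3)] and A2 = tass_props[OF fin(1) f2(2) fin(4)] and A3 = tass_props[OF fin(2-4)]
    and A4 = tass_props[OF f2(1) fin(3,4)] and A5 = tass_props[OF fin(1,2) f2(3)]
  note P1 = tmap_props[OF f3(1) fin(4) f3(2) fin(4) A1(1) i(2)] and P2 = tmap_props[OF fin(1) f3(3) fin(1) f3(4) i(1) A3(1)]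
  have "compose (carrier ?D) (tmap U (tensor (tensor V W) X) U (tensor V (tensor W X)) ?i (tass V W X))
      (compose (carrier ?D) (tass U (tensor V W) X) (tmap (tensor (tensor U V) W) X (tensor U (tensor V W)) X (tass U V W) ?j))
    = compose (carrier ?D) (tass U V (tensor W X)) (tass (tensor U V) W X)"
    by (rule tensor_eqI4[OF fin c(2) lin_compose_fun[OF c(1) lin_compose_fun[OF c(1) P1(1) A2(1)] P2(1)]
          lin_compose_fun[OF c(1) A4(1) A5(1)]])
      (simp_all add: compose_eq pt_simps(1) fin A1(3) A2(3) A3(3) A4(3) A5(3) P1(3) P2(3))
  thus ?thesis by (simp add: arrow_simps lie_Id_def del: tensor_arrow.simps)
qed

lemma triangle_M:
  assumes Ob: "V \<in> Ob sl2_mod" "X \<in> Ob M"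
  shows "arrow_compose (tensor_arrow (lie_Id V) (tensor_lunit X)) (tensor_assoc V trivial_module X)
    = tensor_arrow (tensor_runit V) (lie_Id X)"
proof -
  note fin = C_Ob(2)[OF Ob(1)] Ob_fd[OF Ob(2)]
  have f2: "fd (tensor trivial_module X)" "fd (tensor V trivial_module)" using fin by auto
  let ?D = "tensor (tensor V trivial_module) X"
  have c: "cvs ?D" "cvs V" "cvs X" "cvs (tensor V X)" using fin by (auto simp: fd_cvs)
  let ?i = "restrict (\<lambda>v. v) (carrier V)" and ?j = "restrict (\<lambda>v. v) (carrier X)"
  have i: "lin V V ?i" "lin X X ?j" using c by (simp_all add: lin_id)
  note A = tass_props[OF fin(1) fd_trivial fin(2)] and UX = unit_props[OF fin(2)] and UV = unit_props[OF fin(1)]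
  note P1 = tmap_props[OF fin(1) f2(1) fin i(1) UX(1)] and P2 = tmap_props[OF f2(2) fin(2) fin UV(5) i(2)]
  note pt = bilinear_mapD[OF pt_bilinear[OF fin]]
  have "compose (carrier ?D) (tmap V (tensor trivial_module X) V X ?i (lun X)) (tass V trivial_module X)
    = tmap (tensor V trivial_module) X V X (run V) ?j"
    by (rule tensor_eqI3[OF fin(1) fd_trivial fin(2) c(4) lin_compose_fun[OF c(1) A(1) P1(1)] P2(1) _ P2(2)])
      (simp_all add: compose_eq pt_simps(1) fin A(3) P1(3) P2(3) UX(3) UV(7) cvs_simps(3)[OF c(3)] cvs_simps(3)[OF c(2)] pt(6,7)[simplified])
  thus ?thesis by (simp add: arrow_simps lie_Id_def del: tensor_arrow.simps)
qed

end

context embedded_complex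
begin

text \<open>Most axioms are those of \<open>sl2_mod\<close> acting on itself. The right unit has no
  counterpart among the isomorphisms of a module category, so its invertibility and naturality are
  treated here.\<close>

lemma monoidal: "monoidal_category (sl2_mod :: ('u lmod, 'u arrow) moncat)"
proof -
  interpret lie_action embed sl2 "sl2_mod :: ('u lmod, 'u arrow) moncat"
    by unfold_locales (auto simp: Ob_sl2_mod lie_closed_sl2 intro: lie_module_tensor)
  show ?thesis
  proof (intro monoidal_category.intro monoidal_category_axioms.intro, unfold sl2_mod_sel)
    show "bilinear_bifunctor (sl2_mod :: ('u lmod, 'u arrow) moncat) sl2_mod sl2_mod tensor tensor_arrow" by (rule bifunctor)
    show "trivial_module \<in> Ob (sl2_mod :: ('u lmod, 'u arrow) moncat)" by (simp add: Ob_sl2_mod trivial_props)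
    show "is_iso sl2_mod (tensor V trivial_module) V (tensor_runit V)" if V: "V \<in> Ob sl2_mod" for V :: "'u lmod"
      unfolding arrow_simps
    proof (rule sl2_cat.is_iso_bij[OF _ V])
      have "(trivial_module :: 'u lmod) \<in> Ob sl2_mod" by (simp add: Ob_sl2_mod trivial_props)
      thus "tensor V trivial_module \<in> Ob sl2_mod" by (rule tensor_Ob[OF V])
      show "run V \<in> lie_hom sl2 (tensor V trivial_module) V"
        by (rule unit_hom(2)[OF sl2_cat.Ob_lie[OF V] Ob_fd[OF V]]) simp
      show "bij_betw (run V) (carrier (tensor V trivial_module)) (carrier V)"
        by (rule unit_props(8)[OF Ob_fd[OF V]])
    qed
    fix V V' :: "'u lmod" and f
    assume Ob: "V \<in> Ob sl2_mod" "V' \<in> Ob sl2_mod" and h: "f \<in> carrier (lie_Hom sl2 V V')"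
    show "arrow_compose f (tensor_runit V) = arrow_compose (tensor_runit V') (tensor_arrow f (lie_Id trivial_module))"
    proof -
      note fin = Ob_fd[OF Ob(1)] Ob_fd[OF Ob(2)]
      from h obtain h0 where h0: "f = (V, h0, V')" "lin V V' h0" "\<And>v. v \<in> carrier V \<Longrightarrow> h0 v \<in> carrier V'"
        by (auto dest: lie_homD)
      have c: "cvs (tensor V trivial_module)" "cvs V'" using fin by (auto simp: fd_cvs)
      let ?i = "restrict (\<lambda>v. v) (carrier (trivial_module :: 'u lmod))"
      have i: "lin trivial_module trivial_module ?i" by (simp add: fd_cvs lin_id)
      note P = tmap_props[OF fin(1) fd_trivial fin(2) fd_trivial h0(2) i]
      note U = unit_props[OF fin(1)] and U' = unit_props[OF fin(2)]
      have "compose (carrier (tensor V trivial_module)) h0 (run V)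
         = compose (carrier (tensor V trivial_module)) (run V') (tmap V trivial_module V' trivial_module h0 ?i)"
        by (rule tensor_eqI[OF fin(1) fd_trivial c(2) lin_compose_fun[OF c(1) U(5) h0(2)] lin_compose_fun[OF c(1) P(1) U'(5)]])
          (simp_all add: compose_eq pt_simps(1) fin U(7) U'(7) P(3) h0 linD(3)[OF h0(2)])
      thus ?thesis by (simp add: h0(1) arrow_simps lie_Id_def del: tensor_arrow.simps)
    qed
  qed (simp_all only: assoc_iso lunit_iso assoc_natural[simplified sl2_mod_sel] lunit_natural[simplified sl2_mod_sel] pentagon_M triangle_M)
qed

end

theorem (in lie_action) module_category_lie:
  fixes N :: "('u lmod, 'u arrow, 'u lmod, 'u arrow, 'y) modcat_scheme"
  assumes N: "Ob N = Ob M" "Hom N = Hom M" "Id N = Id M" "Cmp N = Cmp M" "ActO N = tensor" "ActA N = tensor_arrow"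
    "ActAssoc N = tensor_assoc" "ActUnit N = tensor_lunit"
  shows "module_category sl2_mod N"
proof -
  interpret N: lie_action embed g N
    by unfold_locales (auto simp: N Ob_lie g_sl2 g_closed[unfolded lie_closed_def] Ob_fd tensor_Ob g_closed dest: subsetD[OF g_sl2])
  show ?thesis
  proof (intro module_category.intro module_category_axioms.intro, unfold sl2_mod_sel N(5-8) N.Cmp_C)
    show "monoidal_category (sl2_mod :: ('u lmod, 'u arrow) moncat)" by (rule monoidal)
    show "bilinear_bifunctor (sl2_mod :: ('u lmod, 'u arrow) moncat) N N tensor tensor_arrow" by (rule N.bifunctor)
  qed (simp_all only: N.assoc_iso N.lunit_iso N.assoc_natural[simplified sl2_mod_sel] N.lunit_natural N.pentagon_M N.triangle_M N.Id_C)
qed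

section \<open>String bases of Borel modules and their lowering operators\<close>

section \<open>Modules over the Borel subalgebra\<close>

abbreviation strings :: "'j set \<Rightarrow> ('j \<Rightarrow> nat) \<Rightarrow> ('j \<times> nat) set"
  where "strings J n \<equiv> (SIGMA j:J. {..n j})"

text \<open>A basis adapted to a sum of strings: \<open>j\<close> names a string of type Q(l, n j),
  and \<open>k\<close> is the height in it, counted from the lowest weight. The operator e has
  coefficients 1, as on the vectors of N(l - n j).\<close>

definition qbasis :: "complex \<Rightarrow> 'v lmod \<Rightarrow> ('j \<times> nat \<Rightarrow> 'v) \<Rightarrow> 'j set \<Rightarrow> ('j \<Rightarrow> nat) \<Rightarrow> bool"
  where "qbasis l M b J n \<longleftrightarrow> fbasis M b (strings J n) \<and>
    (\<forall>j\<in>J. \<forall>k\<le>n j. act M mat_h (b (j, k)) = (l - of_nat (n j) + 2 * of_nat k) \<odot>\<^bsub>M\<^esub> b (j, k) \<and>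
      act M mat_e (b (j, k)) = (if k < n j then b (j, Suc k) else \<zero>\<^bsub>M\<^esub>))"

text \<open>After twisting by the character \<open>- l\<close>, the operator \<open>F\<close> completes the action of \<open>borel\<close> to one of \<open>sl2\<close>.\<close>

definition sl2ext :: "complex \<Rightarrow> 'v lmod \<Rightarrow> ('v \<Rightarrow> 'v) \<Rightarrow> bool"
  where "sl2ext l M F \<longleftrightarrow> lin M M F \<and> (\<forall>v\<in>carrier M.
    act M mat_h (F v) = F (act M mat_h v) \<ominus>\<^bsub>M\<^esub> 2 \<odot>\<^bsub>M\<^esub> F v \<and>
    act M mat_e (F v) = F (act M mat_e v) \<oplus>\<^bsub>M\<^esub> (act M mat_h v \<ominus>\<^bsub>M\<^esub> l \<odot>\<^bsub>M\<^esub> v))"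

lemma he_borel [simp]: "mat_h \<in> borel" "mat_e \<in> borel"
  by (simp_all add: borel_iff)

lemma borel_decomp:
  assumes "x \<in> borel"
  shows "x = x $$ (0, 0) \<cdot>\<^sub>m mat_h + x $$ (0, 1) \<cdot>\<^sub>m mat_e"
  by (rule mat2_eqI) (use assms in \<open>auto simp: borel_iff\<close>)

lemma he_bracket: "mat_h * mat_e - mat_e * mat_h = 2 \<cdot>\<^sub>m mat_e"
  by (rule mat2_eqI) (auto simp: mat2_mult minus_carrier_mat simp del: index_mult_mat(1))

lemma borel_act:
  assumes M: "lie_module borel M" and x: "x \<in> borel" and v: "v \<in> carrier M"
  shows "act M x v = x $$ (0, 0) \<odot>\<^bsub>M\<^esub> act M mat_h v \<oplus>\<^bsub>M\<^esub> x $$ (0, 1) \<odot>\<^bsub>M\<^esub> act M mat_e v"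
proof -
  have cl: "c \<cdot>\<^sub>m y \<in> borel" if "y \<in> borel" for c y
    using lie_closed_borel that by (auto simp: lie_closed_def)
  have "act M x v = act M (x $$ (0, 0) \<cdot>\<^sub>m mat_h + x $$ (0, 1) \<cdot>\<^sub>m mat_e) v"
    using borel_decomp[OF x] by simp
  also have "\<dots> = x $$ (0, 0) \<odot>\<^bsub>M\<^esub> act M mat_h v \<oplus>\<^bsub>M\<^esub> x $$ (0, 1) \<odot>\<^bsub>M\<^esub> act M mat_e v"
    by (simp only: lie_moduleD(3)[OF M cl cl v] lie_moduleD(4)[OF M _ v] he_borel)
  finally show ?thesis .
qed

lemma he_act:
  assumes M: "lie_module borel M" "fd M" and v: "v \<in> carrier M"
  shows "act M mat_h (act M mat_e v) = act M mat_e (act M mat_h v) \<oplus>\<^bsub>M\<^esub> 2 \<odot>\<^bsub>M\<^esub> act M mat_e v"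
proof -
  note D = lie_moduleD[OF M(1)] and S = cvs_simps[OF fd_cvs[OF M(2)]]
  have m: "act M x w \<in> carrier M" if "x \<in> {mat_h, mat_e}" "w \<in> carrier M" for x w
    using that D(6) by auto
  have "2 \<odot>\<^bsub>M\<^esub> act M mat_e v = act M mat_h (act M mat_e v) \<ominus>\<^bsub>M\<^esub> act M mat_e (act M mat_h v)"
    using D(4)[of mat_e v 2] D(5)[of mat_h mat_e v] v by (simp add: he_bracket)
  thus ?thesis
    by (intro sep_fd[OF M(2)]) (simp_all add: S m v)
qed

lemma lie_hom_borelI:
  assumes M: "lie_module borel M" and N: "lie_module borel N" and f: "lin M N f"
    and h: "\<And>v. v \<in> carrier M \<Longrightarrow> f (act M mat_h v) = act N mat_h (f v)"
    and e: "\<And>v. v \<in> carrier M \<Longrightarrow> f (act M mat_e v) = act N mat_e (f v)"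
  shows "restrict f (carrier M) \<in> lie_hom borel M N"
proof (rule lie_hom_restrictI[OF M f])
  fix x v assume x: "x \<in> borel" and v: "v \<in> carrier M"
  have m: "act M y v \<in> carrier M" if "y \<in> borel" for y using lie_moduleD(6)[OF M that v] .
  show "f (act M x v) = act N x (f v)"
    unfolding borel_act[OF M x v] borel_act[OF N x linD(1)[OF f v]]
    using m cvs_simps(3)[OF lie_moduleD(1)[OF M]] by (simp add: linD(2,3)[OF f] h e v)
qed

text \<open>Such a module amounts to two operators with [h, e] = 2 e: since x acts as a combination
  of h and e, the remaining axioms follow by expanding both sides.\<close>

lemma lie_module_borelI:
  fixes M :: "'v lmod"
  assumes M: "fd M" and h: "lin M M (act M mat_h)" and e: "lin M M (act M mat_e)"
    and he: "\<And>v. v \<in> carrier M \<Longrightarrow> act M mat_h (act M mat_e v) = act M mat_e (act M mat_h v) \<oplus>\<^bsub>M\<^esub> 2 \<odot>\<^bsub>M\<^esub> act M mat_e v"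
    and x: "\<And>x v. \<lbrakk>x \<in> borel; v \<in> carrier M\<rbrakk> \<Longrightarrow>
      act M x v = x $$ (0, 0) \<odot>\<^bsub>M\<^esub> act M mat_h v \<oplus>\<^bsub>M\<^esub> x $$ (0, 1) \<odot>\<^bsub>M\<^esub> act M mat_e v"
  shows "lie_module borel M"
proof -
  note c = fd_cvs[OF M]
  note S = cvs_simps[OF c] and H = linD[OF h] and E = linD[OF e]
  show ?thesis
  proof (rule lie_moduleI[OF c])
    show "lin M M (act M y)" if "y \<in> borel" for y
      by (rule lin_cong[OF c lin_add[OF c lin_smult[OF c h] lin_smult[OF c e]] x[OF that]])
    fix y z v assume yz: "y \<in> borel" "z \<in> borel" and v: "v \<in> carrier M"
    note cl = lie_closed_borel[unfolded lie_closed_def]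
    have yz': "y + z \<in> borel" "y * z - z * y \<in> borel" using cl yz by auto
    have d: "y \<in> carrier_mat 2 2" "z \<in> carrier_mat 2 2" "y $$ (1, 0) = 0" "z $$ (1, 0) = 0"
      "y $$ (1, 1) = - y $$ (0, 0)" "z $$ (1, 1) = - z $$ (0, 0)"
      using yz by (auto simp: borel_iff)
    have ent: "(y + z) $$ (0, 0) = y $$ (0, 0) + z $$ (0, 0)" "(y + z) $$ (0, 1) = y $$ (0, 1) + z $$ (0, 1)"
      "(y * z - z * y) $$ (0, 0) = 0"
      "(y * z - z * y) $$ (0, 1) = 2 * (y $$ (0, 0) * z $$ (0, 1) - z $$ (0, 0) * y $$ (0, 1))"
      using d by (auto simp: mat2_mult simp del: index_mult_mat(1))
    have m: "act M mat_h v \<in> carrier M" "act M mat_e v \<in> carrier M" "act M mat_h (act M mat_h v) \<in> carrier M"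
      "act M mat_e (act M mat_h v) \<in> carrier M" "act M mat_e (act M mat_e v) \<in> carrier M"
      using H(1) E(1) v by auto
    show "act M (y + z) v = act M y v \<oplus>\<^bsub>M\<^esub> act M z v"
      unfolding x[OF yz'(1) v] x[OF yz(1) v] x[OF yz(2) v]
      by (rule sep_fd[OF M]) (simp_all add: S m ent del: One_nat_def, (simp add: algebra_simps del: One_nat_def)?)
    have yv: "act M y v \<in> carrier M" "act M z v \<in> carrier M"
      unfolding x[OF yz(1) v] x[OF yz(2) v] by (simp_all add: S m)
    have e2: "act M a (act M b v) = (a $$ (0, 0) * b $$ (0, 0)) \<odot>\<^bsub>M\<^esub> act M mat_h (act M mat_h v)
        \<oplus>\<^bsub>M\<^esub> ((a $$ (0, 0) * b $$ (0, 1)) \<odot>\<^bsub>M\<^esub> (act M mat_e (act M mat_h v) \<oplus>\<^bsub>M\<^esub> 2 \<odot>\<^bsub>M\<^esub> act M mat_e v)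
        \<oplus>\<^bsub>M\<^esub> ((a $$ (0, 1) * b $$ (0, 0)) \<odot>\<^bsub>M\<^esub> act M mat_e (act M mat_h v)
        \<oplus>\<^bsub>M\<^esub> (a $$ (0, 1) * b $$ (0, 1)) \<odot>\<^bsub>M\<^esub> act M mat_e (act M mat_e v)))"
      if ab: "a \<in> borel" "b \<in> borel" for a b
    proof -
      have bv: "act M b v \<in> carrier M" unfolding x[OF ab(2) v] by (simp add: S m)
      show ?thesis
        unfolding x[OF ab(1) bv] unfolding x[OF ab(2) v]
        by (rule sep_fd[OF M]) (simp_all add: S m H E he[OF v] del: One_nat_def, (simp add: algebra_simps del: One_nat_def)?)
    qed
    show "act M (y * z - z * y) v = act M y (act M z v) \<ominus>\<^bsub>M\<^esub> act M z (act M y v)"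
      unfolding x[OF yz'(2) v] e2[OF yz] e2[OF yz(2,1)]
      by (rule sep_fd[OF M]) (simp_all add: S m ent del: One_nat_def, (simp add: algebra_simps del: One_nat_def)?)
  next
    fix y c' v assume y: "y \<in> borel" and v: "v \<in> carrier M"
    have cy: "c' \<cdot>\<^sub>m y \<in> borel" using lie_closed_borel y by (auto simp: lie_closed_def)
    have m: "act M mat_h v \<in> carrier M" "act M mat_e v \<in> carrier M" using H(1) E(1) v by auto
    have "(c' \<cdot>\<^sub>m y) $$ (0, 0) = c' * y $$ (0, 0)" "(c' \<cdot>\<^sub>m y) $$ (0, 1) = c' * y $$ (0, 1)"
      using y by (auto simp: borel_iff)
    thus "act M (c' \<cdot>\<^sub>m y) v = c' \<odot>\<^bsub>M\<^esub> act M y v"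
      unfolding x[OF cy v] x[OF y v] by (intro sep_fd[OF M]) (simp_all add: S m, (simp add: algebra_simps)?)
  qed
qed

lemma qbasisD:
  assumes "qbasis l M b J n"
  shows "fbasis M b (strings J n)" "\<lbrakk>j \<in> J; k \<le> n j\<rbrakk> \<Longrightarrow> b (j, k) \<in> carrier M"
    "\<lbrakk>j \<in> J; k \<le> n j\<rbrakk> \<Longrightarrow> act M mat_h (b (j, k)) = (l - of_nat (n j) + 2 * of_nat k) \<odot>\<^bsub>M\<^esub> b (j, k)"
    "\<lbrakk>j \<in> J; k \<le> n j\<rbrakk> \<Longrightarrow> act M mat_e (b (j, k)) = (if k < n j then b (j, Suc k) else \<zero>\<^bsub>M\<^esub>)"
    "fd M" "finite J"
proof -
  show fb: "fbasis M b (strings J n)" using assms by (simp add: qbasis_def)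
  show "fd M" by (rule fbasis_imp_fd[OF fb])
  have "finite (fst ` strings J n)" using fbasisD(2)[OF fb] by simp
  moreover have "fst ` strings J n = J" by force
  ultimately show "finite J" by simp
qed (use assms fbasisD(4)[of M b "strings J n"] in \<open>auto simp: qbasis_def\<close>)

lemma sl2extD:
  assumes "sl2ext l M F"
  shows "lin M M F" "v \<in> carrier M \<Longrightarrow> F v \<in> carrier M"
    "v \<in> carrier M \<Longrightarrow> act M mat_h (F v) = F (act M mat_h v) \<ominus>\<^bsub>M\<^esub> 2 \<odot>\<^bsub>M\<^esub> F v"
    "v \<in> carrier M \<Longrightarrow> act M mat_e (F v) = F (act M mat_e v) \<oplus>\<^bsub>M\<^esub> (act M mat_h v \<ominus>\<^bsub>M\<^esub> l \<odot>\<^bsub>M\<^esub> v)"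
  using assms linD(1)[of F M M] by (auto simp: sl2ext_def)

text \<open>The operator h - l completes e and \<open>F\<close> to an sl2-triple. In coordinates
  this triple acts on a subspace of a function type, where complete reducibility applies; the
  resulting strings are carried back.\<close>

theorem sl2ext_imp_qbasis:
  fixes M :: "'v lmod"
  assumes M: "lie_module borel M" "fd M" and F: "sl2ext l M F"
  shows "\<exists>(b :: nat \<times> nat \<Rightarrow> 'v) N n. qbasis l M b {..<N} n"
proof -
  obtain p and d :: nat where p: "fbasis M p {..<d}" using M(2) by (rule fdE)
  note P = fbasisD[OF p] and C = crd[OF p] and D = lie_moduleD[OF M(1)] and FD = sl2extD[OF F]
  note S = cvs_simps[OF P(1)]
  define \<phi> where "\<phi> = comb M p {..<d}"
  define \<rho> where "\<rho> = crd M p {..<d}"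
  define W where "W = carrier (fs {..<d})"
  have \<phi>: "lin (fs {..<d}) M \<phi>" and \<rho>: "lin M (fs {..<d}) \<rho>" unfolding \<phi>_def \<rho>_def by (fact P(6), fact C(1))
  have \<phi>\<rho>: "\<phi> (\<rho> v) = v" if "v \<in> carrier M" for v unfolding \<phi>_def \<rho>_def by (rule C(3)[OF that])
  have \<rho>\<phi>: "\<rho> (\<phi> c) = c" if "c \<in> W" for c unfolding \<phi>_def \<rho>_def by (rule C(4)) (use that W_def in simp)
  have \<phi>_in: "\<phi> c \<in> carrier M" if "c \<in> W" for c using linD(1)[OF \<phi>] that by (simp add: W_def)
  have \<rho>_in: "\<rho> v \<in> W" if "v \<in> carrier M" for v using linD(1)[OF \<rho> that] by (simp add: W_def)
  \<comment> \<open>Linearity is asked on the whole function type, so each operator first discards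
    the coordinates from \<open>d\<close> on.\<close>
  define pr where "pr = (\<lambda>(c :: nat \<Rightarrow> complex) i. if i < d then c i else 0)"
  have pr: "pr c \<in> W" "c \<in> W \<Longrightarrow> pr c = c" "pr (x + y) = pr x \<oplus>\<^bsub>fs {..<d}\<^esub> pr y"
    "pr (\<lambda>i. a * x i) = a \<odot>\<^bsub>fs {..<d}\<^esub> pr x" for c x y a
    by (auto simp: pr_def W_def fun_eq_iff)
  define lift where "lift = (\<lambda>G c. \<rho> (G (\<phi> (pr c))))"
  have lift_lop: "fv.lop (lift G)" if "lin M M G" for G
    unfolding fv.lop_def
  proof (intro conjI allI)
    have l: "lin (fs {..<d}) (fs {..<d}) (\<lambda>c. \<rho> (G (\<phi> c)))"
      by (rule lin_compose[OF lin_compose[OF \<phi> that] \<rho>])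
    show "lift G (x + y) = lift G x + lift G y" for x y
      unfolding lift_def pr(3) using linD(2)[OF l, of "pr x" "pr y"] pr(1) by (simp add: W_def plus_fun_def)
    show "lift G (\<lambda>i. c * x i) = (\<lambda>i. c * lift G x i)" for c x
      unfolding lift_def pr(4) using linD(3)[OF l, of "pr x" c] pr(1) by (simp add: W_def)
  qed
  have lift_in: "lift G c \<in> W" if "lin M M G" "c \<in> W" for G c
    unfolding lift_def using that by (intro \<rho>_in linD(1)[OF that(1)] \<phi>_in pr)
  have \<phi>_lift: "\<phi> (lift G c) = G (\<phi> c)" if "lin M M G" "c \<in> W" for G c
    unfolding lift_def using that by (simp add: \<phi>\<rho> linD(1)[OF that(1)] \<phi>_in pr(2))
  have \<phi>_eqI: "c = c'" if "c \<in> W" "c' \<in> W" "\<phi> c = \<phi> c'" for c c' using \<rho>\<phi> that by metis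
  define H0 where "H0 = (\<lambda>v. act M mat_h v \<ominus>\<^bsub>M\<^esub> l \<odot>\<^bsub>M\<^esub> v)"
  have H0: "lin M M H0" unfolding H0_def by (rule lin_diff[OF P(1) D(2) lin_smult[OF P(1) lin_id]]) simp
  have E0: "lin M M (act M mat_e)" and hh: "lin M M (act M mat_h)" by (simp_all add: D(2))
  define H E F' where "H = lift H0" and "E = lift (act M mat_e)" and "F' = lift F"
  have ops: "sl2_ops (\<lambda>(a :: complex) (c :: nat \<Rightarrow> complex) i. a * c i) H E F' W"
  proof
    show "fv.lop H" "fv.lop E" "fv.lop F'" unfolding H_def E_def F'_def using lift_lop H0 E0 FD(1) by auto
    show "fv.subspace W" by (rule fv.subspaceI) (auto simp: W_def)
    fix w assume w: "w \<in> W"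
    show in1: "H w \<in> W" "E w \<in> W" "F' w \<in> W" unfolding H_def E_def F'_def using lift_in H0 E0 FD(1) w by auto
    have in2: "H (E w) \<in> W" "E (H w) \<in> W" "H (F' w) \<in> W" "F' (H w) \<in> W" "E (F' w) \<in> W" "F' (E w) \<in> W"
      unfolding H_def E_def F'_def using lift_in H0 E0 FD(1) w by auto
    have tr: "\<phi> (H c) = H0 (\<phi> c)" "\<phi> (E c) = act M mat_e (\<phi> c)" "\<phi> (F' c) = F (\<phi> c)" if "c \<in> W" for c
      unfolding H_def E_def F'_def using \<phi>_lift H0 E0 FD(1) that by auto
    have lin_\<phi>: "\<phi> (x + y) = \<phi> x \<oplus>\<^bsub>M\<^esub> \<phi> y" "\<phi> (x - y) = \<phi> x \<ominus>\<^bsub>M\<^esub> \<phi> y" "\<phi> (\<lambda>i. c * x i) = c \<odot>\<^bsub>M\<^esub> \<phi> x"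
      if "x \<in> W" "y \<in> W" for x y c
      using linD(2,3)[OF \<phi>] that lin_minus[OF fs_cvs P(1) \<phi>, of x y] cvs_distribs(3)[OF fs_cvs, of x "{..<d}" y]
      by (simp_all add: W_def plus_fun_def fun_diff_def)
    let ?v = "\<phi> w"
    have v: "?v \<in> carrier M" by (rule \<phi>_in[OF w])
    have m: "act M mat_h v \<in> carrier M" "act M mat_e v \<in> carrier M" "F v \<in> carrier M" if "v \<in> carrier M" for v
      using that D(6) FD(2) by auto
    have W2: "(\<lambda>i. 2 * x i) \<in> W" "x + y \<in> W" "x - y \<in> W" if "x \<in> W" "y \<in> W" for x y using that by (auto simp: W_def)
    show "H (E w) = E (H w) + (\<lambda>i. 2 * E w i)"
    proof (rule \<phi>_eqI)
      show "\<phi> (H (E w)) = \<phi> (E (H w) + (\<lambda>i. 2 * E w i))"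
        unfolding lin_\<phi>(1)[OF in2(2) W2(1)[OF in1(2,2)]] lin_\<phi>(3)[OF in1(2,2)] tr(1)[OF in1(2)] tr(2)[OF in1(1)] tr[OF w] H0_def
        by (rule sep_fd[OF M(2)]) (simp_all add: S m v he_act[OF M v] linD(3)[OF E0] lin_minus[OF P(1) P(1) E0], (simp add: algebra_simps)?)
    qed (use in1 in2 W2 in auto)
    show "H (F' w) = F' (H w) - (\<lambda>i. 2 * F' w i)"
    proof (rule \<phi>_eqI)
      show "\<phi> (H (F' w)) = \<phi> (F' (H w) - (\<lambda>i. 2 * F' w i))"
        unfolding lin_\<phi>(2)[OF in2(4) W2(1)[OF in1(3,3)]] lin_\<phi>(3)[OF in1(3,3)] tr(1)[OF in1(3)] tr(3)[OF in1(1)] tr[OF w] H0_def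
        by (rule sep_fd[OF M(2)]) (simp_all add: S m v FD(3)[OF v] linD(3)[OF FD(1)] lin_minus[OF P(1) P(1) FD(1)], (simp add: algebra_simps)?)
    qed (use in1 in2 W2 in auto)
    show "E (F' w) = F' (E w) + H w"
    proof (rule \<phi>_eqI)
      show "\<phi> (E (F' w)) = \<phi> (F' (E w) + H w)"
        unfolding lin_\<phi>(1)[OF in2(6) in1(1)] tr(2)[OF in1(3)] tr(3)[OF in1(2)] tr[OF w] H0_def by (rule FD(4)[OF v])
    qed (use in1 in2 W2 in auto)
  qed
  interpret sl2_ops "\<lambda>(a :: complex) (c :: nat \<Rightarrow> complex) i. a * c i" H E F' W by (rule ops)
  have "W \<subseteq> fv.span (unit ` {..<d})" unfolding W_def by (rule fs_subset_span) simp
  from fv.string_basis[OF ops finite_imageI[OF finite_lessThan] this] obtain N :: nat and n and x :: "nat \<Rightarrow> nat \<Rightarrow> complex" where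
    x: "\<forall>j<N. x j \<in> W \<and> H (x j) = (\<lambda>i. - of_nat (n j) * x j i) \<and> (E ^^ Suc (n j)) (x j) = 0"
    and span: "\<forall>w\<in>W. \<exists>c. w = (\<Sum>j<N. \<Sum>k\<le>n j. (\<lambda>i. c (j, k) * (E ^^ k) (x j) i))"
    and indep: "\<forall>c. (\<Sum>j<N. \<Sum>k\<le>n j. (\<lambda>i. c (j, k) * (E ^^ k) (x j) i)) = 0 \<longrightarrow> (\<forall>j<N. \<forall>k\<le>n j. c (j, k) = 0)"
    by (elim exE conjE) (rule that, assumption+)
  define b' where "b' = (\<lambda>(j, k). (E ^^ k) (x j))"
  define b where "b = (\<lambda>jk. \<phi> (b' jk))"
  let ?S = "strings {..<N} n"
  have b'_in: "b' jk \<in> W" if "jk \<in> ?S" for jk using that x pow_in(1) by (auto simp: b'_def)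
  have b'_fs: "b' \<in> ?S \<rightarrow> carrier (fs {..<d})" using b'_in by (auto simp: W_def simp del: fs_sel)
  have finS: "finite ?S" by simp
  have comb: "comb M b ?S c = \<phi> (\<Sum>j<N. \<Sum>k\<le>n j. (\<lambda>i. c (j, k) * (E ^^ k) (x j) i))" for c
  proof -
    have "comb (fs {..<d}) b' ?S c = (\<Sum>jk\<in>?S. (\<lambda>i. c jk * b' jk i))" by (rule comb_fs[OF finS b'_fs])
    also have "\<dots> = (\<Sum>j<N. \<Sum>k\<le>n j. (\<lambda>i. c (j, k) * (E ^^ k) (x j) i))"
      by (subst sum.Sigma) (auto simp: b'_def intro!: sum.cong)
    finally show ?thesis
      using lin_comb[OF fs_cvs P(1) \<phi> b'_fs, of c] unfolding b_def by simp
  qed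
  have sum_in: "(\<Sum>j<N. \<Sum>k\<le>n j. (\<lambda>i. c (j, k) * (E ^^ k) (x j) i)) \<in> W" for c
    using x pow_in(1) W by (intro fv.subspace_sum fv.subspace_scale) auto
  have fb: "fbasis M b ?S"
  proof (rule fbasisI[OF P(1) finS])
    show "b \<in> ?S \<rightarrow> carrier M" using b'_in \<phi>_in by (auto simp: b_def)
    fix c jk assume "comb M b ?S c = \<zero>\<^bsub>M\<^esub>" "jk \<in> ?S"
    hence "\<phi> (\<Sum>j<N. \<Sum>k\<le>n j. (\<lambda>i. c (j, k) * (E ^^ k) (x j) i)) = \<phi> 0"
      using lin_zero[OF fs_cvs P(1) \<phi>] by (simp add: comb zero_fun_def)
    hence "(\<Sum>j<N. \<Sum>k\<le>n j. (\<lambda>i. c (j, k) * (E ^^ k) (x j) i)) = 0"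
      by (rule \<phi>_eqI[OF sum_in W_ops(4)])
    from mp[OF spec[OF indep] this] show "c jk = 0" using \<open>jk \<in> ?S\<close> by (cases jk) simp
  next
    fix v assume v: "v \<in> carrier M"
    from bspec[OF span \<rho>_in[OF v]] obtain c where "\<rho> v = (\<Sum>j<N. \<Sum>k\<le>n j. (\<lambda>i. c (j, k) * (E ^^ k) (x j) i))" by blast
    hence "v = comb M b ?S c" using \<phi>\<rho>[OF v] by (simp add: comb)
    thus "\<exists>c. v = comb M b ?S c" by blast
  qed
  have "qbasis l M b {..<N} n"
    unfolding qbasis_def
  proof (intro conjI fb ballI allI impI)
    fix j k assume j: "j \<in> {..<N}" and k: "k \<le> n j"
    let ?w = "(E ^^ k) (x j)"
    have xj: "x j \<in> W" "H (x j) = (\<lambda>i. - of_nat (n j) * x j i)" "(E ^^ Suc (n j)) (x j) = 0" using x j by auto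
    have w: "?w \<in> W" by (rule pow_in(1)[OF xj(1)])
    have bw: "b (j, k) = \<phi> ?w" by (simp add: b_def b'_def)
    have "H ?w = (\<lambda>i. - of_nat (n j) * ?w i) + (\<lambda>i. 2 * of_nat k * ?w i)"
      unfolding H_pow_E[OF xj(1)] xj(2) fv.lopD(2)[OF fv.lop_pow[OF E]] ..
    also have "\<dots> = (\<lambda>i. (- of_nat (n j) + 2 * of_nat k) * ?w i)"
      by (rule ext) (simp only: plus_fun_apply distrib_right)
    finally have "H ?w = (\<lambda>i. (- of_nat (n j) + 2 * of_nat k) * ?w i)" .
    hence "H0 (\<phi> ?w) = (- of_nat (n j) + 2 * of_nat k) \<odot>\<^bsub>M\<^esub> \<phi> ?w"
      using \<phi>_lift[OF H0 w] linD(3)[OF \<phi>, of ?w] w by (simp add: H_def W_def)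
    \<comment> \<open>Undoing the shift: the weight - n j + 2 k for the triple becomes l - n j + 2 k
      for h.\<close>
    hence eq: "act M mat_h (\<phi> ?w) \<ominus>\<^bsub>M\<^esub> l \<odot>\<^bsub>M\<^esub> \<phi> ?w = (- of_nat (n j) + 2 * of_nat k) \<odot>\<^bsub>M\<^esub> \<phi> ?w" by (simp add: H0_def)
    have v: "\<phi> ?w \<in> carrier M" "act M mat_h (\<phi> ?w) \<in> carrier M" using \<phi>_in[OF w] D(6) by auto
    show "act M mat_h (b (j, k)) = (l - of_nat (n j) + 2 * of_nat k) \<odot>\<^bsub>M\<^esub> b (j, k)"
      unfolding bw
    proof (rule sep_fd[OF M(2)])
      fix \<chi> :: "'v \<Rightarrow> complex"
      assume "\<And>x y. \<lbrakk>x \<in> carrier M; y \<in> carrier M\<rbrakk> \<Longrightarrow> \<chi> (x \<ominus>\<^bsub>M\<^esub> y) = \<chi> x - \<chi> y"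
        and s: "\<And>c x. x \<in> carrier M \<Longrightarrow> \<chi> (c \<odot>\<^bsub>M\<^esub> x) = c * \<chi> x"
      from this(1)[of "act M mat_h (\<phi> ?w)" "l \<odot>\<^bsub>M\<^esub> \<phi> ?w"]
      show "\<chi> (act M mat_h (\<phi> ?w)) = \<chi> ((l - of_nat (n j) + 2 * of_nat k) \<odot>\<^bsub>M\<^esub> \<phi> ?w)"
        unfolding eq using v S(3) by (simp add: s algebra_simps)
    qed (use v S(3) in auto)
    have "act M mat_e (\<phi> ?w) = \<phi> ((E ^^ Suc k) (x j))" using \<phi>_lift[OF E0 w] by (simp add: E_def)
    moreover have "\<phi> 0 = \<zero>\<^bsub>M\<^esub>" using lin_zero[OF fs_cvs P(1) \<phi>] by (simp add: zero_fun_def)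
    ultimately show "act M mat_e (b (j, k)) = (if k < n j then b (j, Suc k) else \<zero>\<^bsub>M\<^esub>)"
      using k xj(3) by (cases "k = n j") (auto simp: bw b_def b'_def)
  qed
  thus ?thesis by blast
qed

theorem qbasis_imp_sl2ext:
  assumes M: "lie_module borel M" and q: "qbasis l M b J n"
  shows "\<exists>F. sl2ext l M F"
proof -
  note Q = qbasisD[OF q] and D = lie_moduleD[OF M]
  note c = D(1)
  note S = cvs_simps[OF c]
  \<comment> \<open>The coefficient k (n - k + 1) belongs to the sl2-module normalised so that e
    moves each basis vector to the next: k (n - k + 1) - (k + 1)(n - k) = 2 k - n is then the
    eigenvalue of h - l at height k.\<close>
  have "(\<lambda>(j, k). if k = 0 then \<zero>\<^bsub>M\<^esub> else (of_nat k * (of_nat (n j) - of_nat k + 1)) \<odot>\<^bsub>M\<^esub> b (j, k - 1))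
      \<in> strings J n \<rightarrow> carrier M"
    using Q(2) S by auto
  then obtain F where F: "lin M M F" and Fb': "\<And>jk. jk \<in> strings J n \<Longrightarrow> F (b jk) =
      (\<lambda>(j, k). if k = 0 then \<zero>\<^bsub>M\<^esub> else (of_nat k * (of_nat (n j) - of_nat k + 1)) \<odot>\<^bsub>M\<^esub> b (j, k - 1)) jk"
    by (rule lin_extend[OF Q(1) c]) blast
  have Fb: "F (b (j, k)) = (if k = 0 then \<zero>\<^bsub>M\<^esub> else (of_nat k * (of_nat (n j) - of_nat k + 1)) \<odot>\<^bsub>M\<^esub> b (j, k - 1))"
    if "j \<in> J" "k \<le> n j" for j k
    using Fb'[of "(j, k)"] that by simp
  have hl: "lin M M (act M mat_h)" and el: "lin M M (act M mat_e)" by (simp_all add: D(2))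
  have z: "F \<zero>\<^bsub>M\<^esub> = \<zero>\<^bsub>M\<^esub>" "act M mat_h \<zero>\<^bsub>M\<^esub> = \<zero>\<^bsub>M\<^esub>" "act M mat_e \<zero>\<^bsub>M\<^esub> = \<zero>\<^bsub>M\<^esub>"
    using lin_zero[OF c c] F hl el by auto
  have "act M mat_h (F v) = F (act M mat_h v) \<ominus>\<^bsub>M\<^esub> 2 \<odot>\<^bsub>M\<^esub> F v" if "v \<in> carrier M" for v
  proof (rule lin_ext[OF Q(1) c lin_compose[OF F hl] lin_diff[OF c lin_compose[OF hl F] lin_smult[OF c F]] _ that])
    fix jk assume "jk \<in> strings J n"
    then obtain j k where jk: "jk = (j, k)" "j \<in> J" "k \<le> n j" by auto
    have m: "b (j, k) \<in> carrier M" "b (j, k - 1) \<in> carrier M" using Q(2) jk by auto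
    show "act M mat_h (F (b jk)) = F (act M mat_h (b jk)) \<ominus>\<^bsub>M\<^esub> 2 \<odot>\<^bsub>M\<^esub> F (b jk)"
    proof (cases k)
      case 0 thus ?thesis unfolding jk(1) using m jk
        by (simp add: Fb z Q(3) linD(3)[OF F] S cvs_distribs(7)[OF c])
    next
      case (Suc i)
      have m': "b (j, i) \<in> carrier M" "i \<le> n j" using Q(2) jk Suc by auto
      show ?thesis unfolding jk(1) using m jk m' Suc
        by (intro sep_fd[OF Q(5)]) (simp_all add: Fb z Q(3) linD(3)[OF F] linD(3)[OF hl] S, (simp add: algebra_simps)?)
    qed
  qed
  moreover have "act M mat_e (F v) = F (act M mat_e v) \<oplus>\<^bsub>M\<^esub> (act M mat_h v \<ominus>\<^bsub>M\<^esub> l \<odot>\<^bsub>M\<^esub> v)" if "v \<in> carrier M" for v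
  proof (rule lin_ext[OF Q(1) c lin_compose[OF F el]
        lin_add[OF c lin_compose[OF el F] lin_diff[OF c hl lin_smult[OF c lin_id]]] _ that])
    fix jk assume "jk \<in> strings J n"
    then obtain j k where jk: "jk = (j, k)" "j \<in> J" "k \<le> n j" by auto
    have m: "b (j, k) \<in> carrier M" using Q(2) jk by auto
    have 1: "act M mat_e (F (b (j, k))) = (of_nat k * (of_nat (n j) - of_nat k + 1)) \<odot>\<^bsub>M\<^esub> b (j, k)"
    proof (cases k)
      case 0 thus ?thesis using m jk by (simp add: Fb z S)
    next
      case (Suc i)
      have m': "b (j, i) \<in> carrier M" "i \<le> n j" using Q(2) jk Suc by auto
      show ?thesis using m jk m' Suc by (simp add: Fb linD(3)[OF el] Q(4))
    qed
    have 2: "F (act M mat_e (b (j, k))) = (of_nat (Suc k) * (of_nat (n j) - of_nat k)) \<odot>\<^bsub>M\<^esub> b (j, k)"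
      using m jk by (cases "k = n j") (simp_all add: Q(4) z S Fb)
    show "act M mat_e (F (b jk)) = F (act M mat_e (b jk)) \<oplus>\<^bsub>M\<^esub> (act M mat_h (b jk) \<ominus>\<^bsub>M\<^esub> l \<odot>\<^bsub>M\<^esub> b jk)"
      unfolding jk(1) 1 2 using m jk
      by (intro sep_fd[OF Q(5)]) (simp_all add: Q(3) S, (simp add: algebra_simps)?)
  qed
  ultimately show ?thesis using F by (auto simp: sl2ext_def)
qed

text \<open>Inside a string the powers of e only shift coordinates upwards, so a vector with a
  nonzero coordinate at a height with room for \<open>m\<close> more steps is not killed by the m-th
  power of e.\<close>

lemma crd_act:
  assumes M: "lie_module borel M" and q: "qbasis l M b J n" and v: "v \<in> carrier M" and jk: "j \<in> J" "k \<le> n j"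
  shows "crd M b (strings J n) (act M mat_h v) (j, k) = (l - of_nat (n j) + 2 * of_nat k) * crd M b (strings J n) v (j, k)"
    "k + m \<le> n j \<Longrightarrow> crd M b (strings J n) ((act M mat_e ^^ m) v) (j, k + m) = crd M b (strings J n) v (j, k)"
proof -
  let ?S = "strings J n"
  note Q = qbasisD[OF q] and D = lie_moduleD[OF M]
  note C = crd[OF Q(1)]
  have hl: "lin M M (act M mat_h)" and el: "lin M M (act M mat_e)" by (simp_all add: D(2))
  have z: "crd M b ?S \<zero>\<^bsub>M\<^esub> = (\<lambda>_. 0)" using lin_zero[OF D(1) fs_cvs C(1)] by simp
  have lf: "lin M (fs ?S) (\<lambda>v (j, k). if (j, k) \<in> ?S then (l - of_nat (n j) + 2 * of_nat k) * crd M b ?S v (j, k) else 0)"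
    by (rule linI) (auto simp: linD[OF C(1)] fun_eq_iff algebra_simps)
  have "crd M b ?S (act M mat_h v) = (\<lambda>(j, k). if (j, k) \<in> ?S then (l - of_nat (n j) + 2 * of_nat k) * crd M b ?S v (j, k) else 0)"
  proof (rule lin_ext[OF Q(1) fs_cvs lin_compose[OF hl C(1)] lf _ v])
    fix i assume i: "i \<in> ?S"
    thus "crd M b ?S (act M mat_h (b i)) = (\<lambda>(j, k). if (j, k) \<in> ?S then (l - of_nat (n j) + 2 * of_nat k) * crd M b ?S (b i) (j, k) else 0)"
      using Q(2) by (auto simp: Q(3) linD(3)[OF C(1)] C(5)[OF i] C(5) unit_def fun_eq_iff split: if_splits)
  qed
  thus "crd M b (strings J n) (act M mat_h v) (j, k) = (l - of_nat (n j) + 2 * of_nat k) * crd M b (strings J n) v (j, k)"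
    using jk by simp
  have le: "lin M (fs ?S) (\<lambda>v (j, k). if (j, k) \<in> ?S \<and> 0 < k then crd M b ?S v (j, k - 1) else 0)"
    by (rule linI) (auto simp: linD[OF C(1)] fun_eq_iff)
  have e: "crd M b ?S (act M mat_e v) = (\<lambda>(j, k). if (j, k) \<in> ?S \<and> 0 < k then crd M b ?S v (j, k - 1) else 0)"
    if v: "v \<in> carrier M" for v
  proof (rule lin_ext[OF Q(1) fs_cvs lin_compose[OF el C(1)] le _ v])
    fix i assume i: "i \<in> ?S"
    then obtain j k where jk: "i = (j, k)" "j \<in> J" "k \<le> n j" by auto
    have "crd M b ?S (act M mat_e (b (j, k))) = (if k < n j then unit (j, Suc k) else (\<lambda>_. 0))"
      using jk by (simp add: Q(4) C(5) z)
    also have "\<dots> = (\<lambda>(j', k'). if (j', k') \<in> ?S \<and> 0 < k' then unit (j, k) (j', k' - 1) else 0)"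
      using jk by (auto simp: unit_def fun_eq_iff)
    finally show "crd M b ?S (act M mat_e (b i)) = (\<lambda>(j, k). if (j, k) \<in> ?S \<and> 0 < k then crd M b ?S (b i) (j, k - 1) else 0)"
      using C(5)[OF i] unfolding jk(1) by (simp add: fun_eq_iff)
  qed
  have pow: "(act M mat_e ^^ m) v \<in> carrier M" for m by (induction m) (use v linD(1)[OF el] in auto)
  show "k + m \<le> n j \<Longrightarrow> crd M b ?S ((act M mat_e ^^ m) v) (j, k + m) = crd M b ?S v (j, k)"
    by (induction m) (use jk in \<open>simp_all add: e[OF pow]\<close>)
qed

lemma crd_zeroI:
  assumes q: "fbasis M b I" and v: "v \<in> carrier M" and "\<And>i. i \<in> I \<Longrightarrow> crd M b I v i = 0"
  shows "v = \<zero>\<^bsub>M\<^esub>"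
proof -
  have "crd M b I v \<in> carrier (fs I)" by (rule linD(1)[OF crd(1)[OF q] v])
  hence "crd M b I v = \<zero>\<^bsub>fs I\<^esub>" using assms(3) by (auto simp: fun_eq_iff)
  hence "comb M b I (crd M b I v) = \<zero>\<^bsub>M\<^esub>"
    using lin_zero[OF fs_cvs fbasisD(1)[OF q] fbasisD(6)[OF q]] by simp
  thus ?thesis using crd(3)[OF q v] by simp
qed

lemma string_pow:
  assumes q: "qbasis l M b J n" and j: "j \<in> J"
  shows "k \<le> n j \<Longrightarrow> (act M mat_e ^^ k) (b (j, 0)) = b (j, k)" "(act M mat_e ^^ Suc (n j)) (b (j, 0)) = \<zero>\<^bsub>M\<^esub>"
proof -
  show *: "k \<le> n j \<Longrightarrow> (act M mat_e ^^ k) (b (j, 0)) = b (j, k)" for k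
    by (induction k) (use qbasisD(4)[OF q j] in auto)
  show "(act M mat_e ^^ Suc (n j)) (b (j, 0)) = \<zero>\<^bsub>M\<^esub>"
    using *[of "n j"] qbasisD(4)[OF q j, of "n j"] by simp
qed

text \<open>A \<open>borel\<close>-homomorphism of weight \<open>- 2\<close> vanishes, because \<open>e\<close> is injective on
  the weight spaces below \<open>l\<close>.\<close>

lemma lowering_zero:
  assumes M: "lie_module borel M" and qM: "qbasis l M b J n" and N: "lie_module borel N" and qN: "qbasis l N b' J' n'"
    and G: "lin M N G"
    and Gh: "\<And>v. v \<in> carrier M \<Longrightarrow> act N mat_h (G v) = G (act M mat_h v) \<ominus>\<^bsub>N\<^esub> 2 \<odot>\<^bsub>N\<^esub> G v"
    and Ge: "\<And>v. v \<in> carrier M \<Longrightarrow> act N mat_e (G v) = G (act M mat_e v)"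
    and v: "v \<in> carrier M"
  shows "G v = \<zero>\<^bsub>N\<^esub>"
proof -
  note Q = qbasisD[OF qM] and Q' = qbasisD[OF qN] and D = lie_moduleD[OF M] and D' = lie_moduleD[OF N]
  note S' = cvs_simps[OF D'(1)]
  let ?c = "crd N b' (strings J' n')"
  note C = crd[OF Q'(1)]
  have el: "lin M M (act M mat_e)" "lin N N (act N mat_e)" by (simp_all add: D(2) D'(2))
  have powM: "(act M mat_e ^^ k) w \<in> carrier M" if "w \<in> carrier M" for k w
    by (induction k) (use that linD(1)[OF el(1)] in auto)
  have Gpow: "G ((act M mat_e ^^ k) w) = (act N mat_e ^^ k) (G w)" if "w \<in> carrier M" for k w
    by (induction k) (simp_all add: Ge[OF powM[OF that], symmetric])
  have low: "G (b (j, 0)) = \<zero>\<^bsub>N\<^esub>" if j: "j \<in> J" for j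
  proof (rule crd_zeroI[OF Q'(1)])
    have b: "b (j, 0) \<in> carrier M" using Q(2) j by auto
    show w: "G (b (j, 0)) \<in> carrier N" by (rule linD(1)[OF G b])
    fix i assume "i \<in> strings J' n'"
    then obtain j' k where i: "i = (j', k)" "j' \<in> J'" "k \<le> n' j'" by auto
    show "?c (G (b (j, 0))) i = 0"
    proof (rule ccontr)
      assume nz: "?c (G (b (j, 0))) i \<noteq> 0"
      have "act N mat_h (G (b (j, 0))) = (l - of_nat (n j)) \<odot>\<^bsub>N\<^esub> G (b (j, 0)) \<ominus>\<^bsub>N\<^esub> 2 \<odot>\<^bsub>N\<^esub> G (b (j, 0))"
        using Gh[OF b] Q(3)[OF j, of 0] linD(3)[OF G b] by simp
      also have "\<dots> = (l - of_nat (n j) - 2) \<odot>\<^bsub>N\<^esub> G (b (j, 0))"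
        by (rule sep_fd[OF Q'(5)]) (simp_all add: S' w, (simp add: algebra_simps)?)
      finally have "?c (act N mat_h (G (b (j, 0)))) i = (l - of_nat (n j) - 2) * ?c (G (b (j, 0))) i"
        using linD(3)[OF C(1) w] by simp
      \<comment> \<open>Comparing weights, a nonzero coordinate at height k forces n' = n + 2 + 2 k.
        The string then continues for n + 2 + k steps above that height, so the coordinate survives
        e^(n+1), although e^(n+1) kills the source vector.\<close>
      hence "l - of_nat (n' j') + 2 * of_nat k = l - of_nat (n j) - 2"
        using crd_act(1)[OF N qN w i(2,3)] nz i(1) by simp
      hence "of_nat (n' j') = (of_nat (n j + 2 + 2 * k) :: complex)" by (simp add: algebra_simps)
      hence n': "n' j' = n j + 2 + 2 * k" unfolding of_nat_eq_iff .
      have "(act N mat_e ^^ Suc (n j)) (G (b (j, 0))) = \<zero>\<^bsub>N\<^esub>"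
        using Gpow[OF b, of "Suc (n j)"] string_pow(2)[OF qM j] lin_zero[OF D(1) D'(1) G] by simp
      moreover have "?c ((act N mat_e ^^ Suc (n j)) (G (b (j, 0)))) (j', k + Suc (n j)) = ?c (G (b (j, 0))) (j', k)"
        by (rule crd_act(2)[OF N qN w i(2,3)]) (use n' in simp)
      ultimately show False using nz i(1) lin_zero[OF D'(1) fs_cvs C(1)] by simp
    qed
  qed
  have powz: "(act N mat_e ^^ k) \<zero>\<^bsub>N\<^esub> = \<zero>\<^bsub>N\<^esub>" for k
    by (induction k) (simp_all add: lin_zero[OF D'(1) D'(1) el(2)])
  show ?thesis
  proof (rule lin_ext[OF Q(1) D'(1) G lin_const_zero[OF D'(1)] _ v])
    fix i assume "i \<in> strings J n"
    then obtain j k where i: "i = (j, k)" "j \<in> J" "k \<le> n j" by auto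
    thus "G (b i) = \<zero>\<^bsub>N\<^esub>"
      using Gpow[of "b (j, 0)" k] Q(2)[of j 0] low[OF i(2)] powz string_pow(1)[OF qM i(2,3)] by simp
  qed
qed

text \<open>On both sides the commutator of e with the lowering operator is h - l, which
  \<open>f\<close> intertwines; it cancels in the difference of f F and F' f, which therefore
  commutes with e and lowers weights. For an identity map this says that the operator is
  unique.\<close>

theorem hom_commutes_F:
  assumes M: "lie_module borel M" and N: "lie_module borel N" and fM: "fd M" and fN: "fd N"
    and F: "sl2ext l M F" and F': "sl2ext l N F'" and f: "f \<in> lie_hom borel M N" and v: "v \<in> carrier M"
  shows "f (F v) = F' (f v)"
proof -
  obtain b m n where qM: "qbasis l M (b :: nat \<times> nat \<Rightarrow> _) {..<m} n" using sl2ext_imp_qbasis[OF M fM F] by blast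
  obtain b' m' n' where qN: "qbasis l N (b' :: nat \<times> nat \<Rightarrow> _) {..<m'} n'" using sl2ext_imp_qbasis[OF N fN F'] by blast
  note D = lie_moduleD[OF M] and D' = lie_moduleD[OF N] and FD = sl2extD[OF F] and FD' = sl2extD[OF F'] and fh = lie_homD[OF f]
  note S = cvs_simps[OF D(1)] and S' = cvs_simps[OF D'(1)]
  define G where "G = (\<lambda>v. f (F v) \<ominus>\<^bsub>N\<^esub> F' (f v))"
  have G: "lin M N G" unfolding G_def by (rule lin_diff[OF D'(1) lin_compose[OF FD(1) fh(1)] lin_compose[OF fh(1) FD'(1)]])
  have m: "act M mat_h w \<in> carrier M" "act M mat_e w \<in> carrier M" "F w \<in> carrier M" "f w \<in> carrier N" if "w \<in> carrier M" for w
    using that D(6) FD(2) fh(3) by auto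
  have m': "act N mat_h w \<in> carrier N" "act N mat_e w \<in> carrier N" "F' w \<in> carrier N" if "w \<in> carrier N" for w
    using that D'(6) FD'(2) by auto
  have hl: "lin N N (act N mat_h)" "lin N N (act N mat_e)" by (simp_all add: D'(2))
  note mi = lin_minus[OF D'(1) D'(1) hl(1)] lin_minus[OF D'(1) D'(1) hl(2)] lin_minus[OF D(1) D'(1) fh(1)] linD(2,3)[OF fh(1)]
  have fhe: "act N mat_h (f w) = f (act M mat_h w)" "act N mat_e (f w) = f (act M mat_e w)" if "w \<in> carrier M" for w
    using fh(4) that by simp_all
  have "G v = \<zero>\<^bsub>N\<^esub>"
  proof (rule lowering_zero[OF M qM N qN G _ _ v])
    fix w assume w: "w \<in> carrier M"
    show "act N mat_h (G w) = G (act M mat_h w) \<ominus>\<^bsub>N\<^esub> 2 \<odot>\<^bsub>N\<^esub> G w"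
      unfolding G_def
      by (rule sep_fd[OF fN]) (simp_all add: w S S' m m' mi fhe FD(3) FD'(3), (simp add: algebra_simps)?)
    show "act N mat_e (G w) = G (act M mat_e w)"
      unfolding G_def
      by (rule sep_fd[OF fN]) (simp_all add: w S S' m m' mi fhe FD(4) FD'(4), (simp add: algebra_simps)?)
  qed
  thus ?thesis using cvs_distribs(8)[OF D'(1)] m(3,4) m'(3) v by (simp add: G_def)
qed

section \<open>Homomorphisms between strings: Schur's lemma for the Borel modules\<close>

section \<open>Homomorphisms between string modules\<close>

text \<open>A string is presented by its basis vectors with the values of h and e, so vectors of the
  target obeying the same relations define a homomorphism.\<close>

lemma hom_of_strings:
  assumes M: "lie_module borel M" and q: "qbasis l M b J n" and N: "lie_module borel N"
    and c: "\<And>j k. \<lbrakk>j \<in> J; k \<le> n j\<rbrakk> \<Longrightarrow> c (j, k) \<in> carrier N"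
    and h: "\<And>j k. \<lbrakk>j \<in> J; k \<le> n j\<rbrakk> \<Longrightarrow> act N mat_h (c (j, k)) = (l - of_nat (n j) + 2 * of_nat k) \<odot>\<^bsub>N\<^esub> c (j, k)"
    and e: "\<And>j k. \<lbrakk>j \<in> J; k \<le> n j\<rbrakk> \<Longrightarrow> act N mat_e (c (j, k)) = (if k < n j then c (j, Suc k) else \<zero>\<^bsub>N\<^esub>)"
  obtains f where "f \<in> lie_hom borel M N" "\<And>i. i \<in> strings J n \<Longrightarrow> f (b i) = c i"
proof -
  note Q = qbasisD[OF q] and D = lie_moduleD[OF M] and D' = lie_moduleD[OF N]
  have "c \<in> strings J n \<rightarrow> carrier N" using c by auto
  then obtain f where f: "lin M N f" "f \<in> extensional (carrier M)" and fb: "\<And>i. i \<in> strings J n \<Longrightarrow> f (b i) = c i"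
    by (rule lin_extend[OF Q(1) D'(1)]) blast
  have fb': "f (b (j, k)) = c (j, k)" if "j \<in> J" "k \<le> n j" for j k using fb that by simp
  have "f (act M mat_h v) = act N mat_h (f v)" if "v \<in> carrier M" for v
  proof (rule lin_ext[OF Q(1) D'(1) lin_compose[OF D(2) f(1)] lin_compose[OF f(1) D'(2)] _ that])
    fix i assume "i \<in> strings J n"
    then obtain j k where i: "i = (j, k)" "j \<in> J" "k \<le> n j" by auto
    show "f (act M mat_h (b i)) = act N mat_h (f (b i))"
      unfolding i(1) Q(3)[OF i(2,3)] fb'[OF i(2,3)] h[OF i(2,3)] linD(3)[OF f(1) Q(2)[OF i(2,3)]] ..
  qed simp_all
  moreover have "f (act M mat_e v) = act N mat_e (f v)" if "v \<in> carrier M" for v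
  proof (rule lin_ext[OF Q(1) D'(1) lin_compose[OF D(2) f(1)] lin_compose[OF f(1) D'(2)] _ that])
    fix i assume "i \<in> strings J n"
    then obtain j k where i: "i = (j, k)" "j \<in> J" "k \<le> n j" by auto
    show "f (act M mat_e (b i)) = act N mat_e (f (b i))"
      unfolding i(1) Q(4)[OF i(2,3)] fb'[OF i(2,3)] e[OF i(2,3)]
      using i lin_zero[OF D(1) D'(1) f(1)] by (simp add: fb')
  qed simp_all
  ultimately have "restrict f (carrier M) \<in> lie_hom borel M N" by (intro lie_hom_borelI[OF M N f(1)])
  moreover have "restrict f (carrier M) = f" using f(2) by (rule extensional_restrict)
  ultimately show thesis using fb by (intro that) auto
qed

lemma qbasis_iso:
  assumes M: "lie_module borel M" and q: "qbasis l M b J n" and N: "lie_module borel N" and q': "qbasis l N b' J n"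
  obtains f where "f \<in> lie_hom borel M N" "bij_betw f (carrier M) (carrier N)" "\<And>i. i \<in> strings J n \<Longrightarrow> f (b i) = b' i"
proof -
  note Q = qbasisD[OF q] and Q' = qbasisD[OF q']
  obtain f where f: "f \<in> lie_hom borel M N" "\<And>i. i \<in> strings J n \<Longrightarrow> f (b i) = b' i"
    by (rule hom_of_strings[OF M q N, of b']) (use Q' in blast)+
  have bij: "bij_betw f (carrier M) (carrier N)"
    by (rule bij_of_bases[OF Q(1) lie_homD(1)[OF f(1)] fbasis_cong[OF Q'(1) f(2)]])
  show thesis by (rule that[OF f(1) bij f(2)])
qed

lemma qbasis_image:
  assumes q: "qbasis l M b J n" and M: "lie_module borel M" and N: "lie_module borel N"
    and f: "lin M N f" and bij: "bij_betw f (carrier M) (carrier N)"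
    and h: "\<And>v. v \<in> carrier M \<Longrightarrow> f (act M mat_h v) = act N mat_h (f v)"
    and e: "\<And>v. v \<in> carrier M \<Longrightarrow> f (act M mat_e v) = act N mat_e (f v)"
  shows "qbasis l N (\<lambda>i. f (b i)) J n"
  unfolding qbasis_def
proof (intro conjI ballI allI impI)
  note Q = qbasisD[OF q] and D = lie_moduleD[OF M] and D' = lie_moduleD[OF N]
  show "fbasis N (\<lambda>i. f (b i)) (strings J n)" by (rule fbasis_image[OF Q(1) D'(1) f bij])
  fix j k assume j: "j \<in> J" "k \<le> n j"
  show "act N mat_h (f (b (j, k))) = (l - of_nat (n j) + 2 * of_nat k) \<odot>\<^bsub>N\<^esub> f (b (j, k))"
    using h[OF Q(2)[OF j]] Q(3)[OF j] linD(3)[OF f Q(2)[OF j]] by simp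
  show "act N mat_e (f (b (j, k))) = (if k < n j then f (b (j, Suc k)) else \<zero>\<^bsub>N\<^esub>)"
    unfolding e[OF Q(2)[OF j], symmetric] Q(4)[OF j] using lin_zero[OF D(1) D'(1) f] by simp
qed

lemma qbasis_reindex:
  assumes q: "qbasis l M b J n" and h: "bij_betw h J' J"
  shows "qbasis l M (\<lambda>(j, k). b (h j, k)) J' (\<lambda>j. n (h j))"
proof -
  note Q = qbasisD[OF q]
  have hJ: "h j \<in> J" if "j \<in> J'" for j using h that by (auto simp: bij_betw_def)
  obtain h' where h': "\<And>j. j \<in> J' \<Longrightarrow> h' (h j) = j" "\<And>j. j \<in> J \<Longrightarrow> h (h' j) = j" "\<And>j. j \<in> J \<Longrightarrow> h' j \<in> J'"
    using h by (metis bij_betw_imp_inj_on bij_betw_imp_surj_on f_inv_into_f inv_into_f_f inv_into_into)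
  have "bij_betw (\<lambda>(j, k). (h j, k)) (strings J' (\<lambda>j. n (h j))) (strings J n)"
    by (rule bij_betw_byWitness[of _ "\<lambda>(j, k). (h' j, k)"]) (use hJ h' in auto)
  from fbasis_reindex[OF Q(1) this] have "fbasis M (\<lambda>(j, k). b (h j, k)) (strings J' (\<lambda>j. n (h j)))"
    by (rule fbasis_cong) auto
  thus ?thesis using Q(3,4) hJ by (auto simp: qbasis_def)
qed

text \<open>The image of the lowest vector has weight l - n and is killed by e^(n+1). A coordinate
  at height k > 0 would require the target parameter n + 2 k, where e^(n+1) cannot kill it. Hence
  only height 0 is possible, and only when the parameters agree.\<close>

lemma hom_single_string:
  assumes M: "lie_module borel M" and qM: "qbasis l M b {j} n" and N: "lie_module borel N" and qN: "qbasis l N b' {j'} n'"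
    and f: "f \<in> lie_hom borel M N"
  shows "\<exists>c. (n j \<noteq> n' j' \<longrightarrow> c = 0) \<and> (\<forall>k\<le>n j. f (b (j, k)) = (act N mat_e ^^ k) (c \<odot>\<^bsub>N\<^esub> b' (j', 0)))"
proof -
  note Q = qbasisD[OF qM] and Q' = qbasisD[OF qN] and D = lie_moduleD[OF M] and D' = lie_moduleD[OF N] and fh = lie_homD[OF f]
  note S' = cvs_simps[OF D'(1)]
  let ?S' = "strings {j'} n'"
  let ?c = "crd N b' ?S'"
  note C = crd[OF Q'(1)]
  have el: "lin M M (act M mat_e)" by (simp add: D(2))
  have powM: "(act M mat_e ^^ k) w \<in> carrier M" if "w \<in> carrier M" for k w
    by (induction k) (use that linD(1)[OF el] in auto)
  have fpow: "f ((act M mat_e ^^ k) w) = (act N mat_e ^^ k) (f w)" if "w \<in> carrier M" for k w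
    by (induction k) (simp_all add: fh(4)[OF _ powM[OF that]])
  have b: "b (j, 0) \<in> carrier M" using Q(2) by auto
  let ?w = "f (b (j, 0))"
  have w: "?w \<in> carrier N" by (rule fh(3)[OF b])
  have coeff: "?c ?w (j', k) = 0" if k: "k \<le> n' j'" "k > 0 \<or> n j \<noteq> n' j'" for k
  proof (rule ccontr)
    assume nz: "?c ?w (j', k) \<noteq> 0"
    have "act N mat_h ?w = (l - of_nat (n j)) \<odot>\<^bsub>N\<^esub> ?w"
      using fh(4)[OF _ b, of mat_h] Q(3)[of j 0] linD(3)[OF fh(1) b] by simp
    hence "?c (act N mat_h ?w) (j', k) = (l - of_nat (n j)) * ?c ?w (j', k)" using linD(3)[OF C(1) w] by simp
    hence "l - of_nat (n' j') + 2 * of_nat k = l - of_nat (n j)"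
      using crd_act(1)[OF N qN w, of j' k] k nz by simp
    hence "of_nat (n' j') = (of_nat (n j + 2 * k) :: complex)" by (simp add: algebra_simps)
    hence n': "n' j' = n j + 2 * k" unfolding of_nat_eq_iff .
    with k have k0: "k > 0" by auto
    have "(act N mat_e ^^ Suc (n j)) ?w = \<zero>\<^bsub>N\<^esub>"
      using fpow[OF b, of "Suc (n j)"] string_pow(2)[OF qM, of j] lin_zero[OF D(1) D'(1) fh(1)] by simp
    moreover have "?c ((act N mat_e ^^ Suc (n j)) ?w) (j', k + Suc (n j)) = ?c ?w (j', k)"
      by (rule crd_act(2)[OF N qN w]) (use n' k k0 in auto)
    ultimately show False using nz lin_zero[OF D'(1) fs_cvs C(1)] by simp
  qed
  define c where "c = ?c ?w (j', 0)"
  have b': "b' (j', 0) \<in> carrier N" using Q'(2) by auto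
  have cb: "c \<odot>\<^bsub>N\<^esub> b' (j', 0) \<in> carrier N" using S' b' by blast
  have "?w = c \<odot>\<^bsub>N\<^esub> b' (j', 0)"
  proof -
    have wi: "?w \<ominus>\<^bsub>N\<^esub> c \<odot>\<^bsub>N\<^esub> b' (j', 0) \<in> carrier N" by (rule S'(4)[OF w cb])
    have "?w \<ominus>\<^bsub>N\<^esub> c \<odot>\<^bsub>N\<^esub> b' (j', 0) = \<zero>\<^bsub>N\<^esub>"
    proof (rule crd_zeroI[OF Q'(1) wi])
      fix i assume "i \<in> ?S'"
      then obtain k where i: "i = (j', k)" "k \<le> n' j'" by auto
      have "?c (?w \<ominus>\<^bsub>N\<^esub> c \<odot>\<^bsub>N\<^esub> b' (j', 0)) = ?c ?w \<ominus>\<^bsub>fs ?S'\<^esub> ?c (c \<odot>\<^bsub>N\<^esub> b' (j', 0))"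
        by (rule lin_minus[OF D'(1) fs_cvs C(1) w cb])
      also have "\<dots> = (\<lambda>i. ?c ?w i + (-1) * ?c (c \<odot>\<^bsub>N\<^esub> b' (j', 0)) i)"
        using linD(1)[OF C(1) w] linD(1)[OF C(1) cb] by (subst cvs_distribs(3)[OF fs_cvs]) simp_all
      finally show "?c (?w \<ominus>\<^bsub>N\<^esub> c \<odot>\<^bsub>N\<^esub> b' (j', 0)) i = 0"
        using coeff[of k] i linD(3)[OF C(1) b'] C(5)[of "(j', 0)"] by (cases k) (auto simp: c_def unit_def)
    qed
    thus ?thesis using cvs_distribs(8)[OF D'(1) w cb] by simp
  qed
  moreover have "f (b (j, k)) = (act N mat_e ^^ k) ?w" if "k \<le> n j" for k
    using fpow[OF b, of k] string_pow(1)[OF qM _ that] by simp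
  moreover have "n j \<noteq> n' j' \<longrightarrow> c = 0" using coeff[of 0] by (simp add: c_def)
  ultimately show ?thesis by (intro exI[of _ c] conjI allI impI) (blast, metis)
qed

lemma hom_distinct_strings:
  assumes M: "lie_module borel M" and qM: "qbasis l M b {j} n" and N: "lie_module borel N" and qN: "qbasis l N b' {j'} n'"
    and f: "f \<in> lie_hom borel M N" and ne: "n j \<noteq> n' j'" and v: "v \<in> carrier M"
  shows "f v = \<zero>\<^bsub>N\<^esub>"
proof -
  note D' = lie_moduleD[OF N]
  from hom_single_string[OF M qM N qN f] ne have fb: "\<forall>k\<le>n j. f (b (j, k)) = (act N mat_e ^^ k) (0 \<odot>\<^bsub>N\<^esub> b' (j', 0))" by auto
  have z: "(act N mat_e ^^ k) \<zero>\<^bsub>N\<^esub> = \<zero>\<^bsub>N\<^esub>" for k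
    by (induction k) (simp_all add: lin_zero[OF D'(1) D'(1) D'(2)])
  show ?thesis
    by (rule lin_ext[OF qbasisD(1)[OF qM] D'(1) lie_homD(1)[OF f] lin_const_zero[OF D'(1)] _ v])
      (use fb z qbasisD(2)[OF qN, of j' 0] cvs_simps(8)[OF D'(1)] in auto)
qed

lemma end_single_string:
  assumes M: "lie_module borel M" and q: "qbasis l M b {j} n" and f: "f \<in> lie_hom borel M M"
  obtains c where "\<And>v. v \<in> carrier M \<Longrightarrow> f v = c \<odot>\<^bsub>M\<^esub> v"
proof -
  note D = lie_moduleD[OF M] and Q = qbasisD[OF q]
  from hom_single_string[OF M q M q f] obtain c where fb: "\<forall>k\<le>n j. f (b (j, k)) = (act M mat_e ^^ k) (c \<odot>\<^bsub>M\<^esub> b (j, 0))" by blast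
  have el: "lin M M (act M mat_e)" by (simp add: D(2))
  have b: "b (j, 0) \<in> carrier M" using Q(2) by auto
  have p: "(act M mat_e ^^ k) (b (j, 0)) \<in> carrier M" for k by (induction k) (use b linD(1)[OF el] in auto)
  have "(act M mat_e ^^ k) (c \<odot>\<^bsub>M\<^esub> b (j, 0)) = c \<odot>\<^bsub>M\<^esub> (act M mat_e ^^ k) (b (j, 0))" for k
    by (induction k) (simp_all add: linD(3)[OF el p])
  hence fb': "f (b (j, k)) = c \<odot>\<^bsub>M\<^esub> b (j, k)" if "k \<le> n j" for k
    using fb string_pow(1)[OF q _ that] that by simp
  have "f v = c \<odot>\<^bsub>M\<^esub> v" if "v \<in> carrier M" for v
    by (rule lin_ext[OF Q(1) D(1) lie_homD(1)[OF f] lin_smult[OF D(1) lin_id] _ that]) (use fb' in auto)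
  thus thesis by (rule that)
qed

section \<open>Explicit strings as models of the quotients Q(l, i) and of their direct sums\<close>

section \<open>Standard models\<close>

text \<open>A direct sum of strings in coordinates, where \<open>J\<close> names the summands; a
  single string is taken over the unit type.\<close>

definition std :: "complex \<Rightarrow> 'j set \<Rightarrow> ('j \<Rightarrow> nat) \<Rightarrow> ('j \<times> nat \<Rightarrow> complex) lmod"
  where "std l J n = \<lparr>carrier = carrier (fs (strings J n)), monoid.mult = undefined, one = undefined,
     zero = (\<lambda>i. 0), add = (\<lambda>c d i. c i + d i), module.smult = (\<lambda>a c i. a * c i),
     act = (\<lambda>x c (j, k). if (j, k) \<in> strings J n
       then x $$ (0, 0) * ((l - of_nat (n j) + 2 * of_nat k) * c (j, k)) + x $$ (0, 1) * (if k = 0 then 0 else c (j, k - 1))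
       else 0)\<rparr>"

lemma std_sel [simp]:
  "c \<in> carrier (std l J n) \<longleftrightarrow> (\<forall>i. i \<notin> strings J n \<longrightarrow> c i = 0)"
  "\<zero>\<^bsub>std l J n\<^esub> = (\<lambda>i. 0)" "c \<oplus>\<^bsub>std l J n\<^esub> d = (\<lambda>i. c i + d i)" "a \<odot>\<^bsub>std l J n\<^esub> c = (\<lambda>i. a * c i)"
  "act (std l J n) x c (j, k) = (if (j, k) \<in> strings J n
       then x $$ (0, 0) * ((l - of_nat (n j) + 2 * of_nat k) * c (j, k)) + x $$ (0, Suc 0) * (if k = 0 then 0 else c (j, k - 1))
       else 0)"
  by (simp_all add: std_def)

lemma std_basis:
  assumes "finite J"
  shows "fbasis (std l J n) unit (strings J n)"
proof -
  have l: "lin (fs (strings J n)) (std l J n) (\<lambda>c. c)" by (auto simp: lin_iff)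
  have b: "bij_betw (\<lambda>c. c) (carrier (fs (strings J n))) (carrier (std l J n))" by (auto simp: bij_betw_def)
  have "cvs (std l J n)" by (rule cvs_iso[OF fs_cvs b l]) simp
  from fbasis_of_iso[OF _ this l b] assms show ?thesis by simp
qed

lemma std_module:
  assumes "finite J"
  shows "lie_module borel (std l J n)"
proof (rule lie_module_borelI)
  show "fd (std l J n)" by (rule fbasis_imp_fd[OF std_basis[OF assms]])
  show "lin (std l J n) (std l J n) (act (std l J n) mat_h)" "lin (std l J n) (std l J n) (act (std l J n) mat_e)"
    by (rule linI; auto simp: fun_eq_iff algebra_simps)+
  show "act (std l J n) mat_h (act (std l J n) mat_e v) = act (std l J n) mat_e (act (std l J n) mat_h v)
      \<oplus>\<^bsub>std l J n\<^esub> 2 \<odot>\<^bsub>std l J n\<^esub> act (std l J n) mat_e v" for v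
    by (rule ext, rename_tac jk, case_tac jk) (auto simp: algebra_simps of_nat_diff)
  show "act (std l J n) x v = x $$ (0, 0) \<odot>\<^bsub>std l J n\<^esub> act (std l J n) mat_h v
      \<oplus>\<^bsub>std l J n\<^esub> x $$ (0, 1) \<odot>\<^bsub>std l J n\<^esub> act (std l J n) mat_e v" for x v
    by (rule ext, rename_tac jk, case_tac jk) (auto simp: algebra_simps)
qed

lemma std_qbasis:
  assumes "finite J"
  shows "qbasis l (std l J n) unit J n"
  unfolding qbasis_def
proof (intro conjI ballI allI impI std_basis[OF assms])
  fix j k assume jk: "j \<in> J" "k \<le> n j"
  show "act (std l J n) mat_h (unit (j, k)) = (l - of_nat (n j) + 2 * of_nat k) \<odot>\<^bsub>std l J n\<^esub> unit (j, k)"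
    by (rule ext, rename_tac i, case_tac i) (use jk in \<open>auto simp: unit_def\<close>)
  show "act (std l J n) mat_e (unit (j, k)) = (if k < n j then unit (j, Suc k) else \<zero>\<^bsub>std l J n\<^esub>)"
    by (rule ext, rename_tac i, case_tac i) (use jk in \<open>auto simp: unit_def\<close>)
qed

section \<open>Quotients and direct sums\<close>

text \<open>The cosets of a kernel are the fibres of the map. The isomorphism is taken in the
  direction that sends a point of the image to its fibre, which involves no choice of
  representatives.\<close>

lemma quotient_iso:
  fixes N :: "'v lmod" and S :: "'w lmod"
  assumes N: "cvs N" and S: "cvs S" and \<pi>: "lin N S \<pi>" "\<pi> ` carrier N = carrier S"
    and A: "A = {v \<in> carrier N. \<pi> v = \<zero>\<^bsub>S\<^esub>}"
    and x: "\<And>x v. \<lbrakk>x \<in> g; v \<in> carrier N\<rbrakk> \<Longrightarrow> act N x v \<in> carrier N"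
    and eq: "\<And>x v. \<lbrakk>x \<in> g; v \<in> carrier N\<rbrakk> \<Longrightarrow> \<pi> (act N x v) = act S x (\<pi> v)"
  defines "\<psi> \<equiv> \<lambda>s. {v \<in> carrier N. \<pi> v = s}"
  shows "bij_betw \<psi> (carrier S) (carrier (lie_quotient N A))" "lin S (lie_quotient N A) \<psi>"
    "\<psi> \<zero>\<^bsub>S\<^esub> = \<zero>\<^bsub>lie_quotient N A\<^esub>"
    "\<lbrakk>x \<in> g; s \<in> carrier S\<rbrakk> \<Longrightarrow> act (lie_quotient N A) x (\<psi> s) = \<psi> (act S x s)"
proof -
  note CN = cvs_simps[OF N] and DN = cvs_distribs[OF N] and CS = cvs_simps[OF S] and DS = cvs_distribs[OF S]
  note L = linD[OF \<pi>(1)]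
  interpret N: abelian_group N using N by (simp add: vectorspace_def Module.module_def)
  have surj: "\<exists>v\<in>carrier N. \<pi> v = s" if "s \<in> carrier S" for s using that unfolding \<pi>(2)[symmetric] by blast
  have diff: "w \<ominus>\<^bsub>N\<^esub> v \<in> carrier N" "\<pi> (w \<ominus>\<^bsub>N\<^esub> v) = \<pi> w \<ominus>\<^bsub>S\<^esub> \<pi> v" "(w \<ominus>\<^bsub>N\<^esub> v) \<oplus>\<^bsub>N\<^esub> v = w" "v \<oplus>\<^bsub>N\<^esub> (w \<ominus>\<^bsub>N\<^esub> v) = w"
    if "v \<in> carrier N" "w \<in> carrier N" for v w
  proof -
    show "w \<ominus>\<^bsub>N\<^esub> v \<in> carrier N" by (rule CN(4)[OF that(2,1)])
    show "\<pi> (w \<ominus>\<^bsub>N\<^esub> v) = \<pi> w \<ominus>\<^bsub>S\<^esub> \<pi> v" by (rule lin_minus[OF N S \<pi>(1) that(2,1)])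
    show 1: "(w \<ominus>\<^bsub>N\<^esub> v) \<oplus>\<^bsub>N\<^esub> v = w" using that by (simp add: a_minus_def N.a_assoc N.l_neg)
    show "v \<oplus>\<^bsub>N\<^esub> (w \<ominus>\<^bsub>N\<^esub> v) = w" using 1 N.a_comm[OF that(1) CN(4)[OF that(2,1)]] by simp
  qed
  have coset: "A +>\<^bsub>N\<^esub> v = \<psi> (\<pi> v)" if v: "v \<in> carrier N" for v
  proof (intro equalityI subsetI)
    fix w assume "w \<in> A +>\<^bsub>N\<^esub> v"
    then obtain a where "a \<in> A" "w = a \<oplus>\<^bsub>N\<^esub> v" by (auto simp: a_r_coset_def')
    thus "w \<in> \<psi> (\<pi> v)" using v by (simp add: A \<psi>_def CN L CS)
  next
    fix w assume "w \<in> \<psi> (\<pi> v)"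
    hence w: "w \<in> carrier N" "\<pi> w = \<pi> v" by (auto simp: \<psi>_def)
    have "w \<ominus>\<^bsub>N\<^esub> v \<in> A" using diff(1,2)[OF v w(1)] w(2) L(1)[OF v] by (simp add: A DS(7))
    thus "w \<in> A +>\<^bsub>N\<^esub> v" using diff(3)[OF v w(1)] by (force simp: a_r_coset_def')
  qed
  have car: "carrier (lie_quotient N A) = \<psi> ` carrier S"
    unfolding \<pi>(2)[symmetric] image_image using coset by (auto simp: lie_quotient_def A_RCOSETS_def')
  have ne: "\<psi> s \<noteq> {}" if "s \<in> carrier S" for s using surj[OF that] by (auto simp: \<psi>_def)
  show "bij_betw \<psi> (carrier S) (carrier (lie_quotient N A))"
    unfolding car using ne by (intro inj_on_imp_bij_betw inj_onI) (auto simp: \<psi>_def)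
  show "\<psi> \<zero>\<^bsub>S\<^esub> = \<zero>\<^bsub>lie_quotient N A\<^esub>" by (simp add: \<psi>_def lie_quotient_def A)
  show "lin S (lie_quotient N A) \<psi>"
  proof (rule linI)
    show "\<psi> s \<in> carrier (lie_quotient N A)" if "s \<in> carrier S" for s using that by (simp add: car)
    fix s t assume st: "s \<in> carrier S" "t \<in> carrier S"
    have "\<psi> (s \<oplus>\<^bsub>S\<^esub> t) = \<psi> s <+>\<^bsub>N\<^esub> \<psi> t"
    proof (intro equalityI subsetI)
      fix w assume "w \<in> \<psi> (s \<oplus>\<^bsub>S\<^esub> t)"
      hence w: "w \<in> carrier N" "\<pi> w = s \<oplus>\<^bsub>S\<^esub> t" by (auto simp: \<psi>_def)
      obtain v where v: "v \<in> carrier N" "\<pi> v = s" using surj[OF st(1)] by blast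
      interpret S: abelian_group S using S by (simp add: vectorspace_def Module.module_def)
      have "\<pi> (w \<ominus>\<^bsub>N\<^esub> v) = t"
        using diff(2)[OF v(1) w(1)] st v(2) w(2) by (simp add: S.a_comm[OF st] S.a_assoc a_minus_def[of S] S.r_neg)
      thus "w \<in> \<psi> s <+>\<^bsub>N\<^esub> \<psi> t"
        using diff(1,4)[OF v(1) w(1)] v by (force simp: set_add_def' \<psi>_def)
    qed (auto simp: set_add_def' \<psi>_def CN L)
    thus "\<psi> (s \<oplus>\<^bsub>S\<^esub> t) = \<psi> s \<oplus>\<^bsub>lie_quotient N A\<^esub> \<psi> t" by (simp add: lie_quotient_def)
    fix c
    \<comment> \<open>The quotient operations are unions over all representatives. Each
      representative contributes the same coset, and the fibre is nonempty, so the union is that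
      coset.\<close>
    have "(\<Union>v\<in>\<psi> s. A +>\<^bsub>N\<^esub> (c \<odot>\<^bsub>N\<^esub> v)) = (\<Union>v\<in>\<psi> s. \<psi> (c \<odot>\<^bsub>S\<^esub> s))"
      by (rule SUP_cong) (auto simp: coset CN L \<psi>_def)
    thus "\<psi> (c \<odot>\<^bsub>S\<^esub> s) = c \<odot>\<^bsub>lie_quotient N A\<^esub> \<psi> s" using ne[OF st(1)] by (simp add: lie_quotient_def)
  qed
  show "act (lie_quotient N A) x (\<psi> s) = \<psi> (act S x s)" if xs: "x \<in> g" "s \<in> carrier S" for x s
  proof -
    have "(\<Union>v\<in>\<psi> s. A +>\<^bsub>N\<^esub> (act N x v)) = (\<Union>v\<in>\<psi> s. \<psi> (act S x s))"
      by (rule SUP_cong) (auto simp: coset x[OF xs(1)] eq[OF xs(1)] \<psi>_def)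
    thus ?thesis using ne[OF xs(2)] by (simp add: lie_quotient_def)
  qed
qed

lemma Nmod_sel [simp]:
  "c \<in> carrier (Nmod \<mu>) \<longleftrightarrow> finite {\<nu>. c \<nu> \<noteq> 0} \<and> (\<forall>\<nu>. c \<nu> \<noteq> 0 \<longrightarrow> (\<exists>k :: nat. \<nu> = \<mu> + 2 * of_nat k))"
  "\<zero>\<^bsub>Nmod \<mu>\<^esub> = (\<lambda>\<nu>. 0)" "c \<oplus>\<^bsub>Nmod \<mu>\<^esub> d = (\<lambda>\<nu>. c \<nu> + d \<nu>)" "a \<odot>\<^bsub>Nmod \<mu>\<^esub> c = (\<lambda>\<nu>. a * c \<nu>)"
  "act (Nmod \<mu>) x c = (\<lambda>\<nu>. x $$ (0, 0) * (\<nu> * c \<nu>) + x $$ (0, Suc 0) * c (\<nu> - 2))"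
  by (auto simp: Nmod_def)

lemma Nmod_cvs: "cvs (Nmod \<mu>)"
proof (rule cvsI)
  fix v w assume vw: "v \<in> carrier (Nmod \<mu>)" "w \<in> carrier (Nmod \<mu>)"
  hence fin: "finite ({\<nu>. v \<nu> \<noteq> 0} \<union> {\<nu>. w \<nu> \<noteq> 0})" by simp
  have "finite {\<nu>. v \<nu> + w \<nu> \<noteq> 0}"
    by (rule finite_subset[of _ "{\<nu>. v \<nu> \<noteq> 0} \<union> {\<nu>. w \<nu> \<noteq> 0}", OF _ fin]) auto
  moreover have "\<exists>k :: nat. \<nu> = \<mu> + 2 * of_nat k" if "v \<nu> + w \<nu> \<noteq> 0" for \<nu>
  proof -
    have "v \<nu> \<noteq> 0 \<or> w \<nu> \<noteq> 0" using that by auto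
    thus ?thesis using vw unfolding Nmod_sel(1) by blast
  qed
  ultimately show "v \<oplus>\<^bsub>Nmod \<mu>\<^esub> w \<in> carrier (Nmod \<mu>)" by simp
next
  fix v c assume v: "v \<in> carrier (Nmod \<mu>)"
  hence "finite {\<nu>. v \<nu> \<noteq> 0}" by simp
  hence "finite {\<nu>. c * v \<nu> \<noteq> 0}" by (rule rev_finite_subset) auto
  thus "c \<odot>\<^bsub>Nmod \<mu>\<^esub> v \<in> carrier (Nmod \<mu>)" using v by simp
next
  show "\<zero>\<^bsub>Nmod \<mu>\<^esub> \<in> carrier (Nmod \<mu>)" by simp
qed (simp_all add: fun_eq_iff distrib_left distrib_right del: Nmod_sel(1))

lemma Nmod_act:
  assumes "c \<in> carrier (Nmod \<mu>)"
  shows "act (Nmod \<mu>) x c \<in> carrier (Nmod \<mu>)"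
proof -
  have fin: "finite {\<nu>. c \<nu> \<noteq> 0}" and supp: "\<And>\<nu>. c \<nu> \<noteq> 0 \<Longrightarrow> \<exists>k :: nat. \<nu> = \<mu> + 2 * of_nat k"
    using assms by auto
  have "{\<nu>. act (Nmod \<mu>) x c \<nu> \<noteq> 0} \<subseteq> {\<nu>. c \<nu> \<noteq> 0} \<union> (\<lambda>\<nu>. \<nu> + 2) ` {\<nu>. c \<nu> \<noteq> 0}"
  proof (rule subsetI)
    fix \<nu> assume "\<nu> \<in> {\<nu>. act (Nmod \<mu>) x c \<nu> \<noteq> 0}"
    hence "c \<nu> \<noteq> 0 \<or> c (\<nu> - 2) \<noteq> 0" by auto
    moreover have "\<nu> = (\<nu> - 2) + 2" by simp
    ultimately show "\<nu> \<in> {\<nu>. c \<nu> \<noteq> 0} \<union> (\<lambda>\<nu>. \<nu> + 2) ` {\<nu>. c \<nu> \<noteq> 0}" by blast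
  qed
  hence "finite {\<nu>. act (Nmod \<mu>) x c \<nu> \<noteq> 0}" by (rule finite_subset) (use fin in simp)
  moreover have "\<exists>k :: nat. \<nu> = \<mu> + 2 * of_nat k" if "act (Nmod \<mu>) x c \<nu> \<noteq> 0" for \<nu>
  proof (cases "c \<nu> = 0")
    case True
    hence "c (\<nu> - 2) \<noteq> 0" using that by auto
    then obtain k :: nat where "\<nu> - 2 = \<mu> + 2 * of_nat k" using supp by blast
    hence "\<nu> = \<mu> + 2 * of_nat (Suc k)" by (simp add: algebra_simps)
    thus ?thesis by blast
  qed (use supp in blast)
  ultimately show ?thesis by (simp del: Nmod_sel(5))
qed

lemma Qmod_iso:
  "\<exists>\<phi>. lin (std l {()} (\<lambda>_. i)) (Qmod l i) \<phi> \<and> bij_betw \<phi> (carrier (std l {()} (\<lambda>_. i))) (carrier (Qmod l i)) \<and>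
    \<phi> \<zero>\<^bsub>std l {()} (\<lambda>_. i)\<^esub> = \<zero>\<^bsub>Qmod l i\<^esub> \<and>
    (\<forall>x\<in>borel. \<forall>v\<in>carrier (std l {()} (\<lambda>_. i)). act (Qmod l i) x (\<phi> v) = \<phi> (act (std l {()} (\<lambda>_. i)) x v))"
proof -
  let ?N = "Nmod (l - of_nat i)" and ?S = "std l {()} (\<lambda>_. i)" and ?A = "carrier (Nmod (l + 2 + of_nat i))"
  \<comment> \<open>Reads off the coefficients at the i + 1 lowest weights of N(l - i). The weight l
    + 2 + i sits at height i + 1, so the kernel is exactly the submodule that is factored
    out.\<close>
  define \<pi> where "\<pi> = (\<lambda>(c :: complex \<Rightarrow> complex) (j :: unit, k :: nat). if k \<le> i then c (l - of_nat i + 2 * of_nat k) else 0)"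
  have \<pi>_eq: "\<pi> c (j, k) = (if k \<le> i then c (l - of_nat i + 2 * of_nat k) else 0)" for c j k by (simp add: \<pi>_def)
  have S: "cvs ?S" by (rule lie_moduleD(1)[OF std_module]) simp
  have lin: "lin ?N ?S \<pi>"
    by (rule linI) (auto simp: \<pi>_eq fun_eq_iff simp del: Nmod_sel(1))
  have surj: "\<pi> ` carrier ?N = carrier ?S"
  proof (intro equalityI subsetI)
    fix s assume s: "s \<in> carrier ?S"
    define c where "c = (\<lambda>\<nu>. \<Sum>k\<le>i. if \<nu> = l - of_nat i + 2 * of_nat k then s ((), k) else 0)"
    have supp: "\<exists>k\<le>i. \<nu> = l - of_nat i + 2 * of_nat k" if "c \<nu> \<noteq> 0" for \<nu>
    proof (rule ccontr)
      assume "\<not> ?thesis"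
      hence "c \<nu> = 0" unfolding c_def by (intro sum.neutral) auto
      with that show False by simp
    qed
    have "{\<nu>. c \<nu> \<noteq> 0} \<subseteq> (\<lambda>k. l - of_nat i + 2 * of_nat k) ` {..i}" using supp by auto
    hence "finite {\<nu>. c \<nu> \<noteq> 0}" by (rule finite_subset) simp
    hence "c \<in> carrier ?N" using supp by auto
    moreover have "c (l - of_nat i + 2 * of_nat m) = s ((), m)" if "m \<le> i" for m
    proof -
      have "c (l - of_nat i + 2 * of_nat m) = (\<Sum>k\<le>i. if k = m then s ((), k) else 0)"
        unfolding c_def by (rule sum.cong) auto
      thus ?thesis using that by simp
    qed
    hence "\<pi> c = s" using s by (auto simp: \<pi>_eq fun_eq_iff)
    ultimately show "s \<in> \<pi> ` carrier ?N" by blast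
  qed (use linD(1)[OF lin] in blast)
  have ker: "?A = {v \<in> carrier ?N. \<pi> v = \<zero>\<^bsub>?S\<^esub>}"
  proof (intro equalityI subsetI)
    fix c assume c: "c \<in> ?A"
    have supp: "\<exists>k :: nat. \<nu> = l - of_nat i + 2 * of_nat (i + 1 + k)" if "c \<nu> \<noteq> 0" for \<nu>
    proof -
      from c that obtain k :: nat where "\<nu> = l + 2 + of_nat i + 2 * of_nat k" by auto
      thus ?thesis by (intro exI[of _ k]) (simp add: algebra_simps)
    qed
    have "c (l - of_nat i + 2 * of_nat k) = 0" if "k \<le> i" for k
    proof (rule ccontr)
      assume "c (l - of_nat i + 2 * of_nat k) \<noteq> 0"
      then obtain m :: nat where "l - of_nat i + 2 * of_nat k = l - of_nat i + 2 * (of_nat (i + 1 + m) :: complex)" using supp by blast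
      hence "2 * of_nat k = (2 * of_nat (i + 1 + m) :: complex)" by (rule add_left_imp_eq)
      hence "of_nat k = (of_nat (i + 1 + m) :: complex)" by (simp only: mult_cancel_left) simp
      thus False using that unfolding of_nat_eq_iff by simp
    qed
    moreover have "\<exists>k :: nat. \<nu> = l - of_nat i + 2 * of_nat k" if "c \<nu> \<noteq> 0" for \<nu> using supp[OF that] by blast
    ultimately show "c \<in> {v \<in> carrier ?N. \<pi> v = \<zero>\<^bsub>?S\<^esub>}" using c by (auto simp: \<pi>_eq fun_eq_iff)
  next
    fix c assume "c \<in> {v \<in> carrier ?N. \<pi> v = \<zero>\<^bsub>?S\<^esub>}"
    hence c: "finite {\<nu>. c \<nu> \<noteq> 0}" "\<And>\<nu>. c \<nu> \<noteq> 0 \<Longrightarrow> \<exists>k :: nat. \<nu> = l - of_nat i + 2 * of_nat k" and z: "\<pi> c = (\<lambda>_. 0)" by auto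
    have "\<exists>k :: nat. \<nu> = l + 2 + of_nat i + 2 * of_nat k" if nz: "c \<nu> \<noteq> 0" for \<nu>
    proof -
      from c(2)[OF nz] obtain k :: nat where k: "\<nu> = l - of_nat i + 2 * of_nat k" by blast
      have "k > i" using fun_cong[OF z, of "((), k)"] nz by (auto simp: \<pi>_eq k split: if_splits)
      then obtain m where "k = i + 1 + m" by (metis Suc_eq_plus1 add_Suc less_iff_Suc_add)
      thus ?thesis using k by (intro exI[of _ m]) (simp add: algebra_simps)
    qed
    thus "c \<in> ?A" using c(1) by simp
  qed
  have eq: "\<pi> (act ?N x c) = act ?S x (\<pi> c)" if "x \<in> borel" and c: "c \<in> carrier ?N" for x c
  proof (rule ext)
    fix jk :: "unit \<times> nat"
    obtain k where k: "jk = ((), k)" by (cases jk) auto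
    \<comment> \<open>At the lowest height e refers to the coefficient one step below the support of
      \<open>c\<close>; its vanishing matches the value 0 that \<open>std\<close> prescribes for k =
      0.\<close>
    have "c (l - of_nat i - 2) = 0"
    proof (rule ccontr)
      assume "c (l - of_nat i - 2) \<noteq> 0"
      then obtain m :: nat where "l - of_nat i - 2 = l - of_nat i + 2 * (of_nat m :: complex)" using c by auto
      hence "2 * of_nat (m + 1) = (0 :: complex)" by (simp add: algebra_simps)
      hence "of_nat (m + 1) = (0 :: complex)" by (simp only: mult_eq_0_iff) simp
      thus False by (simp only: of_nat_eq_0_iff)
    qed
    moreover have "c (l - of_nat i + 2 * of_nat (Suc m) - 2) = c (l - of_nat i + 2 * of_nat m)" for m
      by (rule arg_cong[of _ _ c]) (simp add: algebra_simps)
    ultimately show "\<pi> (act ?N x c) jk = act ?S x (\<pi> c) jk" unfolding k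
      by (cases k) (auto simp: \<pi>_eq simp del: of_nat_Suc)
  qed
  have act_in: "act ?N x c \<in> carrier ?N" if "x \<in> borel" "c \<in> carrier ?N" for x c by (rule Nmod_act[OF that(2)])
  show ?thesis
    unfolding Qmod_def
    using quotient_iso[where g = borel and \<pi> = \<pi> and N = ?N and S = ?S and A = ?A, OF Nmod_cvs S lin surj ker act_in eq] by (intro exI conjI ballI)
qed

text \<open>Stated for any modules isomorphic to single strings, so that the cosets of the quotients
  do not appear in the computation.\<close>

lemma direct_sum_iso:
  fixes Ms :: "'v lmod list"
  assumes "length Ms = N"
    and \<phi>: "\<And>j. j < N \<Longrightarrow> lin (std l {()} (\<lambda>_. n j)) (Ms ! j) (\<phi> j)"
    "\<And>j. j < N \<Longrightarrow> bij_betw (\<phi> j) (carrier (std l {()} (\<lambda>_. n j))) (carrier (Ms ! j))"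
    "\<And>j. j < N \<Longrightarrow> \<phi> j \<zero>\<^bsub>std l {()} (\<lambda>_. n j)\<^esub> = \<zero>\<^bsub>Ms ! j\<^esub>"
    "\<And>j x v. \<lbrakk>j < N; x \<in> borel; v \<in> carrier (std l {()} (\<lambda>_. n j))\<rbrakk> \<Longrightarrow> act (Ms ! j) x (\<phi> j v) = \<phi> j (act (std l {()} (\<lambda>_. n j)) x v)"
  shows "lie_module borel (lie_direct_sum Ms)" "\<exists>b. qbasis l (lie_direct_sum Ms) b {..<N} n"
proof -
  let ?D = "lie_direct_sum Ms" and ?S = "std l {..<N} n"
  \<comment> \<open>The part of a coordinate function that belongs to summand \<open>j\<close>, read
    as a function on a single string.\<close>
  define sl where "sl = (\<lambda>(c :: nat \<times> nat \<Rightarrow> complex) j (u :: unit, k :: nat). if k \<le> n j then c (j, k) else 0)"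
  have sl: "sl c j \<in> carrier (std l {()} (\<lambda>_. n j))" "sl c j (u, k) = (if k \<le> n j then c (j, k) else 0)" for c j u k
    by (auto simp: sl_def)
  define \<Phi> where "\<Phi> = (\<lambda>c. map (\<lambda>j. \<phi> j (sl c j)) [0..<N])"
  have nth: "\<Phi> c ! j = \<phi> j (sl c j)" if "j < N" for c j using that by (simp add: \<Phi>_def)
  have len: "length (\<Phi> c) = N" for c by (simp add: \<Phi>_def)
  have sl_ops: "sl (\<lambda>i. c i + d i) j = sl c j \<oplus>\<^bsub>std l {()} (\<lambda>_. n j)\<^esub> sl d j" "sl (\<lambda>i. a * c i) j = a \<odot>\<^bsub>std l {()} (\<lambda>_. n j)\<^esub> sl c j"
    "sl (\<lambda>i. 0) j = \<zero>\<^bsub>std l {()} (\<lambda>_. n j)\<^esub>" for c d a j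
    by (auto simp: sl_def fun_eq_iff)
  have sl_act: "sl (act ?S x c) j = act (std l {()} (\<lambda>_. n j)) x (sl c j)" if "j < N" for x c j
    using that by (auto simp: fun_eq_iff sl(2))
  have lin: "lin ?S ?D \<Phi>"
  proof (rule linI)
    show "\<Phi> v \<in> carrier ?D" for v using linD(1)[OF \<phi>(1) sl(1)] by (simp add: lie_direct_sum_def assms(1) len nth)
    show "\<Phi> (v \<oplus>\<^bsub>?S\<^esub> w) = \<Phi> v \<oplus>\<^bsub>?D\<^esub> \<Phi> w" for v w
      unfolding std_sel(3)[where l = l and J = "{..<N}"]
      by (rule nth_equalityI) (simp_all add: lie_direct_sum_def assms(1) len nth sl_ops(1) linD(2)[OF \<phi>(1) sl(1) sl(1)] del: std_sel)
    show "\<Phi> (c \<odot>\<^bsub>?S\<^esub> v) = c \<odot>\<^bsub>?D\<^esub> \<Phi> v" for c v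
      unfolding std_sel(4)[where l = l and J = "{..<N}"]
      by (rule nth_equalityI) (simp_all add: lie_direct_sum_def assms(1) len nth sl_ops(2) linD(3)[OF \<phi>(1) sl(1)] del: std_sel)
  qed
  have bij: "bij_betw \<Phi> (carrier ?S) (carrier ?D)"
  proof (rule bij_betw_imageI)
    show "inj_on \<Phi> (carrier ?S)"
    proof (rule inj_onI)
      fix c d assume cd: "c \<in> carrier ?S" "d \<in> carrier ?S" "\<Phi> c = \<Phi> d"
      have eq: "sl c j = sl d j" if "j < N" for j
        using \<phi>(2)[OF that] nth[OF that, of c] nth[OF that, of d] cd(3) sl(1) by (metis bij_betw_imp_inj_on inj_onD)
      show "c = d"
      proof (rule ext)
        fix jk :: "nat \<times> nat"
        obtain j k where jk: "jk = (j, k)" by (cases jk)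
        show "c jk = d jk"
        proof (cases "j < N \<and> k \<le> n j")
          case True thus ?thesis using fun_cong[OF eq, of j "((), k)"] sl(2) by (simp add: jk)
        qed (use cd in \<open>auto simp: jk\<close>)
      qed
    qed
    show "\<Phi> ` carrier ?S = carrier ?D"
    proof (intro equalityI subsetI)
      fix vs assume vs: "vs \<in> carrier ?D"
      have lvs: "length vs = N" using vs by (simp add: lie_direct_sum_def assms(1))
      have img: "vs ! j \<in> \<phi> j ` carrier (std l {()} (\<lambda>_. n j))" if "j < N" for j
        using bij_betw_imp_surj_on[OF \<phi>(2)[OF that]] vs that by (simp add: lie_direct_sum_def assms(1))
      have "\<exists>d. d \<in> carrier (std l {()} (\<lambda>_. n j)) \<and> \<phi> j d = vs ! j" if "j < N" for j
        by (rule imageE[OF img[OF that]]) (rule exI, rule conjI, assumption, rule sym)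
      then obtain d where d: "\<And>j. j < N \<Longrightarrow> d j \<in> carrier (std l {()} (\<lambda>_. n j)) \<and> \<phi> j (d j) = vs ! j" by metis
      define c where "c = (\<lambda>(j, k). if j < N then d j ((), k) else 0)"
      have "c \<in> carrier ?S" using d by (auto simp: c_def)
      moreover have "sl c j = d j" if "j < N" for j using d[OF that] that by (auto simp: fun_eq_iff sl(2) c_def)
      hence "\<Phi> c = vs" using d by (intro nth_equalityI) (simp_all add: len lvs nth)
      ultimately show "vs \<in> \<Phi> ` carrier ?S" by blast
    qed (use linD(1)[OF lin] in blast)
  qed
  have zero: "\<zero>\<^bsub>?D\<^esub> = \<Phi> \<zero>\<^bsub>?S\<^esub>"
    unfolding std_sel(2)[where l = l and J = "{..<N}"]
    by (rule nth_equalityI) (use \<phi>(3) in \<open>simp_all add: lie_direct_sum_def assms(1) len nth sl_ops(3) del: std_sel\<close>)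
  have eq: "act ?D x (\<Phi> v) = \<Phi> (act ?S x v)" if "x \<in> borel" for x v
    by (rule nth_equalityI) (simp_all add: lie_direct_sum_def assms(1) len nth sl_act \<phi>(4)[OF _ that sl(1)])
  have fin: "finite {..<N}" by simp
  show D: "lie_module borel ?D"
    by (rule lie_module_iso[where \<phi> = \<Phi>, OF lie_closed_borel std_module[OF fin] bij lin zero]) (rule eq)
  have "qbasis l ?D (\<lambda>i. \<Phi> (unit i)) {..<N} n"
    by (rule qbasis_image[OF std_qbasis[OF fin] std_module[OF fin] D lin bij]) (simp_all add: eq)
  thus "\<exists>b. qbasis l ?D b {..<N} n" by blast
qed

lemma Qmod_direct_sum:
  "lie_module borel (lie_direct_sum (map (Qmod l) ns))"
  "\<exists>b. qbasis l (lie_direct_sum (map (Qmod l) ns)) b {..<length ns} (\<lambda>j. ns ! j)"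
proof -
  let ?P = "\<lambda>j \<phi>. lin (std l {()} (\<lambda>_. ns ! j)) (Qmod l (ns ! j)) \<phi> \<and> bij_betw \<phi> (carrier (std l {()} (\<lambda>_. ns ! j))) (carrier (Qmod l (ns ! j))) \<and>
    \<phi> \<zero>\<^bsub>std l {()} (\<lambda>_. ns ! j)\<^esub> = \<zero>\<^bsub>Qmod l (ns ! j)\<^esub> \<and>
    (\<forall>x\<in>borel. \<forall>v\<in>carrier (std l {()} (\<lambda>_. ns ! j)). act (Qmod l (ns ! j)) x (\<phi> v) = \<phi> (act (std l {()} (\<lambda>_. ns ! j)) x v))"
  have "?P j (SOME \<phi>. ?P j \<phi>)" for j by (rule someI_ex[of "?P j"]) (rule Qmod_iso)
  note P = this
  have len: "length (map (Qmod l) ns) = length ns" by simp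
  note D = direct_sum_iso[OF len, where n = "\<lambda>j. ns ! j" and \<phi> = "\<lambda>j. SOME \<phi>. ?P j \<phi>"]
  show "lie_module borel (lie_direct_sum (map (Qmod l) ns))"
    by (rule D(1)) (use P in simp_all)
  show "\<exists>b. qbasis l (lie_direct_sum (map (Qmod l) ns)) b {..<length ns} (\<lambda>j. ns ! j)"
    by (rule D(2)) (use P in simp_all)
qed

section \<open>The objects of the additive closure and its stability under the action\<close>

section \<open>The objects of the category\<close>

lemma qbasis_cong:
  assumes "qbasis l M b J n" "\<And>j. j \<in> J \<Longrightarrow> n' j = n j" "\<And>j k. \<lbrakk>j \<in> J; k \<le> n j\<rbrakk> \<Longrightarrow> b' (j, k) = b (j, k)"
  shows "qbasis l M b' J n'"
proof -
  note Q = qbasisD[OF assms(1)]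
  have s: "strings J n' = strings J n" using assms(2) by auto
  have "fbasis M b' (strings J n)" by (rule fbasis_cong[OF Q(1)]) (use assms(3) in auto)
  thus ?thesis using assms(2,3) Q(3,4) by (simp add: qbasis_def s)
qed

text \<open>An injective homomorphism with \<open>F\<close>-stable image carries the operator back.
  It serves for direct summands and for images of idempotents.\<close>

lemma sl2ext_pullback:
  assumes M: "lie_module borel M" and D: "cvs D" and F: "sl2ext l D F"
    and f: "lin M D f" "inj_on f (carrier M)"
    and h: "\<And>v. v \<in> carrier M \<Longrightarrow> f (act M mat_h v) = act D mat_h (f v)"
    and e: "\<And>v. v \<in> carrier M \<Longrightarrow> f (act M mat_e v) = act D mat_e (f v)"
    and im: "\<And>v. v \<in> carrier M \<Longrightarrow> F (f v) \<in> f ` carrier M"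
  shows "\<exists>F'. sl2ext l M F'"
proof -
  note S = cvs_simps[OF lie_moduleD(1)[OF M]] and L = linD[OF f(1)] and FD = sl2extD[OF F]
  define F' where "F' = (\<lambda>v. inv_into (carrier M) f (F (f v)))"
  have F': "F' v \<in> carrier M" "f (F' v) = F (f v)" if "v \<in> carrier M" for v
    using im[OF that] by (simp_all add: F'_def inv_into_into f_inv_into_f)
  have m: "act M mat_h v \<in> carrier M" "act M mat_e v \<in> carrier M" if "v \<in> carrier M" for v
    using lie_moduleD(6)[OF M _ that] by auto
  have fm: "f (v \<ominus>\<^bsub>M\<^esub> w) = f v \<ominus>\<^bsub>D\<^esub> f w" if "v \<in> carrier M" "w \<in> carrier M" for v w
    by (rule lin_minus[OF lie_moduleD(1)[OF M] D f(1) that])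
  have eqI: "v = w" if "f v = f w" "v \<in> carrier M" "w \<in> carrier M" for v w using inj_onD[OF f(2) that] .
  have "lin M M F'"
    by (rule linI) (auto intro!: eqI simp: F' S L linD(2,3)[OF FD(1)])
  moreover have "act M mat_h (F' v) = F' (act M mat_h v) \<ominus>\<^bsub>M\<^esub> 2 \<odot>\<^bsub>M\<^esub> F' v" if "v \<in> carrier M" for v
    by (rule eqI) (simp_all add: that m F' S L fm h FD(3))
  moreover have "act M mat_e (F' v) = F' (act M mat_e v) \<oplus>\<^bsub>M\<^esub> (act M mat_h v \<ominus>\<^bsub>M\<^esub> l \<odot>\<^bsub>M\<^esub> v)" if "v \<in> carrier M" for v
    by (rule eqI) (simp_all add: that m F' S L fm h e FD(4))
  ultimately have "sl2ext l M F'" by (simp add: sl2ext_def)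
  thus ?thesis by blast
qed

text \<open>The projection p to \<open>A\<close> along \<open>B\<close> is an endomorphism of the
  module and hence commutes with \<open>F\<close>, so F v = F (p v) = p (F v) lies in
  \<open>A\<close>.\<close>

lemma sl2ext_summand:
  assumes D: "lie_module borel D" "fd D" and F: "sl2ext l D F"
    and A: "lie_submodule borel A D" and B: "lie_submodule borel B D"
    and int: "A \<inter> B = {\<zero>\<^bsub>D\<^esub>}" and sum: "A <+>\<^bsub>D\<^esub> B = carrier D" and v: "v \<in> A"
  shows "F v \<in> A"
proof -
  note S = cvs_simps[OF lie_moduleD(1)[OF D(1)]] and FD = sl2extD[OF F] and LD = linD[OF lie_moduleD(2)[OF D(1)]]
  have sub: "X \<subseteq> carrier D" "\<zero>\<^bsub>D\<^esub> \<in> X" "\<lbrakk>x \<in> X; y \<in> X\<rbrakk> \<Longrightarrow> x \<oplus>\<^bsub>D\<^esub> y \<in> X" "x \<in> X \<Longrightarrow> c \<odot>\<^bsub>D\<^esub> x \<in> X"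
    "\<lbrakk>z \<in> borel; x \<in> X\<rbrakk> \<Longrightarrow> act D z x \<in> X" if "X = A \<or> X = B" for X x y c z
    using A B that by (auto simp: lie_submodule_def subspace_iff)
  note sA = sub[OF disjI1[OF refl]] and sB = sub[OF disjI2[OF refl]]
  have Ac: "x \<in> carrier D" if "x \<in> A" for x using sA(1) that by blast
  have Bc: "x \<in> carrier D" if "x \<in> B" for x using sB(1) that by blast
  have "\<exists>a b. a \<in> A \<and> b \<in> B \<and> x = a \<oplus>\<^bsub>D\<^esub> b" if "x \<in> carrier D" for x
    using that unfolding sum[symmetric] by (auto simp: set_add_def')
  then obtain p q where pq: "p x \<in> A" "q x \<in> B" "p x \<oplus>\<^bsub>D\<^esub> q x = x" if "x \<in> carrier D" for x
    by metis
  \<comment> \<open>Uniqueness of the decomposition turns linearity and equivariance of the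
    projection into membership checks for the two components.\<close>
  have uniq: "p x = a" if a: "a \<in> A" and b: "b \<in> B" and x: "x = a \<oplus>\<^bsub>D\<^esub> b" for x a b
  proof -
    have xc: "x \<in> carrier D" using a b by (simp add: x S Ac Bc)
    note P = pq[OF xc]
    have "p x \<ominus>\<^bsub>D\<^esub> a = b \<ominus>\<^bsub>D\<^esub> q x"
    proof (rule sep_fd[OF D(2)])
      fix \<chi> :: "'a \<Rightarrow> complex"
      assume add: "\<And>x y. \<lbrakk>x \<in> carrier D; y \<in> carrier D\<rbrakk> \<Longrightarrow> \<chi> (x \<oplus>\<^bsub>D\<^esub> y) = \<chi> x + \<chi> y"
        and minus: "\<And>x y. \<lbrakk>x \<in> carrier D; y \<in> carrier D\<rbrakk> \<Longrightarrow> \<chi> (x \<ominus>\<^bsub>D\<^esub> y) = \<chi> x - \<chi> y"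
      have "\<chi> (p x) + \<chi> (q x) = \<chi> a + \<chi> b"
        using arg_cong[OF P(3), of \<chi>] add[OF Ac[OF P(1)] Bc[OF P(2)]] add[OF Ac[OF a] Bc[OF b]] x by simp
      thus "\<chi> (p x \<ominus>\<^bsub>D\<^esub> a) = \<chi> (b \<ominus>\<^bsub>D\<^esub> q x)" using P a b by (simp add: minus Ac Bc algebra_simps)
    qed (use P a b in \<open>simp_all add: S Ac Bc\<close>)
    moreover have "p x \<ominus>\<^bsub>D\<^esub> a \<in> A"
      unfolding cvs_distribs(3)[OF lie_moduleD(1)[OF D(1)] Ac[OF P(1)] Ac[OF a]] using P a sA(3,4) by blast
    moreover have "b \<ominus>\<^bsub>D\<^esub> q x \<in> B"
      unfolding cvs_distribs(3)[OF lie_moduleD(1)[OF D(1)] Bc[OF b] Bc[OF P(2)]] using P b sB(3,4) by blast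
    ultimately have "p x \<ominus>\<^bsub>D\<^esub> a = \<zero>\<^bsub>D\<^esub>" using int by auto
    thus "p x = a" using cvs_distribs(8)[OF lie_moduleD(1)[OF D(1)] Ac[OF P(1)] Ac[OF a]] by simp
  qed
  have pl: "lin D D p"
  proof (rule linI)
    fix x y assume x: "x \<in> carrier D" and y: "y \<in> carrier D"
    show "p (x \<oplus>\<^bsub>D\<^esub> y) = p x \<oplus>\<^bsub>D\<^esub> p y"
    proof (rule uniq)
      have "x \<oplus>\<^bsub>D\<^esub> y = (p x \<oplus>\<^bsub>D\<^esub> q x) \<oplus>\<^bsub>D\<^esub> (p y \<oplus>\<^bsub>D\<^esub> q y)" using pq x y by simp
      also have "\<dots> = (p x \<oplus>\<^bsub>D\<^esub> p y) \<oplus>\<^bsub>D\<^esub> (q x \<oplus>\<^bsub>D\<^esub> q y)"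
        using pq(1,2)[OF x] pq(1,2)[OF y] by (intro sep_fd[OF D(2)]) (simp_all add: S Ac Bc)
      finally show "x \<oplus>\<^bsub>D\<^esub> y = (p x \<oplus>\<^bsub>D\<^esub> p y) \<oplus>\<^bsub>D\<^esub> (q x \<oplus>\<^bsub>D\<^esub> q y)" .
    qed (use pq[OF x] pq[OF y] sA(3) sB(3) in blast)+
  next
    fix x c assume x: "x \<in> carrier D"
    show "p (c \<odot>\<^bsub>D\<^esub> x) = c \<odot>\<^bsub>D\<^esub> p x"
      by (rule uniq[of _ "c \<odot>\<^bsub>D\<^esub> q x"])
        (use pq[OF x] sA(4) sB(4) cvs_distribs(2)[OF lie_moduleD(1)[OF D(1)] Ac[OF pq(1)[OF x]] Bc[OF pq(2)[OF x]], of c] in auto)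
  qed (use pq Ac in blast)
  have "restrict p (carrier D) \<in> lie_hom borel D D"
  proof (rule lie_hom_restrictI[OF D(1) pl])
    fix z x assume z: "z \<in> borel" and x: "x \<in> carrier D"
    show "p (act D z x) = act D z (p x)"
      by (rule uniq[of _ "act D z (q x)"])
        (use pq[OF x] sA(5)[OF z] sB(5)[OF z] LD(2)[OF z Ac[OF pq(1)[OF x]] Bc[OF pq(2)[OF x]]] in auto)
  qed
  from hom_commutes_F[OF D(1) D(1) D(2) D(2) F F this Ac[OF v]]
  have "p (F v) = F (p v)" using FD(2) Ac[OF v] by simp
  moreover have "p v = v" by (rule uniq[OF v sB(2)]) (simp add: S Ac v)
  ultimately show ?thesis using pq(1)[OF FD(2)[OF Ac[OF v]]] by simp
qed

text \<open>Trades direct summands for an intrinsic criterion: stability under images of idempotents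
  and under the action then amounts to exhibiting one operator. In the direction from right to left,
  the module is isomorphic to a whole direct sum, that is, to a summand with zero
  complement.\<close>

theorem Ob_N6:
  fixes M :: "'u lmod"
  shows "M \<in> Ob (N6 l) \<longleftrightarrow> lie_module borel M \<and> fd M \<and> (\<exists>F. sl2ext l M F)"
proof
  assume "M \<in> Ob (N6 l)"
  then obtain Ms A B where M: "lie_module borel M" and Ms: "set Ms \<subseteq> range (Qmod l)"
    and AB: "lie_submodule borel A (lie_direct_sum Ms)" "lie_submodule borel B (lie_direct_sum Ms)"
      "A \<inter> B = {\<zero>\<^bsub>lie_direct_sum Ms\<^esub>}" "A <+>\<^bsub>lie_direct_sum Ms\<^esub> B = carrier (lie_direct_sum Ms)"
    and iso: "lie_isomorphic borel M ((lie_direct_sum Ms)\<lparr>carrier := A\<rparr>)"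
    unfolding N6_def additive_closure_def by auto
  from Ms obtain ns where ns: "Ms = map (Qmod l) ns" by (metis ex_map_conv image_iff subsetD)
  define D where "D = lie_direct_sum Ms"
  from Qmod_direct_sum[of l ns] obtain b where D: "lie_module borel D" and q: "qbasis l D b {..<length ns} (\<lambda>j. ns ! j)"
    unfolding D_def ns by blast
  obtain F where F: "sl2ext l D F" using qbasis_imp_sl2ext[OF D q] by blast
  have fD: "fd D" by (rule qbasisD(5)[OF q])
  from iso obtain f where f: "f \<in> lie_hom borel M (D\<lparr>carrier := A\<rparr>)" "bij_betw f (carrier M) A"
    unfolding lie_isomorphic_def D_def by auto
  have AD: "A \<subseteq> carrier D" using AB(1) by (simp add: lie_submodule_def subspace_iff D_def)
  have fl: "lin M D f" using lie_homD(1)[OF f(1)] AD by (auto simp: lin_iff)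
  have inj: "inj_on f (carrier M)" using f(2) by (rule bij_betw_imp_inj_on)
  have im: "f ` carrier M = A" using f(2) by (rule bij_betw_imp_surj_on)
  have "\<exists>F'. sl2ext l M F'"
  proof (rule sl2ext_pullback[OF M fd_cvs[OF fD] F fl inj])
    show "F (f v) \<in> f ` carrier M" if "v \<in> carrier M" for v
      unfolding im by (rule sl2ext_summand[OF D fD F AB[folded D_def]]) (use im that in blast)
  qed (use lie_homD(4)[OF f(1)] in simp_all)
  thus "lie_module borel M \<and> fd M \<and> (\<exists>F. sl2ext l M F)"
    using M fd_of_inj_fd[OF lie_moduleD(1)[OF M] fD fl inj] by blast
next
  assume "lie_module borel M \<and> fd M \<and> (\<exists>F. sl2ext l M F)"
  then obtain b :: "nat \<times> nat \<Rightarrow> 'u" and N :: nat and n where M: "lie_module borel M" and q: "qbasis l M b {..<N} n"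
    using sl2ext_imp_qbasis by metis
  define ns where "ns = map n [0..<N]"
  have len: "length ns = N" by (simp add: ns_def)
  define D where "D = lie_direct_sum (map (Qmod l) ns)"
  from Qmod_direct_sum[of l ns] obtain b' where D: "lie_module borel D" and q': "qbasis l D b' {..<length ns} (\<lambda>j. ns ! j)"
    unfolding D_def by blast
  have "qbasis l D b' {..<N} n" by (rule qbasis_cong[OF q'[unfolded len]]) (simp_all add: ns_def)
  from qbasis_iso[OF M q D this] obtain f where f: "f \<in> lie_hom borel M D" "bij_betw f (carrier M) (carrier D)" by blast
  note S = cvs_simps[OF lie_moduleD(1)[OF D]]
  have upd: "D\<lparr>carrier := carrier D\<rparr> = D" by simp
  have sub: "lie_submodule borel (carrier D) D" "lie_submodule borel {\<zero>\<^bsub>D\<^esub>} D"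
    using lie_moduleD(1)[OF D] lie_moduleD(6)[OF D] lin_zero[OF lie_moduleD(1,1)[OF D] lie_moduleD(2)[OF D]]
    by (auto simp: lie_submodule_def subspace_iff S)
  have int: "carrier D \<inter> {\<zero>\<^bsub>D\<^esub>} = {\<zero>\<^bsub>D\<^esub>}" "carrier D <+>\<^bsub>D\<^esub> {\<zero>\<^bsub>D\<^esub>} = carrier D"
    using S by (auto simp: set_add_def' intro!: exI[of _ "\<zero>\<^bsub>D\<^esub>"])
  have iso: "lie_isomorphic borel M (D\<lparr>carrier := carrier D\<rparr>)" unfolding upd lie_isomorphic_def using f by blast
  have "\<exists>Ms A B. set Ms \<subseteq> range (Qmod l) \<and> lie_submodule borel A (lie_direct_sum Ms) \<and> lie_submodule borel B (lie_direct_sum Ms) \<and>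
      A \<inter> B = {\<zero>\<^bsub>lie_direct_sum Ms\<^esub>} \<and> A <+>\<^bsub>lie_direct_sum Ms\<^esub> B = carrier (lie_direct_sum Ms) \<and>
      lie_isomorphic borel M ((lie_direct_sum Ms)\<lparr>carrier := A\<rparr>)"
    by (rule exI[of _ "map (Qmod l) ns"], rule exI[of _ "carrier D"], rule exI[of _ "{\<zero>\<^bsub>D\<^esub>}"])
      (use sub int iso in \<open>auto simp: D_def\<close>)
  thus "M \<in> Ob (N6 l)" using M by (simp add: N6_def additive_closure_def)
qed

lemma Ob_N6_qbasis:
  fixes M :: "'u lmod"
  shows "\<lbrakk>lie_module borel M; qbasis l M b J n\<rbrakk> \<Longrightarrow> M \<in> Ob (N6 l)"
    and "M \<in> Ob (N6 l) \<Longrightarrow> \<exists>(b :: nat \<times> nat \<Rightarrow> 'u) N n. qbasis l M b {..<N} n"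
  using qbasis_imp_sl2ext[of M l b J n] qbasisD(5)[of l M b J n] sl2ext_imp_qbasis[of M l] by (auto simp: Ob_N6)

definition mat_f :: "complex mat"
  where "mat_f = mat_of_rows_list 2 [[0, 0], [1, 0]]"

lemma mat_f_entries [simp]: "mat_f \<in> carrier_mat 2 2" "mat_f $$ (0, 0) = 0" "mat_f $$ (0, Suc 0) = 0"
  "mat_f $$ (Suc 0, 0) = 1" "mat_f $$ (Suc 0, Suc 0) = 0" "dim_row mat_f = 2" "dim_col mat_f = 2"
  by (rule carrier_matI | simp_all add: mat_f_def mat_of_rows_list_def)+

lemma mat_f [simp]: "mat_f \<in> sl2"
  "mat_h * mat_f - mat_f * mat_h = (-2) \<cdot>\<^sub>m mat_f" "mat_e * mat_f - mat_f * mat_e = mat_h"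
proof -
  show "mat_f \<in> sl2" by (simp add: sl2_iff)
  show "mat_h * mat_f - mat_f * mat_h = (-2) \<cdot>\<^sub>m mat_f"
    by (rule mat2_eqI) (auto simp: mat2_mult simp del: index_mult_mat(1) intro!: minus_carrier_mat)
  show "mat_e * mat_f - mat_f * mat_e = mat_h"
    by (rule mat2_eqI) (auto simp: mat2_mult simp del: index_mult_mat(1) intro!: minus_carrier_mat)
qed

text \<open>On a genuine \<open>sl2\<close>-module the matrix f supplies the operator, with shift
  0.\<close>

lemma sl2_module_ext:
  assumes V: "lie_module sl2 V" "fd V"
  shows "sl2ext 0 V (act V mat_f)"
proof -
  note D = lie_moduleD[OF V(1)] and S = cvs_simps[OF fd_cvs[OF V(2)]]
  have he: "mat_h \<in> sl2" "mat_e \<in> sl2" using borel_subset_sl2 by auto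
  have m: "act V x w \<in> carrier V" if "x \<in> {mat_h, mat_e, mat_f}" "w \<in> carrier V" for x w using that D(6) he by auto
  have "act V mat_h (act V mat_f v) = act V mat_f (act V mat_h v) \<ominus>\<^bsub>V\<^esub> 2 \<odot>\<^bsub>V\<^esub> act V mat_f v"
    "act V mat_e (act V mat_f v) = act V mat_f (act V mat_e v) \<oplus>\<^bsub>V\<^esub> (act V mat_h v \<ominus>\<^bsub>V\<^esub> 0 \<odot>\<^bsub>V\<^esub> v)" if v: "v \<in> carrier V" for v
  proof -
    have "(-2) \<odot>\<^bsub>V\<^esub> act V mat_f v = act V mat_h (act V mat_f v) \<ominus>\<^bsub>V\<^esub> act V mat_f (act V mat_h v)"
      using D(4)[of mat_f v "-2"] D(5)[of mat_h mat_f v] v he by simp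
    moreover have "act V mat_f (act V mat_h v) \<ominus>\<^bsub>V\<^esub> 2 \<odot>\<^bsub>V\<^esub> act V mat_f v = act V mat_f (act V mat_h v) \<oplus>\<^bsub>V\<^esub> (-2) \<odot>\<^bsub>V\<^esub> act V mat_f v"
      by (rule sep_fd[OF V(2)]) (simp_all add: S m v)
    moreover have "act V mat_h (act V mat_f v) = act V mat_f (act V mat_h v) \<oplus>\<^bsub>V\<^esub> (act V mat_h (act V mat_f v) \<ominus>\<^bsub>V\<^esub> act V mat_f (act V mat_h v))"
      by (rule sep_fd[OF V(2)]) (simp_all add: S m v)
    ultimately show "act V mat_h (act V mat_f v) = act V mat_f (act V mat_h v) \<ominus>\<^bsub>V\<^esub> 2 \<odot>\<^bsub>V\<^esub> act V mat_f v" by simp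
    have "act V mat_h v = act V mat_e (act V mat_f v) \<ominus>\<^bsub>V\<^esub> act V mat_f (act V mat_e v)"
      using D(5)[of mat_e mat_f v] v he by simp
    thus "act V mat_e (act V mat_f v) = act V mat_f (act V mat_e v) \<oplus>\<^bsub>V\<^esub> (act V mat_h v \<ominus>\<^bsub>V\<^esub> 0 \<odot>\<^bsub>V\<^esub> v)"
      by (intro sep_fd[OF V(2)]) (simp_all add: S m v)
  qed
  thus ?thesis using D(2)[of mat_f] by (simp add: sl2ext_def)
qed

context embedded_complex
begin

text \<open>The operator is F \<otimes> 1 + 1 \<otimes> G. The shifts add because h - (l + m) acts
  as (h - l) \<otimes> 1 + 1 \<otimes> (h - m); an \<open>sl2\<close>-module has shift 0, so
  tensoring with it preserves the parameter of the other factor.\<close>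

lemma sl2ext_tensor:
  fixes V M :: "'u lmod"
  assumes V: "lie_module borel V" "fd V" and M: "lie_module borel M" "fd M"
    and F: "sl2ext l V F" and G: "sl2ext m M G"
  shows "\<exists>H. sl2ext (l + m) (tensor V M) H"
proof -
  let ?T = "tensor V M" and ?p = "pure_tensor V M"
  note DF = sl2extD[OF F] and DG = sl2extD[OF G]
  have T: "lie_module borel ?T" "fd ?T" by (rule lie_module_tensor[OF lie_closed_borel V M]) (rule fd_tensor[OF V(2) M(2)])
  note cT = lie_moduleD(1)[OF T(1)]
  define F1 where "F1 = tmap V M V M F (\<lambda>w. w)"
  define G1 where "G1 = tmap V M V M (\<lambda>v. v) G"
  note PF = tmap_props[OF V(2) M(2) V(2) M(2) DF(1) lin_id, folded F1_def]
  note PG = tmap_props[OF V(2) M(2) V(2) M(2) lin_id DG(1), folded G1_def]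
  define H where "H = (\<lambda>x. F1 x \<oplus>\<^bsub>?T\<^esub> G1 x)"
  have H: "lin ?T ?T H" unfolding H_def by (rule lin_add[OF cT PF(1) PG(1)])
  have Hp: "H (?p v w) = ?p (F v) w \<oplus>\<^bsub>?T\<^esub> ?p v (G w)" if "v \<in> carrier V" "w \<in> carrier M" for v w
    unfolding H_def by (simp only: PF(3)[OF that] PG(3)[OF that])
  note he = he_borel
  have h: "lin ?T ?T (act ?T x)" "lin V V (act V x)" "lin M M (act M x)" if "x \<in> borel" for x
    using lie_moduleD(2)[OF T(1) that] lie_moduleD(2)[OF V(1) that] lie_moduleD(2)[OF M(1) that] by auto
  have act: "act ?T x (?p v w) = ?p (act V x v) w \<oplus>\<^bsub>?T\<^esub> ?p v (act M x w)" if "x \<in> borel" "v \<in> carrier V" "w \<in> carrier M" for x v w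
    by (rule tensor_act(2)[OF V M that])
  note B = pt_bilinear[OF V(2) M(2)]
  note BD = bilinear_mapD[OF B]
  have bm: "?p (v \<ominus>\<^bsub>V\<^esub> v') w = ?p v w \<ominus>\<^bsub>?T\<^esub> ?p v' w" if "v \<in> carrier V" "v' \<in> carrier V" "w \<in> carrier M" for v v' w
    by (rule lin_minus[OF fd_cvs[OF V(2)] cT BD(2)[OF that(3)] that(1,2)])
  have bm': "?p v (w \<ominus>\<^bsub>M\<^esub> w') = ?p v w \<ominus>\<^bsub>?T\<^esub> ?p v w'" if "v \<in> carrier V" "w \<in> carrier M" "w' \<in> carrier M" for v w w'
    by (rule lin_minus[OF fd_cvs[OF M(2)] cT BD(1)[OF that(1)] that(2,3)])
  note S = cvs_simps[OF cT] cvs_simps(1-4)[OF fd_cvs[OF V(2)]] cvs_simps(1-4)[OF fd_cvs[OF M(2)]]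
  have mem: "act V mat_h v \<in> carrier V" "act V mat_e v \<in> carrier V" "F v \<in> carrier V" if "v \<in> carrier V" for v
    using lie_moduleD(6)[OF V(1) _ that] DF(2)[OF that] by auto
  have mem': "act M mat_h v \<in> carrier M" "act M mat_e v \<in> carrier M" "G v \<in> carrier M" if "v \<in> carrier M" for v
    using lie_moduleD(6)[OF M(1) _ that] DG(2)[OF that] by auto
  have LH: "lin ?T ?T (\<lambda>x. H (act ?T mat_h x) \<ominus>\<^bsub>?T\<^esub> 2 \<odot>\<^bsub>?T\<^esub> H x)"
    by (rule lin_diff[OF cT lin_compose[OF h(1) H] lin_smult[OF cT H]]) simp
  have LE: "lin ?T ?T (\<lambda>x. H (act ?T mat_e x) \<oplus>\<^bsub>?T\<^esub> (act ?T mat_h x \<ominus>\<^bsub>?T\<^esub> (l + m) \<odot>\<^bsub>?T\<^esub> x))"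
    by (rule lin_add[OF cT lin_compose[OF h(1) H] lin_diff[OF cT h(1) lin_smult[OF cT lin_id]]]) simp_all
  have "act ?T mat_h (H x) = H (act ?T mat_h x) \<ominus>\<^bsub>?T\<^esub> 2 \<odot>\<^bsub>?T\<^esub> H x" if "x \<in> carrier ?T" for x
  proof (rule tensor_ext[OF V(2) M(2) cT lin_compose[OF H h(1)[OF he(1)]] LH])
    fix v w assume v: "v \<in> carrier V" and w: "w \<in> carrier M"
    show "act ?T mat_h (H (?p v w)) = H (act ?T mat_h (?p v w)) \<ominus>\<^bsub>?T\<^esub> 2 \<odot>\<^bsub>?T\<^esub> H (?p v w)"
      by (rule sep_fd[OF T(2)]) (simp_all add: v w S mem mem' BD(3-7) bm bm' Hp act DF(3) DG(3) linD(2)[OF H] linD(2)[OF h(1)] del: tensor_sel,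
        (simp add: algebra_simps)?)
  qed (use that in simp)
  moreover have "act ?T mat_e (H x) = H (act ?T mat_e x) \<oplus>\<^bsub>?T\<^esub> (act ?T mat_h x \<ominus>\<^bsub>?T\<^esub> (l + m) \<odot>\<^bsub>?T\<^esub> x)" if "x \<in> carrier ?T" for x
  proof (rule tensor_ext[OF V(2) M(2) cT lin_compose[OF H h(1)[OF he(2)]] LE])
    fix v w assume v: "v \<in> carrier V" and w: "w \<in> carrier M"
    show "act ?T mat_e (H (?p v w)) = H (act ?T mat_e (?p v w)) \<oplus>\<^bsub>?T\<^esub> (act ?T mat_h (?p v w) \<ominus>\<^bsub>?T\<^esub> (l + m) \<odot>\<^bsub>?T\<^esub> ?p v w)"
      by (rule sep_fd[OF T(2)]) (simp_all add: v w S mem mem' BD(3-7) bm bm' Hp act DF(4) DG(4) linD(2)[OF H] linD(2)[OF h(1)] del: tensor_sel,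
        (simp add: algebra_simps)?)
  qed (use that in simp)
  ultimately have "sl2ext (l + m) ?T H" using H by (simp add: sl2ext_def del: tensor_sel)
  thus ?thesis by blast
qed

lemma lie_action_N6: "lie_action embed borel (N6 l :: ('u lmod, 'u arrow, 'u lmod, 'u arrow) modcat)"
proof unfold_locales
  fix V X :: "'u lmod" assume V: "V \<in> Ob sl2_mod" and X: "X \<in> Ob (N6 l)"
  hence V': "lie_module borel V" "fd V" "lie_module sl2 V" using lie_module_subset[OF _ borel_subset_sl2] by (auto simp: Ob_sl2_mod)
  from X obtain F where X': "lie_module borel X" "fd X" "sl2ext l X F" by (auto simp: Ob_N6)
  from sl2ext_tensor[OF V'(1,2) X'(1,2) sl2_module_ext[OF V'(3,2)] X'(3)]
  show "tensor V X \<in> Ob (N6 l)"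
    using lie_module_tensor[OF lie_closed_borel V'(1,2) X'(1,2)] fd_tensor[OF V'(2) X'(2)] by (simp add: Ob_N6)
qed (use borel_subset_sl2 lie_closed_borel in \<open>auto simp: Ob_N6 N6_def[of l, THEN arg_cong[of _ _ Hom]] N6_def[of l, THEN arg_cong[of _ _ Id]] N6_def[of l, THEN arg_cong[of _ _ Cmp]]\<close>)

end

section \<open>An abstract criterion for type A-infinity and simple transitivity\<close>

section \<open>Linear categories generated by bricks\<close>

context linear_category
begin

lemma Cmp_lin:
  assumes "X \<in> Ob C" "Y \<in> Ob C" "Z \<in> Ob C"
  shows "g \<in> Arr C Y Z \<Longrightarrow> lin (Hom C X Y) (Hom C X Z) (Cmp C g)"
    "f \<in> Arr C X Y \<Longrightarrow> lin (Hom C Y Z) (Hom C X Z) (\<lambda>g. Cmp C g f)"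
  using Cmp_arr[OF assms] Cmp_add_left[OF assms] Cmp_add_right[OF assms] Cmp_smult_left[OF assms] Cmp_smult_right[OF assms]
  by (simp_all add: lin_iff)

lemma Cmp_zero:
  assumes "X \<in> Ob C" "Y \<in> Ob C" "Z \<in> Ob C"
  shows "g \<in> Arr C Y Z \<Longrightarrow> Cmp C g \<zero>\<^bsub>Hom C X Y\<^esub> = \<zero>\<^bsub>Hom C X Z\<^esub>"
    "f \<in> Arr C X Y \<Longrightarrow> Cmp C \<zero>\<^bsub>Hom C Y Z\<^esub> f = \<zero>\<^bsub>Hom C X Z\<^esub>"
  using lin_zero[OF Hom_vectorspace Hom_vectorspace Cmp_lin(1)] lin_zero[OF Hom_vectorspace Hom_vectorspace Cmp_lin(2)] assms by blast+

lemma Cmp_minus: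
  assumes "X \<in> Ob C" "Y \<in> Ob C" "Z \<in> Ob C"
  shows "\<lbrakk>g \<in> Arr C Y Z; f \<in> Arr C X Y; f' \<in> Arr C X Y\<rbrakk> \<Longrightarrow> Cmp C g (f \<ominus>\<^bsub>Hom C X Y\<^esub> f') = Cmp C g f \<ominus>\<^bsub>Hom C X Z\<^esub> Cmp C g f'"
    "\<lbrakk>f \<in> Arr C X Y; g \<in> Arr C Y Z; g' \<in> Arr C Y Z\<rbrakk> \<Longrightarrow> Cmp C (g \<ominus>\<^bsub>Hom C Y Z\<^esub> g') f = Cmp C g f \<ominus>\<^bsub>Hom C X Z\<^esub> Cmp C g' f"
  using lin_minus[OF Hom_vectorspace Hom_vectorspace Cmp_lin(1)] lin_minus[OF Hom_vectorspace Hom_vectorspace Cmp_lin(2)] assms by blast+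

lemma direct_sumE:
  assumes "direct_sum C Xs P"
  obtains inj prj where "\<And>i. i < length Xs \<Longrightarrow> Xs ! i \<in> Ob C" "P \<in> Ob C"
    "\<And>i. i < length Xs \<Longrightarrow> inj i \<in> Arr C (Xs ! i) P" "\<And>i. i < length Xs \<Longrightarrow> prj i \<in> Arr C P (Xs ! i)"
    "\<And>i. i < length Xs \<Longrightarrow> Cmp C (prj i) (inj i) = Id C (Xs ! i)"
    "\<And>i j. \<lbrakk>i < length Xs; j < length Xs; i \<noteq> j\<rbrakk> \<Longrightarrow> Cmp C (prj i) (inj j) = \<zero>\<^bsub>Hom C (Xs ! j) (Xs ! i)\<^esub>"
    "finsum (Hom C P P) (\<lambda>i. Cmp C (inj i) (prj i)) {..<length Xs} = Id C P"
proof -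
  from assms obtain inj prj where "set Xs \<subseteq> Ob C" "P \<in> Ob C"
    and a: "\<forall>i<length Xs. inj i \<in> Arr C (Xs ! i) P \<and> prj i \<in> Arr C P (Xs ! i)"
    and b: "\<forall>i<length Xs. \<forall>j<length Xs. Cmp C (prj i) (inj j) = (if i = j then Id C (Xs ! i) else \<zero>\<^bsub>Hom C (Xs ! j) (Xs ! i)\<^esub>)"
    and c: "finsum (Hom C P P) (\<lambda>i. Cmp C (inj i) (prj i)) {..<length Xs} = Id C P"
    unfolding direct_sum_def by blast
  from this(1) have "Xs ! i \<in> Ob C" if "i < length Xs" for i using that nth_mem by blast
  thus thesis using \<open>P \<in> Ob C\<close> a b c by (intro that[of inj prj]) auto
qed

lemma direct_sum_pairI:
  assumes "A \<in> Ob C" "B \<in> Ob C" "P \<in> Ob C"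
    and "i \<in> Arr C A P" "p \<in> Arr C P A" "j \<in> Arr C B P" "q \<in> Arr C P B"
    and "Cmp C p i = Id C A" "Cmp C q j = Id C B" "Cmp C p j = \<zero>\<^bsub>Hom C B A\<^esub>" "Cmp C q i = \<zero>\<^bsub>Hom C A B\<^esub>"
    and "Cmp C i p \<oplus>\<^bsub>Hom C P P\<^esub> Cmp C j q = Id C P"
  shows "direct_sum C [A, B] P"
proof -
  interpret H: vectorspace "class_ring :: complex ring" "Hom C P P" by (rule Hom_vectorspace) fact+
  let ?i = "\<lambda>k :: nat. if k = 0 then i else j" and ?p = "\<lambda>k :: nat. if k = 0 then p else q"
  have m: "Cmp C i p \<in> Arr C P P" "Cmp C j q \<in> Arr C P P" using assms Cmp_arr by blast+
  have "{..<2 :: nat} = {0, 1}" by auto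
  hence "finsum (Hom C P P) (\<lambda>k. Cmp C (?i k) (?p k)) {..<2} = Id C P"
    using m assms(12) by simp
  thus ?thesis
    unfolding direct_sum_def using assms(1-11)
    by (intro conjI exI[of _ ?i] exI[of _ ?p]) (auto simp: less_2_cases_iff numeral_2_eq_2 nth_Cons')
qed

text \<open>Inserting the identity of \<open>X\<close> as a sum over the summands expresses
  \<open>f\<close> through its restrictions, which cannot all vanish. With the dual statement below,
  a nonzero arrow has a nonzero component between summands.\<close>

lemma nonzero_on_summand:
  assumes X: "direct_sum C Xs X" and Y: "Y \<in> Ob C" and f: "f \<in> Arr C X Y" "f \<noteq> \<zero>\<^bsub>Hom C X Y\<^esub>"
  shows "\<exists>i<length Xs. \<exists>j\<in>Arr C (Xs ! i) X. Cmp C f j \<noteq> \<zero>\<^bsub>Hom C (Xs ! i) Y\<^esub>"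
proof (rule ccontr)
  assume no: "\<not> ?thesis"
  obtain inj prj where D: "\<And>i. i < length Xs \<Longrightarrow> Xs ! i \<in> Ob C" "X \<in> Ob C"
    "\<And>i. i < length Xs \<Longrightarrow> inj i \<in> Arr C (Xs ! i) X" "\<And>i. i < length Xs \<Longrightarrow> prj i \<in> Arr C X (Xs ! i)"
    and s: "finsum (Hom C X X) (\<lambda>i. Cmp C (inj i) (prj i)) {..<length Xs} = Id C X"
    using X by (rule direct_sumE) blast
  interpret H: vectorspace "class_ring :: complex ring" "Hom C X Y" by (rule Hom_vectorspace) fact+
  have m: "(\<lambda>i. Cmp C (inj i) (prj i)) \<in> {..<length Xs} \<rightarrow> Arr C X X" using Cmp_arr D by blast
  have "f = Cmp C f (finsum (Hom C X X) (\<lambda>i. Cmp C (inj i) (prj i)) {..<length Xs})"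
    unfolding s using Cmp_Id_right D(2) Y f(1) by simp
  also have "\<dots> = finsum (Hom C X Y) (\<lambda>i. Cmp C f (Cmp C (inj i) (prj i))) {..<length Xs}"
    by (rule lin_finsum[OF Hom_vectorspace Hom_vectorspace Cmp_lin(1) m]) (use D(2) Y f in auto)
  also have "\<dots> = finsum (Hom C X Y) (\<lambda>i. \<zero>\<^bsub>Hom C X Y\<^esub>) {..<length Xs}"
  proof (rule H.finsum_cong')
    fix i assume "i \<in> {..<length Xs}"
    hence i: "i < length Xs" by simp
    have "Cmp C f (Cmp C (inj i) (prj i)) = Cmp C (Cmp C f (inj i)) (prj i)"
      using Cmp_assoc[OF D(2) D(1)[OF i] D(2) Y D(4)[OF i] D(3)[OF i] f(1)] .
    also have "Cmp C f (inj i) = \<zero>\<^bsub>Hom C (Xs ! i) Y\<^esub>" using no i D(3) by blast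
    finally show "Cmp C f (Cmp C (inj i) (prj i)) = \<zero>\<^bsub>Hom C X Y\<^esub>" using Cmp_zero(2) D i Y by simp
  qed auto
  finally show False using f(2) by simp
qed

lemma nonzero_in_summand:
  assumes Y: "direct_sum C Ys Y" and X: "X \<in> Ob C" and f: "f \<in> Arr C X Y" "f \<noteq> \<zero>\<^bsub>Hom C X Y\<^esub>"
  shows "\<exists>i<length Ys. \<exists>p\<in>Arr C Y (Ys ! i). Cmp C p f \<noteq> \<zero>\<^bsub>Hom C X (Ys ! i)\<^esub>"
proof (rule ccontr)
  assume no: "\<not> ?thesis"
  obtain inj prj where D: "\<And>i. i < length Ys \<Longrightarrow> Ys ! i \<in> Ob C" "Y \<in> Ob C"
    "\<And>i. i < length Ys \<Longrightarrow> inj i \<in> Arr C (Ys ! i) Y" "\<And>i. i < length Ys \<Longrightarrow> prj i \<in> Arr C Y (Ys ! i)"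
    and s: "finsum (Hom C Y Y) (\<lambda>i. Cmp C (inj i) (prj i)) {..<length Ys} = Id C Y"
    using Y by (rule direct_sumE) blast
  interpret H: vectorspace "class_ring :: complex ring" "Hom C X Y" by (rule Hom_vectorspace) fact+
  have m: "(\<lambda>i. Cmp C (inj i) (prj i)) \<in> {..<length Ys} \<rightarrow> Arr C Y Y" using Cmp_arr D by blast
  have "f = Cmp C (finsum (Hom C Y Y) (\<lambda>i. Cmp C (inj i) (prj i)) {..<length Ys}) f"
    unfolding s using Cmp_Id_left D(2) X f(1) by simp
  also have "\<dots> = finsum (Hom C X Y) (\<lambda>i. Cmp C (Cmp C (inj i) (prj i)) f) {..<length Ys}"
    by (rule lin_finsum[OF Hom_vectorspace Hom_vectorspace Cmp_lin(2) m]) (use D(2) X f in auto)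
  also have "\<dots> = finsum (Hom C X Y) (\<lambda>i. \<zero>\<^bsub>Hom C X Y\<^esub>) {..<length Ys}"
  proof (rule H.finsum_cong')
    fix i assume "i \<in> {..<length Ys}"
    hence i: "i < length Ys" by simp
    have "Cmp C (Cmp C (inj i) (prj i)) f = Cmp C (inj i) (Cmp C (prj i) f)"
      using Cmp_assoc[OF X D(2) D(1)[OF i] D(2) f(1) D(4)[OF i] D(3)[OF i]] by simp
    also have "Cmp C (prj i) f = \<zero>\<^bsub>Hom C X (Ys ! i)\<^esub>" using no i D(4) by blast
    finally show "Cmp C (Cmp C (inj i) (prj i)) f = \<zero>\<^bsub>Hom C X Y\<^esub>" using Cmp_zero(1) D i X by simp
  qed auto
  finally show False using f(2) by simp
qed

lemma zero_ob_iff: "X \<in> Ob C \<Longrightarrow> zero_ob C X \<longleftrightarrow> Id C X = \<zero>\<^bsub>Hom C X X\<^esub>"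
proof
  assume X: "X \<in> Ob C" and z: "Id C X = \<zero>\<^bsub>Hom C X X\<^esub>"
  have "f = \<zero>\<^bsub>Hom C X Y\<^esub>" if "Y \<in> Ob C" "f \<in> Arr C X Y" for Y f
    using Cmp_Id_right[OF X that] Cmp_zero(1)[OF X X that(1,2)] z by simp
  moreover have "f = \<zero>\<^bsub>Hom C Y X\<^esub>" if "Y \<in> Ob C" "f \<in> Arr C Y X" for Y f
    using Cmp_Id_left[OF that(1) X that(2)] Cmp_zero(2)[OF that(1) X X that(2)] z by simp
  ultimately show "zero_ob C X"
    using X cvs_simps(1)[OF Hom_vectorspace] unfolding zero_ob_def by blast
qed (use Id_arr in \<open>auto simp: zero_ob_def\<close>)

text \<open>The complement comes from splitting the idempotent Id - i p, which is orthogonal to i p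
  because p i is the identity.\<close>

lemma split_complement:
  assumes split: "idempotent_split C" and Ob: "A \<in> Ob C" "Y \<in> Ob C"
    and i: "i \<in> Arr C A Y" and p: "p \<in> Arr C Y A" and pi: "Cmp C p i = Id C A"
  obtains B j q where "B \<in> Ob C" "j \<in> Arr C B Y" "q \<in> Arr C Y B" "Cmp C q j = Id C B"
    "Cmp C p j = \<zero>\<^bsub>Hom C B A\<^esub>" "Cmp C q i = \<zero>\<^bsub>Hom C A B\<^esub>" "Cmp C i p \<oplus>\<^bsub>Hom C Y Y\<^esub> Cmp C j q = Id C Y"
proof -
  note V = Hom_vectorspace[OF Ob(2,2)]
  have ip: "Cmp C i p \<in> Arr C Y Y" using Cmp_arr Ob i p by blast
  note I = Id_arr[OF Ob(2)]
  define e where "e = Id C Y \<ominus>\<^bsub>Hom C Y Y\<^esub> Cmp C i p"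
  have e: "e \<in> Arr C Y Y" unfolding e_def by (rule cvs_simps(4)[OF V I ip])
  have pe: "Cmp C p e = \<zero>\<^bsub>Hom C Y A\<^esub>"
    unfolding e_def Cmp_minus(1)[OF Ob(2,2,1) p I ip] Cmp_Id_right[OF Ob(2,1) p] Cmp_assoc[OF Ob(2,1,2,1) p i p] pi
      Cmp_Id_left[OF Ob(2,1) p] by (rule cvs_distribs(7)[OF Hom_vectorspace[OF Ob(2,1)] p])
  have ei: "Cmp C e i = \<zero>\<^bsub>Hom C A Y\<^esub>"
    unfolding e_def Cmp_minus(2)[OF Ob(1,2,2) i I ip] Cmp_Id_left[OF Ob i] Cmp_assoc[OF Ob(1,2,1,2) i p i, symmetric] pi
      Cmp_Id_right[OF Ob i] by (rule cvs_distribs(7)[OF Hom_vectorspace[OF Ob] i])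
  have "Cmp C e e = Cmp C (Id C Y) e \<ominus>\<^bsub>Hom C Y Y\<^esub> Cmp C (Cmp C i p) e"
    by (subst e_def) (rule Cmp_minus(2)[OF Ob(2,2,2) e I ip])
  also have "Cmp C (Cmp C i p) e = \<zero>\<^bsub>Hom C Y Y\<^esub>"
    unfolding Cmp_assoc[OF Ob(2,2,1,2) e p i, symmetric] pe by (rule Cmp_zero(1)[OF Ob(2,1,2) i])
  finally have ee: "Cmp C e e = e"
    using cvs_simps(1,9)[OF V] cvs_simps(5)[OF V e] cvs_distribs(3)[OF V e cvs_simps(1)[OF V]] Cmp_Id_left[OF Ob(2,2) e] by simp
  then obtain B q j where B: "B \<in> Ob C" "q \<in> Arr C Y B" "j \<in> Arr C B Y" and jq: "Cmp C j q = e" and qj: "Cmp C q j = Id C B"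
    using split Ob(2) e unfolding idempotent_split_def by blast
  have "Cmp C e j = j" unfolding jq[symmetric] Cmp_assoc[OF B(1) Ob(2) B(1) Ob(2) B(3,2,3), symmetric] qj by (rule Cmp_Id_right[OF B(1) Ob(2) B(3)])
  hence "Cmp C p j = Cmp C (Cmp C p e) j" using Cmp_assoc[OF B(1) Ob(2,2,1) B(3) e p] by simp
  hence pj: "Cmp C p j = \<zero>\<^bsub>Hom C B A\<^esub>" unfolding pe using Cmp_zero(2)[OF B(1) Ob(2,1) B(3)] by simp
  have "Cmp C q e = q" unfolding jq[symmetric] Cmp_assoc[OF Ob(2) B(1) Ob(2) B(1,2,3,2)] qj by (rule Cmp_Id_left[OF Ob(2) B(1,2)])
  hence "Cmp C q i = Cmp C q (Cmp C e i)" using Cmp_assoc[OF Ob(1,2,2) B(1) i e B(2)] by simp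
  hence qi: "Cmp C q i = \<zero>\<^bsub>Hom C A B\<^esub>" unfolding ei using Cmp_zero(1)[OF Ob B(1,2)] by simp
  have "Cmp C i p \<oplus>\<^bsub>Hom C Y Y\<^esub> e = Id C Y"
  proof -
    interpret H: abelian_group "Hom C Y Y" using V by (simp add: vectorspace_def Module.module_def)
    show ?thesis unfolding e_def a_minus_def using ip I by (simp add: H.a_lcomm[OF ip I] H.r_neg)
  qed
  thus thesis using that[OF B(1,3,2) qj pj qi] jq by simp
qed

text \<open>Nonzero scalars are invertible, so zero is the only endomorphism that is not an
  isomorphism, and sums of zeros stay zero.\<close>

lemma brick_local_End:
  assumes X: "X \<in> Ob C" "Id C X \<noteq> \<zero>\<^bsub>Hom C X X\<^esub>" and sc: "\<And>f. f \<in> Arr C X X \<Longrightarrow> \<exists>c. f = c \<odot>\<^bsub>Hom C X X\<^esub> Id C X"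
  shows "local_End C X"
proof -
  note V = cvs_simps[OF Hom_vectorspace[OF X(1,1)]] and I = Id_arr[OF X(1)]
  have iso: "is_iso C X X f" if f: "f \<in> Arr C X X" "f \<noteq> \<zero>\<^bsub>Hom C X X\<^esub>" for f
  proof -
    from sc[OF f(1)] obtain c where c: "f = c \<odot>\<^bsub>Hom C X X\<^esub> Id C X" by blast
    hence "c \<noteq> 0" using f(2) V(8)[OF I] by auto
    moreover have "inverse c \<odot>\<^bsub>Hom C X X\<^esub> Id C X \<in> Arr C X X" using V(3) I by blast
    ultimately show ?thesis
      unfolding is_iso_def using f(1)
      by (auto simp: c Cmp_smult_left[OF X(1,1,1)] Cmp_smult_right[OF X(1,1,1)] V I Cmp_Id_left[OF X(1,1)]
          intro!: bexI[of _ "inverse c \<odot>\<^bsub>Hom C X X\<^esub> Id C X"])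
  qed
  have "\<not> is_iso C X X \<zero>\<^bsub>Hom C X X\<^esub>"
    unfolding is_iso_def using Cmp_zero(1)[OF X(1,1,1)] X(2) by metis
  moreover have "\<zero>\<^bsub>Hom C X X\<^esub> \<oplus>\<^bsub>Hom C X X\<^esub> \<zero>\<^bsub>Hom C X X\<^esub> = \<zero>\<^bsub>Hom C X X\<^esub>" using V(1,5) by blast
  ultimately show ?thesis unfolding local_End_def using iso X(2) by metis
qed

text \<open>The idempotent belonging to the first summand is a scalar \<open>c\<close>. If
  \<open>c\<close> = 0, the first summand is zero; otherwise the second projection, which kills the
  first injection, vanishes, and the second summand is zero.\<close>

lemma brick_indecomposable:
  assumes X: "X \<in> Ob C" "Id C X \<noteq> \<zero>\<^bsub>Hom C X X\<^esub>" and sc: "\<And>f. f \<in> Arr C X X \<Longrightarrow> \<exists>c. f = c \<odot>\<^bsub>Hom C X X\<^esub> Id C X"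
  shows "indecomposable C X"
  unfolding indecomposable_def
proof (intro conjI ballI impI)
  show "\<not> zero_ob C X" using X zero_ob_iff by blast
  fix A B assume Ob: "A \<in> Ob C" "B \<in> Ob C" and ds: "direct_sum C [A, B] X"
  obtain inj prj where "\<And>i. i < length [A, B] \<Longrightarrow> inj i \<in> Arr C ([A, B] ! i) X"
    "\<And>i. i < length [A, B] \<Longrightarrow> prj i \<in> Arr C X ([A, B] ! i)"
    "\<And>i. i < length [A, B] \<Longrightarrow> Cmp C (prj i) (inj i) = Id C ([A, B] ! i)"
    "\<And>i j. \<lbrakk>i < length [A, B]; j < length [A, B]; i \<noteq> j\<rbrakk> \<Longrightarrow> Cmp C (prj i) (inj j) = \<zero>\<^bsub>Hom C ([A, B] ! j) ([A, B] ! i)\<^esub>"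
    using ds by (rule direct_sumE) blast
  from this(1)[of 0] this(1)[of 1] this(2)[of 0] this(2)[of 1] this(3)[of 0] this(3)[of 1] this(4)[of 1 0]
  have i: "inj 0 \<in> Arr C A X" "inj 1 \<in> Arr C B X" and p: "prj 0 \<in> Arr C X A" "prj 1 \<in> Arr C X B"
    and pi: "Cmp C (prj 0) (inj 0) = Id C A" "Cmp C (prj 1) (inj 1) = Id C B" "Cmp C (prj 1) (inj 0) = \<zero>\<^bsub>Hom C A B\<^esub>"
    by simp_all
  from sc[OF Cmp_arr[OF X(1) Ob(1) X(1) p(1) i(1)]] obtain c where c: "Cmp C (inj 0) (prj 0) = c \<odot>\<^bsub>Hom C X X\<^esub> Id C X" by blast
  note V = cvs_simps[OF Hom_vectorspace[OF X(1,1)]]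
  show "zero_ob C A \<or> zero_ob C B"
  proof (cases "c = 0")
    case True
    have "Id C A = Cmp C (Cmp C (prj 0) (inj 0)) (Cmp C (prj 0) (inj 0))"
      unfolding pi(1) using Cmp_Id_left[OF Ob(1,1) Id_arr[OF Ob(1)]] by simp
    also have "\<dots> = Cmp C (prj 0) (Cmp C (Cmp C (inj 0) (prj 0)) (inj 0))"
      using Cmp_assoc[OF Ob(1) X(1) Ob(1) X(1) i(1) p(1) i(1)]
        Cmp_assoc[OF Ob(1,1) X(1) Ob(1) Cmp_arr[OF Ob(1) X(1) Ob(1) i(1) p(1)] i(1) p(1)] by simp
    also have "\<dots> = \<zero>\<^bsub>Hom C A A\<^esub>"
      unfolding c True V(8)[OF Id_arr[OF X(1)]] Cmp_zero(2)[OF Ob(1) X(1,1) i(1)] by (rule Cmp_zero(1)[OF Ob(1) X(1) Ob(1) p(1)])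
    finally show ?thesis using zero_ob_iff[OF Ob(1)] by blast
  next
    case False
    have "c \<odot>\<^bsub>Hom C X B\<^esub> prj 1 = Cmp C (prj 1) (Cmp C (inj 0) (prj 0))"
      unfolding c Cmp_smult_right[OF X(1,1) Ob(2) Id_arr[OF X(1)] p(2)] Cmp_Id_right[OF X(1) Ob(2) p(2)] ..
    also have "\<dots> = \<zero>\<^bsub>Hom C X B\<^esub>"
      unfolding Cmp_assoc[OF X(1) Ob(1) X(1) Ob(2) p(1) i(1) p(2)] pi(3) by (rule Cmp_zero(2)[OF X(1) Ob p(1)])
    finally have "inverse c \<odot>\<^bsub>Hom C X B\<^esub> (c \<odot>\<^bsub>Hom C X B\<^esub> prj 1) = \<zero>\<^bsub>Hom C X B\<^esub>"
      using cvs_simps(9)[OF Hom_vectorspace[OF X(1) Ob(2)]] by simp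
    hence "prj 1 = \<zero>\<^bsub>Hom C X B\<^esub>" using False p(2) cvs_simps(7,10)[OF Hom_vectorspace[OF X(1) Ob(2)]] by simp
    hence "Id C B = \<zero>\<^bsub>Hom C B B\<^esub>" using pi(2) Cmp_zero(2)[OF Ob(2) X(1) Ob(2) i(2)] by simp
    thus ?thesis using zero_ob_iff[OF Ob(2)] by blast
  qed
qed (fact X)

lemma idealD:
  assumes "category_ideal C I" "X \<in> Ob C" "Y \<in> Ob C"
  shows "I X Y \<subseteq> Arr C X Y" "\<zero>\<^bsub>Hom C X Y\<^esub> \<in> I X Y" "\<lbrakk>f \<in> I X Y; g \<in> I X Y\<rbrakk> \<Longrightarrow> f \<oplus>\<^bsub>Hom C X Y\<^esub> g \<in> I X Y"
    "f \<in> I X Y \<Longrightarrow> c \<odot>\<^bsub>Hom C X Y\<^esub> f \<in> I X Y"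
    "\<lbrakk>Z \<in> Ob C; f \<in> I X Y; g \<in> Arr C Y Z\<rbrakk> \<Longrightarrow> Cmp C g f \<in> I X Z"
    "\<lbrakk>Z \<in> Ob C; f \<in> I X Y; g \<in> Arr C Z X\<rbrakk> \<Longrightarrow> Cmp C f g \<in> I Z Y"
  using assms by (auto simp: category_ideal_def subspace_iff)

text \<open>When p i is the identity of \<open>Y\<close>, this says that an ideal containing the
  identity of an object contains that of every retract.\<close>

lemma ideal_through:
  assumes I: "category_ideal C I" and Ob: "X \<in> Ob C" "Y \<in> Ob C" and Id: "Id C X \<in> I X X"
    and i: "i \<in> Arr C Y X" and p: "p \<in> Arr C X Y"
  shows "Cmp C p i \<in> I Y Y"
  using idealD(5)[OF I Ob(2,1,2) idealD(6)[OF I Ob(1,1,2) Id i] p] Cmp_Id_left[OF Ob(2,1) i] by simp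

text \<open>The identity of a direct sum is a sum of arrows that factor through identities of the
  summands.\<close>

lemma ideal_direct_sum:
  assumes I: "category_ideal C I" and P: "direct_sum C Xs P" and Id: "\<And>X. X \<in> set Xs \<Longrightarrow> Id C X \<in> I X X"
  shows "Id C P \<in> I P P"
proof -
  obtain inj prj where D: "\<And>i. i < length Xs \<Longrightarrow> Xs ! i \<in> Ob C" "P \<in> Ob C"
    "\<And>i. i < length Xs \<Longrightarrow> inj i \<in> Arr C (Xs ! i) P" "\<And>i. i < length Xs \<Longrightarrow> prj i \<in> Arr C P (Xs ! i)"
    and s: "finsum (Hom C P P) (\<lambda>i. Cmp C (inj i) (prj i)) {..<length Xs} = Id C P"
    using P by (rule direct_sumE) blast
  interpret H: vectorspace "class_ring :: complex ring" "Hom C P P" by (rule Hom_vectorspace) fact+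
  note J = idealD[OF I D(2,2)]
  have m: "Cmp C (inj i) (prj i) \<in> I P P" if "i < length Xs" for i
    by (rule ideal_through[OF I D(1)[OF that] D(2) Id D(4)[OF that] D(3)[OF that]]) (use that in simp)
  have "finsum (Hom C P P) (\<lambda>i. Cmp C (inj i) (prj i)) {..<k} \<in> I P P" if "k \<le> length Xs" for k
    using that
  proof (induction k)
    case (Suc k)
    have "finsum (Hom C P P) (\<lambda>i. Cmp C (inj i) (prj i)) {..<Suc k} =
        Cmp C (inj k) (prj k) \<oplus>\<^bsub>Hom C P P\<^esub> finsum (Hom C P P) (\<lambda>i. Cmp C (inj i) (prj i)) {..<k}"
      unfolding lessThan_Suc by (rule H.finsum_insert) (use Suc.prems m J(1) in auto)
    thus ?case using J(3) m Suc by simp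
  qed (simp add: J(2))
  thus ?thesis using s by (metis order_refl)
qed

lemma ideal_full:
  assumes I: "category_ideal C I" and Ob: "X \<in> Ob C" "Y \<in> Ob C" and Id: "Id C X \<in> I X X"
  shows "I X Y = Arr C X Y"
  using idealD(1)[OF I Ob] idealD(5)[OF I Ob(1,1,2) Id] Cmp_Id_right[OF Ob] by force

end

text \<open>What the categorical argument uses: pairwise orthogonal bricks X n that produce every
  object by direct sums and obey the rule for the action of L(1). The zero object, the Krull-Schmidt
  property and countability are consequences.\<close>

locale A_infinity_data = module_category C M
  for C :: "('c, 'k, 'x) moncat_scheme" and M :: "('o, 'm, 'c, 'k, 'y) modcat_scheme" +
  fixes L :: 'c and X :: "nat \<Rightarrow> 'o"
  assumes L: "L \<in> Ob C"
    and X_Ob: "X n \<in> Ob M" and X_Id: "Id M (X n) \<noteq> \<zero>\<^bsub>Hom M (X n) (X n)\<^esub>"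
    and X_End: "f \<in> Arr M (X n) (X n) \<Longrightarrow> \<exists>c. f = c \<odot>\<^bsub>Hom M (X n) (X n)\<^esub> Id M (X n)"
    and X_Hom: "\<lbrakk>m \<noteq> n; f \<in> Arr M (X m) (X n)\<rbrakk> \<Longrightarrow> f = \<zero>\<^bsub>Hom M (X m) (X n)\<^esub>"
    and decomp: "Y \<in> Ob M \<Longrightarrow> \<exists>ns. direct_sum M (map X ns) Y"
    and L_zero: "iso_ob M (ActO M L (X 0)) (X 1)"
    and L_Suc: "direct_sum M [X n, X (Suc (Suc n))] (ActO M L (X (Suc n)))"
    and split: "idempotent_split M" and sums: "\<lbrakk>Y \<in> Ob M; Z \<in> Ob M\<rbrakk> \<Longrightarrow> \<exists>P. direct_sum M [Y, Z] P"
    and fin: "finite_dimensional_Homs M"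
begin

text \<open>Invariance puts the identity of \<open>L\<close> acting on X n into the ideal; X (n +
  1), and also X (n - 1) when n > 0, is a retract of that object.\<close>

lemma ideal_neighbours:
  assumes inv: "invariant_ideal C M I" and Id: "Id M (X n) \<in> I (X n) (X n)"
  shows "Id M (X (Suc n)) \<in> I (X (Suc n)) (X (Suc n))" "n = Suc m \<Longrightarrow> Id M (X m) \<in> I (X m) (X m)"
proof -
  have I: "category_ideal M I" using inv by (simp add: invariant_ideal_def)
  note LX = FO_ob[OF L X_Ob]
  have Id': "Id M (ActO M L (X n)) \<in> I (ActO M L (X n)) (ActO M L (X n))"
    using inv Id L X_Ob FA_Id[OF L X_Ob] unfolding invariant_ideal_def by metis
  have Suc: "Id M (X k) \<in> I (X k) (X k)" if n: "n = Suc m" and k: "k = m \<or> k = Suc n" for m k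
  proof -
    from k obtain i where i: "i < 2" "[X m, X (Suc (Suc m))] ! i = X k"
      using n by (cases "k = m") (force intro: that[of 0] that[of 1])+
    obtain inj prj where "\<And>i. i < length [X m, X (Suc (Suc m))] \<Longrightarrow> inj i \<in> Arr M ([X m, X (Suc (Suc m))] ! i) (ActO M L (X (Suc m)))"
      "\<And>i. i < length [X m, X (Suc (Suc m))] \<Longrightarrow> prj i \<in> Arr M (ActO M L (X (Suc m))) ([X m, X (Suc (Suc m))] ! i)"
      "\<And>i. i < length [X m, X (Suc (Suc m))] \<Longrightarrow> Cmp M (prj i) (inj i) = Id M ([X m, X (Suc (Suc m))] ! i)"
      using L_Suc[of m] by (rule B.direct_sumE) blast
    from this(1-3)[of i] i have "inj i \<in> Arr M (X k) (ActO M L (X n))" "prj i \<in> Arr M (ActO M L (X n)) (X k)" "Cmp M (prj i) (inj i) = Id M (X k)"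
      unfolding n by simp_all
    thus ?thesis using B.ideal_through[OF I LX X_Ob Id'] by metis
  qed
  show "n = Suc m \<Longrightarrow> Id M (X m) \<in> I (X m) (X m)" using Suc by blast
  show "Id M (X (Suc n)) \<in> I (X (Suc n)) (X (Suc n))"
  proof (cases n)
    case 0
    from L_zero obtain f g where "f \<in> Arr M (ActO M L (X 0)) (X 1)" "g \<in> Arr M (X 1) (ActO M L (X 0))" "Cmp M f g = Id M (X 1)"
      unfolding iso_ob_def is_iso_def by blast
    thus ?thesis using B.ideal_through[OF I LX X_Ob Id'] unfolding 0 One_nat_def by metis
  qed (use Suc in blast)
qed

theorem simple_transitive: "simple_transitive C M"
  unfolding simple_transitive_def
proof (intro conjI allI impI)
  fix I assume inv: "invariant_ideal C M I"
  hence I: "category_ideal M I" by (simp add: invariant_ideal_def)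
  show "(\<forall>X\<in>Ob M. \<forall>Y\<in>Ob M. I X Y = {\<zero>\<^bsub>Hom M X Y\<^esub>}) \<or> (\<forall>X\<in>Ob M. \<forall>Y\<in>Ob M. I X Y = Arr M X Y)"
  proof (cases "\<forall>X\<in>Ob M. \<forall>Y\<in>Ob M. I X Y = {\<zero>\<^bsub>Hom M X Y\<^esub>}")
    case False
    then obtain Y Z where YZ: "Y \<in> Ob M" "Z \<in> Ob M" "I Y Z \<noteq> {\<zero>\<^bsub>Hom M Y Z\<^esub>}" by blast
    then obtain f where f: "f \<in> I Y Z" "f \<noteq> \<zero>\<^bsub>Hom M Y Z\<^esub>" using B.idealD(2)[OF I YZ(1,2)] by blast
    hence fA: "f \<in> Arr M Y Z" using B.idealD(1)[OF I YZ(1,2)] by blast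
    obtain ns ms where ns: "direct_sum M (map X ns) Y" and ms: "direct_sum M (map X ms) Z"
      using decomp YZ by blast
    \<comment> \<open>A nonzero arrow of the ideal is cut down to a nonzero arrow between two
      bricks; orthogonality makes the bricks equal, and rescaling turns the arrow into an
      identity.\<close>
    from B.nonzero_on_summand[OF ns YZ(2) fA f(2)] obtain n j where j: "j \<in> Arr M (X n) Y" "Cmp M f j \<noteq> \<zero>\<^bsub>Hom M (X n) Z\<^esub>"
      by auto
    have fj: "Cmp M f j \<in> I (X n) Z" by (rule B.idealD(6)[OF I YZ(1,2) X_Ob f(1) j(1)])
    from B.nonzero_in_summand[OF ms X_Ob _ j(2)] fj B.idealD(1)[OF I X_Ob YZ(2)] obtain m p where
      p: "p \<in> Arr M Z (X m)" "Cmp M p (Cmp M f j) \<noteq> \<zero>\<^bsub>Hom M (X n) (X m)\<^esub>" by (auto simp: subset_iff)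
    have pfj: "Cmp M p (Cmp M f j) \<in> I (X n) (X m)" by (rule B.idealD(5)[OF I X_Ob YZ(2) X_Ob fj p(1)])
    hence pfjA: "Cmp M p (Cmp M f j) \<in> Arr M (X n) (X m)" using B.idealD(1)[OF I X_Ob X_Ob] by blast
    have nm: "n = m" using X_Hom[OF _ pfjA] p(2) by blast
    from X_End pfjA obtain c where c: "Cmp M p (Cmp M f j) = c \<odot>\<^bsub>Hom M (X n) (X n)\<^esub> Id M (X n)" unfolding nm by blast
    note V = cvs_simps[OF B.Hom_vectorspace[OF X_Ob X_Ob]] and Id_in = B.Id_arr[OF X_Ob]
    have "c \<noteq> 0" using p(2) V(8)[OF Id_in] unfolding c nm by metis
    hence "inverse c \<odot>\<^bsub>Hom M (X n) (X n)\<^esub> Cmp M p (Cmp M f j) = Id M (X n)" unfolding c using V Id_in by simp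
    hence Idn: "Id M (X n) \<in> I (X n) (X n)" using B.idealD(4)[OF I X_Ob X_Ob pfj[folded nm]] by metis
    \<comment> \<open>Walking down to index 0 and from there upwards reaches every brick.\<close>
    have "Id M (X k) \<in> I (X k) (X k) \<Longrightarrow> Id M (X 0) \<in> I (X 0) (X 0)" for k
      by (induction k) (use ideal_neighbours(2)[OF inv _ refl] in auto)
    with Idn have Id0: "Id M (X 0) \<in> I (X 0) (X 0)" by blast
    have Idk: "Id M (X k) \<in> I (X k) (X k)" for k
      by (induction k) (use Id0 ideal_neighbours(1)[OF inv] in auto)
    have "Id M Y \<in> I Y Y" if Y: "Y \<in> Ob M" for Y
    proof -
      obtain ns where "direct_sum M (map X ns) Y" using decomp Y by blast
      thus ?thesis by (rule B.ideal_direct_sum[OF I]) (use Idk in auto)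
    qed
    thus ?thesis using B.ideal_full[OF I] by blast
  qed simp
qed (unfold_locales)

text \<open>The first brick in a decomposition of \<open>Y\<close> is a retract. Its complement is
  zero by indecomposability, so the retraction is an isomorphism.\<close>

lemma indecomposable_iso_X:
  assumes Y: "indecomposable M Y"
  shows "\<exists>n. iso_ob M Y (X n)"
proof -
  have Ob: "Y \<in> Ob M" and nz: "\<not> zero_ob M Y"
    and ind: "\<And>A B. \<lbrakk>A \<in> Ob M; B \<in> Ob M; direct_sum M [A, B] Y\<rbrakk> \<Longrightarrow> zero_ob M A \<or> zero_ob M B"
    using Y by (auto simp: indecomposable_def)
  from decomp[OF Ob] obtain ns where ns: "direct_sum M (map X ns) Y" by blast
  have "Id M Y \<noteq> \<zero>\<^bsub>Hom M Y Y\<^esub>" using nz B.zero_ob_iff[OF Ob] by simp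
  from B.nonzero_on_summand[OF ns Ob B.Id_arr[OF Ob] this] have len: "0 < length (map X ns)" by auto
  obtain inj prj where D: "\<And>i. i < length (map X ns) \<Longrightarrow> inj i \<in> Arr M (map X ns ! i) Y"
    "\<And>i. i < length (map X ns) \<Longrightarrow> prj i \<in> Arr M Y (map X ns ! i)"
    "\<And>i. i < length (map X ns) \<Longrightarrow> Cmp M (prj i) (inj i) = Id M (map X ns ! i)"
    using ns by (rule B.direct_sumE) blast
  define n where "n = ns ! 0"
  have i: "inj 0 \<in> Arr M (X n) Y" and p: "prj 0 \<in> Arr M Y (X n)" and pi: "Cmp M (prj 0) (inj 0) = Id M (X n)"
    using D[OF len] len by (simp_all add: n_def)
  obtain Z j q where Z: "Z \<in> Ob M" "j \<in> Arr M Z Y" "q \<in> Arr M Y Z" "Cmp M q j = Id M Z"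
    "Cmp M (prj 0) j = \<zero>\<^bsub>Hom M Z (X n)\<^esub>" "Cmp M q (inj 0) = \<zero>\<^bsub>Hom M (X n) Z\<^esub>"
    "Cmp M (inj 0) (prj 0) \<oplus>\<^bsub>Hom M Y Y\<^esub> Cmp M j q = Id M Y"
    using B.split_complement[OF split X_Ob Ob i p pi] by blast
  have "direct_sum M [X n, Z] Y" by (rule B.direct_sum_pairI[OF X_Ob Z(1) Ob i p Z(2,3) pi Z(4-7)])
  hence "zero_ob M Z" using ind[OF X_Ob Z(1)] B.zero_ob_iff[OF X_Ob] X_Id by blast
  hence "j = \<zero>\<^bsub>Hom M Z Y\<^esub>" using Z(2) Ob by (auto simp: zero_ob_def)
  hence "Cmp M j q = \<zero>\<^bsub>Hom M Y Y\<^esub>" using B.Cmp_zero(2)[OF Ob Z(1) Ob Z(3)] by simp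
  hence "Cmp M (inj 0) (prj 0) = Id M Y"
    using Z(7) cvs_simps(5)[OF B.Hom_vectorspace[OF Ob Ob] B.Cmp_arr[OF Ob X_Ob Ob p i]] by simp
  hence "is_iso M Y (X n) (prj 0)" unfolding is_iso_def using i p pi by blast
  thus ?thesis using Ob X_Ob unfolding iso_ob_def by blast
qed

theorem type_A_infinity: "type_A_infinity C L M"
proof -
  \<comment> \<open>A zero object arises by splitting the zero idempotent of X 0.\<close>
  have "\<exists>Z. zero_ob M Z"
  proof -
    note V = cvs_simps[OF B.Hom_vectorspace[OF X_Ob X_Ob]]
    let ?z = "\<zero>\<^bsub>Hom M (X 0) (X 0)\<^esub>"
    have "Cmp M ?z ?z = ?z" by (rule B.Cmp_zero(1)[OF X_Ob X_Ob X_Ob V(1)])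
    with split V(1) X_Ob[of 0] obtain Z r s where Z: "Z \<in> Ob M" "r \<in> Arr M (X 0) Z" "s \<in> Arr M Z (X 0)"
      "Cmp M s r = ?z" "Cmp M r s = Id M Z" unfolding idempotent_split_def by blast
    have "Id M Z = Cmp M (Cmp M r s) (Cmp M r s)" unfolding Z(5) using B.Cmp_Id_left[OF Z(1,1) B.Id_arr[OF Z(1)]] by simp
    also have "\<dots> = Cmp M r (Cmp M (Cmp M s r) s)"
      using B.Cmp_assoc[OF Z(1) X_Ob Z(1) X_Ob Z(3,2,3)]
        B.Cmp_assoc[OF Z(1,1) X_Ob Z(1) B.Cmp_arr[OF Z(1) X_Ob Z(1) Z(3,2)] Z(3,2)] by simp
    also have "\<dots> = \<zero>\<^bsub>Hom M Z Z\<^esub>"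
      unfolding Z(4) B.Cmp_zero(2)[OF Z(1) X_Ob X_Ob Z(3)] by (rule B.Cmp_zero(1)[OF Z(1) X_Ob Z(1,2)])
    finally show ?thesis using B.zero_ob_iff[OF Z(1)] by blast
  qed
  hence "additive_category M" using sums B.linear_category_axioms by (auto simp: additive_category_def)
  moreover have "krull_schmidt M"
    unfolding krull_schmidt_def
  proof
    fix Y assume "Y \<in> Ob M"
    from decomp[OF this] obtain ns where "direct_sum M (map X ns) Y" by blast
    moreover have "\<forall>Z\<in>set (map X ns). local_End M Z" using B.brick_local_End[OF X_Ob X_Id X_End] by auto
    ultimately show "\<exists>Xs. (\<forall>Z\<in>set Xs. local_End M Z) \<and> direct_sum M Xs Y" by blast
  qed
  moreover have "countably_many_indecomposables M"
    unfolding countably_many_indecomposables_def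
    by (rule exI[of _ "range X"]) (use indecomposable_iso_X X_Ob in auto)
  moreover have "module_category C M" by unfold_locales
  ultimately have lf: "locally_finitary C M" using split fin by (simp add: locally_finitary_def)
  have inj: "m = n" if "iso_ob M (X m) (X n)" for m n
  proof (rule ccontr)
    assume ne: "m \<noteq> n"
    from that obtain f g where f: "f \<in> Arr M (X m) (X n)" and g: "g \<in> Arr M (X n) (X m)" "Cmp M g f = Id M (X m)"
      unfolding iso_ob_def is_iso_def by blast
    have "f = \<zero>\<^bsub>Hom M (X m) (X n)\<^esub>" by (rule X_Hom[OF ne f])
    with g(2) B.Cmp_zero(1)[OF X_Ob X_Ob X_Ob g(1), of m] have "Id M (X m) = \<zero>\<^bsub>Hom M (X m) (X m)\<^esub>" by simp
    with X_Id show False by blast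
  qed
  have L': "direct_sum M [X (i - 1), X (i + 1)] (ActO M L (X i))" if "i \<ge> 1" for i
    using L_Suc[of "i - 1"] that by simp
  show ?thesis
    unfolding type_A_infinity_def
    by (intro conjI lf exI[of _ X] allI impI)
      (use B.brick_indecomposable[OF X_Ob X_Id X_End] inj indecomposable_iso_X L_zero L' in blast)+
qed

end

section \<open>Direct sums, split idempotents and finite dimensional hom-spaces in
  \<open>N6\<close>\<close>

section \<open>Direct sums, idempotents and homomorphism spaces\<close>

lemma N6_sel [simp]:
  "Hom (N6 l) = lie_Hom borel" "Id (N6 l) = lie_Id" "Cmp (N6 l) = arrow_compose" "ActO (N6 l) = tensor"
  "ActA (N6 l) = tensor_arrow" "ActAssoc (N6 l) = tensor_assoc" "ActUnit (N6 l) = tensor_lunit"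
  by (simp_all add: N6_def)

interpretation N6_cat: lie_cat borel "N6 l :: ('u lmod, 'u arrow, 'u lmod, 'u arrow) modcat" for l
  by unfold_locales (simp_all add: Ob_N6)

lemma lie_hom_eqI:
  assumes "f \<in> lie_hom g M N" "f' \<in> lie_hom g M N" "\<And>v. v \<in> carrier M \<Longrightarrow> f v = f' v"
  shows "f = f'"
  using assms by (intro extensionalityI[of f "carrier M" f']) (auto dest: lie_homD(2))

text \<open>Evaluation at a vector is linear on the hom-space, so it can be pulled through the
  sum.\<close>

lemma finsum_lie_Hom:
  assumes M: "lie_module g M" and N: "lie_module g N" and f: "\<And>i. i \<in> A \<Longrightarrow> f i \<in> lie_hom g M N"
  obtains h where "h \<in> lie_hom g M N" "finsum (lie_Hom g M N) (\<lambda>i. (M, f i, N)) A = (M, h, N)"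
    "\<And>v. v \<in> carrier M \<Longrightarrow> h v = finsum N (\<lambda>i. f i v) A"
proof -
  note H = lie_Hom_cvs[OF M N]
  interpret H: vectorspace "class_ring :: complex ring" "lie_Hom g M N" by (rule H)
  have m: "(\<lambda>i. (M, f i, N)) \<in> A \<rightarrow> carrier (lie_Hom g M N)" using f by auto
  obtain h where h: "h \<in> lie_hom g M N" "finsum (lie_Hom g M N) (\<lambda>i. (M, f i, N)) A = (M, h, N)"
    using H.finsum_closed[OF m] by auto
  have "h v = finsum N (\<lambda>i. f i v) A" if v: "v \<in> carrier M" for v
  proof -
    have "lin (lie_Hom g M N) N (\<lambda>p. fst (snd p) v)" by (rule linI) (use v lie_homD(3) in auto)
    from lin_finsum[OF H lie_moduleD(1)[OF N] this m] show ?thesis by (simp add: h(2))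
  qed
  with h show thesis by (rule that)
qed

text \<open>All strings carry names from one set \<open>J\<close>, divided among the summands into
  disjoint parts \<open>Js i\<close>, with a common length function \<open>n\<close>. Injections and
  projections then send basis vectors to those of the same name, or to zero.\<close>

theorem direct_sum_strings:
  fixes P :: "'u lmod"
  assumes P: "lie_module borel P" "qbasis l P b J n"
    and X: "\<And>i. i < length Xs \<Longrightarrow> lie_module borel (Xs ! i)" "\<And>i. i < length Xs \<Longrightarrow> qbasis l (Xs ! i) (c i) (Js i) n"
    and J: "J = (\<Union>i<length Xs. Js i)" and disj: "\<And>i i' j. \<lbrakk>j \<in> Js i; j \<in> Js i'; i < length Xs; i' < length Xs\<rbrakk> \<Longrightarrow> i = i'"
  shows "direct_sum (N6 l) Xs P"
proof -
  note QP = qbasisD[OF P(2)] and QX = qbasisD[OF X(2)] and SX = cvs_simps[OF lie_moduleD(1)[OF X(1)]]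
  note cP = lie_moduleD(1)[OF P(1)] and cX = lie_moduleD(1)[OF X(1)]
  have JJ: "j \<in> J" if "i < length Xs" "j \<in> Js i" for i j using that J by blast
  have "\<exists>f. f \<in> lie_hom borel (Xs ! i) P \<and> (\<forall>j\<in>Js i. \<forall>k\<le>n j. f (c i (j, k)) = b (j, k))" if i: "i < length Xs" for i
  proof -
    obtain f where "f \<in> lie_hom borel (Xs ! i) P" "\<And>jk. jk \<in> strings (Js i) n \<Longrightarrow> f (c i jk) = b jk"
      by (rule hom_of_strings[OF X(1)[OF i] X(2)[OF i] P(1), of b]) (use QP JJ[OF i] in blast)+
    thus ?thesis by (intro exI[of _ f]) auto
  qed
  then obtain inj where inj: "inj i \<in> lie_hom borel (Xs ! i) P" "\<lbrakk>j \<in> Js i; k \<le> n j\<rbrakk> \<Longrightarrow> inj i (c i (j, k)) = b (j, k)"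
    if "i < length Xs" for i j k by metis
  have "\<exists>f. f \<in> lie_hom borel P (Xs ! i) \<and> (\<forall>j\<in>J. \<forall>k\<le>n j. f (b (j, k)) = (if j \<in> Js i then c i (j, k) else \<zero>\<^bsub>Xs ! i\<^esub>))"
    if i: "i < length Xs" for i
  proof -
    note z = lin_zero[OF cX[OF i] cX[OF i] lie_moduleD(2)[OF X(1)[OF i]]]
    obtain f where "f \<in> lie_hom borel P (Xs ! i)"
      "\<And>jk. jk \<in> strings J n \<Longrightarrow> f (b jk) = (\<lambda>(j, k). if j \<in> Js i then c i (j, k) else \<zero>\<^bsub>Xs ! i\<^esub>) jk"
      by (rule hom_of_strings[OF P X(1)[OF i], of "\<lambda>(j, k). if j \<in> Js i then c i (j, k) else \<zero>\<^bsub>Xs ! i\<^esub>"])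
        (use QX[OF i] SX[OF i] z in \<open>auto split: if_splits\<close>)
    thus ?thesis by (intro exI[of _ f]) auto
  qed
  then obtain prj where prj: "prj i \<in> lie_hom borel P (Xs ! i)"
    "\<lbrakk>j \<in> J; k \<le> n j\<rbrakk> \<Longrightarrow> prj i (b (j, k)) = (if j \<in> Js i then c i (j, k) else \<zero>\<^bsub>Xs ! i\<^esub>)"
    if "i < length Xs" for i j k by metis
  have pi: "prj i (inj m v) = (if i = m then v else \<zero>\<^bsub>Xs ! i\<^esub>)"
    if i: "i < length Xs" and m: "m < length Xs" and v: "v \<in> carrier (Xs ! m)" for i m v
  proof (cases "i = m")
    case True
    have "prj m (inj m v) = v"
      by (rule lin_ext[OF QX(1)[OF m] cX[OF m] lin_compose[OF lie_homD(1)[OF inj(1)[OF m]] lie_homD(1)[OF prj(1)[OF m]]] lin_id _ v])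
        (use inj(2)[OF m] prj(2)[OF m] JJ[OF m] in auto)
    thus ?thesis using True by simp
  next
    case False
    have nd: "j \<notin> Js i" if "j \<in> Js m" for j using disj[OF _ that i m] False by blast
    have "prj i (inj m v) = \<zero>\<^bsub>Xs ! i\<^esub>"
      by (rule lin_ext[OF QX(1)[OF m] cX[OF i] lin_compose[OF lie_homD(1)[OF inj(1)[OF m]] lie_homD(1)[OF prj(1)[OF i]]] lin_const_zero[OF cX[OF i]] _ v])
        (use nd inj(2)[OF m] prj(2)[OF i] JJ[OF m] in auto)
    thus ?thesis using False by simp
  qed
  interpret P: vectorspace "class_ring :: complex ring" P by (rule cP)
  define h where "h = (\<lambda>i. compose (carrier P) (inj i) (prj i))"
  have h: "h i \<in> lie_hom borel P P" if "i < length Xs" for i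
    unfolding h_def by (rule lie_hom_compose[OF P(1) prj(1)[OF that] inj(1)[OF that]])
  obtain s where s: "s \<in> lie_hom borel P P" "finsum (lie_Hom borel P P) (\<lambda>i. (P, h i, P)) {..<length Xs} = (P, s, P)"
    "\<And>v. v \<in> carrier P \<Longrightarrow> s v = finsum P (\<lambda>i. h i v) {..<length Xs}"
    by (rule finsum_lie_Hom[OF P(1) P(1), of "{..<length Xs}" h]) (use h in auto)
  have "s v = v" if v: "v \<in> carrier P" for v
  proof (rule lin_ext[OF QP(1) cP lie_homD(1)[OF s(1)] lin_id _ v])
    fix jk assume "jk \<in> strings J n"
    then obtain j k where jk: "jk = (j, k)" "j \<in> J" "k \<le> n j" by auto
    obtain m where m: "m < length Xs" "j \<in> Js m" using jk(2) J by blast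
    have bc: "b (j, k) \<in> carrier P" by (rule QP(2)[OF jk(2,3)])
    have "s (b (j, k)) = finsum P (\<lambda>i. if m = i then b (j, k) else \<zero>\<^bsub>P\<^esub>) {..<length Xs}"
      unfolding s(3)[OF bc]
    proof (rule P.finsum_cong')
      fix i assume "i \<in> {..<length Xs}"
      hence i: "i < length Xs" by simp
      show "h i (b (j, k)) = (if m = i then b (j, k) else \<zero>\<^bsub>P\<^esub>)"
        using prj(2)[OF i jk(2,3)] inj(2)[OF i _ jk(3)] m disj[OF _ m(2) i m(1)] lin_zero[OF cX[OF i] cP lie_homD(1)[OF inj(1)[OF i]]] bc
        by (auto simp: h_def compose_def)
    qed (use bc in auto)
    also have "\<dots> = b (j, k)" by (rule P.finsum_singleton) (use m bc in auto)
    finally show "s (b jk) = b jk" unfolding jk(1) .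
  qed
  hence "s = restrict (\<lambda>v. v) (carrier P)" by (intro lie_hom_eqI[OF s(1) lie_hom_id[OF P(1)]]) simp
  hence sum: "finsum (lie_Hom borel P P) (\<lambda>i. (P, h i, P)) {..<length Xs} = lie_Id P" by (simp add: s(2) lie_Id_def)
  have Ob: "P \<in> Ob (N6 l)" "set Xs \<subseteq> Ob (N6 l)"
    using Ob_N6_qbasis(1)[OF P] Ob_N6_qbasis(1)[OF X] by (auto simp: in_set_conv_nth)
  show ?thesis
    unfolding direct_sum_def
  proof (intro conjI Ob, rule exI[of _ "\<lambda>i. (Xs ! i, inj i, P)"], rule exI[of _ "\<lambda>i. (P, prj i, Xs ! i)"], intro conjI allI impI)
    fix i m assume im: "i < length Xs" "m < length Xs"
    have "compose (carrier (Xs ! m)) (prj i) (inj m) = restrict (\<lambda>v. if i = m then v else \<zero>\<^bsub>Xs ! i\<^esub>) (carrier (Xs ! m))"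
      using pi[OF im] by (auto simp: compose_def fun_eq_iff)
    thus "Cmp (N6 l) (P, prj i, Xs ! i) (Xs ! m, inj m, P) = (if i = m then Id (N6 l) (Xs ! i) else \<zero>\<^bsub>Hom (N6 l) (Xs ! m) (Xs ! i)\<^esub>)"
      by (simp add: lie_Id_def)
  qed (use inj(1) prj(1) sum in \<open>simp_all add: h_def\<close>)
qed

lemma lie_module_submodule:
  assumes M: "lie_module g M" and A: "lie_submodule g A M"
  shows "lie_module g (M\<lparr>carrier := A\<rparr>)"
proof -
  have AM: "A \<subseteq> carrier M" and sub: "VectorSpace.subspace class_ring A M" and a: "\<And>x v. \<lbrakk>x \<in> g; v \<in> A\<rbrakk> \<Longrightarrow> act M x v \<in> A"
    using A by (auto simp: lie_submodule_def subspace_iff)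
  note c = cvs_carrier_update[OF sub] and D = lie_moduleD[OF M]
  show ?thesis
  proof (rule lie_moduleI)
    show "cvs (M\<lparr>carrier := A\<rparr>)" by (rule c)
    show "lin (M\<lparr>carrier := A\<rparr>) (M\<lparr>carrier := A\<rparr>) (act (M\<lparr>carrier := A\<rparr>) x)" if "x \<in> g" for x
      using linD[OF D(2)[OF that]] a[OF that] by (auto simp: lin_iff subsetD[OF AM])
    fix x y v assume xy: "x \<in> g" "y \<in> g" and "v \<in> carrier (M\<lparr>carrier := A\<rparr>)"
    hence v: "v \<in> A" and vM: "v \<in> carrier M" using AM by auto
    show "act (M\<lparr>carrier := A\<rparr>) (x + y) v = act (M\<lparr>carrier := A\<rparr>) x v \<oplus>\<^bsub>M\<lparr>carrier := A\<rparr>\<^esub> act (M\<lparr>carrier := A\<rparr>) y v"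
      using D(3)[OF xy vM] by simp
    have m: "act M x (act M y v) \<in> A" "act M y (act M x v) \<in> A" using a xy v by auto
    have "act M x (act M y v) \<ominus>\<^bsub>M\<lparr>carrier := A\<rparr>\<^esub> act M y (act M x v) = act M x (act M y v) \<ominus>\<^bsub>M\<^esub> act M y (act M x v)"
      using cvs_distribs(3)[OF c, of "act M x (act M y v)" "act M y (act M x v)"] m
        cvs_distribs(3)[OF D(1), of "act M x (act M y v)" "act M y (act M x v)"] subsetD[OF AM] by simp
    thus "act (M\<lparr>carrier := A\<rparr>) (x * y - y * x) v = act (M\<lparr>carrier := A\<rparr>) x (act (M\<lparr>carrier := A\<rparr>) y v)
        \<ominus>\<^bsub>M\<lparr>carrier := A\<rparr>\<^esub> act (M\<lparr>carrier := A\<rparr>) y (act (M\<lparr>carrier := A\<rparr>) x v)"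
      using D(5)[OF xy vM] by simp
  next
    fix x c' v assume "x \<in> g" "v \<in> carrier (M\<lparr>carrier := A\<rparr>)"
    thus "act (M\<lparr>carrier := A\<rparr>) (c' \<cdot>\<^sub>m x) v = c' \<odot>\<^bsub>M\<lparr>carrier := A\<rparr>\<^esub> act (M\<lparr>carrier := A\<rparr>) x v"
      using D(4) AM by auto
  qed
qed

text \<open>As a module the image splits the idempotent. It is an object again because the
  idempotent commutes with the lowering operator, which makes the image stable.\<close>

lemma N6_idempotent_split: "idempotent_split (N6 l :: ('u lmod, 'u arrow, 'u lmod, 'u arrow) modcat)"
  unfolding idempotent_split_def
proof (intro ballI impI)
  fix X :: "'u lmod" and e assume X: "X \<in> Ob (N6 l)" and e: "e \<in> Arr (N6 l) X X" and ee: "Cmp (N6 l) e e = e"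
  from e obtain f where f: "f \<in> lie_hom borel X X" and e_def: "e = (X, f, X)" by auto
  from X obtain F where M: "lie_module borel X" and fX: "fd X" and F: "sl2ext l X F" by (auto simp: Ob_N6)
  note S = cvs_simps[OF lie_moduleD(1)[OF M]] and fD = lie_homD[OF f] and L = linD[OF lie_homD(1)[OF f]]
  have "compose (carrier X) f f = f" using ee by (simp add: e_def)
  hence ff: "f (f v) = f v" if "v \<in> carrier X" for v using that by (metis compose_eq)
  define A where "A = f ` carrier X"
  have AX: "A \<subseteq> carrier X" using L(1) by (auto simp: A_def)
  have fA: "f v = v" if "v \<in> A" for v using that ff by (auto simp: A_def)
  have "VectorSpace.subspace class_ring A X"
    unfolding subspace_iff
  proof (intro conjI allI ballI AX lie_moduleD(1)[OF M])
    show "\<zero>\<^bsub>X\<^esub> \<in> A" unfolding A_def using S(1) lin_zero[OF lie_moduleD(1,1)[OF M] fD(1)] by force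
    show "v \<oplus>\<^bsub>X\<^esub> w \<in> A" if "v \<in> A" "w \<in> A" for v w
      using that AX L(2)[of v w] fA S(2) unfolding A_def by (metis imageI subsetD)
    show "c \<odot>\<^bsub>X\<^esub> v \<in> A" if "v \<in> A" for c v
      using that AX L(3)[of v c] fA S(3) unfolding A_def by (metis imageI subsetD)
  qed
  moreover have "act X x v \<in> A" if "x \<in> borel" "v \<in> A" for x v
    using that AX fD(4)[of x v] fA lie_moduleD(6)[OF M, of x v] unfolding A_def by (metis imageI subsetD)
  ultimately have sub: "lie_submodule borel A X" by (simp add: lie_submodule_def)
  let ?Y = "X\<lparr>carrier := A\<rparr>"
  have Y: "lie_module borel ?Y" by (rule lie_module_submodule[OF M sub])
  have fY: "fd ?Y" using fd_subspace[OF fX] sub by (simp add: lie_submodule_def)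
  have inc: "lin ?Y X (\<lambda>v. v)" using AX by (auto simp: lin_iff)
  have "\<exists>F'. sl2ext l ?Y F'"
  proof (rule sl2ext_pullback[OF Y lie_moduleD(1)[OF M] F inc])
    fix v assume "v \<in> carrier ?Y"
    hence v: "v \<in> A" by simp
    have "F v = f (F v)" using hom_commutes_F[OF M M fX fX F F f] v AX fA by auto
    thus "F v \<in> (\<lambda>v. v) ` carrier ?Y" using sl2extD(2)[OF F] v AX by (force simp: A_def)
  qed (simp_all add: inj_on_def)
  hence YO: "?Y \<in> Ob (N6 l)" using Y fY by (simp add: Ob_N6)
  have r: "f \<in> lie_hom borel X ?Y" using fD by (auto simp: lie_hom_iff lin_iff A_def)
  have s: "restrict (\<lambda>v. v) A \<in> lie_hom borel ?Y X" using lie_hom_restrictI[OF Y inc] by simp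
  have "compose (carrier X) (restrict (\<lambda>v. v) A) f = f"
    using fD(2) by (auto simp: compose_def fun_eq_iff A_def extensional_def)
  moreover have "compose A f (restrict (\<lambda>v. v) A) = restrict (\<lambda>v. v) A" using fA by (auto simp: compose_def fun_eq_iff)
  ultimately show "\<exists>Y\<in>Ob (N6 l). \<exists>r\<in>Arr (N6 l) X Y. \<exists>s\<in>Arr (N6 l) Y X. Cmp (N6 l) s r = e \<and> Cmp (N6 l) r s = Id (N6 l) Y"
    using r s by (intro bexI[OF _ YO] bexI[of _ "(X, f, ?Y)"] bexI[of _ "(?Y, restrict (\<lambda>v. v) A, X)"]) (simp_all add: e_def lie_Id_def)
qed

lemma lie_Hom_fd:
  fixes M N :: "'u lmod"
  assumes M: "lie_module g M" "fd M" and N: "lie_module g N" "fd N"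
  shows "fd (lie_Hom g M N)"
proof -
  obtain b and r :: nat where b: "fbasis M b {..<r}" using M(2) by (rule fdE)
  obtain d and s :: nat where d: "fbasis N d {..<s}" using N(2) by (rule fdE)
  \<comment> \<open>A homomorphism is recorded by the matrix of its values on a basis; this map into
    a coordinate space is injective, which bounds the dimension.\<close>
  define \<theta> where "\<theta> = (\<lambda>(p :: 'u arrow) (i, k). if i < r \<and> k < s then crd N d {..<s} (fst (snd p) (b i)) k else 0)"
  note C = linD[OF crd(1)[OF d]]
  have ev: "fst (snd p) (b i) \<in> carrier N" if "p \<in> carrier (lie_Hom g M N)" "i < r" for p i
    using lie_homD(3)[OF fst_snd_lie_Hom[OF that(1)]] fbasisD(4)[OF b] that(2) by simp
  have bi: "b i \<in> carrier M" if "i < r" for i using fbasisD(4)[OF b] that by simp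
  show ?thesis
  proof (rule fd_of_inj[OF lie_Hom_cvs[OF M(1) N(1)]])
    show "finite ({..<r} \<times> {..<s})" by simp
    show "lin (lie_Hom g M N) (fs ({..<r} \<times> {..<s})) \<theta>"
    proof (rule linI)
      show "\<theta> (p \<oplus>\<^bsub>lie_Hom g M N\<^esub> q) = \<theta> p \<oplus>\<^bsub>fs ({..<r} \<times> {..<s})\<^esub> \<theta> q" if "p \<in> carrier (lie_Hom g M N)" "q \<in> carrier (lie_Hom g M N)" for p q
        using C(2)[OF ev[OF that(1)] ev[OF that(2)]] bi by (auto simp: \<theta>_def fun_eq_iff)
      show "\<theta> (a \<odot>\<^bsub>lie_Hom g M N\<^esub> p) = a \<odot>\<^bsub>fs ({..<r} \<times> {..<s})\<^esub> \<theta> p" if "p \<in> carrier (lie_Hom g M N)" for a p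
        using C(3)[OF ev[OF that]] bi by (auto simp: \<theta>_def fun_eq_iff)
    qed (auto simp: \<theta>_def)
    show "inj_on \<theta> (carrier (lie_Hom g M N))"
    proof (rule inj_onI)
      fix p q assume p: "p \<in> carrier (lie_Hom g M N)" and q: "q \<in> carrier (lie_Hom g M N)" and eq: "\<theta> p = \<theta> q"
      have "fst (snd p) (b i) = fst (snd q) (b i)" if i: "i < r" for i
      proof (rule inj_onD[OF bij_betw_imp_inj_on[OF crd(2)[OF d]] _ ev[OF p i] ev[OF q i]], rule ext)
        fix k
        show "crd N d {..<s} (fst (snd p) (b i)) k = crd N d {..<s} (fst (snd q) (b i)) k"
          using fun_cong[OF eq, of "(i, k)"] i C(1)[OF ev[OF p i]] C(1)[OF ev[OF q i]] by (cases "k < s") (auto simp: \<theta>_def)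
      qed
      hence "fst (snd p) v = fst (snd q) v" if "v \<in> carrier M" for v
        by (intro lin_ext[OF b lie_moduleD(1)[OF N(1)] lie_homD(1)[OF fst_snd_lie_Hom[OF p]] lie_homD(1)[OF fst_snd_lie_Hom[OF q]] _ that]) simp
      hence "fst (snd p) = fst (snd q)" by (rule lie_hom_eqI[OF fst_snd_lie_Hom[OF p] fst_snd_lie_Hom[OF q]])
      thus "p = q" using p q by auto
    qed
  qed
qed

lemma N6_fin_dim_Homs: "finite_dimensional_Homs (N6 l :: ('u lmod, 'u arrow, 'u lmod, 'u arrow) modcat)"
  unfolding finite_dimensional_Homs_def
proof (intro ballI)
  fix X Y :: "'u lmod" assume X: "X \<in> Ob (N6 l)" and Y: "Y \<in> Ob (N6 l)"
  hence "fd (lie_Hom borel X Y)" by (intro lie_Hom_fd) (auto simp: Ob_N6)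
  thus "vectorspace.fin_dim class_ring (Hom (N6 l) X Y)" using fd_iff fd_cvs by fastforce
qed

text \<open>Supplies the bricks, the direct sums of two objects, and the comparison module for the
  tensor product with L(1).\<close>

lemma (in embedded_complex) string_module_exists:
  assumes "finite J"
  shows "\<exists>(M :: 'u lmod) (b :: 'j \<times> nat \<Rightarrow> 'u). lie_module borel M \<and> qbasis l M b J n"
proof -
  note S = std_module[OF assms, of l n] and Q = std_qbasis[OF assms, of l n]
  from lie_model_exists[OF lie_closed_borel S qbasisD(5)[OF Q]] obtain M :: "'u lmod" and \<phi> where M: "lie_module borel M"
    and \<phi>: "lin (std l J n) M \<phi>" "bij_betw \<phi> (carrier (std l J n)) (carrier M)"
    and act: "\<And>x v. v \<in> carrier (std l J n) \<Longrightarrow> act M x (\<phi> v) = \<phi> (act (std l J n) x v)" by blast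
  have "qbasis l M (\<lambda>i. \<phi> (unit i)) J n" by (rule qbasis_image[OF Q S M \<phi>]) (simp_all only: act)
  with M show ?thesis by blast
qed

lemma (in embedded_complex) N6_sums:
  fixes X Y :: "'u lmod"
  assumes "X \<in> Ob (N6 l)" "Y \<in> Ob (N6 l)"
  shows "\<exists>P. direct_sum (N6 l) [X, Y] P"
proof -
  from Ob_N6_qbasis(2)[OF assms(1)] obtain b and N :: nat and n where q: "qbasis l X b {..<N} n" by blast
  from Ob_N6_qbasis(2)[OF assms(2)] obtain b' and N' :: nat and n' where q': "qbasis l Y b' {..<N'} n'" by blast
  \<comment> \<open>Tagging the names with 0 and 1 keeps the strings of the two summands
    apart.\<close>
  define Js where "Js = (\<lambda>i :: nat. {i} \<times> (if i = 0 then {..<N} else {..<N'}))"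
  define m where "m = (\<lambda>(i :: nat, j). if i = 0 then n j else n' j)"
  define c where "c = (\<lambda>i :: nat. \<lambda>((i' :: nat, j :: nat), k :: nat). if i = 0 then b (j, k) else b' (j, k))"
  have h: "bij_betw snd (Js 0) {..<N}" "bij_betw snd (Js 1) {..<N'}" by (auto simp: Js_def bij_betw_def inj_on_def image_iff)
  have QX: "qbasis l X (c 0) (Js 0) m" by (rule qbasis_cong[OF qbasis_reindex[OF q h(1)]]) (auto simp: Js_def m_def c_def)
  have QY: "qbasis l Y (c 1) (Js 1) m" by (rule qbasis_cong[OF qbasis_reindex[OF q' h(2)]]) (auto simp: Js_def m_def c_def)
  have "finite (Js 0 \<union> Js 1)" by (simp add: Js_def)
  from string_module_exists[OF this, of l m] obtain P :: "'u lmod" and bP where P: "lie_module borel P" "qbasis l P bP (Js 0 \<union> Js 1) m" by blast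
  have "direct_sum (N6 l) [X, Y] P"
  proof (rule direct_sum_strings[OF P, of "[X, Y]" c Js])
    fix i assume "i < length [X, Y]"
    hence i: "i = 0 \<or> i = 1" by auto
    show "lie_module borel ([X, Y] ! i)" using i assms by (auto simp: Ob_N6)
    show "qbasis l ([X, Y] ! i) (c i) (Js i) m" using i QX QY by auto
  next
    have "{..<length [X, Y]} = {0, 1}" by auto
    thus "Js 0 \<union> Js 1 = (\<Union>i<length [X, Y]. Js i)" by simp
  qed (auto simp: Js_def)
  thus ?thesis ..
qed

section \<open>The module L(1) and the Clebsch-Gordan rule\<close>

section \<open>The two dimensional simple module\<close>

lemma sl2_act:
  assumes V: "lie_module sl2 V" and x: "x \<in> sl2" and v: "v \<in> carrier V"
  shows "act V x v = x $$ (0, 0) \<odot>\<^bsub>V\<^esub> act V mat_h v \<oplus>\<^bsub>V\<^esub>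
    (x $$ (0, 1) \<odot>\<^bsub>V\<^esub> act V mat_e v \<oplus>\<^bsub>V\<^esub> x $$ (1, 0) \<odot>\<^bsub>V\<^esub> act V mat_f v)"
proof -
  note D = lie_moduleD[OF V] and cl = lie_closed_sl2[unfolded lie_closed_def]
  have he: "mat_h \<in> sl2" "mat_e \<in> sl2" using borel_subset_sl2 by auto
  have "x = x $$ (0, 0) \<cdot>\<^sub>m mat_h + (x $$ (0, 1) \<cdot>\<^sub>m mat_e + x $$ (1, 0) \<cdot>\<^sub>m mat_f)"
    by (rule mat2_eqI) (use x in \<open>auto simp: sl2_iff\<close>)
  moreover have "act V (x $$ (0, 0) \<cdot>\<^sub>m mat_h + (x $$ (0, 1) \<cdot>\<^sub>m mat_e + x $$ (1, 0) \<cdot>\<^sub>m mat_f)) v =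
      x $$ (0, 0) \<odot>\<^bsub>V\<^esub> act V mat_h v \<oplus>\<^bsub>V\<^esub> (x $$ (0, 1) \<odot>\<^bsub>V\<^esub> act V mat_e v \<oplus>\<^bsub>V\<^esub> x $$ (1, 0) \<odot>\<^bsub>V\<^esub> act V mat_f v)"
    using cl he v by (simp add: D(3,4))
  ultimately show ?thesis by simp
qed

text \<open>Column vectors under matrix multiplication, the witness that the choice of
  \<open>L1\<close> has a candidate.\<close>

definition natural_module :: "(nat \<Rightarrow> complex) lmod"
  where "natural_module = \<lparr>carrier = carrier (fs {..<2}), monoid.mult = undefined, one = undefined,
     zero = (\<lambda>i. 0), add = (\<lambda>c d i. c i + d i), module.smult = (\<lambda>a c i. a * c i),
     act = (\<lambda>x c i. if i < 2 then x $$ (i, 0) * c 0 + x $$ (i, 1) * c 1 else 0)\<rparr>"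

lemma natural_module_sel [simp]:
  "c \<in> carrier natural_module \<longleftrightarrow> (\<forall>i\<ge>2. c i = 0)"
  "\<zero>\<^bsub>natural_module\<^esub> = (\<lambda>i. 0)" "c \<oplus>\<^bsub>natural_module\<^esub> d = (\<lambda>i. c i + d i)" "a \<odot>\<^bsub>natural_module\<^esub> c = (\<lambda>i. a * c i)"
  "act natural_module x c i = (if i < 2 then x $$ (i, 0) * c 0 + x $$ (i, Suc 0) * c (Suc 0) else 0)"
  by (auto simp: natural_module_def)

lemma natural_module: "lie_module sl2 natural_module" "fbasis natural_module unit {..<2}"
proof -
  have l: "lin (fs {..<2}) natural_module (\<lambda>c. c)" by (auto simp: lin_iff)
  have b: "bij_betw (\<lambda>c. c) (carrier (fs {..<2})) (carrier natural_module)" by (auto simp: bij_betw_def)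
  have c: "cvs natural_module" by (rule cvs_iso[OF fs_cvs b l]) simp
  from fbasis_of_iso[OF _ this l b] show "fbasis natural_module unit {..<2}" by simp
  show "lie_module sl2 natural_module"
  proof (rule lie_moduleI[OF c])
    show "lin natural_module natural_module (act natural_module x)" for x
      by (rule linI) (auto simp: fun_eq_iff algebra_simps)
    fix x y v assume xy: "x \<in> sl2" "y \<in> sl2" and v: "v \<in> carrier natural_module"
    have d: "x \<in> carrier_mat 2 2" "y \<in> carrier_mat 2 2" using xy by (auto simp: sl2_iff)
    show "act natural_module (x + y) v = act natural_module x v \<oplus>\<^bsub>natural_module\<^esub> act natural_module y v"
      using d by (auto simp: fun_eq_iff algebra_simps)
    have m: "(x * y - y * x) $$ (i, j) = x $$ (i, 0) * y $$ (0, j) + x $$ (i, 1) * y $$ (1, j)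
        - (y $$ (i, 0) * x $$ (0, j) + y $$ (i, 1) * x $$ (1, j))" if "i < 2" "j < 2" for i j
      using mat2_mult[OF d that] mat2_mult[OF d(2,1) that] d that by simp
    have "act natural_module x (act natural_module y v) \<ominus>\<^bsub>natural_module\<^esub> act natural_module y (act natural_module x v) =
        act natural_module x (act natural_module y v) \<oplus>\<^bsub>natural_module\<^esub> (-1) \<odot>\<^bsub>natural_module\<^esub> act natural_module y (act natural_module x v)"
      by (rule cvs_distribs(3)[OF c]) simp_all
    also have "\<dots> = act natural_module (x * y - y * x) v"
      by (rule ext) (simp add: m algebra_simps)
    finally show "act natural_module (x * y - y * x) v =
        act natural_module x (act natural_module y v) \<ominus>\<^bsub>natural_module\<^esub> act natural_module y (act natural_module x v)" ..
  next
    fix x c' v assume "x \<in> sl2"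
    thus "act natural_module (c' \<cdot>\<^sub>m x) v = c' \<odot>\<^bsub>natural_module\<^esub> act natural_module x v"
      by (auto simp: fun_eq_iff algebra_simps sl2_iff)
  qed
qed

text \<open>A nonzero vector of a submodule is either a multiple of \<open>b 0\<close> or is sent by
  e to a nonzero multiple of it; then f yields \<open>b 1\<close> as well.\<close>

lemma simple_two_dim:
  assumes V: "lie_module sl2 V" and b: "fbasis V b {..<2 :: nat}"
    and e: "act V mat_e (b 0) = \<zero>\<^bsub>V\<^esub>" "act V mat_e (b 1) = b 0" and f: "act V mat_f (b 0) = b 1"
  shows "lie_simple sl2 V"
proof -
  note B = fbasisD[OF b] and D = lie_moduleD[OF V]
  note S = cvs_simps[OF B(1)]
  have he: "mat_h \<in> sl2" "mat_e \<in> sl2" using borel_subset_sl2 by auto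
  have bc: "b 0 \<in> carrier V" "b 1 \<in> carrier V" using B(4) by simp_all
  have nz: "b 0 \<noteq> \<zero>\<^bsub>V\<^esub>"
  proof
    assume "b 0 = \<zero>\<^bsub>V\<^esub>"
    hence "comb V b {..<2} (unit 0) = \<zero>\<^bsub>V\<^esub>" using comb_unit[OF B(1-3), of 0] by simp
    from fbasis_zero[OF b this, of 0] show False by (simp add: unit_def)
  qed
  interpret W: vectorspace "class_ring :: complex ring" V by (rule B(1))
  have "A = {\<zero>\<^bsub>V\<^esub>} \<or> A = carrier V" if A: "lie_submodule sl2 A V" for A
  proof (cases "A = {\<zero>\<^bsub>V\<^esub>}")
    case False
    have AV: "A \<subseteq> carrier V" and z: "\<zero>\<^bsub>V\<^esub> \<in> A" and add: "\<And>v w. \<lbrakk>v \<in> A; w \<in> A\<rbrakk> \<Longrightarrow> v \<oplus>\<^bsub>V\<^esub> w \<in> A"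
      and smult: "\<And>c v. v \<in> A \<Longrightarrow> c \<odot>\<^bsub>V\<^esub> v \<in> A" and act: "\<And>x v. \<lbrakk>x \<in> sl2; v \<in> A\<rbrakk> \<Longrightarrow> act V x v \<in> A"
      using A by (auto simp: lie_submodule_def subspace_iff)
    have scale: "w \<in> A" if "c \<odot>\<^bsub>V\<^esub> w \<in> A" "c \<noteq> 0" "w \<in> carrier V" for c w
      using smult[OF that(1), of "inverse c"] that S by simp
    have expand: "\<exists>x y. v = x \<odot>\<^bsub>V\<^esub> b 0 \<oplus>\<^bsub>V\<^esub> y \<odot>\<^bsub>V\<^esub> b 1" if "v \<in> carrier V" for v
    proof -
      have "{..<2 :: nat} = {0, 1}" by auto
      hence "comb V b {..<2} (crd V b {..<2} v) = crd V b {..<2} v 0 \<odot>\<^bsub>V\<^esub> b 0 \<oplus>\<^bsub>V\<^esub> crd V b {..<2} v 1 \<odot>\<^bsub>V\<^esub> b 1"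
        unfolding comb_def using S(3) bc by simp
      thus ?thesis using crd(3)[OF b that] by metis
    qed
    obtain v where v: "v \<in> A" "v \<noteq> \<zero>\<^bsub>V\<^esub>" using False z by blast
    then obtain x y where xy: "v = x \<odot>\<^bsub>V\<^esub> b 0 \<oplus>\<^bsub>V\<^esub> y \<odot>\<^bsub>V\<^esub> b 1" using expand AV by blast
    have "b 0 \<in> A"
    proof (cases "y = 0")
      case True
      hence "v = x \<odot>\<^bsub>V\<^esub> b 0" using xy S bc by simp
      thus ?thesis using v scale[of x "b 0"] S(8) bc by metis
    next
      case False
      have "act V mat_e v = y \<odot>\<^bsub>V\<^esub> b 0"
        unfolding xy using linD(2,3)[OF D(2)[OF he(2)]] bc S by (simp add: e(1) e(2)[simplified])
      thus ?thesis using act[OF he(2) v(1)] scale[OF _ False bc(1)] by simp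
    qed
    moreover from act[OF mat_f(1) this] have "b 1 \<in> A" unfolding f .
    ultimately have "carrier V \<subseteq> A" using expand add smult by blast
    thus ?thesis using AV by blast
  qed simp
  thus ?thesis unfolding lie_simple_def using V nz bc(1) by blast
qed

text \<open>Since \<open>L1\<close> is a choice, every two dimensional simple module has to be
  identified as the string with parameter 1. The string sizes n j + 1 add up to 2; the other
  possibility is two strings of size 1, where all of \<open>sl2\<close> acts by zero and a line is a
  proper submodule.\<close>

lemma simple_two_dim_strings:
  fixes V :: "'v lmod"
  assumes V: "lie_simple sl2 V" and fin: "fd V" and dim: "vectorspace.dim class_ring V = 2"
  shows "\<exists>b :: nat \<times> nat \<Rightarrow> 'v. qbasis 0 V b {0} (\<lambda>_. 1)"
proof -
  have M: "lie_module sl2 V" using V by (simp add: lie_simple_def)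
  note D = lie_moduleD[OF M]
  note S = cvs_simps[OF D(1)]
  have he: "mat_h \<in> sl2" "mat_e \<in> sl2" using borel_subset_sl2 by auto
  from sl2ext_imp_qbasis[OF lie_module_subset[OF M borel_subset_sl2] fin sl2_module_ext[OF M fin]]
  obtain b :: "nat \<times> nat \<Rightarrow> 'v" and N :: nat and n where q: "qbasis 0 V b {..<N} n" by blast
  note Q = qbasisD[OF q]
  have card: "(\<Sum>j<N. Suc (n j)) = 2" using fbasis_fin_dim(2)[OF Q(1)] dim by simp
  have "N \<noteq> 0" using card by (cases N) auto
  then obtain N' where N: "N = Suc N'" by (cases N) auto
  hence card': "Suc (n 0) + (\<Sum>j<N'. Suc (n (Suc j))) = 2" using card unfolding N sum.lessThan_Suc_shift by simp
  show ?thesis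
  proof (cases "n 0 = 0")
    case False
    hence n0: "n 0 = 1" and "(\<Sum>j<N'. Suc (n (Suc j))) = 0" using card' by linarith+
    hence "N' = 0" by (cases N') auto
    hence J: "{..<N} = {0}" using N by auto
    have "qbasis 0 V b {0} (\<lambda>_. 1)" by (rule qbasis_cong[OF q[unfolded J]]) (simp_all add: n0)
    thus ?thesis by blast
  next
    case True
    have zero: "n j = 0" if "j < N" for j
    proof (cases j)
      case (Suc k)
      have "(\<Sum>j<N'. Suc (n (Suc j))) = 1" using card' True by simp
      moreover have "Suc (n (Suc k)) \<le> (\<Sum>j<N'. Suc (n (Suc j)))"
        by (rule member_le_sum) (use that Suc N in auto)
      ultimately show ?thesis using Suc by simp
    qed (use True in simp)
    have N2: "N = 2" using card by (simp add: zero)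
    have bc: "b (0, 0) \<in> carrier V" "b (1, 0) \<in> carrier V" using Q(2) N2 by auto
    have he0: "act V mat_h v = \<zero>\<^bsub>V\<^esub>" "act V mat_e v = \<zero>\<^bsub>V\<^esub>" if v: "v \<in> carrier V" for v
      by (rule lin_ext[OF Q(1) D(1) D(2) lin_const_zero[OF D(1)] _ v], use he Q(2,3,4) zero S(8) in auto)+
    \<comment> \<open>The relation [h, f] = - 2 f forces f to act by zero once h does.\<close>
    have f0: "act V mat_f v = \<zero>\<^bsub>V\<^esub>" if v: "v \<in> carrier V" for v
    proof -
      have fv: "act V mat_f v \<in> carrier V" by (rule D(6)[OF mat_f(1) v])
      have "(-2) \<odot>\<^bsub>V\<^esub> act V mat_f v = act V mat_h (act V mat_f v) \<ominus>\<^bsub>V\<^esub> act V mat_f (act V mat_h v)"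
        using D(4)[of mat_f v "-2"] D(5)[of mat_h mat_f v] v he by simp
      also have "\<dots> = \<zero>\<^bsub>V\<^esub>"
        unfolding he0(1)[OF v] he0(1)[OF fv] lin_zero[OF D(1,1) D(2)[OF mat_f(1)]] by (rule cvs_distribs(7)[OF D(1) S(1)])
      finally have "(-1/2) \<odot>\<^bsub>V\<^esub> ((-2) \<odot>\<^bsub>V\<^esub> act V mat_f v) = \<zero>\<^bsub>V\<^esub>" using S(9) by simp
      thus ?thesis using S fv by simp
    qed
    have x0: "act V x v = \<zero>\<^bsub>V\<^esub>" if "x \<in> sl2" "v \<in> carrier V" for x v
      unfolding sl2_act[OF M that] he0[OF that(2)] f0[OF that(2)] using S by simp
    define A where "A = {c \<odot>\<^bsub>V\<^esub> b (0, 0) | c. True}"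
    have "lie_submodule sl2 A V"
      unfolding lie_submodule_def subspace_iff
    proof (intro conjI allI ballI D(1))
      show AV: "A \<subseteq> carrier V" using S(3) bc by (auto simp: A_def)
      show z: "\<zero>\<^bsub>V\<^esub> \<in> A" using S(8)[OF bc(1)] unfolding A_def by (metis (mono_tags, lifting) mem_Collect_eq)
      show "v \<oplus>\<^bsub>V\<^esub> w \<in> A" if "v \<in> A" "w \<in> A" for v w
        using that cvs_distribs(1)[OF D(1) bc(1)] unfolding A_def by (smt (verit) mem_Collect_eq)
      show "c \<odot>\<^bsub>V\<^esub> v \<in> A" if "v \<in> A" for c v using that S(10)[OF bc(1)] by (auto simp: A_def)
      show "act V x v \<in> A" if "x \<in> sl2" "v \<in> A" for x v using x0[OF that(1), of v] that(2) AV z by auto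
    qed
    hence "A = {\<zero>\<^bsub>V\<^esub>} \<or> A = carrier V" using V by (simp add: lie_simple_def)
    moreover have indep: "x = 0 \<and> y = 0" if eq: "x \<odot>\<^bsub>V\<^esub> b (0, 0) \<oplus>\<^bsub>V\<^esub> y \<odot>\<^bsub>V\<^esub> b (1, 0) = \<zero>\<^bsub>V\<^esub>" for x y
    proof -
      interpret W: vectorspace "class_ring :: complex ring" V by (rule D(1))
      have J: "{..<N} = {0, 1}" by (auto simp: N2)
      have s: "strings {..<N} n = {(0, 0), (1, 0)}"
        unfolding J using zero[of 0] zero[of 1] N2 by (simp add: Sigma_def insert_commute)
      have "comb V b (strings {..<N} n) (\<lambda>i. if i = (0, 0) then x else y) = \<zero>\<^bsub>V\<^esub>"
        unfolding comb_def s using S(3) bc eq by simp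
      from fbasis_zero[OF Q(1) this, of "(0, 0)"] fbasis_zero[OF Q(1) this, of "(1, 0)"] show ?thesis by (simp add: s)
    qed
    moreover have "A \<noteq> {\<zero>\<^bsub>V\<^esub>}"
    proof
      assume "A = {\<zero>\<^bsub>V\<^esub>}"
      hence "1 \<odot>\<^bsub>V\<^esub> b (0, 0) = \<zero>\<^bsub>V\<^esub>" unfolding A_def by blast
      thus False using indep[of 1 0] S bc by simp
    qed
    moreover have "A \<noteq> carrier V"
    proof
      assume "A = carrier V"
      hence "b (1, 0) \<in> A" using bc(2) by simp
      then obtain c where "b (1, 0) = c \<odot>\<^bsub>V\<^esub> b (0, 0)" unfolding A_def by blast
      hence "c \<odot>\<^bsub>V\<^esub> b (0, 0) \<oplus>\<^bsub>V\<^esub> (-1) \<odot>\<^bsub>V\<^esub> b (1, 0) = (c + -1 * c) \<odot>\<^bsub>V\<^esub> b (0, 0)"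
        unfolding cvs_distribs(1)[OF D(1) bc(1)] using S(10)[OF bc(1)] by simp
      thus False using indep[of c "-1"] S(8)[OF bc(1)] by simp
    qed
    ultimately show ?thesis by blast
  qed
qed

context embedded_complex
begin

lemma L1_props: "(L1 :: 'u lmod) \<in> Ob sl2_mod" "lie_simple sl2 (L1 :: 'u lmod)" "vectorspace.dim class_ring (L1 :: 'u lmod) = 2"
proof -
  note N = natural_module
  from lie_model_exists[OF lie_closed_sl2 N(1) fbasis_imp_fd[OF N(2)]] obtain M :: "'u lmod" and \<phi> where M: "lie_module sl2 M"
    and \<phi>: "lin natural_module M \<phi>" "bij_betw \<phi> (carrier natural_module) (carrier M)"
    and act: "\<And>x v. v \<in> carrier natural_module \<Longrightarrow> act M x (\<phi> v) = \<phi> (act natural_module x v)" by blast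
  note B = fbasis_image[OF N(2) lie_moduleD(1)[OF M] \<phi>]
  have u: "unit 0 \<in> carrier natural_module" "unit 1 \<in> carrier natural_module" by (auto simp: unit_def)
  have a: "act natural_module mat_e (unit 0) = (\<lambda>_. 0)" "act natural_module mat_e (unit 1) = unit 0" "act natural_module mat_f (unit 0) = unit 1"
    by (auto simp: fun_eq_iff unit_def less_2_cases_iff)
  have "\<phi> (\<lambda>_. 0) = \<zero>\<^bsub>M\<^esub>" using lin_zero[OF lie_moduleD(1)[OF N(1)] lie_moduleD(1)[OF M] \<phi>(1)] by simp
  hence "lie_simple sl2 M"
    by (intro simple_two_dim[OF M B]) (simp_all only: act[OF u(1)] act[OF u(2)] a)
  moreover have "M \<in> Ob sl2_mod" using M fbasis_imp_fd[OF B] by (simp add: Ob_sl2_mod)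
  moreover have "vectorspace.dim class_ring M = 2" using fbasis_fin_dim(2)[OF B] by simp
  ultimately have "\<exists>L :: 'u lmod. L \<in> Ob sl2_mod \<and> lie_simple sl2 L \<and> vectorspace.dim class_ring L = 2" by blast
  from someI_ex[OF this] show "(L1 :: 'u lmod) \<in> Ob sl2_mod" "lie_simple sl2 (L1 :: 'u lmod)" "vectorspace.dim class_ring (L1 :: 'u lmod) = 2"
    unfolding L1_def by auto
qed

end

section \<open>Tensoring with the two dimensional simple module\<close>

context embedded_complex
begin

text \<open>The rule L(1) \<otimes> L(i) = L(i - 1) \<oplus> L(i + 1), shifted by l. Both strings
  are written down explicitly, and the change of basis is inverted in each weight space; for i = 0
  the string named 0 is absent.\<close>

lemma tensor_string:
  fixes V M :: "'u lmod" and p q :: "nat \<times> nat \<Rightarrow> 'u"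
  assumes V: "lie_module borel V" "qbasis 0 V p {0} (\<lambda>_. 1)" and M: "lie_module borel M" "qbasis l M q {0} (\<lambda>_. i)"
  shows "\<exists>y :: nat \<times> nat \<Rightarrow> 'u. qbasis l (tensor V M) y (if i = 0 then {1} else {0, 1}) (\<lambda>j. if j = 0 then i - 1 else i + 1)"
proof -
  let ?T = "tensor V M" and ?J = "if i = 0 then {1} else {0, 1 :: nat}" and ?n = "\<lambda>j :: nat. if j = 0 then i - 1 else i + 1"
  note QV = qbasisD[OF V(2)] and QM = qbasisD[OF M(2)]
  note fV = QV(5) and fM = QM(5)
  have T: "lie_module borel ?T" "fd ?T" by (rule lie_module_tensor[OF lie_closed_borel V(1) fV M(1) fM]) (rule fd_tensor[OF fV fM])
  note cT = lie_moduleD(1)[OF T(1)]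
  note ST = cvs_simps[OF cT] and SM = cvs_simps[OF fd_cvs[OF fM]] and SV = cvs_simps[OF fd_cvs[OF fV]]
  note h = lie_moduleD(2)[OF T(1) he_borel(1)] and e = lie_moduleD(2)[OF T(1) he_borel(2)]
  note B = bilinear_mapD[OF pt_bilinear[OF fV fM]]
  \<comment> \<open>Continuing by zero above height \<open>i\<close> lets e raise the index without
    a case distinction.\<close>
  define x where "x = (\<lambda>k. if k \<le> i then q (0, k) else \<zero>\<^bsub>M\<^esub>)"
  have x: "x k \<in> carrier M" for k using QM(2) SM(1) by (simp add: x_def)
  have xh: "act M mat_h (x k) = (l - of_nat i + 2 * of_nat k) \<odot>\<^bsub>M\<^esub> x k" for k
    using QM(3)[of 0 k] SM(9) lin_zero[OF fd_cvs fd_cvs lie_moduleD(2)[OF M(1)], OF fM fM] by (simp add: x_def)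
  have xe: "act M mat_e (x k) = x (Suc k)" for k
    using QM(4)[of 0 k] lin_zero[OF fd_cvs fd_cvs lie_moduleD(2)[OF M(1)], OF fM fM] by (simp add: x_def)
  have pV: "p (0, 0) \<in> carrier V" "p (0, 1) \<in> carrier V" using QV(2) by auto
  have ph: "act V mat_h (p (0, 0)) = (-1) \<odot>\<^bsub>V\<^esub> p (0, 0)" "act V mat_h (p (0, 1)) = 1 \<odot>\<^bsub>V\<^esub> p (0, 1)"
    using QV(3)[of 0 0] QV(3)[of 0 1] by simp_all
  have pe: "act V mat_e (p (0, 0)) = p (0, 1)" "act V mat_e (p (0, 1)) = \<zero>\<^bsub>V\<^esub>"
    using QV(4)[of 0 0] QV(4)[of 0 1] by simp_all
  define W where "W = (\<lambda>k. pure_tensor V M (p (0, 0)) (x k))"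
  define U where "U = (\<lambda>k. pure_tensor V M (p (0, 1)) (x k))"
  have WU: "W k \<in> carrier ?T" "U k \<in> carrier ?T" for k unfolding W_def U_def using B(3) pV x by blast+
  have z: "W k = \<zero>\<^bsub>?T\<^esub>" "U k = \<zero>\<^bsub>?T\<^esub>" if "k > i" for k
    using that lin_zero[OF fd_cvs[OF fM] cT B(1)[OF pV(1)]] lin_zero[OF fd_cvs[OF fM] cT B(1)[OF pV(2)]]
    by (simp_all add: W_def U_def x_def del: tensor_sel)
  have pt: "pure_tensor V M (p (0, 0)) (x k) = W k" "pure_tensor V M (p (0, 1)) (x k) = U k" for k by (simp_all add: W_def U_def)
  note act = tensor_act(2)[OF V(1) fV M(1) fM]
  have Wh: "act ?T mat_h (W k) = (l - of_nat (i + 1) + 2 * of_nat k) \<odot>\<^bsub>?T\<^esub> W k" for k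
    unfolding pt(1)[symmetric] act[OF he_borel(1) pV(1) x] ph xh B(6)[OF pV(1) x] B(7)[OF pV(1) x] unfolding pt
    by (rule sep_fd[OF T(2)]) (simp_all add: ST WU del: tensor_sel, simp add: algebra_simps)
  have Uh: "act ?T mat_h (U k) = (l - of_nat (i + 1) + 2 * of_nat (k + 1)) \<odot>\<^bsub>?T\<^esub> U k" for k
    unfolding pt(2)[symmetric] act[OF he_borel(1) pV(2) x] ph xh B(6)[OF pV(2) x] B(7)[OF pV(2) x] unfolding pt
    by (rule sep_fd[OF T(2)]) (simp_all add: ST WU del: tensor_sel, simp add: algebra_simps)
  have We: "act ?T mat_e (W k) = U k \<oplus>\<^bsub>?T\<^esub> W (Suc k)" for k
    unfolding W_def U_def act[OF he_borel(2) pV(1) x] pe xe ..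
  have Ue: "act ?T mat_e (U k) = U (Suc k)" for k
    unfolding pt(2)[symmetric] act[OF he_borel(2) pV(2) x] pe xe lin_zero[OF fd_cvs[OF fV] cT B(2)[OF x]]
    by (rule ST(6)[OF WU(2)[unfolded pt(2)[symmetric]]])
  note L = linD(2)[OF h] linD(3)[OF h] linD(2)[OF e] linD(3)[OF e] lin_minus[OF cT cT h] lin_minus[OF cT cT e]
  \<comment> \<open>Y k is e^k applied to the lowest vector W 0. At k = 0 the truncated index k - 1
    occurs with coefficient zero.\<close>
  define Y where "Y = (\<lambda>k. W k \<oplus>\<^bsub>?T\<^esub> of_nat k \<odot>\<^bsub>?T\<^esub> U (k - 1))"
  \<comment> \<open>The second string starts at W 1 - i U 0. Applying e^i to W 1 - c U 0 gives (i -
    c) U i, so c = i is the choice for which the string ends after i vectors.\<close>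
  define Z where "Z = (\<lambda>k. W (Suc k) \<ominus>\<^bsub>?T\<^esub> (of_nat i - of_nat k) \<odot>\<^bsub>?T\<^esub> U k)"
  have YZ: "Y k \<in> carrier ?T" "Z k \<in> carrier ?T" for k by (simp_all add: Y_def Z_def ST WU del: tensor_sel)
  have Yh: "act ?T mat_h (Y k) = (l - of_nat (i + 1) + 2 * of_nat k) \<odot>\<^bsub>?T\<^esub> Y k" for k
    unfolding Y_def by (rule sep_fd[OF T(2)], (simp_all add: ST WU L Wh Uh del: tensor_sel)[2], cases k)
      (simp_all add: ST WU L Wh Uh del: tensor_sel, simp add: algebra_simps)
  have Zh: "act ?T mat_h (Z k) = (l - of_nat (i - 1) + 2 * of_nat k) \<odot>\<^bsub>?T\<^esub> Z k" if "i \<noteq> 0" for k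
    unfolding Z_def using that
    by (intro sep_fd[OF T(2)]) (simp_all add: ST WU L Wh Uh of_nat_diff del: tensor_sel, simp add: algebra_simps)
  have Ye: "act ?T mat_e (Y k) = Y (Suc k)" for k
    unfolding Y_def by (rule sep_fd[OF T(2)], (simp_all add: ST WU L We Ue del: tensor_sel)[2], cases k)
      (simp_all add: ST WU L We Ue del: tensor_sel, simp add: algebra_simps)
  have Ze: "act ?T mat_e (Z k) = Z (Suc k)" for k
    unfolding Z_def by (rule sep_fd[OF T(2)]) (simp_all add: ST WU L We Ue del: tensor_sel, simp add: algebra_simps)
  have Y0: "Y (Suc (i + 1)) = \<zero>\<^bsub>?T\<^esub>" unfolding Y_def using z[of "Suc (i + 1)"] z[of "i + 1"] ST by (simp del: tensor_sel)
  have Z0: "Z i = \<zero>\<^bsub>?T\<^esub>" unfolding Z_def using z[of "Suc i"] ST(8)[OF WU(2)] cvs_distribs(7)[OF cT ST(1)] by (simp del: tensor_sel)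
  have fin: "finite ?J" by simp
  \<comment> \<open>A model with the expected strings is mapped to the tensor product; an explicit
    inverse takes the place of an independence argument for \<open>Y\<close> and
    \<open>Z\<close>.\<close>
  obtain S :: "'u lmod" and b where S: "lie_module borel S" and qS: "qbasis l S b ?J ?n"
    using string_module_exists[OF fin, of l ?n] by blast
  note QS = qbasisD[OF qS]
  note SS = cvs_simps[OF lie_moduleD(1)[OF S]]
  obtain f where f: "f \<in> lie_hom borel S ?T" and fb: "\<And>jk. jk \<in> strings ?J ?n \<Longrightarrow> f (b jk) = (\<lambda>(j, k). if j = 0 then Z k else Y k) jk"
  proof (rule hom_of_strings[OF S qS T(1), of "\<lambda>(j, k). if j = 0 then Z k else Y k"])
    fix j k assume j: "j \<in> ?J" and k: "k \<le> ?n j"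
    have i: "i \<noteq> 0" if "j = 0" using j that by (auto split: if_splits)
    show "(case (j, k) of (j, k) \<Rightarrow> if j = 0 then Z k else Y k) \<in> carrier ?T" using YZ by simp
    show "act ?T mat_h (case (j, k) of (j, k) \<Rightarrow> if j = 0 then Z k else Y k) =
        (l - of_nat (?n j) + 2 * of_nat k) \<odot>\<^bsub>?T\<^esub> (case (j, k) of (j, k) \<Rightarrow> if j = 0 then Z k else Y k)"
      by (cases "j = 0") (simp_all only: if_True if_False prod.case simp_thms Yh Zh[OF i])
    show "act ?T mat_e (case (j, k) of (j, k) \<Rightarrow> if j = 0 then Z k else Y k) =
        (if k < ?n j then case (j, Suc k) of (j, k) \<Rightarrow> if j = 0 then Z k else Y k else \<zero>\<^bsub>?T\<^esub>)"
    proof (cases "j = 0")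
      case True
      hence "k < i - 1 \<or> Suc k = i" using i k by auto
      thus ?thesis using True Ze Z0 by (auto simp del: tensor_sel)
    next
      case False
      hence "k < i + 1 \<or> k = i + 1" using k by auto
      thus ?thesis using False Ye Y0 by (auto simp del: tensor_sel)
    qed
  qed blast
  \<comment> \<open>Basis vectors of the model, continued by zero so that the formulas for the
    inverse also hold at the ends of the strings.\<close>
  define y where "y = (\<lambda>k. if k \<le> i + 1 then b (1, k) else \<zero>\<^bsub>S\<^esub>)"
  define z' where "z' = (\<lambda>k. if k < i then b (0, k) else \<zero>\<^bsub>S\<^esub>)"
  have yz: "y k \<in> carrier S" "z' k \<in> carrier S" for k using QS(2)[of 1 k] QS(2)[of 0 k] SS(1) by (auto simp: y_def z'_def)
  have fyz: "k \<le> i + 1 \<Longrightarrow> f (y k) = Y k" "k \<le> i \<Longrightarrow> f (z' k) = Z k" for k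
  proof -
    show "f (y k) = Y k" if "k \<le> i + 1" using fb[of "(1, k)"] that by (simp add: y_def)
    show "f (z' k) = Z k" if "k \<le> i"
    proof (cases "k = i")
      case True
      thus ?thesis using Z0 lin_zero[OF lie_moduleD(1)[OF S] cT lie_homD(1)[OF f]] by (simp add: z'_def del: tensor_sel)
    next
      case False
      hence "(0, k) \<in> strings ?J ?n" using that by auto
      from fb[OF this] show ?thesis using False that by (simp add: z'_def)
    qed
  qed
  \<comment> \<open>Y (k + 1) and Z k are combinations of W (k + 1) and U k whose determinant is -
    (i + 1), for every k; \<open>a\<close> is the resulting denominator.\<close>
  define a where "a = inverse (of_nat (i + 1) :: complex)"
  have "of_nat (i + 1) \<noteq> (0 :: complex)" unfolding of_nat_eq_0_iff by simp
  hence "a * of_nat (i + 1) = 1" unfolding a_def by (rule left_inverse)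
  hence a1: "a * (1 + of_nat i) = 1" by simp
  have a2: "a * ((of_nat i - t) * (w + (1 + t) * u) + (1 + t) * (w - (of_nat i - t) * u)) = w"
    "a * ((1 + t) * u + (of_nat i - t) * u) = u"
    "a * ((of_nat i - t) * u + (1 + t) * w) - (of_nat i - t) * a * (u - w) = w"
    "a * ((of_nat i - t) * u + (1 + t) * w) + (1 + t) * a * (u - w) = u" for t u w :: complex
  proof -
    have "a * ((of_nat i - t) * (w + (1 + t) * u) + (1 + t) * (w - (of_nat i - t) * u)) = a * (1 + of_nat i) * w"
      "a * ((1 + t) * u + (of_nat i - t) * u) = a * (1 + of_nat i) * u"
      "a * ((of_nat i - t) * u + (1 + t) * w) - (of_nat i - t) * a * (u - w) = a * (1 + of_nat i) * w"
      "a * ((of_nat i - t) * u + (1 + t) * w) + (1 + t) * a * (u - w) = a * (1 + of_nat i) * u"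
      by (simp_all add: algebra_simps)
    thus "a * ((of_nat i - t) * (w + (1 + t) * u) + (1 + t) * (w - (of_nat i - t) * u)) = w"
      "a * ((1 + t) * u + (of_nat i - t) * u) = u"
      "a * ((of_nat i - t) * u + (1 + t) * w) - (of_nat i - t) * a * (u - w) = w"
      "a * ((of_nat i - t) * u + (1 + t) * w) + (1 + t) * a * (u - w) = u" by (simp_all add: a1)
  qed
  \<comment> \<open>Solving for the pure tensors gives (i + 1) W k = (i + 1 - k) Y k + k Z (k - 1)
    and (i + 1) U k = Y (k + 1) - Z k.\<close>
  define gW where "gW = (\<lambda>k. a \<odot>\<^bsub>S\<^esub> ((of_nat (i + 1) - of_nat k) \<odot>\<^bsub>S\<^esub> y k \<oplus>\<^bsub>S\<^esub> of_nat k \<odot>\<^bsub>S\<^esub> z' (k - 1)))"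
  define gU where "gU = (\<lambda>k. a \<odot>\<^bsub>S\<^esub> (y (Suc k) \<ominus>\<^bsub>S\<^esub> z' k))"
  have gc: "gW k \<in> carrier S" "gU k \<in> carrier S" for k by (simp_all add: gW_def gU_def yz SS)
  have TB: "fbasis ?T (\<lambda>((j, m), (j', k)). pure_tensor V M (p (j, m)) (q (j', k))) (strings {0} (\<lambda>_. 1) \<times> strings {0} (\<lambda>_. i))"
    by (rule fbasis_cong[OF tensor_basis[OF QV(1) QM(1)]]) auto
  have TBW: "(\<lambda>((j, m), (j', k)). pure_tensor V M (p (j, m)) (q (j', k))) jk = (\<lambda>((j, m), (j', k)). if m = 0 then W k else U k) jk"
    if "jk \<in> strings {0} (\<lambda>_. 1) \<times> strings {0} (\<lambda>_. i)" for jk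
    using that by (auto simp: W_def U_def x_def le_Suc_eq)
  have TB': "fbasis ?T (\<lambda>((j :: nat, m), (j' :: nat, k)). if m = 0 then W k else U k) (strings {0} (\<lambda>_. 1) \<times> strings {0} (\<lambda>_. i))"
    by (rule fbasis_cong[OF TB]) (simp only: TBW)
  have gin: "(\<lambda>((j :: nat, m :: nat), (j' :: nat, k)). if m = 0 then gW k else gU k) \<in> strings {0} (\<lambda>_. 1) \<times> strings {0} (\<lambda>_. i) \<rightarrow> carrier S"
    using gc by auto
  obtain g where g: "lin ?T S g" and gb: "\<And>jk. jk \<in> strings {0} (\<lambda>_. 1) \<times> strings {0} (\<lambda>_. i) \<Longrightarrow>
      g ((\<lambda>((j, m), (j', k)). if m = 0 then W k else U k) jk) = (\<lambda>((j :: nat, m :: nat), (j' :: nat, k)). if m = 0 then gW k else gU k) jk"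
    by (rule lin_extend[OF TB' lie_moduleD(1)[OF S] gin]) blast
  have gU: "g (U k) = gU k" if "k \<le> i" for k using gb[of "((0, 1), (0, k))"] that by simp
  \<comment> \<open>The formula extends to k = i + 1, where W k is zero: the coefficient of the
    first term vanishes, and z' i is zero by convention.\<close>
  have gW: "g (W k) = gW k" if "k \<le> i + 1" for k
  proof (cases "k = i + 1")
    case True
    have "gW k = \<zero>\<^bsub>S\<^esub>" using SS SS(8)[OF yz(1)] by (simp add: gW_def True z'_def)
    thus ?thesis using lin_zero[OF cT lie_moduleD(1)[OF S] g] z(1)[of k] True by (simp del: tensor_sel)
  qed (use gb[of "((0, 0), (0, k))"] that in simp)
  note fl = linD(2,3)[OF lie_homD(1)[OF f]] lin_minus[OF lie_moduleD(1)[OF S] cT lie_homD(1)[OF f]]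
  note gl = linD(2,3)[OF g] lin_minus[OF cT lie_moduleD(1)[OF S] g]
  have fg: "f (g t) = t" if "t \<in> carrier ?T" for t
  proof (rule lin_ext[OF TB' cT lin_compose[OF g lie_homD(1)[OF f]] lin_id _ that])
    fix jk assume "jk \<in> strings {0 :: nat} (\<lambda>_. 1) \<times> strings {0 :: nat} (\<lambda>_. i)"
    then obtain m k where jk: "jk = ((0, m), (0, k))" "m \<le> 1" "k \<le> i" by auto
    have "f (gW k) = W k"
      using jk(3) unfolding gW_def
      by (cases k; intro sep_fd[OF T(2)];
        (simp add: fl yz SS fyz Y_def Z_def ST WU a1 a2 del: tensor_sel)?)
    moreover have "f (gU k) = U k"
      using jk(3) unfolding gU_def
      by (intro sep_fd[OF T(2)]; (simp add: fl yz SS fyz Y_def Z_def ST WU a1 a2 del: tensor_sel)?)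
    ultimately show "f (g ((\<lambda>((j, m), (j', k)). if m = 0 then W k else U k) jk)) = (\<lambda>((j, m), (j', k)). if m = 0 then W k else U k) jk"
      using gW[of k] gU[of k] jk by simp
  qed
  have gf: "g (f s) = s" if "s \<in> carrier S" for s
  proof (rule lin_ext[OF QS(1) lie_moduleD(1)[OF S] lin_compose[OF lie_homD(1)[OF f] g] lin_id _ that])
    fix jk assume jk: "jk \<in> strings ?J ?n"
    obtain j k where jk': "jk = (j, k)" by (cases jk)
    show "g (f (b jk)) = b jk"
    proof (cases "j = 0")
      case True
      hence i: "i \<noteq> 0" and k: "k < i" using jk jk' by (auto split: if_splits)
      have "g (Z k) = z' k"
        unfolding Z_def using k
        by (intro sep_fd[OF QS(5)]; (simp add: gl WU ST gW gU gW_def gU_def yz SS a1 a2 del: tensor_sel)?)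
      thus ?thesis using fb[OF jk] True k by (simp add: jk' z'_def)
    next
      case False
      hence j: "j = 1" and k: "k \<le> i + 1" using jk jk' by (auto split: if_splits)
      have "g (Y k) = y k"
        unfolding Y_def using k
        by (cases k; intro sep_fd[OF QS(5)]; (simp add: gl WU ST gW gU gW_def gU_def yz SS a1 a2 del: tensor_sel)?)
      thus ?thesis using fb[OF jk] j k by (simp add: jk' y_def)
    qed
  qed
  have bij: "bij_betw f (carrier S) (carrier ?T)"
    by (rule bij_betw_byWitness[of _ g]) (use fg gf linD(1)[OF g] linD(1)[OF lie_homD(1)[OF f]] in \<open>auto simp del: tensor_sel\<close>)
  have "qbasis l ?T (\<lambda>i. f (b i)) ?J ?n"
    by (rule qbasis_image[OF qS S T(1) lie_homD(1)[OF f] bij]) (simp_all add: lie_homD(4)[OF f])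
  thus ?thesis by blast
qed

end

theorem proposition15:
  fixes l :: complex and embed :: "complex \<Rightarrow> 'u"
  assumes "inj embed"
  shows "simple_transitive (sl2_mod :: ('u lmod, 'u arrow) moncat) (N6 l)
    \<and> type_A_infinity (sl2_mod :: ('u lmod, 'u arrow) moncat) L1 (N6 l)"
proof -
  interpret embedded_complex embed by unfold_locales (rule assms)
  interpret A: lie_action embed borel "N6 l" by (rule lie_action_N6)
  \<comment> \<open>For every \<open>n\<close> one copy of Q(l, n) in the carrier type is fixed;
    these copies are the indecomposables of the list.\<close>
  have "\<exists>(M :: 'u lmod) (b :: nat \<times> nat \<Rightarrow> 'u). lie_module borel M \<and> qbasis l M b {0} (\<lambda>_. n)" for n
    by (rule string_module_exists) simp
  then obtain X :: "nat \<Rightarrow> 'u lmod" and c :: "nat \<Rightarrow> nat \<times> nat \<Rightarrow> 'u" where X: "\<And>n. lie_module borel (X n)"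
    and q: "\<And>n. qbasis l (X n) (c n) {0} (\<lambda>_. n)" by metis
  note QX = qbasisD[OF q]
  have XOb: "X n \<in> Ob (N6 l)" for n by (rule Ob_N6_qbasis(1)[OF X q])
  have L: "lie_module borel (L1 :: 'u lmod)" "fd (L1 :: 'u lmod)"
    using L1_props(1) lie_module_subset[OF _ borel_subset_sl2] by (auto simp: Ob_sl2_mod)
  from simple_two_dim_strings[OF L1_props(2) L(2) L1_props(3)] obtain p :: "nat \<times> nat \<Rightarrow> 'u"
    where p: "qbasis 0 L1 p {0} (\<lambda>_. 1)" by blast
  have T: "lie_module borel (tensor L1 (X n))" for n by (rule lie_module_tensor[OF lie_closed_borel L X QX(5)])
  \<comment> \<open>Renames the only string of a brick from 0 to \<open>j\<close>, because direct
    sums of strings are matched by name.\<close>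
  have summand: "qbasis l (X (n j)) (\<lambda>(j', k). c (n j) (0, k)) {j} n" for j :: nat and n
    by (rule qbasis_cong[OF qbasis_reindex[OF q[of "n j"], of "\<lambda>_. 0" "{j}"]]) auto
  interpret A_infinity_data "sl2_mod :: ('u lmod, 'u arrow) moncat" "N6 l" L1 X
  proof (intro A_infinity_data.intro A_infinity_data_axioms.intro)
    show "module_category (sl2_mod :: ('u lmod, 'u arrow) moncat) (N6 l)" by (rule A.module_category_lie) simp_all
    show "(L1 :: 'u lmod) \<in> Ob sl2_mod" by (rule L1_props(1))
    show "X n \<in> Ob (N6 l)" for n by (rule XOb)
    show "Id (N6 l) (X n) \<noteq> \<zero>\<^bsub>Hom (N6 l) (X n) (X n)\<^esub>" for n
    proof
      assume "Id (N6 l) (X n) = \<zero>\<^bsub>Hom (N6 l) (X n) (X n)\<^esub>"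
      hence "restrict (\<lambda>v. v) (carrier (X n)) (c n (0, 0)) = restrict (\<lambda>v. \<zero>\<^bsub>X n\<^esub>) (carrier (X n)) (c n (0, 0))" by (simp add: lie_Id_def)
      hence "c n (0, 0) = \<zero>\<^bsub>X n\<^esub>" using QX(2)[of 0 0 n] by simp
      hence "comb (X n) (c n) (strings {0} (\<lambda>_. n)) (unit (0, 0)) = \<zero>\<^bsub>X n\<^esub>"
        using comb_unit[OF fbasisD(1-3)[OF QX(1)], of "(0, 0)"] by simp
      from fbasis_zero[OF QX(1) this, of "(0, 0)"] show False by (simp add: unit_def)
    qed
    show "\<exists>a. f = a \<odot>\<^bsub>Hom (N6 l) (X n) (X n)\<^esub> Id (N6 l) (X n)" if f: "f \<in> Arr (N6 l) (X n) (X n)" for f n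
    proof -
      from f obtain f0 where f0: "f0 \<in> lie_hom borel (X n) (X n)" "f = (X n, f0, X n)" by auto
      obtain a where a: "\<And>v. v \<in> carrier (X n) \<Longrightarrow> f0 v = a \<odot>\<^bsub>X n\<^esub> v" by (rule end_single_string[OF X q f0(1)]) blast
      have "f0 = restrict (\<lambda>v. a \<odot>\<^bsub>X n\<^esub> restrict (\<lambda>v. v) (carrier (X n)) v) (carrier (X n))"
        by (rule lie_hom_eqI[OF f0(1) lie_hom_ops(2)[OF X X lie_hom_id[OF X] lie_hom_id[OF X]]]) (simp add: a)
      thus ?thesis by (intro exI[of _ a]) (simp add: f0(2) lie_Id_def)
    qed
    show "f = \<zero>\<^bsub>Hom (N6 l) (X m) (X n)\<^esub>" if "m \<noteq> n" "f \<in> Arr (N6 l) (X m) (X n)" for m n f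
    proof -
      from that(2) obtain f0 where f0: "f0 \<in> lie_hom borel (X m) (X n)" "f = (X m, f0, X n)" by auto
      have "f0 = restrict (\<lambda>v. \<zero>\<^bsub>X n\<^esub>) (carrier (X m))"
        by (rule lie_hom_eqI[OF f0(1) lie_hom_zero[OF X X]]) (use hom_distinct_strings[OF X q X q f0(1) that(1)] in simp)
      thus ?thesis by (simp add: f0(2))
    qed
    show "\<exists>ns. direct_sum (N6 l) (map X ns) Y" if Y: "Y \<in> Ob (N6 l)" for Y
    proof -
      from Ob_N6_qbasis(2)[OF Y] obtain b :: "nat \<times> nat \<Rightarrow> 'u" and N :: nat and n where b: "qbasis l Y b {..<N} n" by blast
      have "direct_sum (N6 l) (map X (map n [0..<N])) Y"
        by (rule direct_sum_strings[where Js = "\<lambda>j. {j}" and c = "\<lambda>i (j', k). c (n i) (0, k)", OF _ b])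
          (use Y X summand in \<open>auto simp: Ob_N6\<close>)
      thus ?thesis ..
    qed
    show "iso_ob (N6 l) (ActO (N6 l) L1 (X 0)) (X 1)"
    proof -
      from tensor_string[OF L(1) p X q, of 0] obtain y :: "nat \<times> nat \<Rightarrow> 'u" where
        "qbasis l (tensor L1 (X 0)) y (if (0 :: nat) = 0 then {1} else {0, 1}) (\<lambda>j. if j = 0 then 0 - 1 else 0 + 1)" by blast
      hence "qbasis l (tensor L1 (X 0)) y {1} (\<lambda>j. if j = 0 then 0 - 1 else 0 + 1)" by (simp only: simp_thms if_True)
      \<comment> \<open>For X 0 only the string with parameter 1 occurs, under the name 1; it is
        renamed to 0 to match the basis of X 1.\<close>
      from qbasis_reindex[OF this, of "\<lambda>_. 1" "{0}"]
      have y: "qbasis l (tensor L1 (X 0)) (\<lambda>(j, k). y (1, k)) {0 :: nat} (\<lambda>_. 1)" by (simp add: bij_betw_def)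
      obtain f where "f \<in> lie_hom borel (tensor L1 (X 0)) (X 1)" "bij_betw f (carrier (tensor L1 (X 0))) (carrier (X 1))"
        by (rule qbasis_iso[OF T y X q]) blast
      moreover have "tensor L1 (X 0) \<in> Ob (N6 l)" by (rule Ob_N6_qbasis(1)[OF T y])
      ultimately show ?thesis using N6_cat.is_iso_bij[OF _ XOb] XOb unfolding iso_ob_def by (simp del: tensor_sel) blast
    qed
    show "direct_sum (N6 l) [X n, X (Suc (Suc n))] (ActO (N6 l) L1 (X (Suc n)))" for n
    proof -
      let ?n = "\<lambda>j :: nat. if j = 0 then n else Suc (Suc n)"
      from tensor_string[OF L(1) p X q, of "Suc n"] obtain y :: "nat \<times> nat \<Rightarrow> 'u" where
        "qbasis l (tensor L1 (X (Suc n))) y (if Suc n = 0 then {1} else {0, 1}) (\<lambda>j. if j = 0 then Suc n - 1 else Suc n + 1)" by blast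
      hence "qbasis l (tensor L1 (X (Suc n))) y {0, 1} (\<lambda>j. if j = 0 then Suc n - 1 else Suc n + 1)" by (simp only: nat.distinct if_False)
      hence y: "qbasis l (tensor L1 (X (Suc n))) y {0, 1} ?n" by (rule qbasis_cong) auto
      have "direct_sum (N6 l) [X n, X (Suc (Suc n))] (tensor L1 (X (Suc n)))"
      proof (rule direct_sum_strings[where Js = "\<lambda>j. {j}" and c = "\<lambda>i (j', k). c (?n i) (0, k)", OF T y])
        fix i assume "i < length [X n, X (Suc (Suc n))]"
        hence i: "[X n, X (Suc (Suc n))] ! i = X (?n i)" by (auto simp: less_Suc_eq)
        show "lie_module borel ([X n, X (Suc (Suc n))] ! i)" unfolding i by (rule X)
        show "qbasis l ([X n, X (Suc (Suc n))] ! i) (\<lambda>(j', k). c (?n i) (0, k)) {i} ?n" unfolding i by (rule summand)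
      next
        have "{..<length [X n, X (Suc (Suc n))]} = {0, 1}" by auto
        thus "{0, 1} = (\<Union>i<length [X n, X (Suc (Suc n))]. {i})" by (simp add: insert_commute)
      qed auto
      thus ?thesis by simp
    qed
    show "idempotent_split (N6 l :: ('u lmod, 'u arrow, 'u lmod, 'u arrow) modcat)" by (rule N6_idempotent_split)
    show "\<exists>P. direct_sum (N6 l) [Y, Z] P" if "Y \<in> Ob (N6 l)" "Z \<in> Ob (N6 l)" for Y Z :: "'u lmod"
      by (rule N6_sums[OF that])
    show "finite_dimensional_Homs (N6 l :: ('u lmod, 'u arrow, 'u lmod, 'u arrow) modcat)" by (rule N6_fin_dim_Homs)
  qed
  show ?thesis using simple_transitive type_A_infinity by blast
qed

end
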